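(* Fix $\lambda\in\mathbb{Q}\cap\,]0,1]$. For $k\ge 2$ and for the fundamental invariants $\lambda_1,\dots,\lambda_k$ of a rank $k$ $[\lambda]$-primitive fresco such that $p_j\ge 1$ for each $j\in[1,k-1]$ (where $\lambda_{j+1}=\lambda_j+p_j-1$), let $\mathcal{F}_0(\lambda_1,\dots,\lambda_k)$ be the set of isomorphism classes $[E]$ of $[\lambda]$-primitive frescos $E$ with fundamental invariants $\lambda_1,\dots,\lambda_k$ such that $F_{k-1}$ and $E/F_1$ are semi-simple, where $(F_j)_{j\in[1,k]}$ is the principal Jordan-Hölder sequence of $E$. Then there exists a unique polynomial function (one for each such $(\lambda_1,\dots,\lambda_k)$) $$\alpha:\mathcal{F}_0(\lambda_1,\dots,\lambda_k)\to\mathbb{C}$$ with the following properties: (i) $\alpha([E])=0$ if and only if $E$ is semi-simple. (ii) For $k\ge 3$: when $E$ has a generator $e$ such that $(a-\lambda_{k-1}b)(a-\lambda_kb)e$ is in $F_{k-2}$, one has $\alpha(E)=\alpha(G_{k-1})$, where $G_{k-1}:=\tilde{\mathcal A}(a-(\lambda_{k-1}-1)b)e\subset E$ (whose class lies in $\mathcal{F}_0(\lambda_1,\dots,\lambda_{k-2},\lambda_k+1)$). (iii) For $k=2$: when $E\simeq\tilde{\mathcal A}/\tilde{\mathcal A}(a-\lambda_1b)(1+xb^{p_1})^{-1}(a-\lambda_2b)$ with $x\in\mathbb{C}$, one has $\alpha([E])=x$.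
   Context: $\tilde{\mathcal A}$ is the $\mathbb{C}$-algebra of formal series $\sum_{\nu\ge 0}P_\nu(a)b^\nu$, $P_\nu\in\mathbb{C}[x]$, with $ab-ba=b^2$, left and right multiplication by $a$ being continuous for the $b$-adic filtration. An (a,b)-module is a left $\tilde{\mathcal A}$-module free of finite rank over $\mathbb{C}[[b]]$; submodule means left $\tilde{\mathcal A}$-submodule. It has a simple pole if $aE\subset bE$; then its Bernstein polynomial is the minimal polynomial of $-b^{-1}a$ on $E/bE$. It is regular if it embeds in a simple pole (a,b)-module; its Bernstein polynomial is then that of its saturation $E^\sharp$ by $b^{-1}a$. It is geometric if regular with all roots of the Bernstein polynomial rational and strictly negative. A fresco is a geometric (a,b)-module generated by one element over $\tilde{\mathcal A}$. A regular (a,b)-module is $[\lambda]$-primitive if all roots of its Bernstein polynomial lie in $-\lambda+\mathbb{Z}$; it is semi-simple if it is isomorphic to a submodule of a finite direct sum of regular rank 1 (a,b)-modules. A submodule $F\subset E$ is normal if $F\cap bE=bF$. For $\mu\in\mathbb{C}$, $E_\mu:=\tilde{\mathcal A}/\tilde{\mathcal A}(a-\mu b)$. A Jordan-Hölder sequence of $E$ of rank $k$ is a sequence $0=F_0\subset F_1\subset\dots\subset F_k=E$ of normal submodules with $F_j/F_{j-1}\simeq E_{\lambda_j}$ of rank 1. A $[\lambda]$-primitive fresco $E$ has a unique J-H. sequence, called principal, for which $j\mapsto\lambda_j+j$ is non decreasing; the corresponding ordered tuple $(\lambda_1,\dots,\lambda_k)$ is called the fundamental invariants of $E$. $\mathcal{F}(\lambda_1,\dots,\lambda_k)$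 is the set of isomorphism classes of frescos with these fundamental invariants. The numbers $p_j$ are defined by $\lambda_{j+1}=\lambda_j+p_j-1$. Polynomial function: a function $g:\mathcal{F}_0\to\mathbb{C}$ on a subset $\mathcal{F}_0\subset\mathcal{F}(\lambda_1,\dots,\lambda_k)$ is polynomial (depends polynomially on $[E]$) if the following holds. Let $s$ be the collection of independent variables given by the non constant coefficients of $k$ power series $S_1,\dots,S_k\in\mathbb{C}[[b]]$ with $S_j(0)=1$, and for each value of $s$ let $E(s)=\tilde{\mathcal A}/\tilde{\mathcal A}P(s)$, $P(s)=(a-\lambda_1b)S_1(s)^{-1}\cdots(a-\lambda_kb)S_k(s)^{-1}$. Then there is a polynomial $F\in\mathbb{C}[s]$ (involving finitely many of the variables) such that $F(s)=g([E(s)])$ for every $s$ with $[E(s)]\in\mathcal{F}_0$. *)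

theory Defs
  imports
    Complex_Main
    "HOL-Computational_Algebra.Polynomial"
    "HOL-Computational_Algebra.Formal_Power_Series"
    "HOL-Library.Poly_Mapping"
    "HOL-Library.FuncSet"
    "HOL-Algebra.AbelCoset"
    "HOL-Algebra.Module"
begin

section \<open>The algebra of formal series in \<open>a\<close> and \<open>b\<close>\<close>

text \<open>
  An element of \<open>atilde\<close> is the sequence \<open>(P\<^sub>\<nu>)\<close> of the left coefficients of the series
  \<open>\<Sum>\<nu>. P\<^sub>\<nu>(a) b^\<nu>\<close>.  The relation \<open>a b - b a = b\<^sup>2\<close> and continuity for the \<open>b\<close>-adic filtration
  force \<open>b^\<nu> Q(a) = \<Sum>j. (-\<nu> gchoose j) Q^(j)(a) b^(\<nu> + j)\<close>, where \<open>Q^(j)\<close> is the \<open>j\<close>-th derivative;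
  this is a finite sum, and it gives the product below.
\<close>

typedef atilde = "UNIV :: (nat \<Rightarrow> complex poly) set"
  morphisms acoeff Aseries ..

definition deg_triples :: "nat \<Rightarrow> (nat \<times> nat \<times> nat) set" where
  "deg_triples n = {(\<nu>, j, \<mu>). \<nu> + j + \<mu> = n}"

definition comm_coeff :: "nat \<Rightarrow> nat \<Rightarrow> complex" where
  "comm_coeff \<nu> j = (- of_nat \<nu>) gchoose j"

definition series_mult :: "(nat \<Rightarrow> complex poly) \<Rightarrow> (nat \<Rightarrow> complex poly) \<Rightarrow> nat \<Rightarrow> complex poly" where
  "series_mult P Q n =
     (\<Sum>(\<nu>, j, \<mu>)\<in>deg_triples n. Polynomial.smult (comm_coeff \<nu> j) (P \<nu> * (pderiv ^^ j) (Q \<mu>)))"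

lemma finite_deg_triples [simp, intro]: "finite (deg_triples n)"
  by (rule finite_subset[of _ "{..n} \<times> {..n} \<times> {..n}"]) (auto simp: deg_triples_def)

lemma comm_coeff_0 [simp]: "comm_coeff \<nu> 0 = 1" "comm_coeff 0 j = (if j = 0 then 1 else 0)"
  by (auto simp: comm_coeff_def gbinomial_0_left)

lemma smult_sumR: "Polynomial.smult c (sum f A) = (\<Sum>x\<in>A. Polynomial.smult c (f x))"
  by (induction A rule: infinite_finite_induct) (auto simp: smult_add_right)

lemma smult_sumL: "Polynomial.smult (sum f A) p = (\<Sum>x\<in>A. Polynomial.smult (f x) p)"
  by (induction A rule: infinite_finite_induct) (auto simp: smult_add_left)

lemma pderiv_sumR: "pderiv (sum f A) = (\<Sum>x\<in>A. pderiv (f x))"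
  by (induction A rule: infinite_finite_induct) (auto simp: pderiv_add)

lemma higher_pderiv_mult:
  fixes Q R :: "complex poly"
  shows "(pderiv ^^ i) (Q * R) =
    (\<Sum>t\<le>i. Polynomial.smult (of_nat (i choose t)) ((pderiv ^^ (i - t)) Q * (pderiv ^^ t) R))"
proof (induction i)
  case (Suc i)
  have *: "(pderiv ^^ Suc i) (Q * R) = 
     (\<Sum>t\<le>i. Polynomial.smult (of_nat (i choose t)) ((pderiv ^^ (Suc i - t)) Q * (pderiv ^^ t) R)) +
     (\<Sum>t\<le>i. Polynomial.smult (of_nat (i choose t)) ((pderiv ^^ (i - t)) Q * (pderiv ^^ Suc t) R))"
    by (simp add: Suc pderiv_sumR pderiv_smult pderiv_mult smult_add_right sum.distrib Suc_diff_le algebra_simps)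
  have "(\<Sum>t\<le>Suc i. Polynomial.smult (of_nat (Suc i choose t)) ((pderiv ^^ (Suc i - t)) Q * (pderiv ^^ t) R))
     = (pderiv ^^ Suc i) Q * R + (\<Sum>t\<le>i. Polynomial.smult (of_nat ((i choose t) + (i choose Suc t))) ((pderiv ^^ (i - t)) Q * (pderiv ^^ Suc t) R))"
    by (subst sum.atMost_Suc_shift) (simp del: of_nat_add)
  also have "\<dots> = (pderiv ^^ Suc i) Q * R + (\<Sum>t\<le>i. Polynomial.smult (of_nat (i choose Suc t)) ((pderiv ^^ (i - t)) Q * (pderiv ^^ Suc t) R))
      + (\<Sum>t\<le>i. Polynomial.smult (of_nat (i choose t)) ((pderiv ^^ (i - t)) Q * (pderiv ^^ Suc t) R))"
    by (simp add: smult_add_left sum.distrib algebra_simps)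
  also have "(pderiv ^^ Suc i) Q * R + (\<Sum>t\<le>i. Polynomial.smult (of_nat (i choose Suc t)) ((pderiv ^^ (i - t)) Q * (pderiv ^^ Suc t) R))
     = (\<Sum>t\<le>Suc i. Polynomial.smult (of_nat (i choose t)) ((pderiv ^^ (Suc i - t)) Q * (pderiv ^^ t) R))"
    by (subst sum.atMost_Suc_shift) simp
  also have "\<dots> = (\<Sum>t\<le>i. Polynomial.smult (of_nat (i choose t)) ((pderiv ^^ (Suc i - t)) Q * (pderiv ^^ t) R))"
    by simp
  finally show ?case using * by simp
qed simp

lemma comm_coeff_sum: "(\<Sum>t\<le>l. comm_coeff \<nu> (j + t) * of_nat ((j + t) choose t) * comm_coeff \<mu> (l - t)) = comm_coeff \<nu> j * comm_coeff (\<nu> + j + \<mu>) l"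
proof -
  have "comm_coeff \<nu> (j + t) * of_nat ((j + t) choose t) = comm_coeff \<nu> j * ((- of_nat \<nu> - of_nat j) gchoose t)" for t
  proof -
    have "comm_coeff \<nu> (j + t) * (of_nat (j + t) gchoose j) = comm_coeff \<nu> j * ((- of_nat \<nu> - of_nat j) gchoose (j + t - j))"
      unfolding comm_coeff_def by (rule gbinomial_trinomial_revision) simp
    moreover have "(j + t) choose t = (j + t) choose j" using binomial_symmetric[of t "j+t"] by simp
    ultimately show ?thesis by (simp add: binomial_gbinomial)
  qed
  hence "(\<Sum>t\<le>l. comm_coeff \<nu> (j + t) * of_nat ((j + t) choose t) * comm_coeff \<mu> (l - t)) =
     comm_coeff \<nu> j * (\<Sum>t\<in>{0..l}. ((- of_nat \<nu> - of_nat j) gchoose t) * ((- of_nat \<mu>) gchoose (l - t)))"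
    by (simp add: sum_distrib_left comm_coeff_def atMost_atLeast0 mult.assoc)
  also have "\<dots> = comm_coeff \<nu> j * comm_coeff (\<nu> + j + \<mu>) l"
    by (subst gbinomial_Vandermonde) (simp add: comm_coeff_def algebra_simps)
  finally show ?thesis .
qed

lemma series_mult_assoc: "series_mult (series_mult P Q) R n = series_mult P (series_mult Q R) n"
proof -
  define D :: "nat \<Rightarrow> complex poly \<Rightarrow> complex poly" where "D j = pderiv ^^ j" for j
  define A where "A = {(\<nu>::nat, j::nat, \<mu>::nat, l::nat, \<rho>::nat). \<nu> + j + \<mu> + l + \<rho> = n}"
  have finA: "finite A"
    unfolding A_def by (rule finite_subset[of _ "{..n} \<times> {..n} \<times> {..n} \<times> {..n} \<times> {..n}"]) auto
  let ?m = "\<lambda>\<nu> j \<mu> l \<rho>. P \<nu> * D j (Q \<mu>) * D l (R \<rho>)"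
  have "series_mult (series_mult P Q) R n =
     (\<Sum>x\<in>deg_triples n. \<Sum>y\<in>deg_triples (fst x). case x of (m, l, \<rho>) \<Rightarrow> case y of (\<nu>, j, \<mu>) \<Rightarrow>
        Polynomial.smult (comm_coeff m l * comm_coeff \<nu> j) (?m \<nu> j \<mu> l \<rho>))"
    unfolding series_mult_def D_def
    by (intro sum.cong refl)
       (auto simp: sum_distrib_right smult_sumR split_def intro!: sum.cong)
  also have "\<dots> = (\<Sum>(x,y)\<in>Sigma (deg_triples n) (\<lambda>x. deg_triples (fst x)). case x of (m, l, \<rho>) \<Rightarrow> case y of (\<nu>, j, \<mu>) \<Rightarrow>
        Polynomial.smult (comm_coeff m l * comm_coeff \<nu> j) (?m \<nu> j \<mu> l \<rho>))"
    by (rule sum.Sigma) auto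
  also have "\<dots> = (\<Sum>(\<nu>, j, \<mu>, l, \<rho>)\<in>A. Polynomial.smult (comm_coeff (\<nu> + j + \<mu>) l * comm_coeff \<nu> j) (?m \<nu> j \<mu> l \<rho>))"
    by (rule sum.reindex_bij_witness[of _ "\<lambda>(\<nu>, j, \<mu>, l, \<rho>). ((\<nu> + j + \<mu>, l, \<rho>), (\<nu>, j, \<mu>))"
          "\<lambda>((m, l, \<rho>), (\<nu>, j, \<mu>)). (\<nu>, j, \<mu>, l, \<rho>)"]) (auto simp: deg_triples_def A_def)
  also have "\<dots> = (\<Sum>(\<nu>, j, \<mu>, l, \<rho>)\<in>A. \<Sum>t\<le>l. Polynomial.smult (comm_coeff \<nu> (j + t) * of_nat ((j + t) choose t) * comm_coeff \<mu> (l - t)) (?m \<nu> j \<mu> l \<rho>))"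
  proof (intro sum.cong refl, clarify)
    fix \<nu> j \<mu> l \<rho>
    show "Polynomial.smult (comm_coeff (\<nu> + j + \<mu>) l * comm_coeff \<nu> j) (?m \<nu> j \<mu> l \<rho>) = (\<Sum>t\<le>l. Polynomial.smult (comm_coeff \<nu> (j + t) * of_nat ((j + t) choose t) * comm_coeff \<mu> (l - t)) (?m \<nu> j \<mu> l \<rho>))"
      by (subst smult_sumL [symmetric]) (simp only: comm_coeff_sum mult.commute[of "comm_coeff (\<nu> + j + \<mu>) l"])
  qed
  also have "\<dots> = (\<Sum>(x, t)\<in>Sigma A (\<lambda>x. {..fst (snd (snd (snd x)))}). case x of (\<nu>, j, \<mu>, l, \<rho>) \<Rightarrow>
      Polynomial.smult (comm_coeff \<nu> (j + t) * of_nat ((j + t) choose t) * comm_coeff \<mu> (l - t)) (?m \<nu> j \<mu> l \<rho>))"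
    by (subst sum.Sigma [symmetric]) (auto simp: finA intro!: sum.cong)
  also have "\<dots> = (\<Sum>((x,y),t)\<in>(SIGMA z:(SIGMA x:deg_triples n. deg_triples (snd (snd x))). {..fst (snd (fst z))}).
      case x of (\<nu>, i, m) \<Rightarrow> case y of (\<mu>, l, \<rho>) \<Rightarrow>
      Polynomial.smult (comm_coeff \<nu> i * of_nat (i choose t) * comm_coeff \<mu> l) (?m \<nu> (i - t) \<mu> (l + t) \<rho>))"
    by (rule sum.reindex_bij_witness[of _ 
           "\<lambda>(((\<nu>, i, m), (\<mu>, l, \<rho>)), t). ((\<nu>, i - t, \<mu>, l + t, \<rho>), t)"
           "\<lambda>((\<nu>, j, \<mu>, l, \<rho>), t). (((\<nu>, j + t, \<mu> + (l - t) + \<rho>), (\<mu>, l - t, \<rho>)), t)"])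
       (auto simp: deg_triples_def A_def)
  also have "\<dots> = (\<Sum>(x,y)\<in>(SIGMA x:deg_triples n. deg_triples (snd (snd x))). \<Sum>t\<le>fst (snd x). 
      case x of (\<nu>, i, m) \<Rightarrow> case y of (\<mu>, l, \<rho>) \<Rightarrow>
      Polynomial.smult (comm_coeff \<nu> i * of_nat (i choose t) * comm_coeff \<mu> l) (?m \<nu> (i - t) \<mu> (l + t) \<rho>))"
    by (subst sum.Sigma [symmetric]) (auto intro!: finite_SigmaI sum.cong)
  also have "\<dots> = (\<Sum>x\<in>deg_triples n. \<Sum>y\<in>deg_triples (snd (snd x)). \<Sum>t\<le>fst (snd x). 
      case x of (\<nu>, i, m) \<Rightarrow> case y of (\<mu>, l, \<rho>) \<Rightarrow>
      Polynomial.smult (comm_coeff \<nu> i * of_nat (i choose t) * comm_coeff \<mu> l) (?m \<nu> (i - t) \<mu> (l + t) \<rho>))"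
    by (rule sum.Sigma [symmetric]) auto
  also have "\<dots> = series_mult P (series_mult Q R) n"
    unfolding series_mult_def D_def
    by (intro sum.cong refl)
       (auto simp: sum_distrib_left smult_sumR split_def higher_pderiv_sum higher_pderiv_smult higher_pderiv_mult
          funpow_add mult.assoc mult_ac add.commute intro!: sum.cong)
  finally show ?thesis .
qed

lemma series_mult_1L: "series_mult (\<lambda>\<nu>. if \<nu> = 0 then 1 else 0) P n = P n"
proof -
  have "series_mult (\<lambda>\<nu>. if \<nu> = 0 then 1 else 0) P n = (\<Sum>(\<nu>, j, \<mu>)\<in>{(0::nat,0::nat,n)}. P \<mu>)"
    unfolding series_mult_def by (rule sum.mono_neutral_cong_right[OF finite_deg_triples]) (auto simp: deg_triples_def split: if_splits)
  thus ?thesis by simp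
qed
lemma higher_pderiv_one: "(pderiv ^^ j) (1 :: complex poly) = (if j = 0 then 1 else 0)"
  by (induction j) auto
lemma series_mult_1R: "series_mult P (\<lambda>\<nu>. if \<nu> = 0 then 1 else 0) n = P n"
proof -
  have "series_mult P (\<lambda>\<nu>. if \<nu> = 0 then 1 else 0) n = (\<Sum>(\<nu>, j, \<mu>)\<in>{(n,0::nat,0::nat)}. P \<nu>)"
    unfolding series_mult_def by (rule sum.mono_neutral_cong_right[OF finite_deg_triples]) (auto simp: deg_triples_def higher_pderiv_one split: if_splits)
  thus ?thesis by simp
qed
lemma series_mult_addL: "series_mult (\<lambda>\<nu>. P \<nu> + Q \<nu>) R n = series_mult P R n + series_mult Q R n"
  unfolding series_mult_def by (simp add: split_def smult_add_right sum.distrib algebra_simps)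
lemma series_mult_addR: "series_mult R (\<lambda>\<nu>. P \<nu> + Q \<nu>) n = series_mult R P n + series_mult R Q n"
  unfolding series_mult_def by (simp add: split_def smult_add_right sum.distrib algebra_simps higher_pderiv_add)
lemma acoeff_Aseries [simp]: "acoeff (Aseries f) = f"
  by (simp add: Aseries_inverse)

lemma atilde_eq_iff: "x = y \<longleftrightarrow> (\<forall>\<nu>. acoeff x \<nu> = acoeff y \<nu>)"
  by (metis acoeff_inverse ext)

instantiation atilde :: ring_1
begin

definition "0 = Aseries (\<lambda>_. 0)"
definition "1 = Aseries (\<lambda>\<nu>. if \<nu> = 0 then 1 else 0)"
definition "x + y = Aseries (\<lambda>\<nu>. acoeff x \<nu> + acoeff y \<nu>)"
definition "x - y = Aseries (\<lambda>\<nu>. acoeff x \<nu> - acoeff y \<nu>)"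
definition "- x = Aseries (\<lambda>\<nu>. - acoeff x \<nu>)"
definition "x * y = Aseries (series_mult (acoeff x) (acoeff y))"

instance
proof
  show "x * y * z = x * (y * z)" for x y z :: atilde
    by (simp add: atilde_eq_iff times_atilde_def series_mult_assoc)
qed (auto simp: atilde_eq_iff plus_atilde_def minus_atilde_def uminus_atilde_def zero_atilde_def one_atilde_def
      times_atilde_def series_mult_addL series_mult_addR series_mult_1L series_mult_1R dest: fun_cong[of _ _ 0])
end

definition avar :: atilde where
  "avar = Aseries (\<lambda>\<nu>. if \<nu> = 0 then [:0, 1:] else 0)"

definition bvar :: atilde where
  "bvar = Aseries (\<lambda>\<nu>. if \<nu> = 1 then 1 else 0)"

definition of_fps :: "complex fps \<Rightarrow> atilde" where
  "of_fps S = Aseries (\<lambda>\<nu>. [:fps_nth S \<nu>:])"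

abbreviation acst :: "complex \<Rightarrow> atilde" where
  "acst c \<equiv> of_fps (fps_const c)"

lemma series_mult_single_left:
  "series_mult (\<lambda>\<nu>. if \<nu> = m then p else 0) Q n =
     (\<Sum>j\<le>n. if m + j \<le> n then Polynomial.smult (comm_coeff m j) (p * (pderiv ^^ j) (Q (n - m - j))) else 0)"
proof -
  have "series_mult (\<lambda>\<nu>. if \<nu> = m then p else 0) Q n =
      (\<Sum>(\<nu>, j, \<mu>)\<in>{x \<in> deg_triples n. fst x = m}. Polynomial.smult (comm_coeff m j) (p * (pderiv ^^ j) (Q \<mu>)))"
    unfolding series_mult_def by (rule sum.mono_neutral_cong_right) (auto split: if_splits)
  also have "\<dots> = (\<Sum>j\<in>{j\<in>{..n}. m + j \<le> n}. Polynomial.smult (comm_coeff m j) (p * (pderiv ^^ j) (Q (n - m - j))))"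
    by (rule sum.reindex_bij_witness[of _ "\<lambda>j. (m, j, n - m - j)" "\<lambda>(\<nu>, j, \<mu>). j"])
       (auto simp: deg_triples_def)
  also have "\<dots> = (\<Sum>j\<le>n. if m + j \<le> n then Polynomial.smult (comm_coeff m j) (p * (pderiv ^^ j) (Q (n - m - j))) else 0)"
    by (rule sum.inter_filter) simp
  finally show ?thesis .
qed

lemma avar_bvar_commutator: "avar * bvar - bvar * avar = bvar\<^sup>2"
proof -
  have "series_mult (acoeff avar) (acoeff bvar) n - series_mult (acoeff bvar) (acoeff avar) n =
      series_mult (acoeff bvar) (acoeff bvar) n" for n
  proof -
    have pd: "(pderiv ^^ j) [:0, 1 :: complex:] = (if j = 0 then [:0, 1:] else if j = 1 then 1 else 0)" for j
    proof (cases j)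
      case (Suc i)
      have "(pderiv ^^ Suc i) [:0, 1 :: complex:] = (pderiv ^^ i) 1"
        by (simp add: funpow_Suc_right pderiv_pCons one_pCons del: funpow.simps)
      thus ?thesis using Suc by (simp add: higher_pderiv_one del: funpow.simps)
    qed simp
    have *: "(\<Sum>j\<le>n. f j) = f 0" if "\<And>j. j > 0 \<Longrightarrow> f j = 0" for f :: "nat \<Rightarrow> complex poly"
      by (subst sum.mono_neutral_right[of "{..n}" "{0}"]) (auto intro: that)
    have **: "(\<Sum>j\<le>n. f j) = f 0 + (if n = 0 then 0 else f 1)" if "\<And>j. j > 1 \<Longrightarrow> f j = 0"
      for f :: "nat \<Rightarrow> complex poly"
    proof (cases "n = 0")
      case False
      thus ?thesis
        by (subst sum.mono_neutral_right[of "{..n}" "{0, 1}"]) (auto intro: that)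
    qed simp
    have z: "comm_coeff (Suc 0) (Suc 0) = -1" by (simp add: comm_coeff_def)
    have if1: "(pderiv ^^ j) (if c then p else 0) = (if c then (pderiv ^^ j) p else 0)"
      for j c and p :: "complex poly" by simp
    have bb: "series_mult (acoeff bvar) (acoeff bvar) n = (if n = 2 then 1 else 0)"
      unfolding bvar_def acoeff_Aseries series_mult_single_left
      by (subst *) (auto simp: if1 higher_pderiv_one)
    have ab: "series_mult (acoeff avar) (acoeff bvar) n = (if n = 1 then [:0, 1:] else 0)"
      unfolding bvar_def avar_def acoeff_Aseries series_mult_single_left
      by (subst *) auto
    have ba: "series_mult (acoeff bvar) (acoeff avar) n = (if n = 1 then [:0, 1:] else if n = 2 then -1 else 0)"
      unfolding bvar_def avar_def acoeff_Aseries series_mult_single_left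
      by (subst **) (auto simp: if1 pd z pderiv_pCons one_pCons)
    show ?thesis unfolding bb ab ba by auto
  qed
  thus ?thesis
    by (simp add: atilde_eq_iff minus_atilde_def times_atilde_def power2_eq_square)
qed

lemma of_fps_mult: "of_fps (S * T) = of_fps S * of_fps T"
proof -
  have pd: "(pderiv ^^ j) [:c :: complex:] = (if j = 0 then [:c:] else 0)" for j c
    by (cases j) (auto simp: funpow_Suc_right simp del: funpow.simps)
  have "series_mult (acoeff (of_fps S)) (acoeff (of_fps T)) n = [:fps_nth (S * T) n:]" for n
  proof -
    have "series_mult (acoeff (of_fps S)) (acoeff (of_fps T)) n =
        (\<Sum>(\<nu>, j, \<mu>)\<in>{x \<in> deg_triples n. fst (snd x) = 0}. [:fps_nth S \<nu> * fps_nth T \<mu>:])"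
      unfolding series_mult_def
      by (rule sum.mono_neutral_cong_right) (auto simp: of_fps_def pd split: if_splits)
    also have "\<dots> = (\<Sum>i\<in>{0..n}. [:fps_nth S i * fps_nth T (n - i):])"
      by (rule sum.reindex_bij_witness[of _ "\<lambda>i. (i, 0, n - i)" "\<lambda>(\<nu>, j, \<mu>). \<nu>"])
         (auto simp: deg_triples_def)
    also have "\<dots> = [:\<Sum>i\<in>{0..n}. fps_nth S i * fps_nth T (n - i):]"
      by (induction rule: infinite_finite_induct[of _ "{0..n}"]) auto
    finally show ?thesis by (simp add: fps_mult_nth)
  qed
  thus ?thesis
    by (simp add: atilde_eq_iff times_atilde_def of_fps_def)
qed

definition lin :: "complex \<Rightarrow> atilde" where
  "lin \<mu> = avar - acst \<mu> * bvar"


section \<open>Left modules\<close>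

text \<open>
  The fields \<^const>\<open>monoid.mult\<close> and \<^const>\<open>monoid.one\<close> that a record of type \<open>module\<close> inherits
  play no role in what follows.
\<close>

locale left_module = abelian_group M
  for M :: "('r::ring_1, 'm) module" (structure) +
  assumes lsmult_closed: "x \<in> carrier M \<Longrightarrow> r \<odot> x \<in> carrier M"
    and lsmult_l_distr: "x \<in> carrier M \<Longrightarrow> (r + s) \<odot> x = r \<odot> x \<oplus> s \<odot> x"
    and lsmult_r_distr: "x \<in> carrier M \<Longrightarrow> y \<in> carrier M \<Longrightarrow> r \<odot> (x \<oplus> y) = r \<odot> x \<oplus> r \<odot> y"
    and lsmult_assoc: "x \<in> carrier M \<Longrightarrow> (r * s) \<odot> x = r \<odot> (s \<odot> x)"
    and lsmult_one: "x \<in> carrier M \<Longrightarrow> 1 \<odot> x = x"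

definition left_submodule :: "'m set \<Rightarrow> ('r::ring_1, 'm) module \<Rightarrow> bool" where
  "left_submodule N M \<longleftrightarrow>
     subgroup N (add_monoid M) \<and> (\<forall>r. \<forall>x\<in>N. r \<odot>\<^bsub>M\<^esub> x \<in> N)"

abbreviation sub_mod :: "('r, 'm) module \<Rightarrow> 'm set \<Rightarrow> ('r, 'm) module" where
  "sub_mod M N \<equiv> M\<lparr>carrier := N\<rparr>"

definition quot_mod :: "('r, 'm) module \<Rightarrow> 'm set \<Rightarrow> ('r, 'm set) module" where
  "quot_mod M N =
     \<lparr>carrier = a_rcosets\<^bsub>M\<^esub> N, mult = undefined, one = undefined,
      zero = N, add = (\<lambda>X Y. X <+>\<^bsub>M\<^esub> Y),
      smult = (\<lambda>r X. \<Union>x\<in>X. N +>\<^bsub>M\<^esub> (r \<odot>\<^bsub>M\<^esub> x))\<rparr>"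

definition lmod_hom :: "('r, 'm) module \<Rightarrow> ('r, 'n) module \<Rightarrow> ('m \<Rightarrow> 'n) set" where
  "lmod_hom M N =
     {h \<in> carrier M \<rightarrow> carrier N.
        (\<forall>x\<in>carrier M. \<forall>y\<in>carrier M. h (x \<oplus>\<^bsub>M\<^esub> y) = h x \<oplus>\<^bsub>N\<^esub> h y) \<and>
        (\<forall>r. \<forall>x\<in>carrier M. h (r \<odot>\<^bsub>M\<^esub> x) = r \<odot>\<^bsub>N\<^esub> h x)}"

definition lmod_iso :: "('r, 'm) module \<Rightarrow> ('r, 'n) module \<Rightarrow> bool" where
  "lmod_iso M N \<longleftrightarrow> (\<exists>h\<in>lmod_hom M N. bij_betw h (carrier M) (carrier N))"

definition direct_sum :: "nat \<Rightarrow> (nat \<Rightarrow> ('r, 'm) module) \<Rightarrow> ('r, nat \<Rightarrow> 'm) module" where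
  "direct_sum n R =
     \<lparr>carrier = (\<Pi>\<^sub>E i\<in>{..<n}. carrier (R i)), mult = undefined, one = undefined,
      zero = (\<lambda>i\<in>{..<n}. \<zero>\<^bsub>R i\<^esub>),
      add = (\<lambda>f g. \<lambda>i\<in>{..<n}. f i \<oplus>\<^bsub>R i\<^esub> g i),
      smult = (\<lambda>r f. \<lambda>i\<in>{..<n}. r \<odot>\<^bsub>R i\<^esub> f i)\<rparr>"

definition cyclic :: "('r, 'm) module \<Rightarrow> 'm \<Rightarrow> 'm set" where
  "cyclic M x = range (\<lambda>r. r \<odot>\<^bsub>M\<^esub> x)"

definition regular_rep :: "('r::ring_1, 'r) module" where
  "regular_rep = \<lparr>carrier = UNIV, mult = (*), one = 1, zero = 0, add = (+), smult = (*)\<rparr>"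

definition cyclic_quot :: "'r::ring_1 \<Rightarrow> ('r, 'r set) module" where
  "cyclic_quot P = quot_mod regular_rep (range (\<lambda>Q. Q * P))"


section \<open>(a,b)-modules\<close>

definition has_rank :: "(atilde, 'm) module \<Rightarrow> nat \<Rightarrow> bool" where
  "has_rank E n \<longleftrightarrow>
     (\<exists>e. (\<forall>i<n. e i \<in> carrier E) \<and>
        (\<forall>x\<in>carrier E. \<exists>!S. S \<in> {..<n} \<rightarrow>\<^sub>E UNIV \<and>
            x = (\<Oplus>\<^bsub>E\<^esub>i\<in>{..<n}. of_fps (S i) \<odot>\<^bsub>E\<^esub> e i)))"

definition ab_module :: "(atilde, 'm) module \<Rightarrow> bool" where
  "ab_module E \<longleftrightarrow> left_module E \<and> (\<exists>n. has_rank E n)"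

definition bE :: "(atilde, 'm) module \<Rightarrow> 'm set" where
  "bE E = (\<lambda>x. bvar \<odot>\<^bsub>E\<^esub> x) ` carrier E"

definition simple_pole :: "(atilde, 'm) module \<Rightarrow> bool" where
  "simple_pole E \<longleftrightarrow> ab_module E \<and> (\<lambda>x. avar \<odot>\<^bsub>E\<^esub> x) ` carrier E \<subseteq> bE E"

text \<open>
  Multiplication by \<open>b\<close> is injective on an (a,b)-module, so that \<open>b\<inverse> a\<close> is well defined if
  the module has a simple pole.
\<close>

definition binv_a :: "(atilde, 'm) module \<Rightarrow> 'm \<Rightarrow> 'm" where
  "binv_a E x = (THE y. y \<in> carrier E \<and> avar \<odot>\<^bsub>E\<^esub> x = bvar \<odot>\<^bsub>E\<^esub> y)"

definition neg_binv_a_mod_b :: "(atilde, 'm) module \<Rightarrow> 'm set \<Rightarrow> 'm set" where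
  "neg_binv_a_mod_b E X = (\<Union>x\<in>X. bE E +>\<^bsub>E\<^esub> (\<ominus>\<^bsub>E\<^esub> binv_a E x))"

definition annihilating_poly ::
  "(atilde, 'm) module \<Rightarrow> ('m \<Rightarrow> 'm) \<Rightarrow> complex poly \<Rightarrow> bool" where
  "annihilating_poly V T p \<longleftrightarrow>
     (\<forall>v\<in>carrier V. (\<Oplus>\<^bsub>V\<^esub>i\<in>{..degree p}. acst (coeff p i) \<odot>\<^bsub>V\<^esub> (T ^^ i) v) = \<zero>\<^bsub>V\<^esub>)"

definition minimal_poly :: "(atilde, 'm) module \<Rightarrow> ('m \<Rightarrow> 'm) \<Rightarrow> complex poly" where
  "minimal_poly V T =
     (THE p. lead_coeff p = 1 \<and> annihilating_poly V T p \<and>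
        (\<forall>q. annihilating_poly V T q \<longrightarrow> p dvd q))"

definition bernstein_simple_pole :: "(atilde, 'm) module \<Rightarrow> complex poly" where
  "bernstein_simple_pole E = minimal_poly (quot_mod E (bE E)) (neg_binv_a_mod_b E)"

text \<open>
  A universe for (a,b)-modules: \<open>\<complex>[[b]]\<^sup>n\<close> is a subset of \<^typ>\<open>nat \<Rightarrow> complex fps\<close>, so every
  (a,b)-module is isomorphic to one with elements of this type.  Hence the existential
  quantifications over (a,b)-modules below lose nothing by being restricted to it.
\<close>

type_synonym ab_univ = "nat \<Rightarrow> complex fps"

definition embeds :: "('m \<Rightarrow> 'n) \<Rightarrow> (atilde, 'm) module \<Rightarrow> (atilde, 'n) module \<Rightarrow> bool" where
  "embeds \<phi> E L \<longleftrightarrow> \<phi> \<in> lmod_hom E L \<and> inj_on \<phi> (carrier E)"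

definition regular :: "(atilde, 'm) module \<Rightarrow> bool" where
  "regular E \<longleftrightarrow> ab_module E \<and>
     (\<exists>(L :: (atilde, ab_univ) module) \<phi>. simple_pole L \<and> embeds \<phi> E L)"

text \<open>
  In a module with a simple pole, a submodule \<open>N\<close> is stable under \<open>b\<inverse> a\<close> iff
  \<open>a N \<subseteq> b N\<close>.  The saturation of \<open>E\<close> (formed in \<open>E[b\<inverse>]\<close>) is isomorphic to the one
  of its image in any module with a simple pole that contains it.
\<close>

definition saturation :: "(atilde, 'm) module \<Rightarrow> 'm set \<Rightarrow> 'm set" where
  "saturation L X =
     \<Inter>{N. left_submodule N L \<and> X \<subseteq> N \<and>
         (\<lambda>x. avar \<odot>\<^bsub>L\<^esub> x) ` N \<subseteq> (\<lambda>x. bvar \<odot>\<^bsub>L\<^esub> x) ` N}"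

definition bernstein :: "(atilde, 'm) module \<Rightarrow> complex poly" where
  "bernstein E =
     (THE B. \<exists>(L :: (atilde, ab_univ) module) \<phi>. simple_pole L \<and> embeds \<phi> E L \<and>
        B = bernstein_simple_pole (sub_mod L (saturation L (\<phi> ` carrier E))))"

definition geometric :: "(atilde, 'm) module \<Rightarrow> bool" where
  "geometric E \<longleftrightarrow> regular E \<and> (\<forall>z. poly (bernstein E) z = 0 \<longrightarrow> z \<in> \<rat> \<and> Re z < 0)"

definition is_generator :: "(atilde, 'm) module \<Rightarrow> 'm \<Rightarrow> bool" where
  "is_generator E e \<longleftrightarrow> e \<in> carrier E \<and> carrier E = cyclic E e"

definition fresco :: "(atilde, 'm) module \<Rightarrow> bool" where
  "fresco E \<longleftrightarrow> geometric E \<and> (\<exists>e. is_generator E e)"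

definition primitive :: "real \<Rightarrow> (atilde, 'm) module \<Rightarrow> bool" where
  "primitive lam E \<longleftrightarrow> regular E \<and>
     (\<forall>z. poly (bernstein E) z = 0 \<longrightarrow> (\<exists>m::int. z = - of_real lam + of_int m))"

definition semi_simple :: "(atilde, 'm) module \<Rightarrow> bool" where
  "semi_simple E \<longleftrightarrow> regular E \<and>
     (\<exists>n (R :: nat \<Rightarrow> (atilde, ab_univ) module) N.
        (\<forall>i<n. regular (R i) \<and> has_rank (R i) 1) \<and>
        left_submodule N (direct_sum n R) \<and>
        lmod_iso E (sub_mod (direct_sum n R) N))"


section \<open>Principal Jordan-Hoelder sequences and fundamental invariants\<close>

definition normal_submodule :: "'m set \<Rightarrow> (atilde, 'm) module \<Rightarrow> bool" where
  "normal_submodule F E \<longleftrightarrow> left_submodule F E \<and>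
     F \<inter> bE E = (\<lambda>x. bvar \<odot>\<^bsub>E\<^esub> x) ` F"

definition E_rank1 :: "complex \<Rightarrow> (atilde, atilde set) module" where
  "E_rank1 \<mu> = cyclic_quot (lin \<mu>)"

text \<open>
  Lists are indexed from 0: \<open>ls ! j\<close> is the invariant \<open>\<lambda>\<^bsub>j+1\<^esub>\<close>.  The invariants of a
  \<open>[\<lambda>]\<close>-primitive fresco lie in \<open>\<lambda> + \<int>\<close>, which is why a list of reals suffices.
\<close>

definition JH_sequence :: "(atilde, 'm) module \<Rightarrow> (nat \<Rightarrow> 'm set) \<Rightarrow> complex list \<Rightarrow> bool" where
  "JH_sequence E F ls \<longleftrightarrow>
     has_rank E (length ls) \<and> F 0 = {\<zero>\<^bsub>E\<^esub>} \<and> F (length ls) = carrier E \<and>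
     (\<forall>j\<le>length ls. normal_submodule (F j) E) \<and>
     (\<forall>j<length ls. F j \<subseteq> F (Suc j) \<and>
        lmod_iso (quot_mod (sub_mod E (F (Suc j))) (F j)) (E_rank1 (ls ! j)))"

definition principal_JH :: "(atilde, 'm) module \<Rightarrow> (nat \<Rightarrow> 'm set) \<Rightarrow> real list \<Rightarrow> bool" where
  "principal_JH E F ls \<longleftrightarrow> JH_sequence E F (map complex_of_real ls) \<and>
     (\<forall>i j. i \<le> j \<and> j < length ls \<longrightarrow> ls ! i + real i \<le> ls ! j + real j)"

text \<open>\<open>p_inv ls j\<close> is \<open>p\<^bsub>j+1\<^esub>\<close>.\<close>

definition p_inv :: "real list \<Rightarrow> nat \<Rightarrow> real" where
  "p_inv ls j = ls ! Suc j - ls ! j + 1"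

text \<open>
  A fresco \<open>E\<close> with generator \<open>e\<close> is isomorphic to the quotient of the algebra by the annihilator
  of \<open>e\<close>; so all frescos occur, up to isomorphism, among the modules with elements
  of type \<^typ>\<open>atilde set\<close>.
\<close>

type_synonym fresco_univ = "(atilde, atilde set) module"

definition iso_class :: "(atilde, 'm) module \<Rightarrow> fresco_univ set" where
  "iso_class E = {E'. left_module E' \<and> lmod_iso E' E}"

definition admissible_invariants :: "real \<Rightarrow> real list set" where
  "admissible_invariants lam =
     {ls. length ls \<ge> 2 \<and>
        (\<exists>(E :: fresco_univ) F. fresco E \<and> primitive lam E \<and> principal_JH E F ls) \<and>
        (\<forall>j. Suc j < length ls \<longrightarrow> p_inv ls j \<ge> 1)}"

definition F0_fresco :: "real \<Rightarrow> real list \<Rightarrow> (atilde, 'm) module \<Rightarrow> bool" where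
  "F0_fresco lam ls E \<longleftrightarrow> fresco E \<and> primitive lam E \<and>
     (\<exists>F. principal_JH E F ls \<and>
        semi_simple (sub_mod E (F (length ls - 1))) \<and> semi_simple (quot_mod E (F 1)))"

definition F0_classes :: "real \<Rightarrow> real list \<Rightarrow> fresco_univ set set" where
  "F0_classes lam ls = iso_class ` {E :: fresco_univ. F0_fresco lam ls E}"


section \<open>Polynomial functions on sets of isomorphism classes\<close>

text \<open>
  The variable \<open>(j, m)\<close> with \<open>m \<ge> 1\<close> stands for the coefficient of \<open>b^m\<close> in \<open>S\<^bsub>j+1\<^esub>\<close>.
\<close>

definition unit_series :: "(nat \<times> nat \<Rightarrow> complex) \<Rightarrow> nat \<Rightarrow> complex fps" where
  "unit_series s j = Abs_fps (\<lambda>m. if m = 0 then 1 else s (j, m))"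

definition P_of :: "real list \<Rightarrow> (nat \<times> nat \<Rightarrow> complex) \<Rightarrow> atilde" where
  "P_of ls s = prod_list
     (map (\<lambda>j. lin (of_real (ls ! j)) * of_fps (inverse (unit_series s j))) [0..<length ls])"

definition E_of :: "real list \<Rightarrow> (nat \<times> nat \<Rightarrow> complex) \<Rightarrow> fresco_univ" where
  "E_of ls s = cyclic_quot (P_of ls s)"

definition mpoly_eval :: "(('v \<Rightarrow>\<^sub>0 nat) \<Rightarrow>\<^sub>0 complex) \<Rightarrow> ('v \<Rightarrow> complex) \<Rightarrow> complex" where
  "mpoly_eval f s =
     (\<Sum>m\<in>Poly_Mapping.keys f. Poly_Mapping.lookup f m *
        (\<Prod>v\<in>Poly_Mapping.keys m. s v ^ Poly_Mapping.lookup m v))"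

definition polynomial_function ::
  "real list \<Rightarrow> fresco_univ set set \<Rightarrow> (fresco_univ set \<Rightarrow> complex) \<Rightarrow> bool" where
  "polynomial_function ls \<F> g \<longleftrightarrow>
     (\<exists>f :: ((nat \<times> nat) \<Rightarrow>\<^sub>0 nat) \<Rightarrow>\<^sub>0 complex.
        (\<forall>m\<in>Poly_Mapping.keys f. Poly_Mapping.keys m \<subseteq> {..<length ls} \<times> {1..}) \<and>
        (\<forall>s. iso_class (E_of ls s) \<in> \<F> \<longrightarrow> mpoly_eval f s = g (iso_class (E_of ls s))))"

end

theory Submission
  imports Defs "HOL-Computational_Algebra.Formal_Laurent_Series"
begin

text \<open>
  Right division by \<open>a - \<mu>b\<close> turns the principal Jordan-Hoelder sequence of \<open>E\<close> into a basis
  \<open>e\<^sub>1, \<dots>, e\<^sub>k\<close> over \<open>\<complex>[[b]]\<close> with \<open>(a - \<lambda>\<^sub>j b) e\<^sub>j = S\<^sub>j\<^sub>-\<^sub>1 e\<^sub>j\<^sub>-\<^sub>1\<close>. Such a module is semi-simple iff its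
  homomorphisms into \<open>b\<^sup>\<lambda> \<complex>((b))\<close>, with \<open>a\<close> acting as \<open>b\<^sup>2 d/db\<close>, separate its points. These
  homomorphisms are found by solving a triangular system of first order equations, and each of
  its steps is obstructed by one resonant coefficient. If \<open>F\<^sub>k\<^sub>-\<^sub>1\<close> and \<open>E/F\<^sub>1\<close> are semi-simple,
  only the obstruction at the last step of the solution that starts with \<open>1\<close> on \<open>e\<^sub>1\<close> remains; it
  does not depend on the basis, and up to a nonzero constant it is \<open>\<alpha>\<close>. The coefficients of the solution
  are polynomials in those of the \<open>S\<^sub>j\<close>.

  Uniqueness is an induction on \<open>k\<close>: for \<open>k \<ge> 3\<close> the semi-simplicity of \<open>E/F\<^sub>1\<close> makes the
  coefficient of \<open>S\<^sub>k\<^sub>-\<^sub>1\<close> in the resonant degree vanish, so that \<open>S\<^sub>k\<^sub>-\<^sub>1\<close> can be normalized to \<open>1\<close>; this gives a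
  generator as in (ii). For \<open>k = 2\<close> the same normalization leaves \<open>S\<^sub>1 = 1 + x b\<^sup>p\<close>.
\<close>

section \<open>Right division in the algebra\<close>

text \<open>Right division writes every r as q (a - mu b) + f(b), so that closure of spans,
  linearity and kernels need only be tested with a - mu b on a triangular basis over the power
  series. The condition p_j >= 1 enters as monotonicity of the lambda_j. When one chain is expanded
  in another, a leading coordinate g satisfies (n + r) g_n = 0 with r >= 0 and is constant. The
  change of basis is therefore triangular with a single constant k on the diagonal. Transporting a
  solution multiplies its first entry and its last obstruction by the same k, so the obstruction
  normalized by first entry 1 is an invariant. Two solutions with equal first entry differ by one
  that starts later, and E/F_1 supplies enough unobstructed solutions to remove the difference. The
  constant in front is the product of lambda_k - lambda_i + k - i over 1 < i < k: passing from E to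
  G undoes one division by p_{k-1}, and (iii) requires the value 1 for k = 2. For G to lie in the
  right class it must again be geometric and primitive. This is read off its invariants, whence the
  computation of the Bernstein polynomial from a chain.\<close>

lemma acoeff_simps [simp]:
  "acoeff 0 n = 0" "acoeff (x + y) n = acoeff x n + acoeff y n"
  "acoeff (x - y) n = acoeff x n - acoeff y n" "acoeff (- x) n = - acoeff x n"
  by (simp_all add: zero_atilde_def plus_atilde_def minus_atilde_def uminus_atilde_def)

lemma acoeff_of_fps [simp]: "acoeff (of_fps f) n = [:f $ n:]"
  by (simp add: of_fps_def)

lemma acoeff_mult: "acoeff (x * y) n = series_mult (acoeff x) (acoeff y) n"
  by (simp add: times_atilde_def)

lemma of_fps_simps [simp]:
  "of_fps 0 = 0" "of_fps 1 = 1" "of_fps (f + g) = of_fps f + of_fps g"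
  "of_fps (f - g) = of_fps f - of_fps g" "of_fps (- f) = - of_fps f"
  by (simp_all add: atilde_eq_iff one_atilde_def one_pCons)

lemma bvar_of_fps: "bvar = of_fps fps_X"
  by (auto simp: atilde_eq_iff bvar_def one_pCons)

lemma higher_pderiv_linear:
  "(pderiv ^^ j) [:0, 1 :: complex:] = (if j = 0 then [:0, 1:] else if j = 1 then 1 else 0)"
proof (cases j)
  case (Suc i)
  have "(pderiv ^^ Suc i) [:0, 1 :: complex:] = (pderiv ^^ i) 1"
    by (simp add: funpow_Suc_right pderiv_pCons one_pCons del: funpow.simps)
  thus ?thesis using Suc by (simp add: higher_pderiv_one del: funpow.simps)
qed simp

lemma higher_pderiv_const: "(pderiv ^^ j) [:c :: complex:] = (if j = 0 then [:c:] else 0)"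
  by (cases j) (auto simp: funpow_Suc_right simp del: funpow.simps)

lemma comm_coeff_1: "comm_coeff n (Suc 0) = - of_nat n"
  by (simp add: comm_coeff_def)

text \<open>Since a has degree one, only the derivatives of order 0 and 1 survive:
  \<open>b^n a = a b^n - n b^(n+1)\<close>.\<close>

lemma acoeff_mult_avar:
  "acoeff (q * avar) n =
     pCons 0 (acoeff q n) - (case n of 0 \<Rightarrow> 0 | Suc m \<Rightarrow> Polynomial.smult (of_nat m) (acoeff q m))"
proof -
  let ?f = "\<lambda>(\<nu>, j, \<mu>). Polynomial.smult (comm_coeff \<nu> j)
     (acoeff q \<nu> * (pderiv ^^ j) (acoeff avar \<mu>))"
  have "series_mult (acoeff q) (acoeff avar) n
      = (\<Sum>x\<in>(case n of 0 \<Rightarrow> {(0,0,0)} | Suc m \<Rightarrow> {(n,0,0), (m,1,0)}). ?f x)"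
    unfolding series_mult_def
    by (rule sum.mono_neutral_right[OF finite_deg_triples])
       (auto simp: deg_triples_def avar_def higher_pderiv_linear split: nat.splits if_splits)
  also have "\<dots> = pCons 0 (acoeff q n) -
      (case n of 0 \<Rightarrow> 0 | Suc m \<Rightarrow> Polynomial.smult (of_nat m) (acoeff q m))"
    by (auto simp: avar_def comm_coeff_1 pderiv_pCons one_pCons split: nat.splits)
  finally show ?thesis by (simp add: acoeff_mult)
qed

lemma acoeff_mult_of_fps:
  "acoeff (q * of_fps f) n = (\<Sum>i\<le>n. Polynomial.smult (f $ (n - i)) (acoeff q i))"
proof -
  have "series_mult (acoeff q) (acoeff (of_fps f)) n =
      (\<Sum>(\<nu>, j, \<mu>)\<in>{x \<in> deg_triples n. fst (snd x) = 0}. Polynomial.smult (f $ \<mu>) (acoeff q \<nu>))"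
    unfolding series_mult_def
    by (rule sum.mono_neutral_cong_right) (auto simp: higher_pderiv_const split: if_splits)
  also have "\<dots> = (\<Sum>i\<le>n. Polynomial.smult (f $ (n - i)) (acoeff q i))"
    by (rule sum.reindex_bij_witness[of _ "\<lambda>i. (i, 0, n - i)" "\<lambda>(\<nu>, j, \<mu>). \<nu>"])
       (auto simp: deg_triples_def)
  finally show ?thesis by (simp add: acoeff_mult)
qed

lemma acoeff_mult_bvar:
  "acoeff (q * bvar) n = (case n of 0 \<Rightarrow> 0 | Suc m \<Rightarrow> acoeff q m)"
proof -
  have "acoeff (q * bvar) n = (\<Sum>i\<le>n. if n = Suc i then acoeff q i else 0)"
    unfolding bvar_of_fps acoeff_mult_of_fps
    by (intro sum.cong) auto
  also have "\<dots> = (case n of 0 \<Rightarrow> 0 | Suc m \<Rightarrow> acoeff q m)"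
    by (auto split: nat.splits simp: if_distrib cong: if_cong)
  finally show ?thesis .
qed

lemma acoeff_mult_acst: "acoeff (q * acst c) n = Polynomial.smult c (acoeff q n)"
proof -
  have "acoeff (q * acst c) n = (\<Sum>i\<le>n. if i = n then Polynomial.smult c (acoeff q i) else 0)"
    unfolding acoeff_mult_of_fps by (intro sum.cong) auto
  thus ?thesis by simp
qed

lemma acoeff_mult_lin:
  "acoeff (q * lin \<mu>) n =
     pCons 0 (acoeff q n) - (case n of 0 \<Rightarrow> 0 | Suc m \<Rightarrow> Polynomial.smult (of_nat m + \<mu>) (acoeff q m))"
  by (simp add: lin_def right_diff_distrib acoeff_mult_avar mult.assoc[symmetric] acoeff_mult_bvar
      acoeff_mult_acst smult_add_left split: nat.splits)

text \<open>The commutator with a is the derivation \<open>b^2 d/db\<close> on power series in b.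
  This is the source of all differential equations below.\<close>

lemma avar_mult_of_fps: "avar * of_fps g = of_fps g * avar + of_fps (fps_X^2 * fps_deriv g)"
proof -
  have *: "acoeff (avar * of_fps g) n = [:0, g $ n:]" for n
  proof -
    have "acoeff (avar * of_fps g) n = (\<Sum>i\<le>n. if i = 0 then [:0, g $ n:] else 0)"
      unfolding acoeff_mult_of_fps by (intro sum.cong) (auto simp: avar_def)
    thus ?thesis by simp
  qed
  show ?thesis
    unfolding atilde_eq_iff *
    by (auto simp: acoeff_mult_avar fps_X_power_mult_nth split: nat.splits)
qed

lemma lin_alt: "lin \<mu> = avar - of_fps (fps_const \<mu> * fps_X)"
  by (simp add: lin_def bvar_of_fps of_fps_mult)

text \<open>The parameter \<open>\<nu>\<close> on the right is free. It is chosen as the exponent of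
  the vector that \<open>g\<close> multiplies, so that \<open>lin \<nu>\<close> lowers this vector
  in its chain and only a first order expression in \<open>g\<close> remains.\<close>

lemma lin_mult_of_fps:
  "lin \<mu> * of_fps g = of_fps g * lin \<nu> + of_fps (fps_X^2 * fps_deriv g + fps_const (\<nu> - \<mu>) * fps_X * g)"
proof -
  have "fps_const (\<nu> - \<mu>) * fps_X * g = g * (fps_const \<nu> * fps_X) - (fps_const \<mu> * fps_X) * g"
    by (subst fps_const_sub[symmetric]) (simp only: algebra_simps)
  thus ?thesis
    by (simp only: lin_alt left_diff_distrib right_diff_distrib avar_mult_of_fps
        of_fps_mult[symmetric] of_fps_simps) simp
qed

text \<open>This identity is behind property (ii): with mu = lambda_{k-1} and nu = lambda_k it
  trades the last two factors for a - (lambda_k + 1) b applied to the generator of G, which explains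
  the new last invariant.\<close>

lemma lin_swap: "lin \<mu> * lin \<nu> = lin (\<nu> + 1) * lin (\<mu> - 1)"
proof -
  have d: "avar * of_fps (fps_const c * fps_X) =
      of_fps (fps_const c * fps_X) * avar + of_fps (fps_const c * fps_X^2)" for c
    by (simp add: avar_mult_of_fps mult.commute)
  have e: "of_fps (fps_const c * fps_X) * of_fps (fps_const c' * fps_X) =
      of_fps (fps_const (c * c') * fps_X^2)" for c c'
    by (simp add: of_fps_mult[symmetric] power2_eq_square mult_ac flip: fps_const_mult)
  have f: "lin \<mu> * lin \<nu> = avar * avar - of_fps (fps_const (\<mu> + \<nu>) * fps_X) * avar
       + of_fps (fps_const (\<mu> * \<nu> - \<nu>) * fps_X^2)" for \<mu> \<nu>
    by (simp add: lin_alt left_diff_distrib right_diff_distrib distrib_right d e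
         flip: fps_const_sub fps_const_add)
  have g: "\<mu> + \<nu> = \<nu> + 1 + (\<mu> - 1)" "\<mu> * \<nu> - \<nu> = (\<nu> + 1) * (\<mu> - 1) - (\<mu> - 1)"
    by (simp_all add: algebra_simps)
  show ?thesis unfolding f using g by metis
qed

text \<open>By \<open>acoeff_mult_lin\<close>, comparing coefficients of \<open>b^n\<close> in
  \<open>r = q * lin \<mu> + of_fps g\<close> is a division with remainder by the polynomial
  variable: \<open>poly_shift 1\<close> gives the quotient, and the discarded constant term becomes
  the coefficient of \<open>g\<close>.\<close>

primrec quot_coeff :: "complex \<Rightarrow> atilde \<Rightarrow> nat \<Rightarrow> complex poly" where
  "quot_coeff \<mu> r 0 = poly_shift 1 (acoeff r 0)"
| "quot_coeff \<mu> r (Suc n) =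
     poly_shift 1 (acoeff r (Suc n) + Polynomial.smult (of_nat n + \<mu>) (quot_coeff \<mu> r n))"

lemma pCons_poly_shift: "pCons (poly p 0) (poly_shift 1 p) = p"
  by (auto simp: poly_eq_iff coeff_poly_shift coeff_pCons poly_0_coeff_0 split: nat.splits)

lemma right_division: "\<exists>q g. r = q * lin \<mu> + of_fps g"
proof -
  define R where "R n = (case n of 0 \<Rightarrow> acoeff r 0 | Suc m \<Rightarrow>
      acoeff r (Suc m) + Polynomial.smult (of_nat m + \<mu>) (quot_coeff \<mu> r m))" for n
  have q: "quot_coeff \<mu> r n = poly_shift 1 (R n)" for n by (cases n) (auto simp: R_def)
  have "r = Aseries (quot_coeff \<mu> r) * lin \<mu> + of_fps (Abs_fps (\<lambda>n. poly (R n) 0))"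
  proof (subst atilde_eq_iff, intro allI)
    fix n
    have "pCons 0 (quot_coeff \<mu> r n) + [:poly (R n) 0:] = R n"
      unfolding q using pCons_poly_shift[of "R n"] by simp
    thus "acoeff r n = acoeff (Aseries (quot_coeff \<mu> r) * lin \<mu> + of_fps (Abs_fps (\<lambda>n. poly (R n) 0))) n"
      by (cases n) (auto simp: acoeff_mult_lin R_def algebra_simps)
  qed
  thus ?thesis by blast
qed

text \<open>In each degree a multiple of the polynomial variable is added to a constant, and these
  cannot cancel. Knowing the lower coefficients of \<open>q\<close> to vanish removes the correction
  term.\<close>

lemma right_division_zero:
  assumes "q * lin \<mu> + of_fps g = 0"
  shows "q = 0" "g = 0"
proof -
  have *: "acoeff q n = 0 \<and> g $ n = 0" for n
  proof (induction n)
    case 0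
    have "acoeff (q * lin \<mu> + of_fps g) 0 = 0" using assms by simp
    thus ?case by (simp add: acoeff_mult_lin)
  next
    case (Suc n)
    have "acoeff (q * lin \<mu> + of_fps g) (Suc n) = 0" using assms by simp
    thus ?case using Suc by (simp add: acoeff_mult_lin)
  qed
  thus "q = 0" "g = 0" by (auto simp: atilde_eq_iff fps_eq_iff)
qed

lemma right_division_unique:
  assumes "q * lin \<mu> + of_fps g = q' * lin \<mu> + of_fps g'"
  shows "q = q'" "g = g'"
  using right_division_zero[of "q - q'" \<mu> "g - g'"] assms by (simp_all add: algebra_simps)

text \<open>From \<open>a b = b (a + b)\<close>: multiplication by b on the left acts through the
  alternating sum of derivatives, whose inverse is 1 plus one derivative. This gives
  \<open>R\<close>, and the verification telescopes. Consequently \<open>bE\<close> is a submodule,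
  and divisibility by b survives multiplication by the algebra.\<close>

lemma mult_bvar_left: "\<exists>r'. r * bvar = bvar * r'"
proof -
  define R where "R n = acoeff r n + (case n of 0 \<Rightarrow> 0 | Suc m \<Rightarrow> pderiv (acoeff r m))" for n
  have c: "comm_coeff (Suc 0) j = (-1) ^ j" for j
    by (simp add: comm_coeff_def gbinomial_minus binomial_gbinomial[symmetric])
  have "acoeff (bvar * Aseries R) n = acoeff (r * bvar) n" for n
  proof (cases n)
    case 0
    have "acoeff (bvar * Aseries R) 0 = 0"
      by (simp add: acoeff_mult bvar_def series_mult_single_left)
    then show ?thesis using 0 by (simp add: acoeff_mult_bvar)
  next
    case (Suc m)
    define t where "t j = (if j \<le> m then Polynomial.smult ((-1) ^ j) ((pderiv ^^ j) (acoeff r (m - j))) else 0)" for j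
    have "acoeff (bvar * Aseries R) n =
       (\<Sum>j\<le>n. if 1 + j \<le> n then Polynomial.smult (comm_coeff 1 j) (1 * (pderiv ^^ j) (R (n - 1 - j))) else 0)"
      unfolding acoeff_mult bvar_def acoeff_Aseries series_mult_single_left ..
    also have "\<dots> = (\<Sum>j\<le>m. Polynomial.smult ((-1) ^ j) ((pderiv ^^ j) (R (m - j))))"
      using Suc c by (simp add: sum.atMost_Suc)
    also have "\<dots> = (\<Sum>j\<le>m. t j - t (Suc j))"
    proof (intro sum.cong refl)
      fix j assume "j \<in> {..m}"
      moreover have "m - j = Suc i \<Longrightarrow> m - Suc j = i" for i by simp
      ultimately show "Polynomial.smult ((-1) ^ j) ((pderiv ^^ j) (R (m - j))) = t j - t (Suc j)"
        unfolding R_def t_def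
        by (cases "m - j")
           (auto simp: higher_pderiv_add smult_add_right funpow_swap1 Suc_diff_Suc split: nat.splits)
    qed
    also have "\<dots> = t 0" by (subst sum_telescope) (simp add: t_def)
    finally show ?thesis using Suc by (simp add: t_def acoeff_mult_bvar)
  qed
  thus ?thesis by (metis atilde_eq_iff)
qed

section \<open>Left modules, submodules and quotients\<close>

lemma left_moduleI:
  fixes M :: "('r::ring_1, 'm) module" (structure)
  assumes "\<And>x y. x \<in> carrier M \<Longrightarrow> y \<in> carrier M \<Longrightarrow> x \<oplus> y \<in> carrier M"
    and z: "\<zero> \<in> carrier M"
    and "\<And>x y z. x \<in> carrier M \<Longrightarrow> y \<in> carrier M \<Longrightarrow> z \<in> carrier M \<Longrightarrow> (x \<oplus> y) \<oplus> z = x \<oplus> (y \<oplus> z)"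
    and "\<And>x y. x \<in> carrier M \<Longrightarrow> y \<in> carrier M \<Longrightarrow> x \<oplus> y = y \<oplus> x"
    and "\<And>x. x \<in> carrier M \<Longrightarrow> \<zero> \<oplus> x = x"
    and sc: "\<And>r x. x \<in> carrier M \<Longrightarrow> r \<odot> x \<in> carrier M"
    and sl: "\<And>r s x. x \<in> carrier M \<Longrightarrow> (r + s) \<odot> x = r \<odot> x \<oplus> s \<odot> x"
    and "\<And>r x y. x \<in> carrier M \<Longrightarrow> y \<in> carrier M \<Longrightarrow> r \<odot> (x \<oplus> y) = r \<odot> x \<oplus> r \<odot> y"
    and "\<And>r s x. x \<in> carrier M \<Longrightarrow> (r * s) \<odot> x = r \<odot> (s \<odot> x)"
    and s1: "\<And>x. x \<in> carrier M \<Longrightarrow> 1 \<odot> x = x"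
    and s0: "\<And>x. x \<in> carrier M \<Longrightarrow> 0 \<odot> x = \<zero>"
  shows "left_module M"
proof -
  have "\<exists>y\<in>carrier M. y \<oplus> x = \<zero>" if "x \<in> carrier M" for x
  proof
    show "(-1) \<odot> x \<oplus> x = \<zero>"
      using sl[OF that, of "-1" 1] s1[OF that] s0[OF that] by simp
    show "(-1) \<odot> x \<in> carrier M" using sc[OF that] .
  qed
  then have "abelian_group M"
    by (intro abelian_groupI) (use assms in auto)
  then show ?thesis
    by (intro left_module.intro left_module_axioms.intro) (use assms in auto)
qed

context left_module
begin

lemma lsmult_zero [simp]: "x \<in> carrier M \<Longrightarrow> 0 \<odot> x = \<zero>"
  using lsmult_l_distr[of x 0 0] lsmult_closed[of x 0] by simp

lemma lsmult_rzero [simp]: "r \<odot> \<zero> = \<zero>"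
  using lsmult_r_distr[of \<zero> \<zero> r] lsmult_closed[of \<zero> r] by simp

lemma lsmult_neg: "x \<in> carrier M \<Longrightarrow> (- r) \<odot> x = \<ominus> (r \<odot> x)"
  using lsmult_l_distr[of x "-r" r] minus_equality[of "(-r) \<odot> x" "r \<odot> x"]
  by (simp add: lsmult_closed)

lemma lsmult_rneg: "x \<in> carrier M \<Longrightarrow> r \<odot> (\<ominus> x) = \<ominus> (r \<odot> x)"
  using lsmult_r_distr[of "\<ominus> x" x r] minus_equality[of "r \<odot> (\<ominus> x)" "r \<odot> x"]
  by (simp add: lsmult_closed l_neg)

lemma lsmult_diff: "x \<in> carrier M \<Longrightarrow> (r - s) \<odot> x = r \<odot> x \<ominus> s \<odot> x"
  using lsmult_l_distr[of x r "-s"] by (simp add: lsmult_neg a_minus_def)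

lemma lsmult_rdiff: "x \<in> carrier M \<Longrightarrow> y \<in> carrier M \<Longrightarrow> r \<odot> (x \<ominus> y) = r \<odot> x \<ominus> r \<odot> y"
  by (simp add: a_minus_def lsmult_r_distr lsmult_rneg)

lemma diff_zero_iff: "x \<in> carrier M \<Longrightarrow> y \<in> carrier M \<Longrightarrow> x \<ominus> y = \<zero> \<longleftrightarrow> x = y"
  using add.inv_equality minus_equality by (force simp: a_minus_def r_neg)

lemma diff_trans:
  "x \<in> carrier M \<Longrightarrow> y \<in> carrier M \<Longrightarrow> z \<in> carrier M \<Longrightarrow> (z \<ominus> x) \<oplus> (x \<ominus> y) = z \<ominus> y"
  by (simp add: a_minus_def a_assoc) (simp add: a_assoc[symmetric] l_neg)

lemma minus_diff: "x \<in> carrier M \<Longrightarrow> y \<in> carrier M \<Longrightarrow> \<ominus> (x \<ominus> y) = y \<ominus> x"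
  by (simp add: a_minus_def minus_add a_comm)

lemma left_submoduleI:
  assumes "N \<subseteq> carrier M" "\<zero> \<in> N" "\<And>x y. x \<in> N \<Longrightarrow> y \<in> N \<Longrightarrow> x \<oplus> y \<in> N"
    "\<And>r x. x \<in> N \<Longrightarrow> r \<odot> x \<in> N"
  shows "left_submodule N M"
proof -
  have "\<ominus> x \<in> N" if "x \<in> N" for x
    using assms(4)[OF that, of "-1"] assms(1) that
    by (metis lsmult_neg lsmult_one subsetD)
  then have "subgroup N (add_monoid M)"
    by (intro add.subgroupI) (use assms in \<open>auto simp: a_inv_def\<close>)
  thus ?thesis using assms by (auto simp: left_submodule_def)
qed

end

lemma left_submoduleD:
  fixes M :: "('r::ring_1, 'm) module" (structure)
  assumes "left_submodule N M"
  shows "N \<subseteq> carrier M" "\<zero> \<in> N" "\<And>x y. x \<in> N \<Longrightarrow> y \<in> N \<Longrightarrow> x \<oplus> y \<in> N"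
    "\<And>r x. x \<in> N \<Longrightarrow> r \<odot> x \<in> N" "\<And>x. x \<in> N \<Longrightarrow> \<ominus> x \<in> N"
    "\<And>x y. x \<in> N \<Longrightarrow> y \<in> N \<Longrightarrow> x \<ominus> y \<in> N"
proof -
  have s: "subgroup N (add_monoid M)" using assms by (simp add: left_submodule_def)
  show "N \<subseteq> carrier M" "\<zero> \<in> N" "\<And>r x. x \<in> N \<Longrightarrow> r \<odot> x \<in> N"
    using subgroup.subset[OF s] subgroup.one_closed[OF s] assms by (auto simp: left_submodule_def)
  show 1: "\<And>x y. x \<in> N \<Longrightarrow> y \<in> N \<Longrightarrow> x \<oplus> y \<in> N" using subgroup.m_closed[OF s] by simp
  show 2: "\<And>x. x \<in> N \<Longrightarrow> \<ominus> x \<in> N" using subgroup.m_inv_closed[OF s] by (simp add: a_inv_def)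
  show "\<And>x y. x \<in> N \<Longrightarrow> y \<in> N \<Longrightarrow> x \<ominus> y \<in> N" using 1 2 by (simp add: a_minus_def)
qed

context left_module
begin

lemma sub_mod_left_module:
  assumes "left_submodule N M"
  shows "left_module (sub_mod M N)"
proof -
  note N = left_submoduleD[OF assms]
  show ?thesis
    using N(1) by (intro left_moduleI)
      (auto simp: N a_assoc lsmult_assoc lsmult_one lsmult_l_distr lsmult_r_distr subset_eq intro: a_comm)
qed

lemma left_submodule_zero: "left_submodule {\<zero>} M"
  by (rule left_submoduleI) auto

lemma left_submodule_cyclic: "x \<in> carrier M \<Longrightarrow> left_submodule (cyclic M x) M"
  unfolding cyclic_def
proof (rule left_submoduleI)
  assume x: "x \<in> carrier M"
  show "\<zero> \<in> range (\<lambda>r. r \<odot> x)" using lsmult_zero[OF x] by (metis rangeI)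
  show "y \<oplus> z \<in> range (\<lambda>r. r \<odot> x)" if "y \<in> range (\<lambda>r. r \<odot> x)" "z \<in> range (\<lambda>r. r \<odot> x)" for y z
    using that by (auto simp flip: lsmult_l_distr[OF x])
  show "r \<odot> y \<in> range (\<lambda>r. r \<odot> x)" if "y \<in> range (\<lambda>r. r \<odot> x)" for r y
    using that by (auto simp flip: lsmult_assoc[OF x])
qed (auto simp: lsmult_closed)

lemma left_submodule_sub_mod:
  assumes "left_submodule N M" "left_submodule N' M" "N' \<subseteq> N"
  shows "left_submodule N' (sub_mod M N)"
proof -
  interpret S: left_module "sub_mod M N" by (rule sub_mod_left_module[OF assms(1)])
  show ?thesis using left_submoduleD[OF assms(2)] assms(3) by (intro S.left_submoduleI) auto
qed

end

locale left_quotient = left_module M for M :: "('r::ring_1, 'm) module" (structure) +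
  fixes N assumes N: "left_submodule N M"
begin

lemmas N_props = left_submoduleD[OF N]

lemma N_subset [simp]: "x \<in> N \<Longrightarrow> x \<in> carrier M"
  using N_props(1) by auto

abbreviation cls where "cls x \<equiv> N +> x"

lemma cls_eq_set: "x \<in> carrier M \<Longrightarrow> cls x = {y \<in> carrier M. y \<ominus> x \<in> N}"
proof safe
  fix y assume x: "x \<in> carrier M" and "y \<in> cls x"
  then obtain h where h: "h \<in> N" "y = h \<oplus> x" by (auto simp: a_r_coset_def')
  with x show "y \<in> carrier M" "y \<ominus> x \<in> N"
    by (simp_all add: a_minus_def a_assoc r_neg)
next
  fix y assume x: "x \<in> carrier M" and y: "y \<in> carrier M" "y \<ominus> x \<in> N"
  then have "y = (y \<ominus> x) \<oplus> x" by (simp add: a_minus_def a_assoc l_neg)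
  with y show "y \<in> cls x" by (auto simp: a_r_coset_def')
qed

lemma cls_eq_iff:
  assumes "x \<in> carrier M" "y \<in> carrier M"
  shows "cls x = cls y \<longleftrightarrow> x \<ominus> y \<in> N"
proof
  assume "cls x = cls y"
  moreover have "x \<in> cls x" using assms by (simp add: cls_eq_set N_props a_minus_def r_neg)
  ultimately show "x \<ominus> y \<in> N" using assms by (simp add: cls_eq_set)
next
  assume *: "x \<ominus> y \<in> N"
  have "y \<ominus> x \<in> N" using N_props(5)[OF *] assms by (simp add: minus_diff)
  with * have "z \<ominus> x \<in> N \<longleftrightarrow> z \<ominus> y \<in> N" if "z \<in> carrier M" for z
    using N_props(3) diff_trans[of x y z] diff_trans[of y x z] assms that by metis
  then show "cls x = cls y" using assms by (auto simp: cls_eq_set)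
qed

lemma cls_eq_zero_iff: "x \<in> carrier M \<Longrightarrow> cls x = N \<longleftrightarrow> x \<in> N"
  using cls_eq_iff[of x \<zero>] cls_eq_set[of \<zero>] N_props(1) by (auto simp: a_minus_def)

lemma quot_carrier: "carrier (quot_mod M N) = cls ` carrier M"
  by (auto simp: quot_mod_def A_RCOSETS_def')

lemma quot_zero: "\<zero>\<^bsub>quot_mod M N\<^esub> = N"
  by (simp add: quot_mod_def)

lemma quot_add:
  assumes "x \<in> carrier M" "y \<in> carrier M"
  shows "cls x \<oplus>\<^bsub>quot_mod M N\<^esub> cls y = cls (x \<oplus> y)"
proof -
  have "set_add M (cls x) (cls y) = cls (x \<oplus> y)"
  proof safe
    fix z assume "z \<in> set_add M (cls x) (cls y)"
    then obtain h h' where h: "h \<in> N" "h' \<in> N" "z = (h \<oplus> x) \<oplus> (h' \<oplus> y)"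
      by (auto simp: a_r_coset_def' set_add_def')
    then have "z = (h \<oplus> h') \<oplus> (x \<oplus> y)" using assms by (simp add: a_ac)
    then show "z \<in> cls (x \<oplus> y)" using h N_props(3) by (auto simp: a_r_coset_def')
  next
    fix z assume "z \<in> cls (x \<oplus> y)"
    then obtain h where h: "h \<in> N" "z = h \<oplus> (x \<oplus> y)" by (auto simp: a_r_coset_def')
    then have "z = (h \<oplus> x) \<oplus> (\<zero> \<oplus> y)" using assms by (simp add: a_assoc)
    then show "z \<in> set_add M (cls x) (cls y)" using h N_props(2) unfolding set_add_def' a_r_coset_def' by blast
  qed
  thus ?thesis by (simp add: quot_mod_def)
qed

lemma quot_smult:
  assumes x: "x \<in> carrier M"
  shows "r \<odot>\<^bsub>quot_mod M N\<^esub> cls x = cls (r \<odot> x)"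
proof -
  have "cls (r \<odot> y) = cls (r \<odot> x)" if "y \<in> cls x" for y
    using that assms N_props(4)[of "y \<ominus> x" r]
    by (subst cls_eq_iff) (auto simp: cls_eq_set lsmult_closed lsmult_rdiff)
  moreover have "x \<in> cls x" using assms by (simp add: cls_eq_set N_props a_minus_def r_neg)
  ultimately have "(\<Union>y\<in>cls x. cls (r \<odot> y)) = cls (r \<odot> x)" by blast
  then show ?thesis by (simp add: quot_mod_def)
qed

lemma quot_left_module: "left_module (quot_mod M N)"
proof -
  have z: "cls \<zero> = N" using cls_eq_zero_iff[of \<zero>] N_props by simp
  show ?thesis
  proof (rule left_moduleI; (unfold quot_carrier quot_zero)?)
    show "N \<in> cls ` carrier M" using z by force
    show "N \<oplus>\<^bsub>quot_mod M N\<^esub> x = x" if "x \<in> cls ` carrier M" for x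
      using that quot_add[of \<zero>] by (auto simp: z)
    show "0 \<odot>\<^bsub>quot_mod M N\<^esub> x = N" if "x \<in> cls ` carrier M" for x
      using that by (auto simp: quot_smult z)
    show "x \<oplus>\<^bsub>quot_mod M N\<^esub> y = y \<oplus>\<^bsub>quot_mod M N\<^esub> x"
      if xy: "x \<in> cls ` carrier M" "y \<in> cls ` carrier M" for x y
    proof -
      obtain x' where "x = cls x'" "x' \<in> carrier M" using xy(1) by (rule imageE)
      moreover obtain y' where "y = cls y'" "y' \<in> carrier M" using xy(2) by (rule imageE)
      ultimately show ?thesis by (simp add: quot_add a_comm[of x' y'])
    qed
  qed (auto simp: quot_add quot_smult lsmult_closed a_assoc lsmult_assoc lsmult_one lsmult_l_distr lsmult_r_distr)
qed

lemma cls_hom: "cls \<in> lmod_hom M (quot_mod M N)"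
  by (auto simp: lmod_hom_def quot_carrier quot_add quot_smult)

end

section \<open>Homomorphisms\<close>

lemma lmod_homD:
  assumes "h \<in> lmod_hom M N"
  shows "x \<in> carrier M \<Longrightarrow> h x \<in> carrier N"
    "x \<in> carrier M \<Longrightarrow> y \<in> carrier M \<Longrightarrow> h (x \<oplus>\<^bsub>M\<^esub> y) = h x \<oplus>\<^bsub>N\<^esub> h y"
    "x \<in> carrier M \<Longrightarrow> h (r \<odot>\<^bsub>M\<^esub> x) = r \<odot>\<^bsub>N\<^esub> h x"
  using assms by (auto simp: lmod_hom_def)

locale lmod_pair = M: left_module M + N: left_module N
  for M :: "('r::ring_1, 'm) module" and N :: "('r, 'n) module" +
  fixes h assumes h: "h \<in> lmod_hom M N"
begin

lemmas hD = lmod_homD[OF h]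

lemma hom_zero: "h \<zero>\<^bsub>M\<^esub> = \<zero>\<^bsub>N\<^esub>"
  using hD(3)[of "\<zero>\<^bsub>M\<^esub>" 0] hD(1)[of "\<zero>\<^bsub>M\<^esub>"] by simp

lemma hom_minus: "x \<in> carrier M \<Longrightarrow> h (\<ominus>\<^bsub>M\<^esub> x) = \<ominus>\<^bsub>N\<^esub> h x"
  using hD(3)[of x "-1"] hD(1)[of x] by (simp add: M.lsmult_neg N.lsmult_neg M.lsmult_one N.lsmult_one)

lemma hom_diff: "x \<in> carrier M \<Longrightarrow> y \<in> carrier M \<Longrightarrow> h (x \<ominus>\<^bsub>M\<^esub> y) = h x \<ominus>\<^bsub>N\<^esub> h y"
  by (simp add: a_minus_def hD hom_minus)

lemma hom_inj_iff:
  "inj_on h (carrier M) \<longleftrightarrow> (\<forall>x\<in>carrier M. h x = \<zero>\<^bsub>N\<^esub> \<longrightarrow> x = \<zero>\<^bsub>M\<^esub>)"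
proof
  assume "inj_on h (carrier M)"
  then show "\<forall>x\<in>carrier M. h x = \<zero>\<^bsub>N\<^esub> \<longrightarrow> x = \<zero>\<^bsub>M\<^esub>"
    using hom_zero by (metis M.zero_closed inj_onD)
next
  assume *: "\<forall>x\<in>carrier M. h x = \<zero>\<^bsub>N\<^esub> \<longrightarrow> x = \<zero>\<^bsub>M\<^esub>"
  show "inj_on h (carrier M)"
  proof (rule inj_onI)
    fix x y assume "x \<in> carrier M" "y \<in> carrier M" "h x = h y"
    then have "h (x \<ominus>\<^bsub>M\<^esub> y) = \<zero>\<^bsub>N\<^esub>" by (simp add: hom_diff hD N.diff_zero_iff)
    then show "x = y" using * \<open>x \<in> _\<close> \<open>y \<in> _\<close> by (metis M.diff_zero_iff M.minus_closed)
  qed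
qed

lemma image_submodule: "left_submodule (h ` carrier M) N"
proof (rule N.left_submoduleI)
  show "h ` carrier M \<subseteq> carrier N" using hD(1) by auto
  show "\<zero>\<^bsub>N\<^esub> \<in> h ` carrier M" using hom_zero by (metis M.zero_closed imageI)
  show "x \<oplus>\<^bsub>N\<^esub> y \<in> h ` carrier M" if "x \<in> h ` carrier M" "y \<in> h ` carrier M" for x y
    using that by (auto simp flip: hD(2))
  show "r \<odot>\<^bsub>N\<^esub> x \<in> h ` carrier M" if "x \<in> h ` carrier M" for x r
    using that by (auto simp: M.lsmult_closed simp flip: hD(3))
qed

end

lemma lmod_isoE:
  assumes "lmod_iso M N"
  obtains h where "h \<in> lmod_hom M N" "bij_betw h (carrier M) (carrier N)"
  using assms by (auto simp: lmod_iso_def)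

lemma lmod_hom_inv_into:
  assumes "left_module M" "h \<in> lmod_hom M N" "bij_betw h (carrier M) (carrier N)"
  shows "inv_into (carrier M) h \<in> lmod_hom N M"
proof -
  interpret left_module M by fact
  let ?g = "inv_into (carrier M) h"
  have hg: "h (?g y) = y" "?g y \<in> carrier M" if "y \<in> carrier N" for y
    using that assms(3) by (auto simp: bij_betw_def f_inv_into_f inv_into_into)
  have gh: "?g (h x) = x" if "x \<in> carrier M" for x
    using that assms(3) by (auto simp: bij_betw_def)
  show ?thesis unfolding lmod_hom_def
  proof safe
    fix x y assume "x \<in> carrier N" "y \<in> carrier N"
    then show "?g (x \<oplus>\<^bsub>N\<^esub> y) = ?g x \<oplus>\<^bsub>M\<^esub> ?g y"
      using gh[of "?g x \<oplus>\<^bsub>M\<^esub> ?g y"] by (simp add: lmod_homD[OF assms(2)] hg)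
  next
    fix r x assume "x \<in> carrier N"
    then show "?g (r \<odot>\<^bsub>N\<^esub> x) = r \<odot>\<^bsub>M\<^esub> ?g x"
      using gh[of "r \<odot>\<^bsub>M\<^esub> ?g x"] by (simp add: lmod_homD[OF assms(2)] hg lsmult_closed)
  qed (auto simp: hg)
qed

lemma lmod_iso_sym: "left_module M \<Longrightarrow> lmod_iso M N \<Longrightarrow> lmod_iso N M"
  unfolding lmod_iso_def using bij_betw_inv_into lmod_hom_inv_into by blast

lemma lmod_hom_compose:
  "g \<in> lmod_hom M N \<Longrightarrow> h \<in> lmod_hom N K \<Longrightarrow> (\<lambda>x. h (g x)) \<in> lmod_hom M K"
  by (auto simp: lmod_hom_def Pi_iff)

lemma lmod_iso_trans:
  fixes M :: "('r::ring_1, 'm) module" and N :: "('r, 'n) module" and K :: "('r, 'k) module"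
  shows "lmod_iso M N \<Longrightarrow> lmod_iso N K \<Longrightarrow> lmod_iso M K"
proof -
  assume "lmod_iso M N" "lmod_iso N K"
  then obtain g h where g: "g \<in> lmod_hom M N" "bij_betw g (carrier M) (carrier N)"
    and h: "h \<in> lmod_hom N K" "bij_betw h (carrier N) (carrier K)"
    by (auto simp: lmod_iso_def)
  show "lmod_iso M K"
    unfolding lmod_iso_def using lmod_hom_compose[OF g(1) h(1)] bij_betw_trans[OF g(2) h(2)]
    by (auto simp: comp_def)
qed

lemma lmod_iso_refl: "lmod_iso M M"
  unfolding lmod_iso_def by (rule bexI[of _ "\<lambda>x. x"]) (auto simp: lmod_hom_def bij_betw_def)

lemma iso_class_eq_iff:
  fixes E E' :: fresco_univ
  assumes "left_module E" "left_module E'"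
  shows "iso_class E = iso_class E' \<longleftrightarrow> lmod_iso E E'"
proof
  assume "iso_class E = iso_class E'"
  moreover have "E \<in> iso_class E" using assms lmod_iso_refl by (auto simp: iso_class_def)
  ultimately show "lmod_iso E E'" by (auto simp: iso_class_def)
next
  assume "lmod_iso E E'"
  moreover from this have "lmod_iso E' E" using lmod_iso_sym assms(1) by blast
  ultimately have "lmod_iso K E \<longleftrightarrow> lmod_iso K E'" for K :: fresco_univ
    using lmod_iso_trans[of K E E'] lmod_iso_trans[of K E' E] by blast
  then show "iso_class E = iso_class E'" by (auto simp: iso_class_def)
qed

lemma direct_sum_left_module:
  assumes R: "\<And>i. i < n \<Longrightarrow> left_module (R i)"
  shows "left_module (direct_sum n R)"
proof -
  have ag: "abelian_group (R i)" if "i < n" for i using left_module.axioms(1)[OF R[OF that]] .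
  have am: "abelian_monoid (R i)" if "i < n" for i using abelian_group.axioms(1)[OF ag[OF that]] .
  note facts = abelian_monoid.a_closed[OF am] abelian_monoid.zero_closed[OF am]
    abelian_monoid.a_assoc[OF am] abelian_monoid.l_zero[OF am]
    left_module.lsmult_closed[OF R] left_module.lsmult_l_distr[OF R]
    left_module.lsmult_r_distr[OF R] left_module.lsmult_assoc[OF R] left_module.lsmult_one[OF R]
    left_module.lsmult_zero[OF R]
  have mem: "x i \<in> carrier (R i)" if "x \<in> (\<Pi>\<^sub>E i\<in>{..<n}. carrier (R i))" "i < n" for x i
    using that by auto
  have ext: "x = y" if "x \<in> (\<Pi>\<^sub>E i\<in>{..<n}. carrier (R i))" "y \<in> (\<Pi>\<^sub>E i\<in>{..<n}. carrier (R i))"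
    "\<And>i. i < n \<Longrightarrow> x i = y i" for x y
    using that by (intro PiE_ext) auto
  show ?thesis
    by (rule left_moduleI; simp add: direct_sum_def; (intro ext)?)
       (simp_all add: facts mem PiE_iff abelian_monoid.a_comm[OF am]
         abelian_monoid.a_lcomm[OF am] abelian_monoid.r_zero[OF am])
qed

lemma regular_rep_left_module: "left_module (regular_rep :: ('r::ring_1, 'r) module)"
  by (rule left_moduleI) (auto simp: regular_rep_def algebra_simps)

lemma left_ideal_submodule: "left_submodule (range (\<lambda>Q. Q * P)) (regular_rep :: ('r::ring_1, 'r) module)"
proof (rule left_module.left_submoduleI[OF regular_rep_left_module])
  show "\<zero>\<^bsub>regular_rep\<^esub> \<in> range (\<lambda>Q. Q * P)"
    using rangeI[of "\<lambda>Q. Q * P" 0] by (simp add: regular_rep_def)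
  show "x \<oplus>\<^bsub>regular_rep\<^esub> y \<in> range (\<lambda>Q. Q * P)"
    if xy: "x \<in> range (\<lambda>Q. Q * P)" "y \<in> range (\<lambda>Q. Q * P)" for x y
  proof -
    obtain q q' where "x = q * P" "y = q' * P" using xy by auto
    then have "x + y = (q + q') * P" by (simp add: distrib_right)
    then show ?thesis by (simp add: regular_rep_def)
  qed
  show "s \<odot>\<^bsub>regular_rep\<^esub> x \<in> range (\<lambda>Q. Q * P)" if x: "x \<in> range (\<lambda>Q. Q * P)" for s x
  proof -
    obtain q where "x = q * P" using x by auto
    then have "s * x = (s * q) * P" by (simp add: mult.assoc)
    then show ?thesis by (simp add: regular_rep_def)
  qed
qed (auto simp: regular_rep_def)

lemma first_isomorphism:
  assumes M: "left_module M" and N: "left_module N" and k: "k \<in> lmod_hom M N"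
    and surj: "k ` carrier M = carrier N"
    and K: "left_submodule K M" "\<And>x. x \<in> carrier M \<Longrightarrow> k x = \<zero>\<^bsub>N\<^esub> \<longleftrightarrow> x \<in> K"
  shows "lmod_iso (quot_mod M K) N"
proof -
  interpret Q: left_quotient M K using M K(1) by (simp add: left_quotient_def left_quotient_axioms_def)
  interpret lmod_pair M N k using M N k by (simp add: lmod_pair_def lmod_pair_axioms_def)
  define \<phi> where "\<phi> X = k (SOME x. x \<in> carrier M \<and> X = Q.cls x)" for X
  have \<phi>: "\<phi> (Q.cls x) = k x" if x: "x \<in> carrier M" for x
  proof -
    define y where "y = (SOME y. y \<in> carrier M \<and> Q.cls x = Q.cls y)"
    have "y \<in> carrier M \<and> Q.cls x = Q.cls y"
      unfolding y_def by (rule someI[of _ x]) (simp add: x)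
    then have y: "y \<in> carrier M" "x \<ominus>\<^bsub>M\<^esub> y \<in> K" using x Q.cls_eq_iff by auto
    then have "k x = k y" using K(2)[of "x \<ominus>\<^bsub>M\<^esub> y"] x by (simp add: hom_diff hD N.diff_zero_iff)
    then show ?thesis by (simp add: \<phi>_def y_def)
  qed
  have "\<phi> \<in> lmod_hom (quot_mod M K) N"
    by (auto simp: lmod_hom_def Q.quot_carrier Q.quot_add Q.quot_smult \<phi> hD Q.lsmult_closed)
  moreover have "inj_on \<phi> (carrier (quot_mod M K))"
  proof (rule inj_onI)
    fix X Y assume "X \<in> carrier (quot_mod M K)" "Y \<in> carrier (quot_mod M K)" and eq: "\<phi> X = \<phi> Y"
    then obtain x y where xy: "x \<in> carrier M" "y \<in> carrier M" "X = Q.cls x" "Y = Q.cls y"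
      by (auto simp: Q.quot_carrier)
    then have "k (x \<ominus>\<^bsub>M\<^esub> y) = \<zero>\<^bsub>N\<^esub>" using eq by (simp add: \<phi> hom_diff hD N.diff_zero_iff)
    then show "X = Y" using xy K(2) by (simp add: Q.cls_eq_iff)
  qed
  moreover have "\<phi> ` carrier (quot_mod M K) = carrier N"
    using surj by (auto simp: Q.quot_carrier image_image \<phi>)
  ultimately show ?thesis by (auto simp: lmod_iso_def bij_betw_def)
qed

section \<open>Combinations over the power series in \<open>b\<close>\<close>

text \<open>A recursive sum rather than a finite sum over a set: most facts about spans are
  inductions on the length, along the filtration. \<open>comb_eq_finsum\<close> connects it with
  \<open>has_rank\<close>.\<close>

primrec comb :: "(atilde, 'm) module \<Rightarrow> (nat \<Rightarrow> 'm) \<Rightarrow> nat \<Rightarrow> (nat \<Rightarrow> complex fps) \<Rightarrow> 'm" where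
  "comb M e 0 g = \<zero>\<^bsub>M\<^esub>"
| "comb M e (Suc n) g = comb M e n g \<oplus>\<^bsub>M\<^esub> of_fps (g n) \<odot>\<^bsub>M\<^esub> e n"

abbreviation spn :: "(atilde, 'm) module \<Rightarrow> (nat \<Rightarrow> 'm) \<Rightarrow> nat \<Rightarrow> 'm set" where
  "spn M e n \<equiv> range (comb M e n)"

definition indep :: "(atilde, 'm) module \<Rightarrow> (nat \<Rightarrow> 'm) \<Rightarrow> nat \<Rightarrow> bool" where
  "indep M e n \<longleftrightarrow> (\<forall>g. comb M e n g = \<zero>\<^bsub>M\<^esub> \<longrightarrow> (\<forall>i<n. g i = 0))"

definition single :: "nat \<Rightarrow> complex fps \<Rightarrow> nat \<Rightarrow> complex fps" where
  "single j f = (\<lambda>i. if i = j then f else 0)"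

lemma comb_cong: "(\<And>i. i < n \<Longrightarrow> g i = h i) \<Longrightarrow> (\<And>i. i < n \<Longrightarrow> e i = e' i) \<Longrightarrow> comb M e n g = comb M e' n h"
  by (induction n) auto

locale ab_left = left_module M for M :: "(atilde, 'm) module" (structure)
begin

lemma fs_simps [simp]:
  "x \<in> carrier M \<Longrightarrow> of_fps (f + g) \<odot> x = of_fps f \<odot> x \<oplus> of_fps g \<odot> x"
  "x \<in> carrier M \<Longrightarrow> of_fps 0 \<odot> x = \<zero>" "x \<in> carrier M \<Longrightarrow> of_fps 1 \<odot> x = x"
  by (simp_all add: lsmult_l_distr lsmult_one)

lemma fs_mult: "x \<in> carrier M \<Longrightarrow> of_fps f \<odot> (of_fps g \<odot> x) = of_fps (f * g) \<odot> x"
  by (simp add: of_fps_mult lsmult_assoc)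

lemma comb_closed:
  "(\<And>i. i < n \<Longrightarrow> e i \<in> carrier M) \<Longrightarrow> comb M e n g \<in> carrier M"
  by (induction n) (auto simp: lsmult_closed)

lemma comb_zero: "(\<And>i. i < n \<Longrightarrow> e i \<in> carrier M) \<Longrightarrow> comb M e n (\<lambda>_. 0) = \<zero>"
  by (induction n) (auto simp: lsmult_closed)

lemma comb_add:
  "(\<And>i. i < n \<Longrightarrow> e i \<in> carrier M) \<Longrightarrow>
     comb M e n (\<lambda>i. g i + h i) = comb M e n g \<oplus> comb M e n h"
proof (induction n)
  case (Suc n)
  moreover have "comb M e n g \<in> carrier M" "comb M e n h \<in> carrier M"
    using Suc.prems by (auto intro!: comb_closed)
  ultimately show ?case by (auto simp del: of_fps_simps simp: lsmult_closed a_ac)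
qed auto

lemma comb_smult:
  "(\<And>i. i < n \<Longrightarrow> e i \<in> carrier M) \<Longrightarrow> comb M e n (\<lambda>i. f * g i) = of_fps f \<odot> comb M e n g"
proof (induction n)
  case (Suc n)
  moreover have "comb M e n g \<in> carrier M"
    using Suc.prems by (auto intro!: comb_closed)
  ultimately show ?case by (auto simp: lsmult_closed fs_mult lsmult_r_distr)
qed auto

lemma comb_diff:
  assumes "\<And>i. i < n \<Longrightarrow> e i \<in> carrier M"
  shows "comb M e n (\<lambda>i. g i - h i) = comb M e n g \<ominus> comb M e n h"
proof -
  have "comb M e n (\<lambda>i. g i - h i) = comb M e n (\<lambda>i. g i + (-1) * h i)" by simp
  also have "\<dots> = comb M e n g \<oplus> of_fps (-1) \<odot> comb M e n h"
    by (subst comb_add, fact assms, subst comb_smult) (use assms in auto)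
  also have "\<dots> = comb M e n g \<ominus> comb M e n h"
    using comb_closed[of n e h] assms by (simp add: lsmult_neg lsmult_one a_minus_def)
  finally show ?thesis .
qed

lemma comb_single:
  "(\<And>i. i < n \<Longrightarrow> e i \<in> carrier M) \<Longrightarrow> comb M e n (single j f) = (if j < n then of_fps f \<odot> e j else \<zero>)"
  by (induction n) (auto simp: single_def lsmult_closed less_Suc_eq)

lemma comb_le:
  assumes "m \<le> n" "\<And>i. i < n \<Longrightarrow> e i \<in> carrier M" "\<And>i. m \<le> i \<Longrightarrow> i < n \<Longrightarrow> g i = 0"
  shows "comb M e n g = comb M e m g"
  using assms
proof (induction n)
  case (Suc n)
  then show ?case
    by (cases "m = Suc n") (auto simp: le_Suc_eq intro!: r_zero comb_closed)
qed auto

lemma spn_mono: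
  assumes "m \<le> n" "\<And>i. i < n \<Longrightarrow> e i \<in> carrier M"
  shows "spn M e m \<subseteq> spn M e n"
proof safe
  fix g
  have "comb M e m g = comb M e m (\<lambda>i. if i < m then g i else 0)" by (rule comb_cong) auto
  also have "\<dots> = comb M e n (\<lambda>i. if i < m then g i else 0)"
    using assms by (intro comb_le[symmetric]) auto
  finally show "comb M e m g \<in> spn M e n" by simp
qed

lemma spn_basis:
  assumes "i < n" "\<And>i. i < n \<Longrightarrow> e i \<in> carrier M"
  shows "e i \<in> spn M e n"
  using comb_single[of n e i 1] assms lsmult_one by (metis fs_simps(3) rangeI)

lemma comb_eq_finsum:
  "(\<And>i. i < n \<Longrightarrow> e i \<in> carrier M) \<Longrightarrow> comb M e n g = (\<Oplus>i\<in>{..<n}. of_fps (g i) \<odot> e i)"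
proof (induction n)
  case (Suc n)
  have "(\<Oplus>i\<in>{..<Suc n}. of_fps (g i) \<odot> e i) =
     of_fps (g n) \<odot> e n \<oplus> (\<Oplus>i\<in>{..<n}. of_fps (g i) \<odot> e i)"
    unfolding lessThan_Suc by (subst finsum_insert) (use Suc.prems in \<open>auto simp: lsmult_closed Pi_iff\<close>)
  moreover have "comb M e n g \<in> carrier M" using Suc.prems by (auto intro!: comb_closed)
  ultimately show ?case using Suc by (simp add: lsmult_closed a_comm)
qed auto

text \<open>A span over the power series is stable under the whole algebra once it is triangular:
  dividing \<open>r * of_fps (g n)\<close> by \<open>lin (l n)\<close> leaves a power series times
  \<open>e n\<close> and a multiple of \<open>lin (l n)\<close> applied to \<open>e n\<close>, which
  lies in the smaller span.\<close>

lemma spn_submodule: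
  assumes "\<And>i. i < n \<Longrightarrow> e i \<in> carrier M" "\<And>i. i < n \<Longrightarrow> lin (l i) \<odot> e i \<in> spn M e i"
  shows "left_submodule (spn M e n) M"
  using assms
proof (induction n)
  case 0
  have "spn M e 0 = {\<zero>}" by auto
  then show ?case by (simp add: left_submodule_zero)
next
  case (Suc n)
  have "left_submodule (spn M e n) M" using Suc by auto
  note N = left_submoduleD[OF this]
  show ?case
  proof (rule left_submoduleI)
    show "spn M e (Suc n) \<subseteq> carrier M" using Suc.prems(1) by (auto intro!: comb_closed lsmult_closed)
    show "\<zero> \<in> spn M e (Suc n)" using comb_zero[of "Suc n" e] Suc.prems(1) by (metis rangeI)
    show "x \<oplus> y \<in> spn M e (Suc n)" if xy: "x \<in> spn M e (Suc n)" "y \<in> spn M e (Suc n)" for x y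
    proof -
      obtain g h where "x = comb M e (Suc n) g" "y = comb M e (Suc n) h" using xy by auto
      then have "x \<oplus> y = comb M e (Suc n) (\<lambda>i. g i + h i)" using Suc.prems(1) by (subst comb_add) auto
      then show ?thesis by blast
    qed
    show "r \<odot> x \<in> spn M e (Suc n)" if x: "x \<in> spn M e (Suc n)" for r x
    proof -
      obtain g where g: "x = comb M e (Suc n) g" using x by auto
      obtain q f where qf: "r * of_fps (g n) = q * lin (l n) + of_fps f" using right_division by blast
      have en: "e n \<in> carrier M" and c: "comb M e n g \<in> carrier M"
        using Suc.prems(1) by (auto intro!: comb_closed)
      have "r \<odot> x = r \<odot> comb M e n g \<oplus> (r * of_fps (g n)) \<odot> e n"
        using en c by (simp add: g lsmult_r_distr lsmult_assoc lsmult_closed)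
      also have "\<dots> = (r \<odot> comb M e n g \<oplus> q \<odot> (lin (l n) \<odot> e n)) \<oplus> of_fps f \<odot> e n"
        using en c by (simp add: qf lsmult_l_distr lsmult_assoc lsmult_closed a_assoc)
      finally have eq: "r \<odot> x = (r \<odot> comb M e n g \<oplus> q \<odot> (lin (l n) \<odot> e n)) \<oplus> of_fps f \<odot> e n" .
      have "r \<odot> comb M e n g \<oplus> q \<odot> (lin (l n) \<odot> e n) \<in> spn M e n"
        by (rule N(3)[OF N(4) N(4)]) (use Suc.prems(2)[of n] in simp_all)
      then obtain h where h: "r \<odot> comb M e n g \<oplus> q \<odot> (lin (l n) \<odot> e n) = comb M e n h" by auto
      have "r \<odot> x = comb M e (Suc n) (h(n := f))"
        unfolding eq h by (simp add: comb_cong[of n "h(n := f)" h])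
      then show ?thesis by blast
    qed
  qed
qed

lemma spn_least:
  assumes "left_submodule N M" "\<And>i. i < n \<Longrightarrow> e i \<in> N"
  shows "spn M e n \<subseteq> N"
proof safe
  fix g show "comb M e n g \<in> N"
    using assms(2) by (induction n) (auto intro: left_submoduleD[OF assms(1)])
qed

lemma comb_Suc_shift:
  assumes "\<And>i. i < Suc n \<Longrightarrow> e i \<in> carrier M"
  shows "comb M e (Suc n) g = of_fps (g 0) \<odot> e 0 \<oplus> comb M (\<lambda>i. e (Suc i)) n (\<lambda>i. g (Suc i))"
  using assms
proof (induction n)
  case (Suc n)
  have "comb M (\<lambda>i. e (Suc i)) n (\<lambda>i. g (Suc i)) \<in> carrier M"
    using Suc.prems by (auto intro!: comb_closed)
  moreover have "comb M e (Suc (Suc n)) g = comb M e (Suc n) g \<oplus> of_fps (g (Suc n)) \<odot> e (Suc n)" by simp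
  ultimately show ?case using Suc by (simp add: a_assoc lsmult_closed)
qed (auto simp: lsmult_closed)

lemma comb_sub_mod: "comb (sub_mod M N) e n g = comb M e n g"
  by (induction n) auto

text \<open>Every coefficient is moved past by \<open>lin_mult_of_fps\<close> with the exponent of
  its own basis vector. The right side is the triangular first order system that governs the
  development.\<close>

lemma lin_comb:
  assumes "\<And>i. i < n \<Longrightarrow> e i \<in> carrier M"
    and "\<And>i. i < n \<Longrightarrow> lin (l i) \<odot> e i = (if i = 0 then \<zero> else of_fps (S (i - 1)) \<odot> e (i - 1))"
  shows "lin \<mu> \<odot> comb M e n g = comb M e n (\<lambda>i. fps_X^2 * fps_deriv (g i) +
     fps_const (l i - \<mu>) * fps_X * g i + (if Suc i < n then S i * g (Suc i) else 0))"
  using assms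
proof (induction n)
  case (Suc n)
  define A where "A i = fps_X^2 * fps_deriv (g i) + fps_const (l i - \<mu>) * fps_X * g i" for i
  have e: "e i \<in> carrier M" if "i \<le> n" for i using Suc.prems(1) that by simp
  have c: "comb M e n h \<in> carrier M" for h using e by (intro comb_closed) auto
  have "lin \<mu> \<odot> (of_fps (g n) \<odot> e n) =
      of_fps (g n) \<odot> (lin (l n) \<odot> e n) \<oplus> of_fps (A n) \<odot> e n"
    using e[of n] lin_mult_of_fps[of \<mu> "g n" "l n"]
    by (simp add: A_def lsmult_assoc[symmetric] lsmult_l_distr[symmetric] del: of_fps_simps fs_simps)
  also have "of_fps (g n) \<odot> (lin (l n) \<odot> e n) = comb M e n (if n = 0 then (\<lambda>_. 0) else single (n - 1) (S (n - 1) * g n))"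
    using Suc.prems(2)[of n] e by (auto simp: comb_single comb_zero fs_mult mult.commute)
  finally have "lin \<mu> \<odot> comb M e (Suc n) g =
    comb M e n (\<lambda>i. A i + (if Suc i < n then S i * g (Suc i) else 0)) \<oplus>
     (comb M e n (if n = 0 then (\<lambda>_. 0) else single (n - 1) (S (n - 1) * g n)) \<oplus> of_fps (A n) \<odot> e n)"
    using Suc.IH Suc.prems c e by (simp add: lsmult_r_distr lsmult_closed A_def del: of_fps_simps fs_simps)
  also have "\<dots> = comb M e n (\<lambda>i. A i + (if Suc i < n then S i * g (Suc i) else 0) +
       (if n = 0 then (\<lambda>_. 0) else single (n - 1) (S (n - 1) * g n)) i) \<oplus> of_fps (A n) \<odot> e n"
    using c e by (subst comb_add) (auto simp: a_assoc lsmult_closed)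
  also have "\<dots> = comb M e n (\<lambda>i. A i + (if Suc i < Suc n then S i * g (Suc i) else 0)) \<oplus> of_fps (A n) \<odot> e n"
    by (intro arg_cong2[where f = "(\<oplus>)"] refl comb_cong) (auto simp: single_def)
  finally show ?case by (simp add: A_def del: of_fps_simps fs_simps)
qed auto

section \<open>Bases over the power series in b and coordinates\<close>

definition basis :: "(nat \<Rightarrow> 'm) \<Rightarrow> nat \<Rightarrow> bool" where
  "basis e n \<longleftrightarrow> (\<forall>i<n. e i \<in> carrier M) \<and> carrier M = spn M e n \<and> indep M e n"

lemma comb_eq_iff:
  assumes "indep M e n" "\<And>i. i < n \<Longrightarrow> e i \<in> carrier M"
  shows "comb M e n g = comb M e n h \<longleftrightarrow> (\<forall>i<n. g i = h i)"
proof
  assume "comb M e n g = comb M e n h"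
  then have "comb M e n (\<lambda>i. g i - h i) = \<zero>"
    using assms(2) comb_closed[of n e] by (simp add: comb_diff diff_zero_iff)
  then show "\<forall>i<n. g i = h i" using assms(1) by (auto simp: indep_def)
next
  assume "\<forall>i<n. g i = h i"
  then show "comb M e n g = comb M e n h" by (intro comb_cong) auto
qed

lemma basis_has_rank:
  assumes "basis e n"
  shows "has_rank M n"
  unfolding has_rank_def
proof (intro exI[of _ e] conjI ballI)
  show "\<forall>i<n. e i \<in> carrier M" using assms unfolding basis_def by blast
  then have e: "\<And>i. i < n \<Longrightarrow> e i \<in> carrier M" by auto
  fix x assume "x \<in> carrier M"
  then obtain g where g: "x = comb M e n g" using assms by (auto simp: basis_def)
  have *: "x = (\<Oplus>i\<in>{..<n}. of_fps (S i) \<odot> e i) \<longleftrightarrow> (\<forall>i<n. g i = S i)" for S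
    using comb_eq_iff[of e n g S] e assms by (simp add: g basis_def flip: comb_eq_finsum)
  then show "\<exists>!S. S \<in> {..<n} \<rightarrow>\<^sub>E UNIV \<and> x = (\<Oplus>i\<in>{..<n}. of_fps (S i) \<odot> e i)"
    unfolding * by (intro ex1I[of _ "\<lambda>i\<in>{..<n}. g i"]) (auto simp: PiE_iff extensional_def fun_eq_iff)
qed

lemma has_rank_basis:
  assumes "has_rank M n"
  obtains e where "basis e n"
proof -
  obtain e where e': "\<forall>i<n. e i \<in> carrier M"
    and ex': "\<forall>x\<in>carrier M. \<exists>!S. S \<in> {..<n} \<rightarrow>\<^sub>E UNIV \<and> x = (\<Oplus>i\<in>{..<n}. of_fps (S i) \<odot> e i)"
    using assms unfolding has_rank_def by (elim exE conjE)
  then have e: "e i \<in> carrier M" if "i < n" for i using that by blast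
  have ex: "\<exists>!S. S \<in> {..<n} \<rightarrow>\<^sub>E UNIV \<and> x = comb M e n S" if "x \<in> carrier M" for x
    using ex' that comb_eq_finsum[of n e] e by simp
  have "carrier M = spn M e n"
  proof safe
    show "x \<in> spn M e n" if "x \<in> carrier M" for x using ex[OF that] by (auto elim: ex1E)
    show "comb M e n g \<in> carrier M" for g using comb_closed e by blast
  qed
  moreover have "g i = 0" if g: "comb M e n g = \<zero>" and i: "i < n" for g i
  proof -
    have r: "comb M e n (restrict h {..<n}) = comb M e n h" for h by (rule comb_cong) auto
    have "comb M e n (restrict g {..<n}) = \<zero>" "comb M e n (restrict (\<lambda>_. 0) {..<n}) = \<zero>"
      using g comb_zero[of n e] e by (simp_all add: r)
    then have "restrict g {..<n} = restrict (\<lambda>_. 0) {..<n}"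
      using ex[OF zero_closed] by (metis (no_types, lifting) UNIV_I restrict_PiE_iff)
    then show ?thesis using i by (metis lessThan_iff restrict_apply)
  qed
  ultimately show thesis using that[of e] e by (auto simp: basis_def indep_def)
qed

text \<open>The value 0 beyond the basis lets formulas that mention the next coordinate, such as the
  action of \<open>lin\<close>, hold at the last index without a case distinction.\<close>

definition crd :: "(nat \<Rightarrow> 'm) \<Rightarrow> nat \<Rightarrow> 'm \<Rightarrow> nat \<Rightarrow> complex fps" where
  "crd e n x = (\<lambda>i. if i < n then (SOME g. x = comb M e n g) i else 0)"

context
  fixes e n assumes b: "basis e n"
begin

lemma basis_closed: "i < n \<Longrightarrow> e i \<in> carrier M"
  using b unfolding basis_def by blast

lemma comb_crd: "x \<in> carrier M \<Longrightarrow> comb M e n (crd e n x) = x"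
proof -
  assume "x \<in> carrier M"
  then have "\<exists>g. x = comb M e n g" using b by (auto simp: basis_def)
  then have "x = comb M e n (SOME g. x = comb M e n g)" by (rule someI_ex)
  moreover have "comb M e n (SOME g. x = comb M e n g) = comb M e n (crd e n x)"
    by (rule comb_cong) (auto simp: crd_def)
  ultimately show ?thesis by simp
qed

lemma crd_unique: "x = comb M e n g \<Longrightarrow> i < n \<Longrightarrow> crd e n x i = g i"
  using comb_eq_iff[of e n "crd e n x" g] comb_crd[of x] b comb_closed[of n e g]
  by (auto simp: basis_def)

lemma crd_beyond: "n \<le> i \<Longrightarrow> crd e n x i = 0" by (simp add: crd_def)

lemma crd_add:
  assumes "x \<in> carrier M" "y \<in> carrier M"
  shows "crd e n (x \<oplus> y) i = crd e n x i + crd e n y i"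
proof (cases "i < n")
  case True
  show ?thesis
    using comb_add[of n e "crd e n x" "crd e n y"] basis_closed assms True
    by (intro crd_unique) (simp_all add: comb_crd)
qed (simp add: crd_beyond)

lemma crd_fs:
  assumes "x \<in> carrier M"
  shows "crd e n (of_fps f \<odot> x) i = f * crd e n x i"
proof (cases "i < n")
  case True
  show ?thesis
    using comb_smult[of n e f "crd e n x"] basis_closed assms True
    by (intro crd_unique) (simp_all add: comb_crd)
qed (simp add: crd_beyond)

lemma crd_zero: "crd e n \<zero> i = 0"
  using crd_fs[of \<zero> 0 i] by simp

lemma crd_basis: "j < n \<Longrightarrow> crd e n (e j) i = (if i = j then 1 else 0)"
  using comb_single[of n e j 1] basis_closed crd_unique[of "e j" "single j 1" i]
  by (cases "i < n") (auto simp: single_def crd_beyond lsmult_one)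

lemma crd_eq_iff:
  "x \<in> carrier M \<Longrightarrow> y \<in> carrier M \<Longrightarrow> x = y \<longleftrightarrow> (\<forall>i<n. crd e n x i = crd e n y i)"
  using comb_crd[of x] comb_crd[of y] comb_cong[of n "crd e n x" "crd e n y" e e M] by auto

lemma spn_crd_iff:
  assumes "m \<le> n" "x \<in> carrier M"
  shows "x \<in> spn M e m \<longleftrightarrow> (\<forall>i\<ge>m. crd e n x i = 0)"
proof
  assume "x \<in> spn M e m"
  then obtain g where "x = comb M e m g" by auto
  then have "x = comb M e n (\<lambda>i. if i < m then g i else 0)"
    using assms(1) basis_closed comb_le[of m n e "\<lambda>i. if i < m then g i else 0"]
      comb_cong[of m g "\<lambda>i. if i < m then g i else 0" e e M] by simp
  then have "crd e n x i = 0" if "m \<le> i" for i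
    using that crd_unique[of x _ i] crd_beyond[of i x] by (cases "i < n") auto
  then show "\<forall>i\<ge>m. crd e n x i = 0" by blast
next
  assume "\<forall>i\<ge>m. crd e n x i = 0"
  then have "comb M e n (crd e n x) = comb M e m (crd e n x)"
    using assms basis_closed by (intro comb_le) auto
  then have "x = comb M e m (crd e n x)" using comb_crd[OF assms(2)] by simp
  then show "x \<in> spn M e m" by blast
qed

lemma bE_crd: "x \<in> bE M \<longleftrightarrow> x \<in> carrier M \<and> (\<forall>i. crd e n x i $ 0 = 0)"
proof safe
  assume x: "x \<in> bE M"
  then show "x \<in> carrier M" by (auto simp: bE_def lsmult_closed)
  show "crd e n x i $ 0 = 0" for i using x by (auto simp: bE_def bvar_of_fps crd_fs)
next
  assume x: "x \<in> carrier M" and 0: "\<forall>i. crd e n x i $ 0 = 0"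
  have *: "crd e n x i = fps_X * fps_shift 1 (crd e n x i)" for i
    by (rule fps_ext) (use 0 in auto)
  have "x = comb M e n (\<lambda>i. fps_X * fps_shift 1 (crd e n x i))"
    unfolding *[symmetric] using x by (simp add: comb_crd)
  also have "\<dots> = bvar \<odot> comb M e n (\<lambda>i. fps_shift 1 (crd e n x i))"
    using basis_closed by (simp add: comb_smult bvar_of_fps)
  finally show "x \<in> bE M" using comb_closed[of n e] basis_closed by (auto simp: bE_def)
qed

lemma bvar_inj: 
  assumes "x \<in> carrier M" "y \<in> carrier M" "bvar \<odot> x = bvar \<odot> y"
  shows "x = y"
proof -
  have "fps_X * crd e n x i = fps_X * crd e n y i" for i
    using crd_fs[OF assms(1), of fps_X i] crd_fs[OF assms(2), of fps_X i] assms(3)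
    by (simp add: bvar_of_fps)
  then show ?thesis using crd_eq_iff assms by simp
qed

lemma spn_normal:
  assumes "m \<le> n" "left_submodule (spn M e m) M"
  shows "normal_submodule (spn M e m) M"
proof -
  have "x \<in> (\<odot>) bvar ` spn M e m" if x: "x \<in> spn M e m" "x \<in> bE M" for x
  proof -
    obtain y where y: "y \<in> carrier M" "x = bvar \<odot> y" using x by (auto simp: bE_def)
    then have "\<forall>i\<ge>m. fps_X * crd e n y i = 0"
      using x spn_crd_iff[OF assms(1), of x] crd_fs[OF y(1), of fps_X]
      by (simp add: bvar_of_fps lsmult_closed)
    then have "y \<in> spn M e m" using spn_crd_iff[OF assms(1) y(1)] by simp
    then show ?thesis using y by auto
  qed
  moreover have "(\<odot>) bvar ` spn M e m \<subseteq> spn M e m \<inter> bE M"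
    using left_submoduleD[OF assms(2)] by (auto simp: bE_def)
  ultimately show ?thesis using assms(2) by (auto simp: normal_submodule_def)
qed

end

lemma filtration_basis:
  assumes F0: "F 0 = {\<zero>}" and sub: "\<And>j. j \<le> n \<Longrightarrow> left_submodule (F j) M"
    and e: "\<And>j. j < n \<Longrightarrow> e j \<in> F (Suc j)" and mono: "\<And>j. j < n \<Longrightarrow> F j \<subseteq> F (Suc j)"
    and gen: "\<And>j x. j < n \<Longrightarrow> x \<in> F (Suc j) \<Longrightarrow> \<exists>f. \<exists>y\<in>F j. x = y \<oplus> of_fps f \<odot> e j"
    and free: "\<And>j f. j < n \<Longrightarrow> of_fps f \<odot> e j \<in> F j \<Longrightarrow> f = 0"
  shows "j \<le> n \<Longrightarrow> F j = spn M e j \<and> indep M e j"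
proof (induction j)
  case 0
  show ?case using F0 by (auto simp: indep_def)
next
  case (Suc j)
  then have IH: "F j = spn M e j" "indep M e j" and j: "j < n" by auto
  note Fj = left_submoduleD[OF sub[of j]] and FS = left_submoduleD[OF sub[of "Suc j"]]
  have ej: "e j \<in> carrier M" using e[OF j] FS j by auto
  have "F (Suc j) \<subseteq> spn M e (Suc j)"
  proof
    fix x assume x: "x \<in> F (Suc j)"
    then obtain f g where g: "x = comb M e j g \<oplus> of_fps f \<odot> e j" using gen[OF j x] IH(1) by auto
    then have "x = comb M e (Suc j) (g(j := f))"
      by (simp add: g comb_cong[of j "g(j := f)" g])
    then show "x \<in> spn M e (Suc j)" by blast
  qed
  moreover have "comb M e (Suc j) g \<in> F (Suc j)" for g
  proof -
    have "comb M e j g \<in> F j" using IH by auto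
    then show ?thesis using mono[OF j] FS(3,4) e[OF j] j by auto
  qed
  moreover have "indep M e (Suc j)"
    unfolding indep_def
  proof (intro allI impI)
    fix g i assume z: "comb M e (Suc j) g = \<zero>" and i: "i < Suc j"
    have c: "comb M e j g \<in> F j" using IH by auto
    then have cc: "comb M e j g \<in> carrier M" using Fj(1) j by auto
    have "of_fps (g j) \<odot> e j = \<ominus> comb M e j g"
      using z cc ej by (metis comb.simps(2) a_comm lsmult_closed minus_equality)
    then have "g j = 0" using free[OF j, of "g j"] Fj(5)[OF _ c] j by simp
    then show "g i = 0"
      using z IH(2) i cc ej by (auto simp: indep_def less_Suc_eq)
  qed
  ultimately show ?case by auto
qed

end

declare comb.simps(2) [simp del]

section \<open>Rank one quotients\<close>

text \<open>Says in terms of elements that M/N is isomorphic to \<open>E_rank1 \<mu>\<close>, with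
  \<open>e\<close> a lift of the generator. It spares the later arguments all computations with
  cosets.\<close>

definition rank_one_step :: "(atilde, 'm) module \<Rightarrow> 'm set \<Rightarrow> complex \<Rightarrow> 'm \<Rightarrow> bool" where
  "rank_one_step M N \<mu> e \<longleftrightarrow> e \<in> carrier M \<and> lin \<mu> \<odot>\<^bsub>M\<^esub> e \<in> N \<and>
     (\<forall>x\<in>carrier M. \<exists>f. \<exists>y\<in>N. x = y \<oplus>\<^bsub>M\<^esub> of_fps f \<odot>\<^bsub>M\<^esub> e) \<and>
     (\<forall>f. of_fps f \<odot>\<^bsub>M\<^esub> e \<in> N \<longrightarrow> f = 0)"

lemma left_quotientI: "left_module M \<Longrightarrow> left_submodule N M \<Longrightarrow> left_quotient M N"
  by (simp add: left_quotient_def left_quotient_axioms_def)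

lemma lmod_pairI: "left_module M \<Longrightarrow> left_module N \<Longrightarrow> h \<in> lmod_hom M N \<Longrightarrow> lmod_pair M N h"
  by (simp add: lmod_pair_def lmod_pair_axioms_def)

text \<open>The vector \<open>e\<close> lifts the preimage of the class of 1. Then \<open>r\<close>
  sends it into \<open>N\<close> exactly if \<open>r\<close> is in the left ideal of
  \<open>lin \<mu>\<close>, and right division supplies both the expansion and the freeness over the
  power series.\<close>

lemma lmod_iso_E_rank1_imp_step:
  fixes M :: "(atilde, 'm) module" (structure)
  assumes M: "left_module M" and N: "left_submodule N M"
    and iso: "lmod_iso (quot_mod M N) (E_rank1 \<mu>)"
  shows "\<exists>e. rank_one_step M N \<mu> e"
proof -
  interpret ab_left M using M by (simp add: ab_left_def)
  interpret Q: left_quotient M N by (rule left_quotientI[OF M N])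
  define I where "I = range (\<lambda>Q. Q * lin \<mu>)"
  interpret R: left_quotient regular_rep I
    unfolding I_def by (rule left_quotientI[OF regular_rep_left_module left_ideal_submodule])
  have ER: "E_rank1 \<mu> = quot_mod regular_rep I" by (simp add: E_rank1_def cyclic_quot_def I_def)
  obtain h where h: "h \<in> lmod_hom (quot_mod M N) (quot_mod regular_rep I)"
    and bij: "bij_betw h (carrier (quot_mod M N)) (carrier (quot_mod regular_rep I))"
    using iso unfolding ER by (rule lmod_isoE)
  interpret H: lmod_pair "quot_mod M N" "quot_mod regular_rep I" h
    by (rule lmod_pairI[OF Q.quot_left_module R.quot_left_module h])
  have rr: "carrier (regular_rep :: (atilde, atilde) module) = UNIV" "\<And>r x :: atilde. r \<odot>\<^bsub>regular_rep\<^esub> x = r * x"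
    by (simp_all add: regular_rep_def)
  have inj: "X = Y" if "X \<in> carrier (quot_mod M N)" "Y \<in> carrier (quot_mod M N)" "h X = h Y" for X Y
    using bij that by (auto simp: bij_betw_def inj_on_def)
  have Q_closed: "Q.cls x \<in> carrier (quot_mod M N)" if "x \<in> carrier M" for x
    using that by (simp add: Q.quot_carrier)
  have "R.cls 1 \<in> h ` carrier (quot_mod M N)" using bij by (simp add: bij_betw_def R.quot_carrier rr)
  then obtain e where e: "e \<in> carrier M" "h (Q.cls e) = R.cls 1" by (auto simp: Q.quot_carrier)
  have hr: "h (Q.cls (r \<odot> e)) = R.cls r" for r
    using H.hD(3)[OF Q_closed[OF e(1)], of r] e R.quot_smult[of 1 r] by (simp add: Q.quot_smult rr)
  have ker: "r \<odot> e \<in> N \<longleftrightarrow> r \<in> I" for r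
  proof -
    have c: "r \<odot> e \<in> carrier M" using e lsmult_closed by blast
    have "r \<odot> e \<in> N \<longleftrightarrow> Q.cls (r \<odot> e) = N" using Q.cls_eq_zero_iff[OF c] by blast
    also have "\<dots> \<longleftrightarrow> h (Q.cls (r \<odot> e)) = I"
      using inj[OF Q_closed[OF c] H.M.zero_closed] H.hom_zero by (auto simp: Q.quot_zero R.quot_zero)
    also have "\<dots> \<longleftrightarrow> r \<in> I" using R.cls_eq_zero_iff[of r] by (simp add: hr rr)
    finally show ?thesis .
  qed
  have "\<exists>f. \<exists>y\<in>N. x = y \<oplus> of_fps f \<odot> e" if x: "x \<in> carrier M" for x
  proof -
    have "h (Q.cls x) \<in> carrier (quot_mod regular_rep I)" using H.hD(1) Q_closed x by blast
    then obtain r where r: "h (Q.cls x) = R.cls r" by (auto simp: R.quot_carrier)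
    have c: "r \<odot> e \<in> carrier M" using e lsmult_closed by blast
    have "Q.cls x = Q.cls (r \<odot> e)" using inj Q_closed x c r hr by simp
    then have d: "x \<ominus> r \<odot> e \<in> N" using Q.cls_eq_iff x c by blast
    obtain q f where qf: "r = q * lin \<mu> + of_fps f" using right_division by blast
    have "q * lin \<mu> \<in> I" by (simp add: I_def)
    then have k: "(q * lin \<mu>) \<odot> e \<in> N" using ker by blast
    define w where "w = x \<ominus> r \<odot> e"
    have w: "w \<in> carrier M" using x c by (simp add: w_def)
    have "x = w \<oplus> r \<odot> e" using x c by (simp add: w_def a_minus_def a_assoc l_neg)
    also have "r \<odot> e = (q * lin \<mu>) \<odot> e \<oplus> of_fps f \<odot> e" using e by (simp add: qf lsmult_l_distr)
    finally have "x = (w \<oplus> (q * lin \<mu>) \<odot> e) \<oplus> of_fps f \<odot> e"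
      using w e k by (simp add: a_assoc lsmult_closed)
    then show ?thesis using Q.N_props(3)[OF d k] unfolding w_def[symmetric] by blast
  qed
  moreover have "lin \<mu> \<odot> e \<in> N" using ker[of "lin \<mu>"] by (auto simp: I_def intro: range_eqI[of _ _ 1])
  moreover have "f = 0" if f: "of_fps f \<odot> e \<in> N" for f
  proof -
    obtain q where "of_fps f = q * lin \<mu>" using ker f by (auto simp: I_def)
    then show "f = 0" using right_division_zero(2)[of "-q" \<mu> f] by simp
  qed
  ultimately show ?thesis using e(1) by (auto simp: rank_one_step_def)
qed

lemma step_imp_lmod_iso_E_rank1:
  fixes M :: "(atilde, 'm) module" (structure)
  assumes M: "left_module M" and N: "left_submodule N M" and step: "rank_one_step M N \<mu> e"
  shows "lmod_iso (quot_mod M N) (E_rank1 \<mu>)"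
proof -
  interpret ab_left M using M by (simp add: ab_left_def)
  interpret Q: left_quotient M N by (rule left_quotientI[OF M N])
  define I where "I = range (\<lambda>Q. Q * lin \<mu>)"
  have I: "left_submodule I regular_rep" unfolding I_def by (rule left_ideal_submodule)
  interpret R: left_quotient regular_rep I
    by (rule left_quotientI[OF regular_rep_left_module I])
  have ER: "E_rank1 \<mu> = quot_mod regular_rep I" by (simp add: E_rank1_def cyclic_quot_def I_def)
  note st = step[unfolded rank_one_step_def]
  have e: "e \<in> carrier M" using st by blast
  have rr: "carrier (regular_rep :: (atilde, atilde) module) = UNIV"
    "\<And>r x :: atilde. r \<odot>\<^bsub>regular_rep\<^esub> x = r * x" "\<And>r x :: atilde. r \<oplus>\<^bsub>regular_rep\<^esub> x = r + x"
    by (simp_all add: regular_rep_def)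
  have "lmod_iso (quot_mod regular_rep I) (quot_mod M N)"
  proof (rule first_isomorphism[OF regular_rep_left_module Q.quot_left_module _ _ I])
    show "(\<lambda>r. Q.cls (r \<odot> e)) \<in> lmod_hom regular_rep (quot_mod M N)"
      using e by (auto simp: lmod_hom_def rr Q.quot_carrier Q.quot_add Q.quot_smult lsmult_closed
          lsmult_l_distr lsmult_assoc)
    have "\<exists>r. Q.cls x = Q.cls (r \<odot> e)" if x: "x \<in> carrier M" for x
    proof -
      obtain f y where fy: "y \<in> N" "x = y \<oplus> of_fps f \<odot> e" using st x by blast
      then have "x \<ominus> of_fps f \<odot> e = y" using e x
        by (simp add: a_minus_def a_assoc lsmult_closed r_neg)
      then have "Q.cls x = Q.cls (of_fps f \<odot> e)" using fy e x by (simp add: Q.cls_eq_iff lsmult_closed)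
      then show ?thesis by blast
    qed
    then show "(\<lambda>r. Q.cls (r \<odot> e)) ` carrier regular_rep = carrier (quot_mod M N)"
      using e by (auto simp: rr Q.quot_carrier image_iff lsmult_closed)
    fix r :: atilde
    obtain q f where qf: "r = q * lin \<mu> + of_fps f" using right_division by blast
    have k: "q \<odot> (lin \<mu> \<odot> e) \<in> N" using st Q.N_props(4) by blast
    have "r \<odot> e = q \<odot> (lin \<mu> \<odot> e) \<oplus> of_fps f \<odot> e"
      using e by (simp add: qf lsmult_l_distr lsmult_assoc)
    then have "of_fps f \<odot> e = r \<odot> e \<ominus> q \<odot> (lin \<mu> \<odot> e)"
      using e by (simp add: a_minus_def lsmult_closed a_ac r_neg2 r_neg)
    then have "r \<odot> e \<in> N \<Longrightarrow> f = 0" using st k Q.N_props(6) by auto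
    moreover have "r \<odot> e \<in> N" if "r \<in> I" 
      using that st Q.N_props(4) e by (auto simp: I_def lsmult_assoc)
    moreover have "r \<in> I" if "f = 0" using that qf by (auto simp: I_def)
    ultimately show "(Q.cls (r \<odot> e) = \<zero>\<^bsub>quot_mod M N\<^esub>) = (r \<in> I)"
      using Q.cls_eq_zero_iff[of "r \<odot> e"] e by (auto simp: Q.quot_zero lsmult_closed)
  qed
  then show ?thesis unfolding ER using lmod_iso_sym R.quot_left_module by blast
qed

section \<open>Chains\<close>

text \<open>
  For a module with Jordan-Hoelder sequence \<open>(F\<^sub>j)\<close> a chain is a basis over the power series with
  \<open>F\<^sub>j = \<langle>e\<^sub>0, \<dots>, e\<^sub>j\<^sub>-\<^sub>1\<rangle>\<close> and \<open>(a - \<lambda>\<^sub>j b) e\<^sub>j = S\<^sub>j\<^sub>-\<^sub>1 e\<^sub>j\<^sub>-\<^sub>1\<close>, indices starting from 0.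
\<close>

definition chain ::
  "(atilde, 'm) module \<Rightarrow> (nat \<Rightarrow> complex) \<Rightarrow> (nat \<Rightarrow> complex fps) \<Rightarrow> (nat \<Rightarrow> 'm) \<Rightarrow> nat \<Rightarrow> bool" where
  "chain M l S e n \<longleftrightarrow> left_module M \<and> ab_left.basis M e n \<and>
     (\<forall>i<n. lin (l i) \<odot>\<^bsub>M\<^esub> e i = (if i = 0 then \<zero>\<^bsub>M\<^esub> else of_fps (S (i - 1)) \<odot>\<^bsub>M\<^esub> e (i - 1))) \<and>
     (\<forall>i. Suc i < n \<longrightarrow> S i $ 0 = 1)"

locale ab_chain = ab_left M for M :: "(atilde, 'm) module" (structure) +
  fixes l S e n
  assumes chain: "chain M l S e n"
begin

lemma basis: "basis e n" using chain by (simp add: chain_def)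

lemmas e_closed = basis_closed[OF basis]

lemma S0: "Suc i < n \<Longrightarrow> S i $ 0 = 1" using chain by (simp add: chain_def)

lemma lin_e: "i < n \<Longrightarrow> lin (l i) \<odot> e i = (if i = 0 then \<zero> else of_fps (S (i - 1)) \<odot> e (i - 1))"
  using chain unfolding chain_def by blast

lemma lin_e_spn: 
  assumes "i < n"
  shows "lin (l i) \<odot> e i \<in> spn M e i"
proof (cases i)
  case 0
  then show ?thesis using lin_e[OF assms] by simp
next
  case (Suc j)
  have "comb M e i (single j (S j)) = of_fps (S j) \<odot> e j"
    using assms Suc e_closed by (subst comb_single) auto
  then show ?thesis using lin_e[OF assms] Suc by (metis diff_Suc_1 nat.distinct(1) rangeI)
qed

lemma spn_sub: "j \<le> n \<Longrightarrow> left_submodule (spn M e j) M"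
  by (rule spn_submodule[where l = l]) (auto intro: e_closed lin_e_spn)

abbreviation "c \<equiv> crd e n"

lemma crd_lin:
  assumes x: "x \<in> carrier M"
  shows "c (lin \<mu> \<odot> x) i =
     fps_X^2 * fps_deriv (c x i) + fps_const (l i - \<mu>) * fps_X * c x i + S i * c x (Suc i)"
proof (cases "i < n")
  case True
  have "lin \<mu> \<odot> x = lin \<mu> \<odot> comb M e n (c x)" using comb_crd[OF basis x] by simp
  also have "\<dots> = comb M e n (\<lambda>i. fps_X^2 * fps_deriv (c x i) +
     fps_const (l i - \<mu>) * fps_X * c x i + (if Suc i < n then S i * c x (Suc i) else 0))"
    by (rule lin_comb) (auto simp: e_closed lin_e)
  finally show ?thesis
    using crd_unique[OF basis _ True, of "lin \<mu> \<odot> x"] crd_beyond[of e n "Suc i" x] basis by auto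
qed (simp add: crd_beyond[OF basis])

text \<open>Applying \<open>lin\<close> with the exponent of the leading vector annihilates a
  leading coordinate 1 and leaves, one index lower, a coordinate with constant term
  \<open>S j $ 0 = 1\<close>. Dividing by this unit allows the induction to continue, and then the
  leading vector itself is recovered by subtraction. It shows that a vector with top coordinate 1
  generates.\<close>

lemma spn_le_submodule:
  assumes N: "left_submodule N M"
  shows "j < n \<Longrightarrow> x \<in> N \<Longrightarrow> x \<in> spn M e (Suc j) \<Longrightarrow> c x j = 1 \<Longrightarrow> spn M e (Suc j) \<subseteq> N"
proof (induction j arbitrary: x)
  case 0
  have x: "x \<in> carrier M" using left_submoduleD(1)[OF N] 0 by auto
  have "c x i = 0" if "i > 0" for i
    using 0 spn_crd_iff[OF basis _ x, of "Suc 0"] that by auto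
  then have "x = e 0"
    using 0 x e_closed[of 0] crd_basis[OF basis, of 0] by (subst crd_eq_iff[OF basis]) auto
  then show ?case using 0 by (intro spn_least[OF N]) auto
next
  case (Suc j)
  have x: "x \<in> carrier M" using left_submoduleD(1)[OF N] Suc by auto
  have cx: "c x i = 0" if "i > Suc j" for i
    using Suc.prems spn_crd_iff[OF basis _ x, of "Suc (Suc j)"] that by auto
  define y where "y = lin (l (Suc j)) \<odot> x"
  have y: "y \<in> carrier M" "y \<in> N" using x Suc.prems left_submoduleD[OF N] by (auto simp: y_def lsmult_closed)
  have cy: "c y i = fps_X^2 * fps_deriv (c x i) + fps_const (l i - l (Suc j)) * fps_X * c x i + S i * c x (Suc i)" for i
    unfolding y_def by (rule crd_lin[OF x])
  define u where "u = c y j"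
  have u0: "u $ 0 = 1" using Suc.prems S0[of j] by (simp add: u_def cy)
  have "c y i = 0" if "i > j" for i
    using cx[of "Suc i"] cx[of i] Suc.prems that by (cases "i = Suc j") (auto simp: cy)
  then have ys: "y \<in> spn M e (Suc j)" using spn_crd_iff[OF basis _ y(1)] Suc.prems by auto
  define z where "z = of_fps (inverse u) \<odot> y"
  have "z \<in> N" "z \<in> spn M e (Suc j)"
    using y ys left_submoduleD(4)[OF N] left_submoduleD(4)[OF spn_sub, of "Suc j"] Suc.prems
    by (auto simp: z_def simp del: range_composition)
  moreover have "c z j = 1"
    using y u0 by (simp add: z_def crd_fs[OF basis] u_def[symmetric] inverse_mult_eq_1)
  ultimately have sub: "spn M e (Suc j) \<subseteq> N" using Suc.IH Suc.prems by simp
  have ej: "e (Suc j) \<in> carrier M" using e_closed Suc.prems by auto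
  have "c (x \<ominus> e (Suc j)) i = c x i - (if i = Suc j then 1 else 0)" for i
  proof -
    have "c x i = c ((x \<ominus> e (Suc j)) \<oplus> e (Suc j)) i"
      using x ej by (simp add: a_minus_def a_assoc l_neg)
    also have "\<dots> = c (x \<ominus> e (Suc j)) i + (if i = Suc j then 1 else 0)"
      using x ej Suc.prems by (simp add: crd_add[OF basis] crd_basis[OF basis])
    finally show ?thesis by simp
  qed
  then have "c (x \<ominus> e (Suc j)) i = 0" if "i \<ge> Suc j" for i
    using cx[of i] Suc.prems that by (cases "i = Suc j") auto
  then have d: "x \<ominus> e (Suc j) \<in> N"
    using spn_crd_iff[OF basis _ minus_closed[OF x ej], of "Suc j"] Suc.prems sub by auto
  have "e (Suc j) = x \<ominus> (x \<ominus> e (Suc j))"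
    using x ej by (simp add: a_minus_def minus_add) (simp add: a_assoc[symmetric] r_neg)
  then have "e (Suc j) \<in> N" using left_submoduleD(6)[OF N \<open>x \<in> N\<close> d] by simp
  moreover have "e i \<in> N" if "i < Suc j" for i
    using spn_basis[of i "Suc j" e] sub that e_closed Suc.prems by auto
  ultimately show ?case by (intro spn_least[OF N]) (auto simp: less_Suc_eq)
qed

lemma generator:
  assumes "n > 0" "x \<in> carrier M" "c x (n - 1) = 1"
  shows "is_generator M x"
proof -
  have N: "left_submodule (cyclic M x) M" by (rule left_submodule_cyclic) fact
  have "x \<in> cyclic M x" unfolding cyclic_def using lsmult_one[OF assms(2)] by (metis rangeI)
  moreover have "carrier M = spn M e n" using basis by (simp add: basis_def)
  ultimately have "carrier M \<subseteq> cyclic M x"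
    using spn_le_submodule[OF N, of "n - 1" x] assms by simp
  then show ?thesis using left_submoduleD(1)[OF N] assms by (auto simp: is_generator_def)
qed

lemma step:
  assumes j: "j < n"
  shows "rank_one_step (sub_mod M (spn M e (Suc j))) (spn M e j) (l j) (e j)"
  unfolding rank_one_step_def
proof (intro conjI ballI allI impI)
  show "e j \<in> carrier (sub_mod M (spn M e (Suc j)))"
    using spn_basis[of j "Suc j" e] e_closed j by auto
  show "lin (l j) \<odot>\<^bsub>sub_mod M (spn M e (Suc j))\<^esub> e j \<in> spn M e j" using lin_e_spn[OF j] by simp
  show "\<exists>f. \<exists>y\<in>spn M e j. x = y \<oplus>\<^bsub>sub_mod M (spn M e (Suc j))\<^esub> of_fps f \<odot>\<^bsub>sub_mod M (spn M e (Suc j))\<^esub> e j"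
    if "x \<in> carrier (sub_mod M (spn M e (Suc j)))" for x
    using that by (auto simp: comb.simps(2))
  fix f assume f: "of_fps f \<odot>\<^bsub>sub_mod M (spn M e (Suc j))\<^esub> e j \<in> spn M e j"
  then have "c (of_fps f \<odot> e j) j = 0"
    using spn_crd_iff[OF basis, of j "of_fps f \<odot> e j"] j e_closed by (auto simp: lsmult_closed)
  then show "f = 0" using j e_closed[OF j] by (simp add: crd_fs[OF basis] crd_basis[OF basis])
qed

end

lemma ab_chainI: "chain M l S e n \<Longrightarrow> ab_chain M l S e n"
  by (simp add: ab_chain_def ab_left_def chain_def ab_chain_axioms_def)

lemma ab_leftI: "left_module M \<Longrightarrow> ab_left M" by (simp add: ab_left_def)

lemma chain_JH_sequence:
  assumes "chain E (\<lambda>i. cs ! i) S e (length cs)"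
  shows "JH_sequence E (spn E e) cs"
proof -
  interpret ab_chain E "\<lambda>i. cs ! i" S e "length cs" using assms by (rule ab_chainI)
  have "spn E e 0 = {\<zero>\<^bsub>E\<^esub>}" by auto
  moreover have "spn E e (length cs) = carrier E" using basis by (simp add: basis_def)
  moreover have "lmod_iso (quot_mod (sub_mod E (spn E e (Suc j))) (spn E e j)) (E_rank1 (cs ! j))"
    if "j < length cs" for j
    using that spn_mono[of j "Suc j" e] e_closed
    by (intro step_imp_lmod_iso_E_rank1[OF _ _ step] sub_mod_left_module left_submodule_sub_mod spn_sub) auto
  ultimately show ?thesis
    unfolding JH_sequence_def using basis_has_rank[OF basis] spn_normal[OF basis] spn_sub spn_mono e_closed
    by auto
qed

section \<open>Chains from Jordan-Hoelder sequences\<close>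

lemma lin_acst: "lin \<mu> * acst c = acst c * lin \<mu>"
  using lin_mult_of_fps[of \<mu> "fps_const c" \<mu>] by simp

text \<open>The generator descends through the filtration. If \<open>w\<close> generates one step,
  then up to a unit series it is a lift \<open>\<epsilon>\<close> of the rank one quotient, and
  \<open>lin (l m) \<odot> \<epsilon>\<close> generates the next smaller step. The unit series met
  at each level is the \<open>S\<close> of the chain; the last one, at index \<open>m - 1\<close>,
  belongs to \<open>w\<close> itself.\<close>

lemma chain_exists_aux:
  fixes M :: "(atilde, 'm) module" (structure)
  assumes M: "left_module M" and F0: "F 0 = {\<zero>}" and sub: "\<And>j. j \<le> n \<Longrightarrow> left_submodule (F j) M"
    and mono: "\<And>j. j < n \<Longrightarrow> F j \<subseteq> F (Suc j)"
    and step: "\<And>j. j < n \<Longrightarrow> \<exists>e. rank_one_step (sub_mod M (F (Suc j))) (F j) (l j) e"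
  shows "m \<le> n \<Longrightarrow> w \<in> F m \<Longrightarrow> F m = cyclic M w \<Longrightarrow>
    \<exists>S e. (\<forall>j<m. rank_one_step (sub_mod M (F (Suc j))) (F j) (l j) (e j)) \<and>
      (\<forall>i<m. lin (l i) \<odot> e i = (if i = 0 then \<zero> else of_fps (S (i - 1)) \<odot> e (i - 1))) \<and>
      (\<forall>i. Suc i < m \<longrightarrow> S i $ 0 = 1) \<and> (m > 0 \<longrightarrow> w = of_fps (S (m - 1)) \<odot> e (m - 1) \<and> S (m - 1) $ 0 = 1)"
proof (induction m arbitrary: w)
  case (Suc m)
  interpret ab_left M by (rule ab_leftI[OF M])
  have m: "m < n" using Suc.prems by simp
  note Fm = left_submoduleD[OF sub[of m]] and FS = left_submoduleD[OF sub[of "Suc m"]]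
  have wc: "w \<in> carrier M" using FS(1) m Suc.prems by auto
  obtain e0 where "rank_one_step (sub_mod M (F (Suc m))) (F m) (l m) e0" using step[OF m] by blast
  then have e0: "e0 \<in> F (Suc m)" "lin (l m) \<odot> e0 \<in> F m"
    and gen: "\<And>x. x \<in> F (Suc m) \<Longrightarrow> \<exists>f. \<exists>y\<in>F m. x = y \<oplus> of_fps f \<odot> e0"
    and free: "\<And>f. of_fps f \<odot> e0 \<in> F m \<Longrightarrow> f = 0"
    by (auto simp: rank_one_step_def)
  have e0c: "e0 \<in> carrier M" using e0 FS(1) m by auto
  obtain g y where g: "y \<in> F m" "w = y \<oplus> of_fps g \<odot> e0" using gen[OF Suc.prems(2)] by blast
  have yc: "y \<in> carrier M" using g Fm(1) m by auto
  have e0_step: "\<exists>h. \<exists>z\<in>F m. r \<odot> e0 = z \<oplus> of_fps h \<odot> e0" for r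
  proof -
    have "r \<odot> e0 \<in> F (Suc m)" using e0 FS(4) m by auto
    then show ?thesis by (rule gen)
  qed
  have uniq: "f = h" if z: "z \<in> F m" "z' \<in> F m" and eq: "z \<oplus> of_fps f \<odot> e0 = z' \<oplus> of_fps h \<odot> e0" for f h z z'
  proof -
    have zc: "z \<in> carrier M" "z' \<in> carrier M" using z Fm(1) m by auto
    have ec: "of_fps f \<odot> e0 \<in> carrier M" "of_fps h \<odot> e0 \<in> carrier M" using e0c by (auto simp: lsmult_closed)
    have "of_fps (f - h) \<odot> e0 = of_fps f \<odot> e0 \<ominus> of_fps h \<odot> e0"
      using e0c by (simp add: lsmult_diff)
    also have "\<dots> = (\<ominus> z \<oplus> (z \<oplus> of_fps f \<odot> e0)) \<ominus> of_fps h \<odot> e0"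
      using zc ec by (simp add: a_assoc[symmetric] l_neg)
    also have "\<dots> = (\<ominus> z \<oplus> (z' \<oplus> of_fps h \<odot> e0)) \<ominus> of_fps h \<odot> e0"
      by (simp only: eq)
    also have "\<dots> = z' \<ominus> z" using zc ec by (simp add: a_minus_def a_ac r_neg)
    finally have "of_fps (f - h) \<odot> e0 \<in> F m" using Fm(6)[OF _ z(2) z(1)] m by simp
    then show ?thesis using free[of "f - h"] by simp
  qed
  \<comment> \<open>If b divided \<open>g\<close>, then by \<open>mult_bvar_left\<close> it would
    divide the \<open>e0\<close>-coefficient of every multiple of \<open>w\<close>. But
    \<open>e0\<close> is such a multiple, with coefficient 1.\<close>
  have g0: "g $ 0 \<noteq> 0"
  proof
    assume "g $ 0 = 0"
    then have gX: "g = fps_shift 1 g * fps_X" by (intro fps_ext) auto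
    have "e0 \<in> cyclic M w" using e0 Suc.prems by simp
    then obtain r where r: "e0 = r \<odot> w" by (auto simp: cyclic_def)
    obtain r' where r': "(r * of_fps (fps_shift 1 g)) * bvar = bvar * r'" using mult_bvar_left by blast
    obtain h z where hz: "z \<in> F m" "r' \<odot> e0 = z \<oplus> of_fps h \<odot> e0" using e0_step by blast
    have zc: "z \<in> carrier M" using hz Fm(1) m by auto
    have "r * of_fps g = r * (of_fps (fps_shift 1 g) * bvar)"
      by (subst gX) (simp only: bvar_of_fps of_fps_mult)
    then have "r * of_fps g = bvar * r'" using r' by (simp add: mult.assoc)
    then have "e0 = r \<odot> y \<oplus> bvar \<odot> (r' \<odot> e0)"
      using r g yc e0c by (simp add: lsmult_r_distr lsmult_closed lsmult_assoc[symmetric])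
    also have "\<dots> = (r \<odot> y \<oplus> bvar \<odot> z) \<oplus> of_fps (fps_X * h) \<odot> e0"
      using zc e0c yc by (simp add: hz lsmult_r_distr lsmult_closed bvar_of_fps fs_mult a_assoc)
    finally have "\<zero> \<oplus> of_fps 1 \<odot> e0 = (r \<odot> y \<oplus> bvar \<odot> z) \<oplus> of_fps (fps_X * h) \<odot> e0"
      using e0c by (simp add: lsmult_one)
    then have "1 = fps_X * h"
      using Fm(2,3,4) m g(1) hz(1) by (intro uniq[of \<zero> "r \<odot> y \<oplus> bvar \<odot> z"]) auto
    then show False by (metis fps_mult_nth_0 fps_X_nth fps_one_nth mult_zero_left zero_neq_one)
  qed
  \<comment> \<open>The constant \<open>k\<close> is split off because a chain requires series with
    constant term 1. It is absorbed into \<open>\<epsilon>\<close>, where it does no harm since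
    constants commute with \<open>lin\<close>.\<close>
  define k where "k = g $ 0"
  define u where "u = fps_const (inverse k) * g"
  have u0: "u $ 0 = 1" using g0 by (simp add: u_def k_def)
  have u_inv: "u * inverse u = 1" "inverse u * u = 1"
    using u0 by (simp_all add: inverse_mult_eq_1 inverse_mult_eq_1')
  have gu: "inverse u * g = fps_const k"
  proof -
    have "inverse u * g = inverse u * u * fps_const k"
      using g0 by (simp add: u_def k_def mult_ac fps_const_mult[symmetric] del: fps_const_mult)
    then show ?thesis by (simp add: u_inv)
  qed
  define \<epsilon> where "\<epsilon> = of_fps (inverse u) \<odot> w"
  have \<epsilon>: "\<epsilon> = of_fps (inverse u) \<odot> y \<oplus> acst k \<odot> e0"
    using yc e0c by (simp add: \<epsilon>_def g lsmult_r_distr lsmult_closed fs_mult gu)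
  have y': "of_fps (inverse u) \<odot> y \<in> F m" using g Fm(4) m by auto
  have y'c: "of_fps (inverse u) \<odot> y \<in> carrier M" using yc by (rule lsmult_closed)
  have \<epsilon>F: "\<epsilon> \<in> F (Suc m)" using Suc.prems FS(4) by (auto simp: \<epsilon>_def)
  have \<epsilon>c: "\<epsilon> \<in> carrier M" using wc by (simp add: \<epsilon>_def lsmult_closed)
  have w\<epsilon>: "w = of_fps u \<odot> \<epsilon>" using wc by (simp add: \<epsilon>_def fs_mult u_inv lsmult_one)
  define w' where "w' = lin (l m) \<odot> \<epsilon>"
  have "lin (l m) \<odot> (acst k \<odot> e0) = acst k \<odot> (lin (l m) \<odot> e0)"
    using e0c by (simp add: lsmult_assoc[symmetric] lin_acst)
  then have w': "w' \<in> F m"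
    using Fm(3,4) m y' e0(2) e0c y'c by (simp add: w'_def \<epsilon> lsmult_r_distr lsmult_closed)
  have free\<epsilon>: "h = 0" if "of_fps h \<odot> \<epsilon> \<in> F m" for h
  proof -
    have "of_fps h \<odot> \<epsilon> = of_fps h \<odot> (of_fps (inverse u) \<odot> y) \<oplus> of_fps (h * fps_const k) \<odot> e0"
      using y'c e0c by (simp add: \<epsilon> lsmult_r_distr lsmult_closed fs_mult del: of_fps_simps fs_simps)
    moreover have "of_fps h \<odot> \<epsilon> = of_fps h \<odot> \<epsilon> \<oplus> of_fps 0 \<odot> e0"
      using e0c \<epsilon>c by (simp add: lsmult_closed)
    ultimately have "h * fps_const k = 0"
      using that Fm(4) y' m by (intro uniq[of "of_fps h \<odot> (of_fps (inverse u) \<odot> y)" "of_fps h \<odot> \<epsilon>"]) auto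
    then show ?thesis using g0 by (simp add: k_def)
  qed
  have gen\<epsilon>: "\<exists>f. \<exists>y\<in>F m. x = y \<oplus> of_fps f \<odot> \<epsilon> \<and> (\<exists>q. y = q \<odot> w')" if x: "x \<in> F (Suc m)" for x
  proof -
    have "x \<in> cyclic M w" using x Suc.prems by simp
    then obtain r where r: "x = r \<odot> w" by (auto simp: cyclic_def)
    obtain q f where qf: "r * of_fps u = q * lin (l m) + of_fps f" using right_division by blast
    have "x = (r * of_fps u) \<odot> \<epsilon>" using \<epsilon>c by (simp add: r w\<epsilon> lsmult_assoc)
    then have "x = q \<odot> w' \<oplus> of_fps f \<odot> \<epsilon>"
      using \<epsilon>c by (simp add: qf lsmult_l_distr lsmult_assoc w'_def)
    moreover have "q \<odot> w' \<in> F m" using w' Fm(4) m by auto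
    ultimately show ?thesis by blast
  qed
  \<comment> \<open>Right division by \<open>lin (l m)\<close> writes each element of the larger
    step as a multiple of \<open>w'\<close> plus a power series times \<open>\<epsilon>\<close>;
    inside \<open>F m\<close> the second part vanishes by freeness.\<close>
  have Fm_cyclic: "F m = cyclic M w'"
  proof
    show "cyclic M w' \<subseteq> F m" using w' Fm(4) m by (auto simp: cyclic_def)
    show "F m \<subseteq> cyclic M w'"
    proof
      fix x assume x: "x \<in> F m"
      then obtain f y q where fy: "y \<in> F m" "x = y \<oplus> of_fps f \<odot> \<epsilon>" "y = q \<odot> w'"
        using gen\<epsilon>[of x] mono[OF m] by blast
      have c: "x \<in> carrier M" "y \<in> carrier M" using x fy(1) Fm(1) m by auto
      then have "of_fps f \<odot> \<epsilon> = x \<ominus> y" using \<epsilon>c fy(2) by (simp add: a_minus_def a_ac lsmult_closed r_neg2)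
      then have "f = 0" using free\<epsilon>[of f] Fm(6)[OF _ x fy(1)] m by simp
      then have "x = q \<odot> w'" using fy c \<epsilon>c by simp
      then show "x \<in> cyclic M w'" by (simp add: cyclic_def)
    qed
  qed
  obtain S e where IH:
    "\<forall>j<m. rank_one_step (sub_mod M (F (Suc j))) (F j) (l j) (e j)"
    "\<forall>i<m. lin (l i) \<odot> e i = (if i = 0 then \<zero> else of_fps (S (i - 1)) \<odot> e (i - 1))"
    "\<forall>i. Suc i < m \<longrightarrow> S i $ 0 = 1" "m > 0 \<longrightarrow> w' = of_fps (S (m - 1)) \<odot> e (m - 1) \<and> S (m - 1) $ 0 = 1"
    using Suc.IH[OF _ w' Fm_cyclic] m by auto
  have "rank_one_step (sub_mod M (F (Suc m))) (F m) (l m) \<epsilon>"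
    unfolding rank_one_step_def using \<epsilon>F w' gen\<epsilon> free\<epsilon> by (simp add: w'_def) blast
  moreover have "lin (l m) \<odot> \<epsilon> = (if m = 0 then \<zero> else of_fps (S (m - 1)) \<odot> e (m - 1))"
    using IH(4) w' F0 by (auto simp: w'_def)
  ultimately show ?case
    using IH w\<epsilon> u0
    by (intro exI[of _ "S(m := u)"] exI[of _ "e(m := \<epsilon>)"]) (auto simp: less_Suc_eq)
qed auto

lemma JH_chain_exists:
  fixes E :: "(atilde, 'm) module" (structure)
  assumes E: "left_module E" and JH: "JH_sequence E F cs" and w: "is_generator E w" and n: "cs \<noteq> []"
  obtains S e u where "chain E (\<lambda>i. cs ! i) S e (length cs)" "\<And>j. j \<le> length cs \<Longrightarrow> F j = spn E e j"
    "w = of_fps u \<odot> e (length cs - 1)" "u $ 0 = 1"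
proof -
  interpret ab_left E by (rule ab_leftI[OF E])
  let ?n = "length cs"
  note J = JH[unfolded JH_sequence_def]
  have F0: "F 0 = {\<zero>}" and Fn: "F ?n = carrier E" using J by auto
  have sub: "left_submodule (F j) E" if "j \<le> ?n" for j using J that by (auto simp: normal_submodule_def)
  have mono: "F j \<subseteq> F (Suc j)" if "j < ?n" for j using J that by auto
  have step: "\<exists>e. rank_one_step (sub_mod E (F (Suc j))) (F j) (cs ! j) e" if "j < ?n" for j
    using that J mono sub
    by (intro lmod_iso_E_rank1_imp_step sub_mod_left_module left_submodule_sub_mod) auto
  obtain S e where *: "\<And>j. j < ?n \<Longrightarrow> rank_one_step (sub_mod E (F (Suc j))) (F j) (cs ! j) (e j)"
      "\<And>i. i < ?n \<Longrightarrow> lin (cs ! i) \<odot> e i = (if i = 0 then \<zero> else of_fps (S (i - 1)) \<odot> e (i - 1))"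
      "\<And>i. Suc i < ?n \<Longrightarrow> S i $ 0 = 1" "w = of_fps (S (?n - 1)) \<odot> e (?n - 1)" "S (?n - 1) $ 0 = 1"
    using chain_exists_aux[where n = ?n and F = F and l = "\<lambda>i. cs ! i" and m = ?n and w = w,
        OF E F0 sub mono step] w n Fn by (auto simp: is_generator_def)
  have fb: "F j = spn E e j \<and> indep E e j" if "j \<le> ?n" for j
    using F0 sub _ mono _ _ that
  proof (rule filtration_basis)
    show "e j \<in> F (Suc j)" if "j < ?n" for j using *(1)[OF that] by (simp add: rank_one_step_def)
    show "\<exists>f. \<exists>y\<in>F j. x = y \<oplus> of_fps f \<odot> e j" if "j < ?n" "x \<in> F (Suc j)" for j x
      using *(1)[OF that(1)] that(2) by (simp add: rank_one_step_def)
    show "f = 0" if "j < ?n" "of_fps f \<odot> e j \<in> F j" for j f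
      using *(1)[OF that(1)] that(2) by (simp add: rank_one_step_def)
  qed
  have "basis e ?n"
    unfolding basis_def
  proof (intro conjI allI impI)
    fix i assume "i < ?n"
    then show "e i \<in> carrier E"
      using *(1)[of i] left_submoduleD(1)[OF sub, of "Suc i"] by (auto simp: rank_one_step_def)
  qed (use fb[of ?n] Fn in auto)
  then have "chain E (\<lambda>i. cs ! i) S e ?n" using * E by (auto simp: chain_def)
  then show thesis using that fb *(4,5) by blast
qed

section \<open>Homomorphisms out of a module with a chain\<close>

text \<open>Right division reduces linearity on \<open>r \<odot> e i\<close> to the power series
  part and to \<open>lin (l i) \<odot> e i\<close>, which is a multiple of the preceding basis
  vector. So one relation per basis vector is enough.\<close>

lemma (in ab_chain) hom_linear:
  fixes N :: "(atilde, 'k) module" and h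
  assumes N: "left_module N" and hc: "\<And>x. x \<in> carrier M \<Longrightarrow> h x \<in> carrier N"
    and add: "\<And>x y. x \<in> carrier M \<Longrightarrow> y \<in> carrier M \<Longrightarrow> h (x \<oplus> y) = h x \<oplus>\<^bsub>N\<^esub> h y"
    and fs: "\<And>f x. x \<in> carrier M \<Longrightarrow> h (of_fps f \<odot> x) = of_fps f \<odot>\<^bsub>N\<^esub> h x"
    and he: "\<And>i. i < n \<Longrightarrow> h (lin (l i) \<odot> e i) = lin (l i) \<odot>\<^bsub>N\<^esub> h (e i)"
  shows "h \<in> lmod_hom M N"
proof -
  interpret N: ab_left N by (rule ab_leftI[OF N])
  have he_r: "h (r \<odot> e i) = r \<odot>\<^bsub>N\<^esub> h (e i)" if "i < n" for r i
    using that
  proof (induction i arbitrary: r rule: less_induct)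
    case (less i)
    note i = \<open>i < n\<close>
    obtain q f where qf: "r = q * lin (l i) + of_fps f" using right_division by blast
    have ei: "e i \<in> carrier M" "h (e i) \<in> carrier N" using e_closed[OF i] hc by auto
    have "h (q \<odot> (lin (l i) \<odot> e i)) = q \<odot>\<^bsub>N\<^esub> h (lin (l i) \<odot> e i)"
    proof (cases i)
      case 0
      have "h \<zero> = \<zero>\<^bsub>N\<^esub>" using fs[of \<zero> 0] hc[of \<zero>] by simp
      then show ?thesis using lin_e[OF i] 0 by simp
    next
      case (Suc j)
      have ej: "e j \<in> carrier M" "h (e j) \<in> carrier N" using e_closed[of j] hc i Suc by auto
      have IH: "h (r \<odot> e j) = r \<odot>\<^bsub>N\<^esub> h (e j)" for r using less.IH[of j r] i Suc by simp
      have "h (q \<odot> (of_fps (S j) \<odot> e j)) = (q * of_fps (S j)) \<odot>\<^bsub>N\<^esub> h (e j)"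
        using ej IH[of "q * of_fps (S j)"] by (simp add: lsmult_assoc)
      then show ?thesis using lin_e[OF i] Suc ej by (simp add: fs N.lsmult_assoc)
    qed
    moreover have "r \<odot> e i = q \<odot> (lin (l i) \<odot> e i) \<oplus> of_fps f \<odot> e i"
      using ei by (simp add: qf lsmult_l_distr lsmult_assoc)
    ultimately show "h (r \<odot> e i) = r \<odot>\<^bsub>N\<^esub> h (e i)"
      using ei by (simp add: add lsmult_closed fs he[OF i] qf N.lsmult_l_distr N.lsmult_assoc)
  qed
  have "h (r \<odot> comb M e m g) = r \<odot>\<^bsub>N\<^esub> h (comb M e m g)" if "m \<le> n" for r m g
    using that
  proof (induction m)
    case 0
    have "h \<zero> = \<zero>\<^bsub>N\<^esub>" using fs[of \<zero> 0] hc[of \<zero>] by simp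
    then show ?case by simp
  next
    case (Suc m)
    have em: "e m \<in> carrier M" "comb M e m g \<in> carrier M" using e_closed Suc by (auto intro!: comb_closed)
    have "h (r \<odot> (of_fps (g m) \<odot> e m)) = r \<odot>\<^bsub>N\<^esub> h (of_fps (g m) \<odot> e m)"
      using he_r[of m "r * of_fps (g m)"] em Suc hc by (simp add: lsmult_assoc N.lsmult_assoc fs)
    then show ?case using Suc em by (simp add: comb.simps(2) lsmult_r_distr lsmult_closed add N.lsmult_r_distr hc)
  qed
  then have "h (r \<odot> x) = r \<odot>\<^bsub>N\<^esub> h x" if "x \<in> carrier M" for r x
    using comb_crd[OF basis that] by (metis order_refl)
  then show ?thesis using hc add by (auto simp: lmod_hom_def)
qed

lemma chain_transport:
  assumes ch: "chain M l S e n" and N: "left_module N" and h: "h \<in> lmod_hom M N"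
    and bij: "bij_betw h (carrier M) (carrier N)"
  shows "chain N l S (\<lambda>i. h (e i)) n"
proof -
  interpret ab_chain M l S e n by (rule ab_chainI[OF ch])
  interpret N: ab_left N by (rule ab_leftI[OF N])
  interpret H: lmod_pair M N h by (rule lmod_pairI[OF _ N h]) unfold_locales
  have cm: "comb N (\<lambda>i. h (e i)) m g = h (comb M e m g)" if "m \<le> n" for m g
    using that
  proof (induction m)
    case (Suc m)
    then have em: "e m \<in> carrier M" "comb M e m g \<in> carrier M" using e_closed by (auto intro!: comb_closed)
    then show ?case using Suc by (simp add: comb.simps(2) H.hD lsmult_closed)
  qed (simp add: H.hom_zero)
  have "N.basis (\<lambda>i. h (e i)) n"
    unfolding N.basis_def
  proof (intro conjI allI impI)
    show "h (e i) \<in> carrier N" if "i < n" for i using H.hD(1) e_closed that by blast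
    have "carrier N = h ` spn M e n" using bij basis by (simp add: bij_betw_def basis_def)
    also have "\<dots> = spn N (\<lambda>i. h (e i)) n" by (simp add: cm image_image)
    finally show "carrier N = spn N (\<lambda>i. h (e i)) n" .
    show "indep N (\<lambda>i. h (e i)) n"
      unfolding indep_def
    proof (intro allI impI)
      fix g i assume "comb N (\<lambda>i. h (e i)) n g = \<zero>\<^bsub>N\<^esub>" and i: "i < n"
      then have "h (comb M e n g) = \<zero>\<^bsub>N\<^esub>" by (simp add: cm)
      then have "comb M e n g = \<zero>\<^bsub>M\<^esub>"
        using bij H.hom_inj_iff comb_closed[of n e g] e_closed by (auto simp: bij_betw_def)
      then show "g i = 0" using basis i by (auto simp: basis_def indep_def)
    qed
  qed
  moreover have "lin (l i) \<odot>\<^bsub>N\<^esub> h (e i) = (if i = 0 then \<zero>\<^bsub>N\<^esub> else of_fps (S (i - 1)) \<odot>\<^bsub>N\<^esub> h (e (i - 1)))"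
    if i: "i < n" for i
  proof -
    have "lin (l i) \<odot>\<^bsub>N\<^esub> h (e i) = h (lin (l i) \<odot>\<^bsub>M\<^esub> e i)" using H.hD(3) e_closed[OF i] by simp
    then show ?thesis using lin_e[OF i] e_closed[of "i - 1"] i H.hom_zero by (auto simp: H.hD)
  qed
  ultimately show ?thesis using N S0 by (auto simp: chain_def)
qed

text \<open>The exponents and the series \<open>S\<close> determine the module: keeping the
  coordinates is a homomorphism by \<open>hom_linear\<close>.\<close>

lemma same_chain_iso:
  assumes M: "chain M l S e n" and N: "chain N l S e' n"
  shows "lmod_iso M N"
proof -
  interpret M: ab_chain M l S e n by (rule ab_chainI[OF M])
  interpret N: ab_chain N l S e' n by (rule ab_chainI[OF N])
  define h where "h x = comb N e' n (M.c x)" for x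
  have hc: "h x \<in> carrier N" for x unfolding h_def by (rule N.comb_closed) (rule N.e_closed)
  have add: "h (x \<oplus>\<^bsub>M\<^esub> y) = h x \<oplus>\<^bsub>N\<^esub> h y" if "x \<in> carrier M" "y \<in> carrier M" for x y
  proof -
    have "M.c (x \<oplus>\<^bsub>M\<^esub> y) = (\<lambda>i. M.c x i + M.c y i)" using that by (intro ext M.crd_add[OF M.basis])
    then show ?thesis using N.comb_add[of n e' "M.c x" "M.c y"] N.e_closed by (simp add: h_def)
  qed
  have fs: "h (of_fps f \<odot>\<^bsub>M\<^esub> x) = of_fps f \<odot>\<^bsub>N\<^esub> h x" if "x \<in> carrier M" for f x
  proof -
    have "M.c (of_fps f \<odot>\<^bsub>M\<^esub> x) = (\<lambda>i. f * M.c x i)" using that by (intro ext M.crd_fs[OF M.basis])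
    then show ?thesis using N.comb_smult[of n e' f "M.c x"] N.e_closed by (simp add: h_def)
  qed
  have he: "h (e i) = e' i" if "i < n" for i
  proof -
    have "h (e i) = comb N e' n (single i 1)"
      unfolding h_def by (rule comb_cong) (auto simp: M.crd_basis[OF M.basis that] single_def)
    then show ?thesis using N.comb_single[of n e' i 1] N.e_closed that by (auto simp: N.lsmult_one)
  qed
  have "h \<in> lmod_hom M N"
  proof (rule M.hom_linear)
    show "left_module N" by unfold_locales
    fix i assume i: "i < n"
    show "h (lin (l i) \<odot>\<^bsub>M\<^esub> e i) = lin (l i) \<odot>\<^bsub>N\<^esub> h (e i)"
    proof (cases i)
      case 0
      have "h \<zero>\<^bsub>M\<^esub> = \<zero>\<^bsub>N\<^esub>" using fs[of "\<zero>\<^bsub>M\<^esub>" 0] hc by simp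
      then show ?thesis using 0 i M.lin_e[OF i] N.lin_e[OF i] he by simp
    next
      case (Suc j)
      then show ?thesis using i M.lin_e[OF i] N.lin_e[OF i] he M.e_closed by (simp add: fs)
    qed
  qed (use hc add fs in auto)
  moreover have "bij_betw h (carrier M) (carrier N)"
  proof (rule bij_betwI[of _ _ _ "\<lambda>y. comb M e n (N.c y)"])
    show "h \<in> carrier M \<rightarrow> carrier N" using hc by auto
    show "(\<lambda>y. comb M e n (N.c y)) \<in> carrier N \<rightarrow> carrier M"
      using M.comb_closed M.e_closed by auto
    show "comb M e n (N.c (h x)) = x" if "x \<in> carrier M" for x
    proof -
      have "comb M e n (N.c (h x)) = comb M e n (M.c x)"
        by (rule comb_cong) (auto simp: h_def N.crd_unique[OF N.basis refl])
      then show ?thesis using M.comb_crd[OF M.basis that] by simp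
    qed
    show "h (comb M e n (N.c y)) = y" if "y \<in> carrier N" for y
    proof -
      have "h (comb M e n (N.c y)) = comb N e' n (N.c y)"
        unfolding h_def by (rule comb_cong) (auto simp: M.crd_unique[OF M.basis refl])
      then show ?thesis using N.comb_crd[OF N.basis that] by simp
    qed
  qed
  ultimately show ?thesis by (auto simp: lmod_iso_def)
qed

section \<open>The modules \<open>E_of\<close>\<close>

lemma unit_series_0 [simp]: "unit_series s j $ 0 = 1"
  by (simp add: unit_series_def)

text \<open>With \<open>R j\<close> the tail of the product starting at factor \<open>j\<close> and
  \<open>V j\<close> the inverse series, the basis is given by the classes of
  \<open>V j * R (Suc j)\<close>. Applying \<open>lin\<close> to one of them completes a tail
  \<open>R j\<close>, which is the preceding basis vector times \<open>U (j - 1)\<close>. So the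
  inverses in \<open>P_of\<close> make the series themselves, not their inverses, appear in the
  chain.\<close>

lemma E_of_chain:
  defines "l \<equiv> \<lambda>ls i. complex_of_real (ls ! i)"
  shows "\<exists>e. chain (E_of ls s) (l ls) (unit_series s) e (length ls)"
proof -
  define n where "n = length ls"
  define U where "U j = unit_series s j" for j
  define V where "V j = of_fps (inverse (U j))" for j
  have VU: "V j * of_fps (U j) = 1" "of_fps (U j) * V j = 1" for j
    by (simp_all add: V_def U_def of_fps_mult[symmetric] inverse_mult_eq_1 inverse_mult_eq_1')
  define R where "R j = prod_list (map (\<lambda>j. lin (l ls j) * V j) [j..<n])" for j
  define T where "T j = V j * R (Suc j)" for j
  have R_Suc: "R j = lin (l ls j) * T j" if "j < n" for j
    using that by (simp add: R_def T_def upt_conv_Cons mult.assoc)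
  have R_n: "R n = 1" by (simp add: R_def)
  have P: "P_of ls s = R 0" by (simp add: P_of_def R_def l_def V_def U_def n_def)
  have UT: "of_fps (U j) * T j = R (Suc j)" for j
    by (simp add: T_def mult.assoc[symmetric] VU)
  define I where "I = range (\<lambda>Q. Q * R 0)"
  have I: "left_submodule I regular_rep" unfolding I_def by (rule left_ideal_submodule)
  interpret Q: left_quotient regular_rep I by (rule left_quotientI[OF regular_rep_left_module I])
  have E: "E_of ls s = quot_mod regular_rep I" by (simp add: E_of_def cyclic_quot_def P I_def)
  interpret ab_left "quot_mod regular_rep I" by (rule ab_leftI[OF Q.quot_left_module])
  have rr: "carrier (regular_rep :: (atilde, atilde) module) = UNIV" "\<zero>\<^bsub>regular_rep\<^esub> = (0 :: atilde)"
    "\<And>r x :: atilde. r \<odot>\<^bsub>regular_rep\<^esub> x = r * x" "\<And>r x :: atilde. r \<oplus>\<^bsub>regular_rep\<^esub> x = r + x"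
    by (simp_all add: regular_rep_def)
  note cls = Q.quot_add Q.quot_smult rr
  have cz: "Q.cls x = \<zero>\<^bsub>quot_mod regular_rep I\<^esub> \<longleftrightarrow> x \<in> I" for x
    using Q.cls_eq_zero_iff[of x] by (simp add: Q.quot_zero rr)
  have cc: "Q.cls x \<in> carrier (quot_mod regular_rep I)" for x by (simp add: Q.quot_carrier rr)
  \<comment> \<open>Tails can be cancelled on the right: the series are units, and uniqueness of
    right division shows that \<open>lin\<close> is not a right zero divisor.\<close>
  have cancel: "x * R j = y * R j \<Longrightarrow> x = y" if "j \<le> n" for x y j
    using that
  proof (induction j arbitrary: x y rule: inc_induct)
    case base
    then show ?case by (simp add: R_n)
  next
    case (step j)
    then have "(x * lin (l ls j) * V j) * R (Suc j) = (y * lin (l ls j) * V j) * R (Suc j)"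
      by (simp add: R_Suc T_def mult.assoc)
    then have "x * lin (l ls j) * V j * of_fps (U j) = y * lin (l ls j) * V j * of_fps (U j)"
      using step.IH by metis
    then have "x * lin (l ls j) = y * lin (l ls j)" by (simp add: mult.assoc VU)
    then show ?case using right_division_unique(1)[of x "l ls j" 0 y 0] by simp
  qed
  have I_R: "\<exists>q. x = q * R j" if "x \<in> I" "j \<le> n" for x j
  proof -
    have "[0..<n] = [0..<j] @ [j..<n]" using that(2) using upt_add_eq_append[of 0 j "n - j"] by simp
    then have "R 0 = prod_list (map (\<lambda>j. lin (l ls j) * V j) [0..<j]) * R j"
      by (simp add: R_def)
    then show ?thesis using that(1) by (auto simp: I_def mult.assoc[symmetric])
  qed
  define F where "F j = cyclic (quot_mod regular_rep I) (Q.cls (R j))" for j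
  have F: "F j = range (\<lambda>r. Q.cls (r * R j))" for j by (simp add: F_def cyclic_def cls)
  have F_iff: "Q.cls x \<in> F j \<longleftrightarrow> (\<exists>r. x = r * R j)" if jn: "j \<le> n" for x j
  proof
    assume "Q.cls x \<in> F j"
    then obtain r where "Q.cls x = Q.cls (r * R j)" by (auto simp: F)
    then have "x \<ominus>\<^bsub>regular_rep\<^esub> r * R j \<in> I" using Q.cls_eq_iff[of x "r * R j"] by (simp add: rr)
    then obtain q where q: "x \<ominus>\<^bsub>regular_rep\<^esub> r * R j = q * R j" using I_R jn by blast
    have "x = (x \<ominus>\<^bsub>regular_rep\<^esub> r * R j) \<oplus>\<^bsub>regular_rep\<^esub> r * R j"
      by (simp add: a_minus_def Q.a_assoc Q.l_neg rr(1))
    then have "x = (q + r) * R j" by (simp add: q rr distrib_right)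
    then show "\<exists>r. x = r * R j" by blast
  qed (auto simp: F)
  define e where "e j = Q.cls (T j)" for j
  have fb: "F j = spn (quot_mod regular_rep I) e j \<and> indep (quot_mod regular_rep I) e j" if "j \<le> n" for j
  proof (rule filtration_basis[OF _ _ _ _ _ _ that])
    show "F 0 = {\<zero>\<^bsub>quot_mod regular_rep I\<^esub>}"
      using cz by (auto simp: F I_def)
    show "left_submodule (F j) (quot_mod regular_rep I)" for j
      unfolding F_def by (rule left_submodule_cyclic[OF cc])
    show "e j \<in> F (Suc j)" for j by (auto simp: e_def F T_def)
    show "F j \<subseteq> F (Suc j)" if "j < n" for j
      by (auto simp: F R_Suc[OF that] T_def mult.assoc[symmetric])
    show "\<exists>f. \<exists>y\<in>F j. x = y \<oplus>\<^bsub>quot_mod regular_rep I\<^esub> of_fps f \<odot>\<^bsub>quot_mod regular_rep I\<^esub> e j"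
      if "j < n" and x: "x \<in> F (Suc j)" for j x
    proof -
      obtain r where r: "x = Q.cls (r * R (Suc j))" using x by (auto simp: F)
      obtain q f where qf: "r * of_fps (U j) = q * lin (l ls j) + of_fps f" using right_division by blast
      have "r * R (Suc j) = (r * of_fps (U j)) * T j" by (simp add: mult.assoc UT)
      also have "\<dots> = q * R j + of_fps f * T j" by (simp add: qf distrib_right mult.assoc R_Suc[OF that(1)])
      finally have "x = Q.cls (q * R j) \<oplus>\<^bsub>quot_mod regular_rep I\<^esub> of_fps f \<odot>\<^bsub>quot_mod regular_rep I\<^esub> e j"
        by (simp add: r e_def cls)
      then show ?thesis by (auto simp: F)
    qed
    show "f = 0" if j: "j < n" and f: "of_fps f \<odot>\<^bsub>quot_mod regular_rep I\<^esub> e j \<in> F j" for f j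
    proof -
      have "Q.cls (of_fps f * T j) \<in> F j" using f by (simp add: e_def cls)
      then obtain r where "of_fps f * T j = r * R j" using F_iff[of j] j by auto
      then have "(of_fps f * V j) * R (Suc j) = (r * lin (l ls j) * V j) * R (Suc j)"
        by (simp add: R_Suc[OF j] T_def mult.assoc)
      then have "of_fps f * V j * of_fps (U j) = r * lin (l ls j) * V j * of_fps (U j)"
        using cancel[of "Suc j"] j by (metis Suc_leI)
      then have "of_fps f = r * lin (l ls j)" by (simp add: mult.assoc VU)
      then show "f = 0" using right_division_zero(2)[of "-r" "l ls j" f] by simp
    qed
  qed
  have "F n = carrier (quot_mod regular_rep I)"
    by (auto simp: F R_n Q.quot_carrier rr)
  then have "basis e n" using fb[of n] cc by (auto simp: basis_def e_def)
  moreover have "lin (l ls i) \<odot>\<^bsub>quot_mod regular_rep I\<^esub> e i =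
      (if i = 0 then \<zero>\<^bsub>quot_mod regular_rep I\<^esub> else of_fps (U (i - 1)) \<odot>\<^bsub>quot_mod regular_rep I\<^esub> e (i - 1))"
    if "i < n" for i
  proof (cases i)
    case 0
    have "R 0 \<in> I" unfolding I_def by (rule range_eqI[of _ _ 1]) simp
    then show ?thesis using 0 that cz[of "R 0"] by (simp add: e_def cls R_Suc[symmetric])
  next
    case (Suc j)
    then show ?thesis using that by (simp add: e_def cls R_Suc[symmetric] UT)
  qed
  ultimately have "chain (quot_mod regular_rep I) (l ls) U e n"
    by (auto simp: chain_def Q.quot_left_module U_def)
  then show ?thesis unfolding E U_def n_def by auto
qed

unbundle fps_syntax

section \<open>Log-free solutions\<close>

text \<open>
  A family \<open>(y\<^sub>j)\<close> as below is the image of a chain under a homomorphism into \<open>b^\<lambda>\<^sub>0 \<complex>((b))\<close>,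
  where \<open>a\<close> acts as \<open>b\<^sup>2 d/db\<close>; here \<open>d j = \<lambda>\<^sub>j - \<lambda>\<^sub>0\<close>.
\<close>

abbreviation \<theta> :: "complex fls \<Rightarrow> complex fls" where "\<theta> f \<equiv> fls_X * fls_deriv f"

definition sol :: "(nat \<Rightarrow> int) \<Rightarrow> (nat \<Rightarrow> complex fps) \<Rightarrow> nat \<Rightarrow> (nat \<Rightarrow> complex fls) \<Rightarrow> bool" where
  "sol d S m y \<longleftrightarrow> (\<forall>j<m. fls_X * (\<theta> (y j) - fls_const (of_int (d j)) * y j) =
     (if j = 0 then 0 else fps_to_fls (S (j - 1)) * y (j - 1)))"

lemma fls_X_mult_nth: "(fls_X * f) $$ n = (f :: complex fls) $$ (n - 1)"
  by (simp add: fls_X_times_conv_shift)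

lemma \<theta>_nth: "\<theta> f $$ n = of_int n * f $$ n"
  by (simp add: fls_X_mult_nth)

lemma \<theta>_add: "\<theta> (f + g) = \<theta> f + \<theta> g"
  by (simp add: algebra_simps)

lemma \<theta>_mult: "\<theta> (f * g) = \<theta> f * g + f * \<theta> g"
  by (simp add: algebra_simps)

lemma \<theta>_sum: "\<theta> (sum f A) = (\<Sum>i\<in>A. \<theta> (f i))"
  by (simp add: fls_deriv_sum sum_distrib_left)

lemma \<theta>_fps: "fls_X * \<theta> (fps_to_fls g) = fps_to_fls (fps_X^2 * fps_deriv g)"
  by (simp add: fls_deriv_fps_to_fls fls_times_fps_to_fls power2_eq_square mult.assoc)

lemma \<theta>_shift_nth: "(fls_X * (\<theta> f - fls_const (of_int k) * f)) $$ n = of_int (n - 1 - k) * f $$ (n - 1)"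
  by (simp add: fls_X_mult_nth algebra_simps flip: fls_of_int)

lemma sol_nth:
  assumes "sol d S m y" "j < m"
  shows "of_int (n - d j) * y j $$ n = (if j = 0 then 0 else (fps_to_fls (S (j - 1)) * y (j - 1)) $$ (n + 1))"
  using assms \<theta>_shift_nth[of "y j" "d j" "n + 1"] by (auto simp: sol_def)

lemma solI:
  assumes "\<And>j n. j < m \<Longrightarrow> of_int (n - d j) * y j $$ n =
      (if j = 0 then 0 else (fps_to_fls (S (j - 1)) * y (j - 1)) $$ (n + 1))"
  shows "sol d S m y"
  unfolding sol_def
proof (intro allI impI fls_eqI)
  fix j n assume "j < m"
  then show "(fls_X * (\<theta> (y j) - fls_const (of_int (d j)) * y j)) $$ n =
    (if j = 0 then 0 else fps_to_fls (S (j - 1)) * y (j - 1)) $$ n"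
    unfolding \<theta>_shift_nth using assms[of j "n - 1"] by auto
qed

lemma sol_mono: "sol d S m y \<Longrightarrow> m' \<le> m \<Longrightarrow> sol d S m' y"
  by (auto simp: sol_def)

lemma sol_combine:
  assumes "sol d S m y" "sol d S m y'"
  shows "sol d S m (\<lambda>j. y j - fls_const k * y' j)"
proof -
  have "fls_X * (\<theta> (y j - fls_const k * y' j) - fls_const (of_int (d j)) * (y j - fls_const k * y' j)) =
     fls_X * (\<theta> (y j) - fls_const (of_int (d j)) * y j) -
     fls_const k * (fls_X * (\<theta> (y' j) - fls_const (of_int (d j)) * y' j))" for j
    by (simp add: algebra_simps)
  note eq = this
  show ?thesis
    unfolding sol_def eq
  proof (intro allI impI)
    fix j assume j: "j < m"
    show "fls_X * (\<theta> (y j) - fls_const (of_int (d j)) * y j) -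
       fls_const k * (fls_X * (\<theta> (y' j) - fls_const (of_int (d j)) * y' j)) =
       (if j = 0 then 0 else fps_to_fls (S (j - 1)) * (y (j - 1) - fls_const k * y' (j - 1)))"
      unfolding assms[unfolded sol_def, rule_format, OF j] by (simp add: algebra_simps)
  qed
qed

lemma sol_scale:
  assumes "sol d S m y"
  shows "sol d S m (\<lambda>j. fls_const k * y j)"
proof -
  have "sol d S m (\<lambda>j. 0)" by (auto simp: sol_def)
  from sol_combine[OF this assms, of "-k"] show ?thesis by simp
qed

text \<open>The equation of the first nonzero entry has no inhomogeneous term, so only the resonant
  exponent can occur. A single constant therefore decides how much of one solution to subtract from
  another.\<close>

lemma sol_first:
  assumes "sol d S m y" "i < m" "\<And>j. j < i \<Longrightarrow> y j = 0"
  shows "y i = fls_const (y i $$ d i) * fls_X_intpow (d i)"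
proof (rule fls_eqI)
  fix n
  have "of_int (n - d i) * y i $$ n = 0"
    using sol_nth[OF assms(1,2), of n] assms(3)[of "i - 1"] by (cases "i = 0") auto
  then show "y i $$ n = (fls_const (y i $$ d i) * fls_X_intpow (d i)) $$ n"
    by (auto simp: fls_X_intpow_times_conv_shift)
qed

text \<open>At the exponent \<open>d j\<close> the operator on the left vanishes, so the right side
  must have no coefficient there; the shift by 1 comes from the extra factor b.\<close>

lemma sol_obstruction:
  assumes "sol d S m y" "j < m" "j > 0"
  shows "(fps_to_fls (S (j - 1)) * y (j - 1)) $$ (d j + 1) = 0"
  using sol_nth[OF assms(1,2), of "d j"] assms(3) by simp

text \<open>\<open>\<Phi>\<close> is the value, on the element with coordinates \<open>x\<close>, of
  the homomorphism given by \<open>y\<close>. The bracket on the left has the shape of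
  \<open>crd_lin\<close>. The identity thus says that this homomorphism respects a; it is the
  product rule plus an index shift that uses the equations of \<open>y\<close>.\<close>

lemma eval_lin:
  assumes "sol d S m y" and x: "\<And>i. i \<ge> m \<Longrightarrow> x i = 0"
  defines "\<Phi> \<equiv> (\<Sum>i<m. fps_to_fls (x i) * y i)"
  shows "(\<Sum>i<m. fps_to_fls (fps_X^2 * fps_deriv (x i) + fps_const (of_int (d i) - of_int c) * fps_X * x i +
            S i * x (Suc i)) * y i) = fls_X * (\<theta> \<Phi> - fls_const (of_int c) * \<Phi>)"
proof -
  let ?F = fps_to_fls
  have "(\<Sum>i<m. ?F (S i * x (Suc i)) * y i) =
     (\<Sum>i<m. ?F (x i) * (if i = 0 then 0 else ?F (S (i - 1)) * y (i - 1)))"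
  proof (cases m)
    case (Suc k)
    have "(\<Sum>i<m. ?F (S i * x (Suc i)) * y i) = (\<Sum>i<k. ?F (S i * x (Suc i)) * y i)"
      using x[of m] Suc by simp
    also have "\<dots> = (\<Sum>i<Suc k. ?F (x i) * (if i = 0 then 0 else ?F (S (i - 1)) * y (i - 1)))"
      by (subst sum.lessThan_Suc_shift) (simp add: fls_times_fps_to_fls mult_ac)
    finally show ?thesis using Suc by simp
  qed simp
  also have "\<dots> = (\<Sum>i<m. ?F (x i) * (fls_X * (\<theta> (y i) - fls_const (of_int (d i)) * y i)))"
    using assms(1) by (intro sum.cong) (auto simp: sol_def)
  finally have eq: "(\<Sum>i<m. ?F (S i * x (Suc i)) * y i) = \<dots>" .
  have cc: "?F (fps_const (of_int (d i) - of_int c) * fps_X * x i) =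
      (fls_const (of_int (d i)) - fls_const (of_int c)) * (fls_X * ?F (x i))" for i
    by (simp add: fls_times_fps_to_fls mult.assoc flip: fls_minus_const)
  have "(\<Sum>i<m. ?F (fps_X^2 * fps_deriv (x i) + fps_const (of_int (d i) - of_int c) * fps_X * x i +
            S i * x (Suc i)) * y i) =
     (\<Sum>i<m. (fls_X * \<theta> (?F (x i)) + (fls_const (of_int (d i)) - fls_const (of_int c)) * (fls_X * ?F (x i))) * y i) +
     (\<Sum>i<m. ?F (S i * x (Suc i)) * y i)"
    unfolding \<theta>_fps cc[symmetric] by (simp add: sum.distrib[symmetric] distrib_right)
  also have "\<dots> = (\<Sum>i<m. fls_X * (\<theta> (?F (x i) * y i) - fls_const (of_int c) * (?F (x i) * y i)))"
    unfolding eq sum.distrib[symmetric] \<theta>_mult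
    by (intro sum.cong refl) (simp only: algebra_simps)
  also have "\<dots> = fls_X * (\<theta> \<Phi> - fls_const (of_int c) * \<Phi>)"
    unfolding \<Phi>_def \<theta>_sum by (simp only: sum_distrib_left sum_subtractf[symmetric])
  finally show ?thesis .
qed

section \<open>The obstruction\<close>

text \<open>
  \<open>canon d S j\<close> is \<open>b^j\<close> times the \<open>j\<close>-th entry of the solution with first entry \<open>1\<close> whose resonant
  coefficients vanish.
\<close>

fun canon :: "(nat \<Rightarrow> int) \<Rightarrow> (nat \<Rightarrow> complex fps) \<Rightarrow> nat \<Rightarrow> complex fps" where
  "canon d S 0 = 1"
| "canon d S (Suc j) = Abs_fps (\<lambda>m. (S j * canon d S j) $ m / of_int (int m - int (Suc j) - d (Suc j)))"

definition canon_fls :: "(nat \<Rightarrow> int) \<Rightarrow> (nat \<Rightarrow> complex fps) \<Rightarrow> nat \<Rightarrow> complex fls" where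
  "canon_fls d S j = fls_shift (int j) (fps_to_fls (canon d S j))"

text \<open>The resonant coefficient \<open>d (n - 1) + 1\<close> in the last equation, with
  \<open>n - 2\<close> added because \<open>canon\<close> carries that power of b. Only the entries
  before the last one enter.\<close>

definition obstr :: "(nat \<Rightarrow> int) \<Rightarrow> (nat \<Rightarrow> complex fps) \<Rightarrow> nat \<Rightarrow> complex" where
  "obstr d S n = (S (n - 2) * canon d S (n - 2)) $ nat (d (n - 1) + int n - 1)"

lemma canon_fls_mult_nth:
  "(fps_to_fls g * canon_fls d S j) $$ n = (if n + int j < 0 then 0 else (g * canon d S j) $ nat (n + int j))"
proof -
  have "fps_to_fls g * canon_fls d S j = fls_shift (int j) (fps_to_fls (g * canon d S j))"
    by (simp add: canon_fls_def fls_shifted_times_simps fls_times_fps_to_fls)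
  then show ?thesis by simp
qed

lemma canon_fls_0: "canon_fls d S 0 = 1"
  by (simp add: canon_fls_def)

lemma obstr_eq:
  assumes "n \<ge> 2" "d (n - 1) \<ge> 0"
  shows "obstr d S n = (fps_to_fls (S (n - 2)) * canon_fls d S (n - 2)) $$ (d (n - 1) + 1)"
proof -
  have "d (n - 1) + 1 + int (n - 2) = d (n - 1) + int n - 1" using assms by (simp add: of_nat_diff)
  then show ?thesis using assms by (simp add: obstr_def canon_fls_mult_nth)
qed

lemma canon_sol_Suc:
  assumes d0: "d 0 = 0" and d: "d m \<ge> 0" and sol: "sol d S m (canon_fls d S)" and m: "m > 0"
    and ob: "(fps_to_fls (S (m - 1)) * canon_fls d S (m - 1)) $$ (d m + 1) = 0"
  shows "sol d S (Suc m) (canon_fls d S)"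
proof (rule solI)
  fix j n assume j: "j < Suc m"
  show "of_int (n - d j) * canon_fls d S j $$ n =
      (if j = 0 then 0 else (fps_to_fls (S (j - 1)) * canon_fls d S (j - 1)) $$ (n + 1))"
  proof (cases "j = m")
    case False
    then show ?thesis using sol_nth[OF sol] j by simp
  next
    case True
    obtain k where k: "m = Suc k" using m by (cases m) auto
    have "canon_fls d S m $$ n = (if n + int m < 0 then 0 else
        (S k * canon d S k) $ nat (n + int m) / of_int (n - d m))"
      by (simp add: canon_fls_def k)
    moreover have "(fps_to_fls (S k) * canon_fls d S k) $$ (n + 1) =
        (if n + int m < 0 then 0 else (S k * canon d S k) $ nat (n + int m))"
      by (simp add: canon_fls_mult_nth k add_ac)
    \<comment> \<open>Off resonance the division in \<open>canon\<close> solves the equation. For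
      \<open>n = d m\<close> it is a division by zero, whose value 0 is the chosen resonant
      coefficient, and the equation then holds exactly because of \<open>ob\<close>.\<close>
    ultimately show ?thesis using True ob k by auto
  qed
qed

lemma canon_sol_1: "d 0 = 0 \<Longrightarrow> sol d S (Suc 0) (canon_fls d S)"
  by (auto simp: sol_def canon_fls_0)

text \<open>
  \<open>flat\<close> expresses that \<open>F\<^sub>k\<^sub>-\<^sub>1\<close> and \<open>E/F\<^sub>1\<close> have enough log-free solutions.
\<close>

definition flat :: "(nat \<Rightarrow> int) \<Rightarrow> (nat \<Rightarrow> complex fps) \<Rightarrow> nat \<Rightarrow> bool" where
  "flat d S n \<longleftrightarrow>
     (\<forall>i. 1 \<le> i \<and> i < n \<longrightarrow> (\<exists>\<chi>. sol d S n \<chi> \<and> (\<forall>j<i. \<chi> j = 0) \<and> \<chi> i \<noteq> 0)) \<and>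
     (\<exists>\<phi>. sol d S (n - 1) \<phi> \<and> \<phi> 0 \<noteq> 0)"

text \<open>The solutions \<open>\<chi>\<close> provided by \<open>flat\<close> extend over all
  indices and so meet no obstruction. Subtracting a multiple of the one that starts at
  \<open>i\<close> moves the first entry of \<open>\<psi>\<close> to a later index without changing
  the obstruction; in the end nothing is left below \<open>m\<close>.\<close>

lemma flat_obstruction:
  assumes fl: "flat d S n" and m: "m < n"
  shows "1 \<le> i \<Longrightarrow> i \<le> m \<Longrightarrow> sol d S m \<psi> \<Longrightarrow> (\<And>j. j < i \<Longrightarrow> \<psi> j = 0) \<Longrightarrow>
     (fps_to_fls (S (m - 1)) * \<psi> (m - 1)) $$ (d m + 1) = 0"
proof (induction "m - i" arbitrary: i \<psi>)
  case 0
  then show ?case by simp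
next
  case (Suc k)
  then have i: "1 \<le> i" "i < m" by auto
  then obtain \<chi> where \<chi>: "sol d S n \<chi>" "\<And>j. j < i \<Longrightarrow> \<chi> j = 0" "\<chi> i \<noteq> 0"
    using fl m unfolding flat_def by (meson less_trans)
  define c where "c = \<psi> i $$ d i / \<chi> i $$ d i"
  have 1: "\<chi> i = fls_const (\<chi> i $$ d i) * fls_X_intpow (d i)"
    using i m by (intro sol_first[OF \<chi>(1)]) (auto simp: \<chi>(2))
  have 2: "\<psi> i = fls_const (\<psi> i $$ d i) * fls_X_intpow (d i)"
    using i by (intro sol_first[OF Suc.prems(3)]) (auto simp: Suc.prems(4))
  have nz: "\<chi> i $$ d i \<noteq> 0" using 1 \<chi>(3) by (metis fls_const_0 mult_zero_left)
  define \<psi>' where "\<psi>' j = \<psi> j - fls_const c * \<chi> j" for j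
  have "fls_const c * \<chi> i = fls_const (c * \<chi> i $$ d i) * fls_X_intpow (d i)"
    by (subst 1) (simp add: mult.assoc[symmetric])
  also have "\<dots> = \<psi> i" using 2 nz by (simp add: c_def)
  finally have "\<psi>' i = 0" by (simp add: \<psi>'_def)
  then have z: "\<psi>' j = 0" if "j < Suc i" for j
    using that \<chi>(2) Suc.prems(4) by (auto simp: \<psi>'_def less_Suc_eq)
  have "sol d S m \<psi>'"
    unfolding \<psi>'_def using Suc.prems(3) sol_mono[OF \<chi>(1)] m by (intro sol_combine) auto
  then have "(fps_to_fls (S (m - 1)) * \<psi>' (m - 1)) $$ (d m + 1) = 0"
    using Suc.hyps(2) i z by (intro Suc.hyps(1)[of "Suc i"]) auto
  moreover have "(fps_to_fls (S (m - 1)) * \<chi> (m - 1)) $$ (d m + 1) = 0"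
    using sol_obstruction[OF \<chi>(1) m] i by simp
  moreover have "fps_to_fls (S (m - 1)) * \<psi> (m - 1) =
     fps_to_fls (S (m - 1)) * \<psi>' (m - 1) + fls_const c * (fps_to_fls (S (m - 1)) * \<chi> (m - 1))"
    by (simp add: \<psi>'_def algebra_simps)
  ultimately show ?case by simp
qed

text \<open>The difference of the two solutions starts at index 1 or later, where
  \<open>flat_obstruction\<close> applies. Hence the obstruction depends on the first entry
  only.\<close>

lemma flat_unique:
  assumes fl: "flat d S n" and m: "1 \<le> m" "m < n" and y: "sol d S m y" "sol d S m y'" "y 0 = y' 0"
  shows "(fps_to_fls (S (m - 1)) * y (m - 1)) $$ (d m + 1) = (fps_to_fls (S (m - 1)) * y' (m - 1)) $$ (d m + 1)"
proof -
  have s: "sol d S m (\<lambda>j. y j - y' j)" using sol_combine[OF y(1,2), of 1] by simp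
  have "(fps_to_fls (S (m - 1)) * (y (m - 1) - y' (m - 1))) $$ (d m + 1) = 0"
    using flat_obstruction[OF fl m(2) _ _ s, of 1] m y(3) by simp
  then show ?thesis by (simp add: right_diff_distrib)
qed

lemma flat_normalized:
  assumes fl: "flat d S n" and d0: "d 0 = 0" and n: "n \<ge> 2"
  obtains \<phi> where "sol d S (n - 1) \<phi>" "\<phi> 0 = 1"
proof -
  obtain \<phi> where \<phi>: "sol d S (n - 1) \<phi>" "\<phi> 0 \<noteq> 0" using fl by (auto simp: flat_def)
  have 1: "\<phi> 0 = fls_const (\<phi> 0 $$ 0)" using sol_first[OF \<phi>(1), of 0] n d0 by simp
  then have "\<phi> 0 $$ 0 \<noteq> 0" using \<phi>(2) by (metis fls_const_0)
  then have "fls_const (inverse (\<phi> 0 $$ 0)) * \<phi> 0 = 1" by (subst 1) simp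
  then show thesis using that[OF sol_scale[OF \<phi>(1)]] by blast
qed

text \<open>Some solution with first entry 1 exists up to index \<open>n - 2\<close> and meets no
  obstruction there. By \<open>flat_unique\<close> neither does the canonical one, which has the
  advantage of explicit polynomial coefficients.\<close>

lemma flat_canon_sol:
  assumes fl: "flat d S n" and d0: "d 0 = 0" and d: "\<And>j. j < n \<Longrightarrow> d j \<ge> 0" and n: "n \<ge> 2"
  shows "1 \<le> m \<Longrightarrow> m \<le> n - 1 \<Longrightarrow> sol d S m (canon_fls d S)"
proof (induction m)
  case (Suc m)
  show ?case
  proof (cases "m = 0")
    case True
    then show ?thesis using canon_sol_1[of d S, OF d0] by simp
  next
    case False
    obtain \<phi> where \<phi>: "sol d S (n - 1) \<phi>" "\<phi> 0 = 1" by (rule flat_normalized[OF fl d0 n])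
    have s: "sol d S m (canon_fls d S)" using Suc False by simp
    have "(fps_to_fls (S (m - 1)) * canon_fls d S (m - 1)) $$ (d m + 1) =
        (fps_to_fls (S (m - 1)) * \<phi> (m - 1)) $$ (d m + 1)"
      using False Suc.prems n \<phi> by (intro flat_unique[OF fl _ _ s] sol_mono[OF \<phi>(1)]) (auto simp: canon_fls_0)
    also have "\<dots> = 0" using sol_obstruction[OF \<phi>(1), of m] False Suc.prems n by simp
    finally show ?thesis using False Suc.prems by (intro canon_sol_Suc[where d = d, OF d0 d s]) auto
  qed
qed auto

lemma obstr_of_sol:
  assumes fl: "flat d S n" and d0: "d 0 = 0" and d: "\<And>j. j < n \<Longrightarrow> d j \<ge> 0" and n: "n \<ge> 2"
    and \<phi>: "sol d S (n - 1) \<phi>" "\<phi> 0 = 1"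
  shows "obstr d S n = (fps_to_fls (S (n - 2)) * \<phi> (n - 2)) $$ (d (n - 1) + 1)"
proof -
  have "n - 1 - 1 = n - 2" by simp
  then show ?thesis
    using flat_unique[OF fl, of "n - 1" "canon_fls d S" \<phi>] flat_canon_sol[where S = S and d = d and n = n and m = "n - 1", OF fl d0 d n] n d[of "n - 1"] \<phi>
    by (simp add: obstr_eq canon_fls_0)
qed

lemma obstr_zero_iff:
  assumes fl: "flat d S n" and d0: "d 0 = 0" and d: "\<And>j. j < n \<Longrightarrow> d j \<ge> 0" and n: "n \<ge> 2"
  shows "obstr d S n = 0 \<longleftrightarrow> (\<exists>y. sol d S n y \<and> y 0 \<noteq> 0)"
proof
  assume ob: "obstr d S n = 0"
  have "n - 1 - 1 = n - 2" "Suc (n - 1) = n" using n by auto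
  then have "sol d S n (canon_fls d S)"
    using canon_sol_Suc[where d = d and m = "n - 1" and S = S, OF d0 d flat_canon_sol[OF fl d0 d n]] ob n d[of "n - 1"]
    by (simp add: obstr_eq)
  moreover have "canon_fls d S 0 \<noteq> 0" by (simp add: canon_fls_0)
  ultimately show "\<exists>y. sol d S n y \<and> y 0 \<noteq> 0" by blast
next
  assume "\<exists>y. sol d S n y \<and> y 0 \<noteq> 0"
  then obtain y where y: "sol d S n y" "y 0 \<noteq> 0" by blast
  have 1: "y 0 = fls_const (y 0 $$ 0)" using sol_first[OF y(1), of 0] n d0 by simp
  then have "y 0 $$ 0 \<noteq> 0" using y(2) by (metis fls_const_0)
  then have 2: "fls_const (inverse (y 0 $$ 0)) * y 0 = 1" by (subst 1) simp
  let ?\<phi> = "\<lambda>j. fls_const (inverse (y 0 $$ 0)) * y j"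
  have s: "sol d S n ?\<phi>" by (rule sol_scale[OF y(1)])
  have "obstr d S n = (fps_to_fls (S (n - 2)) * ?\<phi> (n - 2)) $$ (d (n - 1) + 1)"
    using 2 by (intro obstr_of_sol[OF fl d0 d n sol_mono[OF s]]) auto
  moreover have "n - 1 - 1 = n - 2" by simp
  ultimately show "obstr d S n = 0" using sol_obstruction[OF s, of "n - 1"] n by simp
qed

section \<open>Separation by solutions\<close>

text \<open>Solutions that vanish below \<open>i\<close> correspond to homomorphisms from E/F_i. The
  condition says that they separate the points of this quotient, \<open>g\<close> being the
  coordinates of a representative.\<close>

definition separated :: "(nat \<Rightarrow> int) \<Rightarrow> (nat \<Rightarrow> complex fps) \<Rightarrow> nat \<Rightarrow> nat \<Rightarrow> bool" where
  "separated d S n i \<longleftrightarrow> (\<forall>g. (\<exists>j. i \<le> j \<and> j < n \<and> g j \<noteq> 0) \<longrightarrow>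
     (\<exists>y. sol d S n y \<and> (\<forall>j<i. y j = 0) \<and> (\<Sum>j<n. fps_to_fls (g j) * y j) \<noteq> 0))"

lemma separated_sol:
  assumes "separated d S n i" "i < n"
  obtains y where "sol d S n y" "\<And>j. j < i \<Longrightarrow> y j = 0" "y i \<noteq> 0"
proof -
  have "\<exists>j. i \<le> j \<and> j < n \<and> single i 1 j \<noteq> 0"
    using assms(2) by (intro exI[of _ i]) (simp add: single_def)
  then obtain y where y: "sol d S n y" "\<forall>j<i. y j = 0" "(\<Sum>j<n. fps_to_fls (single i 1 j) * y j) \<noteq> 0"
    using assms(1) unfolding separated_def by blast
  have "(\<Sum>j<n. fps_to_fls (single i 1 j) * y j) = (\<Sum>j<n. if j = i then y i else 0)"
    by (intro sum.cong) (auto simp: single_def)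
  then have "y i \<noteq> 0" using y(3) assms(2) by simp
  then show thesis using that y by blast
qed

text \<open>
  Elimination: one solution is used to kill the \<open>i\<close>-th entry of all others.
\<close>

lemma separated_Suc:
  assumes sep: "separated d S n i" and i: "i < n"
  shows "separated d S n (Suc i)"
proof -
  obtain \<chi> where \<chi>: "sol d S n \<chi>" "\<And>j. j < i \<Longrightarrow> \<chi> j = 0" "\<chi> i \<noteq> 0"
    by (rule separated_sol[OF sep i]) blast
  define k where "k = \<chi> i $$ d i"
  have \<chi>i: "\<chi> i = fls_const k * fls_X_intpow (d i)"
    unfolding k_def by (rule sol_first[OF \<chi>(1) i \<chi>(2)])
  have k: "k \<noteq> 0" using \<chi>i \<chi>(3) by auto
  show ?thesis
    unfolding separated_def
  proof (intro allI impI, rule ccontr)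
    fix g assume g: "\<exists>j. Suc i \<le> j \<and> j < n \<and> g j \<noteq> 0"
      and no: "\<nexists>y. sol d S n y \<and> (\<forall>j<Suc i. y j = 0) \<and> (\<Sum>j<n. fps_to_fls (g j) * y j) \<noteq> 0"
    define G where "G = (\<Sum>j<n. fps_to_fls (g j) * \<chi> j)"
    \<comment> \<open>The quotient of \<open>G\<close> by the monomial \<open>\<chi> i\<close> may
      have a pole; the factor b to the power \<open>M\<close> turns it into the power series
      \<open>f\<close>.\<close>
    define M where "M = nat (max 0 (d i - fls_subdegree G))"
    define f where "f = fls_regpart (fls_const (inverse k) * fls_X_intpow (int M - d i) * G)"
    have f: "fps_to_fls f = fls_const (inverse k) * fls_X_intpow (int M - d i) * G"
      unfolding f_def
    proof (rule fls_regpart_to_fls_trivial)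
      show "0 \<le> fls_subdegree (fls_const (inverse k) * fls_X_intpow (int M - d i) * G)"
      proof (cases "G = 0")
        case False
        have nz: "fls_const (inverse k) \<noteq> 0" "(fls_X_intpow (int M - d i) :: complex fls) \<noteq> 0"
          using k by (simp_all add: fls_shift_eq0_iff)
        then have "fls_const (inverse k) * fls_X_intpow (int M - d i) \<noteq> 0" by (rule no_zero_divisors)
        then have "fls_subdegree (fls_const (inverse k) * fls_X_intpow (int M - d i) * G) =
            int M - d i + fls_subdegree G"
          using fls_subdegree_mult[OF _ False] fls_subdegree_mult[OF nz] by simp
        then show ?thesis by (simp add: M_def)
      qed simp
    qed
    have ff: "fps_to_fls f * (fls_const k * fls_X_intpow (d i)) = fls_X_intpow (int M) * G"
    proof -
      have "fls_X_intpow (int M - d i) * fls_X_intpow (d i) = (fls_X_intpow (int M) :: complex fls)"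
        using fls_X_intpow_times_fls_X_intpow[where 'a = complex, of "int M - d i" "d i"]
        by (simp only: diff_add_cancel)
      moreover have "fps_to_fls f * (fls_const k * fls_X_intpow (d i)) =
          (fls_const (inverse k) * fls_const k) * (fls_X_intpow (int M - d i) * fls_X_intpow (d i)) * G"
        unfolding f by (simp only: mult_ac)
      ultimately show ?thesis using k by simp
    qed
    \<comment> \<open>The new element is made to be killed by \<open>\<chi>\<close>. Any solution
      vanishing below \<open>i\<close> is a multiple of \<open>\<chi>\<close> plus one vanishing
      below \<open>Suc i\<close>, and the latter kills \<open>g\<close> by assumption. So all of
      them kill \<open>g'\<close>, although it has a nonzero coordinate above
      \<open>i\<close>.\<close>
    define g' where "g' j = fps_X ^ M * g j - single i f j" for j
    have ev: "(\<Sum>j<n. fps_to_fls (g' j) * y j) =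
        fls_X_intpow (int M) * (\<Sum>j<n. fps_to_fls (g j) * y j) - fps_to_fls f * y i" for y
    proof -
      have "(\<Sum>j<n. fps_to_fls (single i f j) * y j) = (\<Sum>j<n. if j = i then fps_to_fls f * y i else 0)"
        by (intro sum.cong) (auto simp: single_def)
      then have "(\<Sum>j<n. fps_to_fls (single i f j) * y j) = fps_to_fls f * y i" using i by simp
      moreover have "fps_to_fls (fps_X ^ M) = (fls_X_intpow (int M) :: complex fls)"
        by (simp add: fps_to_fls_power fls_X_power_conv_shift_1)
      ultimately show ?thesis
        by (simp add: g'_def left_diff_distrib sum_subtractf fls_times_fps_to_fls sum_distrib_left mult.assoc)
    qed
    have "(\<Sum>j<n. fps_to_fls (g' j) * y j) = 0" if y: "sol d S n y" "\<forall>j<i. y j = 0" for y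
    proof -
      define c where "c = y i $$ d i / k"
      have yi: "y i = fls_const (y i $$ d i) * fls_X_intpow (d i)"
        using y by (intro sol_first[OF y(1) i]) auto
      have yc: "y i = fls_const c * \<chi> i"
        unfolding \<chi>i mult.assoc[symmetric] fls_const_mult_const using k by (subst yi) (simp add: c_def)
      define z where "z j = y j - fls_const c * \<chi> j" for j
      have "sol d S n z" unfolding z_def by (rule sol_combine[OF y(1) \<chi>(1)])
      moreover have "\<forall>j<Suc i. z j = 0" using y(2) \<chi>(2) yc by (auto simp: z_def less_Suc_eq)
      ultimately have "(\<Sum>j<n. fps_to_fls (g j) * z j) = 0" using no by blast
      then have "(\<Sum>j<n. fps_to_fls (g j) * y j) = fls_const c * G"
        by (simp add: z_def G_def right_diff_distrib sum_subtractf sum_distrib_left mult_ac)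
      moreover have "fps_to_fls f * y i = fls_const c * (fls_X_intpow (int M) * G)"
        unfolding yc ff[symmetric] \<chi>i by (simp only: mult_ac)
      ultimately show ?thesis unfolding ev by (simp only: mult_ac) simp
    qed
    moreover have "\<exists>j. i \<le> j \<and> j < n \<and> g' j \<noteq> 0"
    proof -
      obtain j where "Suc i \<le> j" "j < n" "g j \<noteq> 0" using g by blast
      then show ?thesis by (intro exI[of _ j]) (auto simp: g'_def single_def)
    qed
    ultimately show False using sep unfolding separated_def by blast
  qed
qed

lemma separated_le: "separated d S n i \<Longrightarrow> i \<le> j \<Longrightarrow> j \<le> n \<Longrightarrow> separated d S n j"
proof (induction j)
  case (Suc j)
  then show ?case by (cases "i = Suc j") (auto intro: separated_Suc)
qed simp

lemma flatI:
  assumes "separated d S n 1" "sol d S (n - 1) \<phi>" "\<phi> 0 \<noteq> 0"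
  shows "flat d S n"
  unfolding flat_def
proof (intro conjI allI impI)
  fix i assume "1 \<le> i \<and> i < n"
  then have "separated d S n i" "i < n" using separated_le[OF assms(1)] by auto
  then show "\<exists>\<chi>. sol d S n \<chi> \<and> (\<forall>j<i. \<chi> j = 0) \<and> \<chi> i \<noteq> 0"
    by (metis separated_sol)
qed (use assms in blast)

section \<open>Comparison of two chains\<close>

text \<open>The coefficient of index n is multiplied by n + r, which is positive for n > 0. This is
  where the monotonicity of the invariants is used.\<close>

lemma fps_euler_zero:
  fixes g :: "complex fps"
  assumes "fps_X^2 * fps_deriv g + fps_const (of_real r) * fps_X * g = 0" "r \<ge> 0"
  shows "g = fps_const (g $ 0)"
proof (rule fps_ext)
  fix n
  show "g $ n = fps_const (g $ 0) $ n"
  proof (cases n)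
    case (Suc m)
    have "(fps_X^2 * fps_deriv g + fps_const (of_real r) * fps_X * g) $ Suc n = 0" using assms(1) by simp
    then have "of_nat n * g $ n + of_real r * g $ n = 0"
      using Suc by (simp add: fps_X_power_mult_nth mult.assoc)
    then have "(of_real (real n + r)) * g $ n = 0" by (simp add: algebra_simps)
    moreover have "real n + r \<noteq> 0" using Suc assms(2) by simp
    ultimately have "g $ n = 0" using of_real_eq_0_iff[of "real n + r"] by (metis mult_eq_0_iff)
    then show ?thesis using Suc by simp
  qed simp
qed

text \<open>The highest nonzero coordinate of \<open>e' j\<close> solves an Euler equation and is
  constant by monotonicity. If its index exceeded \<open>j\<close>, the constant term of the
  equation one index lower would force it to vanish, since \<open>S\<close> has constant term 1. The
  same constant term, taken at the diagonal, shows that consecutive diagonal entries agree.\<close>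

lemma chain_compare:
  assumes c1: "chain M l S e n" and c2: "chain M l S' e' n"
    and r: "\<And>i. i < n \<Longrightarrow> l i = of_real (r i)" and mono: "\<And>i j. i \<le> j \<Longrightarrow> j < n \<Longrightarrow> r i \<le> r j"
  shows "\<exists>k. \<forall>j<n. ab_left.crd M e n (e' j) j = fps_const k \<and> (\<forall>i>j. ab_left.crd M e n (e' j) i = 0)"
proof -
  interpret A: ab_chain M l S e n by (rule ab_chainI[OF c1])
  interpret B: ab_chain M l S' e' n by (rule ab_chainI[OF c2])
  define x where "x j = A.c (e' j)" for j
  have beyond: "x j i = 0" if "i \<ge> n" for i j using A.crd_beyond[OF A.basis that] by (simp add: x_def)
  have eqn: "fps_X^2 * fps_deriv (x j i) + fps_const (of_real (r i - r j)) * fps_X * x j i + S i * x j (Suc i)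
      = (if j = 0 then 0 else S' (j - 1) * x (j - 1) i)" if j: "j < n" and i: "i < n" for i j
  proof -
    have ej: "e' j \<in> carrier M" "e' (j - 1) \<in> carrier M" using B.e_closed j by auto
    have "A.c (lin (l j) \<odot>\<^bsub>M\<^esub> e' j) i = (if j = 0 then 0 else S' (j - 1) * x (j - 1) i)"
      using B.lin_e[OF j] ej A.crd_zero[OF A.basis] A.crd_fs[OF A.basis] by (auto simp: x_def)
    then show ?thesis using A.crd_lin[OF ej(1), of "l j" i] r[OF i] r[OF j] by (simp add: x_def)
  qed
  have main: "(\<forall>i>j. x j i = 0) \<and> x j j = fps_const (x 0 0 $ 0)" if "j < n" for j
    using that
  proof (induction j)
    case 0
    have hi: "x 0 i = 0" if "i > 0" for i
    proof (rule ccontr)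
      assume "x 0 i \<noteq> 0"
      define I where "I = Max {i. i < n \<and> x 0 i \<noteq> 0}"
      have fin: "finite {i. i < n \<and> x 0 i \<noteq> 0}" by simp
      have iI: "i \<in> {i. i < n \<and> x 0 i \<noteq> 0}" using \<open>x 0 i \<noteq> 0\<close> beyond[of i 0] by (cases "i < n") auto
      have II: "I \<in> {i. i < n \<and> x 0 i \<noteq> 0}" unfolding I_def by (rule Max_in[OF fin]) (use iI in blast)
      have I: "I < n" "x 0 I \<noteq> 0" "I \<ge> i" using II Max_ge[OF fin iI] by (auto simp: I_def)
      have SI: "x 0 (Suc I) = 0"
        using Max_ge[OF fin, of "Suc I"] beyond[of "Suc I" 0] unfolding I_def[symmetric]
        by (cases "Suc I < n") auto
      have k: "x 0 I = fps_const (x 0 I $ 0)"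
        using eqn[OF 0 I(1)] SI mono[of 0 I] I by (intro fps_euler_zero[of _ "r I - r 0"]) auto
      obtain I' where I': "I = Suc I'" using I(3) \<open>i > 0\<close> by (cases I) auto
      have "(fps_X^2 * fps_deriv (x 0 I') + fps_const (of_real (r I' - r 0)) * fps_X * x 0 I' + S I' * x 0 (Suc I')) $ 0 = 0"
        using eqn[OF 0, of I'] I(1) I' by simp
      then have "x 0 I $ 0 = 0" using A.S0[of I'] I(1) I' by simp
      then show False using k I(2) by simp
    qed
    have "x 0 0 = fps_const (x 0 0 $ 0)"
      using eqn[OF 0 0] hi[of "Suc 0"] by (intro fps_euler_zero[of _ 0]) auto
    then show ?case using hi by blast
  next
    case (Suc j)
    then have j: "Suc j < n" and IH: "\<And>i. i > j \<Longrightarrow> x j i = 0" "x j j = fps_const (x 0 0 $ 0)" by auto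
    have hi: "x (Suc j) i = 0" if ij: "i > Suc j" for i
    proof (rule ccontr)
      assume "x (Suc j) i \<noteq> 0"
      define I where "I = Max {i. i < n \<and> x (Suc j) i \<noteq> 0}"
      have fin: "finite {i. i < n \<and> x (Suc j) i \<noteq> 0}" by simp
      have iI: "i \<in> {i. i < n \<and> x (Suc j) i \<noteq> 0}" using \<open>x (Suc j) i \<noteq> 0\<close> beyond[of i "Suc j"] by (cases "i < n") auto
      have II: "I \<in> {i. i < n \<and> x (Suc j) i \<noteq> 0}" unfolding I_def by (rule Max_in[OF fin]) (use iI in blast)
      have I: "I < n" "x (Suc j) I \<noteq> 0" "I \<ge> i" using II Max_ge[OF fin iI] by (auto simp: I_def)
      have SI: "x (Suc j) (Suc I) = 0"
        using Max_ge[OF fin, of "Suc I"] beyond[of "Suc I" "Suc j"] unfolding I_def[symmetric]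
        by (cases "Suc I < n") auto
      have k: "x (Suc j) I = fps_const (x (Suc j) I $ 0)"
        using eqn[OF j I(1)] SI mono[of "Suc j" I] I ij IH(1)[of I]
        by (intro fps_euler_zero[of _ "r I - r (Suc j)"]) auto
      obtain I' where I': "I = Suc I'" "I' > j" using I(3) ij by (cases I) auto
      have "(fps_X^2 * fps_deriv (x (Suc j) I') + fps_const (of_real (r I' - r (Suc j))) * fps_X * x (Suc j) I'
          + S I' * x (Suc j) (Suc I')) $ 0 = 0"
        using eqn[OF j, of I'] I(1) I' IH(1)[of I'] by simp
      then have "x (Suc j) I $ 0 = 0" using A.S0[of I'] I(1) I' by simp
      then show False using k I(2) by simp
    qed
    have k: "x (Suc j) (Suc j) = fps_const (x (Suc j) (Suc j) $ 0)"
      using eqn[OF j j] hi[of "Suc (Suc j)"] IH(1)[of "Suc j"] by (intro fps_euler_zero[of _ 0]) auto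
    have "(fps_X^2 * fps_deriv (x (Suc j) j) + fps_const (of_real (r j - r (Suc j))) * fps_X * x (Suc j) j
          + S j * x (Suc j) (Suc j)) $ 0 = (S' j * x j j) $ 0"
      using eqn[OF j, of j] j by simp
    then have "x (Suc j) (Suc j) $ 0 = x 0 0 $ 0" using A.S0[OF j] B.S0[OF j] by (simp add: IH(2))
    then show ?case using k hi by auto
  qed
  then show ?thesis unfolding x_def by blast
qed

text \<open>This is the uniqueness of the principal Jordan-Hoelder sequence, in the monotone case:
  by triangularity each flag contains the other.\<close>

lemma chain_spn_eq:
  assumes c1: "chain M l S e n" and c2: "chain M l S' e' n"
    and r: "\<And>i. i < n \<Longrightarrow> l i = of_real (r i)" and mono: "\<And>i j. i \<le> j \<Longrightarrow> j < n \<Longrightarrow> r i \<le> r j"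
    and m: "m \<le> n"
  shows "spn M e' m = spn M e m"
proof -
  have sub: "spn M e' m \<subseteq> spn M e m" if c1: "chain M l S e n" and c2: "chain M l S' e' n" for S S' e e'
  proof -
    interpret A: ab_chain M l S e n by (rule ab_chainI[OF c1])
    interpret B: ab_chain M l S' e' n by (rule ab_chainI[OF c2])
    obtain k where k: "\<forall>j<n. A.c (e' j) j = fps_const k \<and> (\<forall>i>j. A.c (e' j) i = 0)"
      using chain_compare[OF c1 c2 r mono] by blast
    show ?thesis
    proof (rule A.spn_least[OF A.spn_sub[OF m]])
      fix i assume "i < m"
      then show "e' i \<in> spn M e m"
        using k m B.e_closed[of i] A.spn_crd_iff[OF A.basis m, of "e' i"] by auto
    qed
  qed
  show ?thesis using sub[OF c1 c2] sub[OF c2 c1] by blast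
qed

text \<open>
  Evaluating the homomorphism given by a solution on another chain gives a solution for
  that chain.
\<close>

lemma obstr_chain_indep:
  assumes c1: "chain M l S e n" and c2: "chain M l S' e' n"
    and r: "\<And>i. i < n \<Longrightarrow> l i = of_real (r i)" and mono: "\<And>i j. i \<le> j \<Longrightarrow> j < n \<Longrightarrow> r i \<le> r j"
    and d: "\<And>i. i < n \<Longrightarrow> r i - r 0 = of_int (d i)" and n: "n \<ge> 2"
    and fl: "flat d S n"
  shows "flat d S' n \<and> obstr d S' n = obstr d S n"
proof -
  interpret A: ab_chain M l S e n by (rule ab_chainI[OF c1])
  interpret B: ab_chain M l S' e' n by (rule ab_chainI[OF c2])
  obtain k where k: "\<And>j. j < n \<Longrightarrow> A.c (e' j) j = fps_const k" "\<And>i j. j < n \<Longrightarrow> i > j \<Longrightarrow> A.c (e' j) i = 0"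
    using chain_compare[OF c1 c2 r mono] by blast
  define x where "x j = A.c (e' j)" for j
  have xk: "\<And>j. j < n \<Longrightarrow> x j j = fps_const k" "\<And>i j. j < n \<Longrightarrow> i > j \<Longrightarrow> x j i = 0" using k by (auto simp: x_def)
  have d0: "d 0 = 0" using d[of 0] n by simp
  have dpos: "d j \<ge> 0" if "j < n" for j
  proof -
    have "(0::real) \<le> of_int (d j)" using d[OF that] mono[of 0 j] that by simp
    then show ?thesis by simp
  qed
  have ldiff: "l i - l j = of_int (d i) - of_int (d j)" if "i < n" "j < n" for i j
  proof -
    have "r i - r j = of_int (d i) - of_int (d j)" using d[OF that(1)] d[OF that(2)] by simp
    then have "complex_of_real (r i - r j) = of_real (of_int (d i) - of_int (d j))" by simp
    then show ?thesis using r that by simp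
  qed
  have k0: "k \<noteq> 0"
  proof
    assume "k = 0"
    then have "A.c (e' 0) i = A.c \<zero>\<^bsub>M\<^esub> i" for i
      using k[of 0] n A.crd_zero[OF A.basis, of i] by (cases "i = 0") auto
    then have "e' 0 = \<zero>\<^bsub>M\<^esub>" using A.crd_eq_iff[OF A.basis] B.e_closed[of 0] n by auto
    then show False using A.crd_basis[OF B.basis, of 0 0] A.crd_zero[OF B.basis, of 0] n by simp
  qed
  have eqn: "fps_X^2 * fps_deriv (x j i) + fps_const (of_int (d i) - of_int (d j)) * fps_X * x j i + S i * x j (Suc i)
      = (if j = 0 then 0 else S' (j - 1) * x (j - 1) i)" if j: "j < n" and i: "i < n" for i j
  proof -
    have ej: "e' j \<in> carrier M" "e' (j - 1) \<in> carrier M" using B.e_closed j by auto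
    have "A.c (lin (l j) \<odot>\<^bsub>M\<^esub> e' j) i = (if j = 0 then 0 else S' (j - 1) * x (j - 1) i)"
      using B.lin_e[OF j] ej A.crd_zero[OF A.basis] A.crd_fs[OF A.basis] by (auto simp: x_def)
    then show ?thesis using A.crd_lin[OF ej(1), of "l j" i] by (simp only: x_def ldiff[OF i j])
  qed
  define tr where "tr m y j = (\<Sum>i<m. fps_to_fls (x j i) * y i)" for m j and y :: "nat \<Rightarrow> complex fls"
  have tr_sol: "sol d S' m (tr m y)" if y: "sol d S m y" and m: "m \<le> n" for m y
    unfolding sol_def
  proof (intro allI impI)
    fix j assume j: "j < m"
    have "fls_X * (\<theta> (tr m y j) - fls_const (of_int (d j)) * tr m y j) =
      (\<Sum>i<m. fps_to_fls (fps_X^2 * fps_deriv (x j i) + fps_const (of_int (d i) - of_int (d j)) * fps_X * x j i +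
            S i * x j (Suc i)) * y i)"
      unfolding tr_def using j m xk by (intro eval_lin[OF y, symmetric]) auto
    also have "\<dots> = (\<Sum>i<m. fps_to_fls (if j = 0 then 0 else S' (j - 1) * x (j - 1) i) * y i)"
      using j m by (intro sum.cong refl) (simp only: eqn lessThan_iff)
    also have "\<dots> = (if j = 0 then 0 else fps_to_fls (S' (j - 1)) * tr m y (j - 1))"
      by (simp add: tr_def sum_distrib_left fls_times_fps_to_fls mult.assoc)
    finally show "fls_X * (\<theta> (tr m y j) - fls_const (of_int (d j)) * tr m y j) =
      (if j = 0 then 0 else fps_to_fls (S' (j - 1)) * tr m y (j - 1))" .
  qed
  \<comment> \<open>Terms with index above \<open>j\<close> vanish by triangularity and those below
    \<open>j\<close> because \<open>y\<close> vanishes there; the diagonal contributes the common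
    constant \<open>k\<close>.\<close>
  have tr_low: "tr m y j = fls_const k * y j" if "j < m" "m \<le> n" "\<And>i. i < j \<Longrightarrow> y i = 0" for m y j
  proof -
    have "tr m y j = (\<Sum>i<m. if i = j then fls_const k * y j else 0)"
      unfolding tr_def
    proof (intro sum.cong refl)
      fix i assume "i \<in> {..<m}"
      consider "i < j" | "i = j" | "i > j" by linarith
      then show "fps_to_fls (x j i) * y i = (if i = j then fls_const k * y j else 0)"
        using that xk by cases auto
    qed
    then show ?thesis using that by simp
  qed
  have fl': "flat d S' n"
    unfolding flat_def
  proof (intro conjI allI impI)
    fix i assume i: "1 \<le> i \<and> i < n"
    then obtain \<chi> where \<chi>: "sol d S n \<chi>" "\<forall>j<i. \<chi> j = 0" "\<chi> i \<noteq> 0" using fl unfolding flat_def by blast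
    have "tr n \<chi> i \<noteq> 0" using tr_low[of i n \<chi>] \<chi> i k0 by simp
    moreover have "tr n \<chi> j = 0" if "j < i" for j using tr_low[of j n \<chi>] \<chi> i that by simp
    ultimately show "\<exists>\<chi>. sol d S' n \<chi> \<and> (\<forall>j<i. \<chi> j = 0) \<and> \<chi> i \<noteq> 0" using tr_sol[OF \<chi>(1)] by blast
  next
    obtain \<phi> where \<phi>: "sol d S (n - 1) \<phi>" "\<phi> 0 = 1" by (rule flat_normalized[OF fl d0 n]) blast
    have "tr (n - 1) \<phi> 0 \<noteq> 0" using tr_low[of 0 "n - 1" \<phi>] n k0 \<phi> by simp
    then show "\<exists>\<phi>. sol d S' (n - 1) \<phi> \<and> \<phi> 0 \<noteq> 0" using tr_sol[OF \<phi>(1)] by auto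
  qed
  obtain \<phi> where \<phi>: "sol d S (n - 1) \<phi>" "\<phi> 0 = 1" by (rule flat_normalized[OF fl d0 n]) blast
  define \<psi> where "\<psi> = tr (n - 1) \<phi>"
  have \<psi>: "sol d S' (n - 1) \<psi>" "\<psi> 0 = fls_const k"
    using tr_sol[OF \<phi>(1)] tr_low[of 0 "n - 1" \<phi>] n \<phi> by (auto simp: \<psi>_def)
  have ob': "obstr d S' n = (fps_to_fls (S' (n - 2)) * (fls_const (inverse k) * \<psi> (n - 2))) $$ (d (n - 1) + 1)"
    using \<psi> k0 by (intro obstr_of_sol[OF fl' d0 dpos n sol_scale[OF \<psi>(1)]]) auto
  \<comment> \<open>The solution \<open>\<phi>\<close> is not defined on the last basis vector, so
    the last component of \<open>e' (n - 1)\<close>, which is \<open>k\<close> times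
    \<open>e (n - 1)\<close>, is split off. In the equation below it leaves the term
    \<open>k S (n - 2)\<close>.\<close>
  define x' where "x' i = (if i = n - 1 then 0 else x (n - 1) i)" for i
  define \<Phi> where "\<Phi> = (\<Sum>i<n - 1. fps_to_fls (x' i) * \<phi> i)"
  have eq: "S' (n - 2) * x (n - 2) i = fps_X^2 * fps_deriv (x' i) + fps_const (of_int (d i) - of_int (d (n - 1))) * fps_X * x' i
     + S i * x' (Suc i) + (if i = n - 2 then fps_const k * S (n - 2) else 0)" if i: "i < n - 1" for i
  proof -
    have *: "n - 1 < n" "i < n" "n - 1 \<noteq> 0" "n - 1 - 1 = n - 2" "x' i = x (n - 1) i" using i n by (auto simp: x'_def)
    have "S i * x (n - 1) (Suc i) = S i * x' (Suc i) + (if i = n - 2 then fps_const k * S (n - 2) else 0)"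
    proof (cases "i = n - 2")
      case True
      then have "Suc i = n - 1" using n by simp
      then show ?thesis using True xk(1)[OF *(1)] by (simp add: x'_def mult.commute)
    qed (use i in \<open>auto simp: x'_def\<close>)
    then show ?thesis using eqn[OF *(1,2)] unfolding *(4,5) using *(3) by (simp add: add.assoc)
  qed
  have "fps_to_fls (S' (n - 2)) * \<psi> (n - 2) = (\<Sum>i<n-1. fps_to_fls (S' (n - 2) * x (n - 2) i) * \<phi> i)"
    by (simp add: \<psi>_def tr_def sum_distrib_left fls_times_fps_to_fls mult.assoc)
  also have "\<dots> = (\<Sum>i<n-1. fps_to_fls (fps_X^2 * fps_deriv (x' i) + fps_const (of_int (d i) - of_int (d (n - 1))) * fps_X * x' i
     + S i * x' (Suc i)) * \<phi> i + (if i = n - 2 then fps_to_fls (fps_const k * S (n - 2)) * \<phi> (n - 2) else 0))"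
    by (intro sum.cong refl) (simp only: eq lessThan_iff, simp add: distrib_right)
  also have "\<dots> = fls_X * (\<theta> \<Phi> - fls_const (of_int (d (n - 1))) * \<Phi>) + fps_to_fls (fps_const k * S (n - 2)) * \<phi> (n - 2)"
  proof -
    have "x' i = 0" if "n - 1 \<le> i" for i using that xk(2)[of "n - 1" i] n by (auto simp: x'_def)
    then have "(\<Sum>i<n-1. fps_to_fls (fps_X^2 * fps_deriv (x' i) + fps_const (of_int (d i) - of_int (d (n - 1))) * fps_X * x' i
     + S i * x' (Suc i)) * \<phi> i) = fls_X * (\<theta> \<Phi> - fls_const (of_int (d (n - 1))) * \<Phi>)"
      unfolding \<Phi>_def by (intro eval_lin[OF \<phi>(1)]) auto
    moreover have "n - 2 < n - 1" using n by simp
    ultimately show ?thesis by (simp add: sum.distrib)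
  qed
  finally have *: "fps_to_fls (S' (n - 2)) * \<psi> (n - 2) = fls_X * (\<theta> \<Phi> - fls_const (of_int (d (n - 1))) * \<Phi>) +
     fls_const k * (fps_to_fls (S (n - 2)) * \<phi> (n - 2))" by (simp add: fls_times_fps_to_fls mult.assoc)
  \<comment> \<open>The two obstructing series differ by an image of the Euler operator, which never
    has a coefficient in the resonant degree. So the obstruction is multiplied by \<open>k\<close>,
    exactly as the first entry, and normalization cancels the factor.\<close>
  have "(fls_X * (\<theta> \<Phi> - fls_const (of_int (d (n - 1))) * \<Phi>)) $$ (d (n - 1) + 1) = 0"
    unfolding \<theta>_shift_nth by simp
  then have "(fps_to_fls (S' (n - 2)) * \<psi> (n - 2)) $$ (d (n - 1) + 1) =
      k * (fps_to_fls (S (n - 2)) * \<phi> (n - 2)) $$ (d (n - 1) + 1)"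
    unfolding * by simp
  also have "\<dots> = k * obstr d S n" using obstr_of_sol[OF fl d0 dpos n \<phi>] by simp
  finally have "obstr d S' n = obstr d S n"
    unfolding ob' mult.left_commute[of _ "fls_const (inverse k)"] using k0 by simp
  then show ?thesis using fl' by blast
qed

section \<open>Functionals\<close>

text \<open>A homomorphism into \<open>E\<^sub>\<mu>\<close>, identified with \<open>\<complex>[[b]]\<close>.\<close>

definition functional :: "(atilde, 'm) module \<Rightarrow> complex \<Rightarrow> ('m \<Rightarrow> complex fps) \<Rightarrow> bool" where
  "functional M \<mu> \<chi> \<longleftrightarrow>
     (\<forall>x\<in>carrier M. \<forall>y\<in>carrier M. \<chi> (x \<oplus>\<^bsub>M\<^esub> y) = \<chi> x + \<chi> y) \<and>
     (\<forall>f. \<forall>x\<in>carrier M. \<chi> (of_fps f \<odot>\<^bsub>M\<^esub> x) = f * \<chi> x) \<and>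
     (\<forall>x\<in>carrier M. \<chi> (avar \<odot>\<^bsub>M\<^esub> x) = fps_X^2 * fps_deriv (\<chi> x) + fps_const \<mu> * fps_X * \<chi> x)"

lemma functional_hom:
  assumes "functional N \<mu> \<chi>" "h \<in> lmod_hom M N"
  shows "functional M \<mu> (\<lambda>x. \<chi> (h x))"
  using assms by (auto simp: functional_def lmod_homD[OF assms(2)])

context ab_left
begin

lemma functional_zero: "functional M \<mu> \<chi> \<Longrightarrow> \<chi> \<zero> = 0"
  unfolding functional_def by (metis fs_simps(2) mult_zero_left zero_closed)

lemma functional_comb:
  assumes f: "functional M \<mu> \<chi>" and e: "\<And>i. i < n \<Longrightarrow> e i \<in> carrier M"
  shows "\<chi> (comb M e n g) = (\<Sum>i<n. g i * \<chi> (e i))"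
  using e
proof (induction n)
  case (Suc n)
  then have "comb M e n g \<in> carrier M" "e n \<in> carrier M" by (auto intro!: comb_closed)
  then show ?case using Suc f by (simp add: comb.simps(2) functional_def lsmult_closed)
qed (simp add: functional_zero[OF f])

lemma functional_lin:
  assumes f: "functional M \<mu> \<chi>" and x: "x \<in> carrier M"
  shows "\<chi> (lin \<nu> \<odot> x) = fps_X^2 * fps_deriv (\<chi> x) + fps_const (\<mu> - \<nu>) * fps_X * \<chi> x"
proof -
  have "lin \<nu> = avar + of_fps (- (fps_const \<nu> * fps_X))"
    unfolding lin_alt by simp
  then have "lin \<nu> \<odot> x = avar \<odot> x \<oplus> of_fps (- (fps_const \<nu> * fps_X)) \<odot> x"
    using x by (simp only: lsmult_l_distr)
  then have "\<chi> (lin \<nu> \<odot> x) = \<chi> (avar \<odot> x) + - (fps_const \<nu> * fps_X) * \<chi> x"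
    using f x by (simp only: functional_def lsmult_closed)
  also have "\<dots> = fps_X^2 * fps_deriv (\<chi> x) + (fps_const \<mu> - fps_const \<nu>) * fps_X * \<chi> x"
    using f x by (simp add: functional_def algebra_simps del: fps_const_sub)
  finally show ?thesis by simp
qed

end

section \<open>Regular modules of rank one\<close>

lemma avar_smult_fs:
  assumes "left_module M" "x \<in> carrier M"
  shows "avar \<odot>\<^bsub>M\<^esub> (of_fps g \<odot>\<^bsub>M\<^esub> x) = of_fps g \<odot>\<^bsub>M\<^esub> (avar \<odot>\<^bsub>M\<^esub> x) \<oplus>\<^bsub>M\<^esub> of_fps (fps_X^2 * fps_deriv g) \<odot>\<^bsub>M\<^esub> x"
proof -
  interpret left_module M by fact
  show ?thesis using assms(2) by (simp add: lsmult_assoc[symmetric] avar_mult_of_fps lsmult_l_distr)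
qed

text \<open>If x is divisible by \<open>b^m\<close>, the simple pole makes \<open>a x\<close>
  divisible by \<open>b^(m+1)\<close>; as \<open>f\<close> is a unit, so is x. Then x is divisible
  by all powers of b.\<close>

lemma simple_pole_eigen:
  assumes L: "simple_pole L" and x: "x \<in> carrier L" "avar \<odot>\<^bsub>L\<^esub> x = of_fps f \<odot>\<^bsub>L\<^esub> x" and f: "f $ 0 \<noteq> 0"
  shows "x = \<zero>\<^bsub>L\<^esub>"
proof -
  interpret ab_left L using L by (auto simp: simple_pole_def ab_module_def intro: ab_leftI)
  obtain n where "has_rank L n" using L by (auto simp: simple_pole_def ab_module_def)
  then obtain e where b: "basis e n" by (rule has_rank_basis)
  have X_inj: "y = z" if "y \<in> carrier L" "z \<in> carrier L" "of_fps (fps_X ^ m) \<odot>\<^bsub>L\<^esub> y = of_fps (fps_X ^ m) \<odot>\<^bsub>L\<^esub> z" for y z m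
  proof -
    have "fps_X ^ m * crd e n y i = fps_X ^ m * crd e n z i" for i
      using crd_fs[OF b that(1)] crd_fs[OF b that(2)] that(3) by metis
    then show ?thesis using crd_eq_iff[OF b] that by simp
  qed
  have "\<exists>y\<in>carrier L. x = of_fps (fps_X ^ m) \<odot>\<^bsub>L\<^esub> y" for m
  proof (induction m)
    case 0
    show ?case using x by (intro bexI[of _ x]) (simp_all add: lsmult_one)
  next
    case (Suc m)
    then obtain y where y: "y \<in> carrier L" "x = of_fps (fps_X ^ m) \<odot>\<^bsub>L\<^esub> y" by blast
    obtain z where z: "z \<in> carrier L" "avar \<odot>\<^bsub>L\<^esub> y = of_fps fps_X \<odot>\<^bsub>L\<^esub> z"
      using L y(1) by (force simp: simple_pole_def bE_def bvar_of_fps)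
    have dX: "fps_X^2 * fps_deriv (fps_X ^ m) = fps_X ^ m * (fps_const (of_nat m) * fps_X :: complex fps)"
    proof (cases m)
      case (Suc k)
      then show ?thesis
        by (simp only: fps_deriv_power fps_deriv_fps_X diff_Suc_1)
          (simp only: power_Suc power2_eq_square mult_1_left mult_1_right mult_ac)
    qed simp
    define w where "w = z \<oplus>\<^bsub>L\<^esub> of_fps (fps_const (of_nat m)) \<odot>\<^bsub>L\<^esub> y"
    have w: "w \<in> carrier L" using y z by (simp add: w_def lsmult_closed)
    have "of_fps (fps_X ^ m) \<odot>\<^bsub>L\<^esub> (of_fps fps_X \<odot>\<^bsub>L\<^esub> w) = avar \<odot>\<^bsub>L\<^esub> (of_fps (fps_X ^ m) \<odot>\<^bsub>L\<^esub> y)"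
      using avar_smult_fs[OF left_module_axioms y(1), of "fps_X ^ m"] y(1) z dX
      by (simp add: w_def lsmult_r_distr lsmult_closed fs_mult mult_ac)
    also have "\<dots> = of_fps f \<odot>\<^bsub>L\<^esub> x" unfolding y(2)[symmetric] by (rule x(2))
    also have "\<dots> = of_fps (fps_X ^ m) \<odot>\<^bsub>L\<^esub> (of_fps f \<odot>\<^bsub>L\<^esub> y)"
      unfolding y(2) using y(1) by (simp add: fs_mult mult.commute)
    finally have "of_fps fps_X \<odot>\<^bsub>L\<^esub> w = of_fps f \<odot>\<^bsub>L\<^esub> y"
      using X_inj[of "of_fps fps_X \<odot>\<^bsub>L\<^esub> w" "of_fps f \<odot>\<^bsub>L\<^esub> y" m] w y(1) by (simp add: lsmult_closed)
    then have "of_fps (inverse f) \<odot>\<^bsub>L\<^esub> (of_fps fps_X \<odot>\<^bsub>L\<^esub> w) = of_fps (inverse f) \<odot>\<^bsub>L\<^esub> (of_fps f \<odot>\<^bsub>L\<^esub> y)" by simp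
    then have yw: "y = of_fps (fps_X * inverse f) \<odot>\<^bsub>L\<^esub> w"
      using y(1) w f by (simp add: fs_mult inverse_mult_eq_1' lsmult_one mult.commute)
    have "x = of_fps (fps_X ^ Suc m) \<odot>\<^bsub>L\<^esub> (of_fps (inverse f) \<odot>\<^bsub>L\<^esub> w)"
      unfolding y(2) by (subst yw) (use w in \<open>simp add: fs_mult mult_ac\<close>)
    then show ?case using w lsmult_closed by blast
  qed
  then have "crd e n x i $ k = 0" for i k
  proof -
    obtain y where "y \<in> carrier L" "x = of_fps (fps_X ^ Suc k) \<odot>\<^bsub>L\<^esub> y"
      using \<open>\<And>m. \<exists>y\<in>carrier L. x = of_fps (fps_X ^ m) \<odot>\<^bsub>L\<^esub> y\<close> by blast
    then have "crd e n x i = fps_X ^ Suc k * crd e n y i" using crd_fs[OF b] by simp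
    then show ?thesis by (simp only: fps_X_power_mult_nth) simp
  qed
  then have "crd e n x i = 0" for i by (simp add: fps_eq_iff)
  then show ?thesis using crd_eq_iff[OF b x(1) zero_closed] crd_zero[OF b] by simp
qed

text \<open>On a generator a acts by a series \<open>f\<close>. Regularity excludes a constant term
  of \<open>f\<close> through \<open>simple_pole_eigen\<close>, the linear coefficient is the
  exponent \<open>\<mu>\<close>, and the higher terms are removed by rescaling the
  generator.\<close>

lemma regular_rank_one_functional:
  fixes R :: "(atilde, 'm) module"
  assumes reg: "regular R" and rk: "has_rank R 1"
  shows "\<exists>\<mu> \<rho>. functional R \<mu> \<rho> \<and> (\<forall>x\<in>carrier R. \<rho> x = 0 \<longrightarrow> x = \<zero>\<^bsub>R\<^esub>)"
proof -
  interpret ab_left R using reg by (auto simp: regular_def ab_module_def intro: ab_leftI)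
  obtain e where b: "basis e 1" using rk by (rule has_rank_basis)
  define e0 where "e0 = e 0"
  have e0: "e0 \<in> carrier R" using basis_closed[OF b] by (simp add: e0_def)
  define c where "c x = crd e 1 x 0" for x
  have cx: "x = of_fps (c x) \<odot>\<^bsub>R\<^esub> e0" if "x \<in> carrier R" for x
    using comb_crd[OF b that] e0 by (simp add: c_def e0_def lsmult_closed comb.simps(2))
  have cadd: "c (x \<oplus>\<^bsub>R\<^esub> y) = c x + c y" if "x \<in> carrier R" "y \<in> carrier R" for x y
    using crd_add[OF b that] by (simp add: c_def)
  have cfs: "c (of_fps f \<odot>\<^bsub>R\<^esub> x) = f * c x" if "x \<in> carrier R" for f x
    using crd_fs[OF b that] by (simp add: c_def)
  have ce0: "c e0 = 1" using crd_basis[OF b, of 0 0] by (simp add: c_def e0_def)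
  define f where "f = c (avar \<odot>\<^bsub>R\<^esub> e0)"
  have f: "avar \<odot>\<^bsub>R\<^esub> e0 = of_fps f \<odot>\<^bsub>R\<^esub> e0" using cx[of "avar \<odot>\<^bsub>R\<^esub> e0"] e0 by (simp add: f_def lsmult_closed)
  obtain L :: "(atilde, ab_univ) module" and \<phi> where L: "simple_pole L" "embeds \<phi> R L"
    using reg by (auto simp: regular_def)
  have lmL: "left_module L" using L by (auto simp: simple_pole_def ab_module_def)
  interpret P: lmod_pair R L \<phi> using L lmL by (intro lmod_pairI) (auto simp: embeds_def intro: left_module_axioms)
  have f0: "f $ 0 = 0"
  proof (rule ccontr)
    assume "f $ 0 \<noteq> 0"
    moreover have "avar \<odot>\<^bsub>L\<^esub> \<phi> e0 = of_fps f \<odot>\<^bsub>L\<^esub> \<phi> e0"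
      using P.hD(3)[OF e0, of avar] P.hD(3)[OF e0, of "of_fps f"] f by simp
    ultimately have "\<phi> e0 = \<zero>\<^bsub>L\<^esub>" using simple_pole_eigen[OF L(1)] P.hD(1)[OF e0] by blast
    then have "e0 = \<zero>\<^bsub>R\<^esub>" using L(2) P.hom_inj_iff e0 by (auto simp: embeds_def)
    then show False using ce0 crd_zero[OF b, of 0] by (simp add: c_def)
  qed
  define \<mu> where "\<mu> = f $ 1"
  define f2 where "f2 = fps_shift 2 f"
  have ff: "f = fps_const \<mu> * fps_X + fps_X^2 * f2"
  proof (rule fps_ext)
    fix n show "f $ n = (fps_const \<mu> * fps_X + fps_X\<^sup>2 * f2) $ n"
      using f0 le_add_diff_inverse2[of 2 n] by (cases "n < 2") (auto simp: less_2_cases_iff \<mu>_def f2_def fps_X_power_mult_nth)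
  qed
  \<comment> \<open>The unit with \<open>v' = f2 v\<close>: it absorbs the part of \<open>f\<close>
    divisible by \<open>b^2\<close>, because a differentiates coefficients by
    \<open>b^2 d/db\<close>.\<close>
  define v where "v = fps_exp 1 oo fps_integral0 f2"
  have v0: "v $ 0 = 1" by (simp add: v_def)
  have dv: "fps_deriv v = f2 * v"
    by (simp add: v_def fps_compose_deriv fps_deriv_fps_integral mult.commute)
  define \<rho> where "\<rho> x = c x * v" for x
  have "functional R \<mu> \<rho>"
    unfolding functional_def
  proof (intro conjI ballI allI)
    fix x assume x: "x \<in> carrier R"
    have "avar \<odot>\<^bsub>R\<^esub> x = avar \<odot>\<^bsub>R\<^esub> (of_fps (c x) \<odot>\<^bsub>R\<^esub> e0)" using cx[OF x] by simp
    also have "\<dots> = of_fps (c x) \<odot>\<^bsub>R\<^esub> (of_fps f \<odot>\<^bsub>R\<^esub> e0) \<oplus>\<^bsub>R\<^esub> of_fps (fps_X^2 * fps_deriv (c x)) \<odot>\<^bsub>R\<^esub> e0"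
      using avar_smult_fs[OF left_module_axioms e0] f by simp
    finally have "c (avar \<odot>\<^bsub>R\<^esub> x) = c x * f + fps_X^2 * fps_deriv (c x)"
      using e0 by (simp add: cadd cfs ce0 lsmult_closed)
    then show "\<rho> (avar \<odot>\<^bsub>R\<^esub> x) = fps_X\<^sup>2 * fps_deriv (\<rho> x) + fps_const \<mu> * fps_X * \<rho> x"
      by (simp add: \<rho>_def dv ff algebra_simps)
  qed (simp_all add: \<rho>_def cadd cfs algebra_simps)
  moreover have "x = \<zero>\<^bsub>R\<^esub>" if "x \<in> carrier R" "\<rho> x = 0" for x
  proof -
    have "v \<noteq> 0" using v0 by auto
    then show ?thesis using that cx[OF that(1)] e0 by (simp add: \<rho>_def)
  qed
  ultimately show ?thesis by blast
qed

text \<open>A nonzero element has a nonzero component in some rank one summand, and there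
  \<open>regular_rank_one_functional\<close> detects it.\<close>

lemma semi_simple_separates:
  fixes M :: "(atilde, 'm) module"
  assumes ss: "semi_simple M" and M: "left_module M" and x: "x \<in> carrier M" "x \<noteq> \<zero>\<^bsub>M\<^esub>"
  obtains \<mu> \<chi> where "functional M \<mu> \<chi>" "\<chi> x \<noteq> 0"
proof -
  obtain n and R :: "nat \<Rightarrow> (atilde, ab_univ) module" and N where
    R: "\<And>i. i < n \<Longrightarrow> regular (R i)" "\<And>i. i < n \<Longrightarrow> has_rank (R i) 1" and
    N: "left_submodule N (direct_sum n R)" and iso: "lmod_iso M (sub_mod (direct_sum n R) N)"
    using ss unfolding semi_simple_def by blast
  have lmR: "left_module (R i)" if "i < n" for i using R(1)[OF that] by (auto simp: regular_def ab_module_def)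
  have D: "left_module (direct_sum n R)" by (rule direct_sum_left_module[OF lmR])
  obtain h where h: "h \<in> lmod_hom M (sub_mod (direct_sum n R) N)"
    and bij: "bij_betw h (carrier M) (carrier (sub_mod (direct_sum n R) N))"
    using iso by (rule lmod_isoE)
  interpret H: lmod_pair M "sub_mod (direct_sum n R) N" h
    by (rule lmod_pairI[OF M left_module.sub_mod_left_module[OF D N] h])
  have hx: "h x \<in> N" "h x \<noteq> \<zero>\<^bsub>direct_sum n R\<^esub>"
    using H.hD(1)[OF x(1)] bij H.hom_inj_iff x by (auto simp: bij_betw_def)
  have Nsub: "N \<subseteq> (\<Pi>\<^sub>E i\<in>{..<n}. carrier (R i))" using left_submoduleD(1)[OF N] by (simp add: direct_sum_def)
  have "\<exists>i<n. h x i \<noteq> \<zero>\<^bsub>R i\<^esub>"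
  proof (rule ccontr)
    assume "\<not> (\<exists>i<n. h x i \<noteq> \<zero>\<^bsub>R i\<^esub>)"
    then have "h x = (\<lambda>i\<in>{..<n}. \<zero>\<^bsub>R i\<^esub>)"
      using hx(1) Nsub by (intro ext) (auto simp: PiE_iff extensional_def subset_iff)
    then show False using hx(2) by (simp add: direct_sum_def)
  qed
  then obtain i where i: "i < n" "h x i \<noteq> \<zero>\<^bsub>R i\<^esub>" by blast
  obtain \<mu> \<rho> where \<rho>: "functional (R i) \<mu> \<rho>" "\<And>y. y \<in> carrier (R i) \<Longrightarrow> \<rho> y = 0 \<Longrightarrow> y = \<zero>\<^bsub>R i\<^esub>"
    using regular_rank_one_functional[OF R(1,2)[OF i(1)]] by blast
  have hc: "h y \<in> N" if "y \<in> carrier M" for y using H.hD(1)[OF that] by simp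
  then have hci: "h y i \<in> carrier (R i)" if "y \<in> carrier M" for y using Nsub i that by blast
  have "(\<lambda>y. h y i) \<in> lmod_hom M (R i)"
    unfolding lmod_hom_def using hci H.hD i(1) by (auto simp: direct_sum_def)
  then have "functional M \<mu> (\<lambda>y. \<rho> (h y i))" by (rule functional_hom[OF \<rho>(1)])
  moreover have "\<rho> (h x i) \<noteq> 0" using \<rho>(2) hci[OF x(1)] i(2) by blast
  ultimately show thesis by (rule that)
qed

section \<open>From functionals to solutions\<close>

text \<open>The exponents differ by integers, so all homomorphisms can be normalized to Laurent
  series once b to the power \<open>l 0\<close> is factored out.\<close>

locale real_chain = ab_chain M l S e n for M :: "(atilde, 'm) module" (structure) and l S e n +
  fixes d :: "nat \<Rightarrow> int"
  assumes l: "i < n \<Longrightarrow> l i = l 0 + of_int (d i)"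
begin

lemma functional_eqn:
  assumes f: "functional M \<mu> \<chi>" and j: "j < n"
  shows "fps_X^2 * fps_deriv (\<chi> (e j)) + fps_const (\<mu> - l j) * fps_X * \<chi> (e j) =
    (if j = 0 then 0 else S (j - 1) * \<chi> (e (j - 1)))"
proof -
  have "\<chi> (lin (l j) \<odot> e j) = (if j = 0 then 0 else S (j - 1) * \<chi> (e (j - 1)))"
    using lin_e[OF j] functional_zero[OF f] f e_closed[of "j - 1"] j by (auto simp: functional_def)
  then show ?thesis using functional_lin[OF f e_closed[OF j], of "l j"] by simp
qed

text \<open>The equation of the first nonzero value, read at its lowest coefficient, shows that
  \<open>\<mu>\<close> differs from \<open>l 0\<close> by an integer \<open>m\<close>.
  Multiplication by b to the power \<open>m\<close> then shifts the exponents to those of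
  \<open>sol\<close>.\<close>

lemma functional_sol:
  assumes f: "functional M \<mu> \<chi>" and nz: "\<exists>j<n. \<chi> (e j) \<noteq> 0"
  obtains m where "sol d S n (\<lambda>j. fls_X_intpow m * fps_to_fls (\<chi> (e j)))"
proof -
  define j where "j = (LEAST j. j < n \<and> \<chi> (e j) \<noteq> 0)"
  have j: "j < n" "\<chi> (e j) \<noteq> 0" using LeastI_ex[OF nz] by (auto simp: j_def)
  have lt: "\<chi> (e i) = 0" if "i < j" for i using not_less_Least[of i "\<lambda>j. j < n \<and> \<chi> (e j) \<noteq> 0"] that j by (auto simp: j_def[symmetric])
  define k where "k = subdegree (\<chi> (e j))"
  have k: "\<chi> (e j) $ k \<noteq> 0" using j(2) by (simp add: k_def)
  have "fps_X^2 * fps_deriv (\<chi> (e j)) + fps_const (\<mu> - l j) * fps_X * \<chi> (e j) = 0"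
    using functional_eqn[OF f j(1)] lt[of "j - 1"] by (auto split: if_splits)
  then have "(fps_X^2 * fps_deriv (\<chi> (e j)) + fps_const (\<mu> - l j) * fps_X * \<chi> (e j)) $ Suc k = 0" by simp
  then have "of_nat k * \<chi> (e j) $ k + (\<mu> - l j) * \<chi> (e j) $ k = 0"
    by (cases k) (simp_all add: fps_X_power_mult_nth mult.assoc)
  then have "(of_nat k + \<mu> - l j) * \<chi> (e j) $ k = 0" by (simp add: algebra_simps)
  then have "of_nat k + \<mu> - l j = 0" using k by (metis mult_eq_0_iff)
  then have "\<mu> = l j - of_nat k" by (simp add: algebra_simps)
  then have \<mu>: "\<mu> = l 0 + of_int (d j - int k)" using l[OF j(1)] by simp
  define m where "m = d j - int k"
  have "sol d S n (\<lambda>j. fls_X_intpow m * fps_to_fls (\<chi> (e j)))"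
    unfolding sol_def
  proof (intro allI impI)
    fix i assume i: "i < n"
    let ?y = "fps_to_fls (\<chi> (e i))"
    have \<theta>m: "\<theta> (fls_X_intpow m) = fls_const (of_int m) * (fls_X_intpow m :: complex fls)"
      by (rule fls_eqI) (auto simp: fls_X_mult_nth)
    have c: "\<mu> - l i = of_int m - of_int (d i)" using l[OF i] by (simp add: \<mu> m_def)
    have "fls_X * (\<theta> (fls_X_intpow m * ?y) - fls_const (of_int (d i)) * (fls_X_intpow m * ?y)) =
      fls_X_intpow m * (fls_X * \<theta> ?y + (fls_const (of_int m) - fls_const (of_int (d i))) * (fls_X * ?y))"
      unfolding \<theta>_mult \<theta>m by (simp only: algebra_simps)
    also have "fls_X * \<theta> ?y + (fls_const (of_int m) - fls_const (of_int (d i))) * (fls_X * ?y) =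
      fps_to_fls (fps_X^2 * fps_deriv (\<chi> (e i)) + fps_const (\<mu> - l i) * fps_X * \<chi> (e i))"
      unfolding \<theta>_fps c by (simp add: fls_times_fps_to_fls mult.assoc fls_minus_const)
    also have "\<dots> = (if i = 0 then 0 else fps_to_fls (S (i - 1)) * fps_to_fls (\<chi> (e (i - 1))))"
      unfolding functional_eqn[OF f i] by (simp add: fls_times_fps_to_fls)
    finally show "fls_X * (\<theta> (fls_X_intpow m * ?y) - fls_const (of_int (d i)) * (fls_X_intpow m * ?y)) =
      (if i = 0 then 0 else fps_to_fls (S (i - 1)) * (fls_X_intpow m * fps_to_fls (\<chi> (e (i - 1)))))"
      by (auto simp: mult_ac)
  qed
  then show thesis by (rule that)
qed

lemma functional_eval:
  fixes g :: "nat \<Rightarrow> complex fps"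
  assumes f: "functional M \<mu> \<chi>"
  shows "(\<Sum>j<n. fps_to_fls (g j) * (fls_X_intpow m * fps_to_fls (\<chi> (e j)))) =
      fls_X_intpow m * fps_to_fls (\<chi> (comb M e n g))"
proof -
  have s: "fps_to_fls (sum h A) = (\<Sum>i\<in>A. fps_to_fls (h i))" for h :: "nat \<Rightarrow> complex fps" and A
    by (induction A rule: infinite_finite_induct) auto
  show ?thesis
    using functional_comb[OF f, of n e g] e_closed
    by (simp only: s sum_distrib_left fls_times_fps_to_fls mult_ac) 
qed

lemma separatedI:
  assumes "\<And>x. x \<in> carrier M \<Longrightarrow> x \<notin> spn M e i \<Longrightarrow>
    \<exists>\<mu> \<chi>. functional M \<mu> \<chi> \<and> \<chi> x \<noteq> 0 \<and> (\<forall>j<i. \<chi> (e j) = 0)" "i \<le> n"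
  shows "separated d S n i"
  unfolding separated_def
proof (intro allI impI)
  fix g :: "nat \<Rightarrow> complex fps" assume "\<exists>j. i \<le> j \<and> j < n \<and> g j \<noteq> 0"
  then obtain j where j: "i \<le> j" "j < n" "g j \<noteq> 0" by blast
  define x where "x = comb M e n g"
  have x: "x \<in> carrier M" unfolding x_def using e_closed by (rule comb_closed)
  have "c x j = g j" using crd_unique[OF basis x_def j(2)] .
  then have "x \<notin> spn M e i" using spn_crd_iff[OF basis assms(2) x] j by auto
  then obtain \<mu> \<chi> where \<chi>: "functional M \<mu> \<chi>" "\<chi> x \<noteq> 0" "\<forall>j<i. \<chi> (e j) = 0" using assms(1) x by blast
  have "\<exists>j<n. \<chi> (e j) \<noteq> 0"
  proof (rule ccontr)
    assume "\<not> (\<exists>j<n. \<chi> (e j) \<noteq> 0)"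
    then have "\<chi> x = 0" unfolding x_def using functional_comb[OF \<chi>(1), of n e g] e_closed by simp
    then show False using \<chi>(2) by simp
  qed
  then obtain m where "sol d S n (\<lambda>j. fls_X_intpow m * fps_to_fls (\<chi> (e j)))"
    by (rule functional_sol[OF \<chi>(1)])
  moreover have "fls_X_intpow m * fps_to_fls (\<chi> x) \<noteq> 0" using \<chi>(2) by simp
  ultimately show "\<exists>y. sol d S n y \<and> (\<forall>j<i. y j = 0) \<and> (\<Sum>j<n. fps_to_fls (g j) * y j) \<noteq> 0"
    using \<chi>(3) functional_eval[OF \<chi>(1), of g m] unfolding x_def by (intro exI conjI) auto
qed

lemma semi_simple_separated:
  assumes "semi_simple M"
  shows "separated d S n 0"
proof (rule separatedI)
  fix x assume x: "x \<in> carrier M" "x \<notin> spn M e 0"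
  then have "x \<noteq> \<zero>" by auto
  then obtain \<mu> \<chi> where "functional M \<mu> \<chi>" "\<chi> x \<noteq> 0"
    by (rule semi_simple_separates[OF assms left_module_axioms x(1)]) blast
  then show "\<exists>\<mu> \<chi>. functional M \<mu> \<chi> \<and> \<chi> x \<noteq> 0 \<and> (\<forall>j<0. \<chi> (e j) = 0)" by auto
qed simp

lemma quotient_separated:
  assumes ss: "semi_simple (quot_mod M (spn M e i))" and i: "i \<le> n"
  shows "separated d S n i"
proof (rule separatedI[OF _ i])
  interpret Q: left_quotient M "spn M e i" by (rule left_quotientI[OF left_module_axioms spn_sub[OF i]])
  interpret QQ: ab_left "quot_mod M (spn M e i)" by (rule ab_leftI[OF Q.quot_left_module])
  fix x assume x: "x \<in> carrier M" "x \<notin> spn M e i"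
  have "Q.cls x \<in> carrier (quot_mod M (spn M e i))" using x by (simp add: Q.quot_carrier)
  moreover have "Q.cls x \<noteq> \<zero>\<^bsub>quot_mod M (spn M e i)\<^esub>" using Q.cls_eq_zero_iff x by (auto simp: Q.quot_zero)
  ultimately obtain \<mu> \<chi> where \<chi>: "functional (quot_mod M (spn M e i)) \<mu> \<chi>" "\<chi> (Q.cls x) \<noteq> 0"
    by (rule semi_simple_separates[OF ss Q.quot_left_module]) blast
  have "functional M \<mu> (\<lambda>x. \<chi> (Q.cls x))" by (rule functional_hom[OF \<chi>(1) Q.cls_hom])
  moreover have "\<chi> (Q.cls (e j)) = 0" if "j < i" for j
  proof -
    have "e j \<in> spn M e i" using that i e_closed by (intro spn_basis) auto
    then have "Q.cls (e j) = spn M e i" using Q.cls_eq_zero_iff e_closed[of j] that i by auto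
    then show ?thesis using QQ.functional_zero[OF \<chi>(1)] by (simp add: Q.quot_zero)
  qed
  ultimately show "\<exists>\<mu> \<chi>. functional M \<mu> \<chi> \<and> \<chi> x \<noteq> 0 \<and> (\<forall>j<i. \<chi> (e j) = 0)" using \<chi>(2) by blast
qed

lemma sub_chain:
  assumes "m \<le> n"
  shows "chain (sub_mod M (spn M e m)) l S e m"
proof -
  interpret T: ab_left "sub_mod M (spn M e m)" by (rule ab_leftI[OF sub_mod_left_module[OF spn_sub[OF assms]]])
  have "T.basis e m"
    unfolding T.basis_def
  proof (intro conjI allI impI)
    show "e i \<in> carrier (sub_mod M (spn M e m))" if "i < m" for i
      using that assms e_closed spn_basis[of i m e] by auto
    show "indep (sub_mod M (spn M e m)) e m"
      unfolding indep_def comb_sub_mod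
    proof (intro allI impI)
      fix g i assume z: "comb M e m g = \<zero>\<^bsub>sub_mod M (spn M e m)\<^esub>" and i: "i < m"
      have "comb M e m g = comb M e m (\<lambda>i. if i < m then g i else 0)" by (rule comb_cong) auto
      also have "\<dots> = comb M e n (\<lambda>i. if i < m then g i else 0)"
        using assms e_closed by (intro comb_le[symmetric]) auto
      finally have z': "comb M e n (\<lambda>i. if i < m then g i else 0) = \<zero>" using z by simp
      have "indep M e n" using basis by (simp add: basis_def)
      from this[unfolded indep_def, rule_format, OF z', of i]
      have "(if i < m then g i else 0) = 0" using i assms by simp
      then show "g i = 0" using i by simp
    qed
  qed (simp add: comb_sub_mod)
  then show ?thesis
    using assms lin_e S0 by (auto simp: chain_def intro: T.left_module_axioms)
qed

lemma flat_of_semi_simple: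
  assumes n: "n \<ge> 2" and s1: "semi_simple (sub_mod M (spn M e (n - 1)))" and s2: "semi_simple (quot_mod M (spn M e 1))"
  shows "flat d S n"
proof -
  have ch: "chain (sub_mod M (spn M e (n - 1))) l S e (n - 1)" by (rule sub_chain) simp
  interpret T: real_chain "sub_mod M (spn M e (n - 1))" l S e "n - 1" d
    by (intro real_chain.intro ab_chainI ch real_chain_axioms.intro l) linarith
  have "0 < n - 1" using n by simp
  then obtain \<phi> where "sol d S (n - 1) \<phi>" "\<phi> 0 \<noteq> 0"
    by (rule separated_sol[OF T.semi_simple_separated[OF s1]]) blast
  then show ?thesis using quotient_separated[OF s2] n by (intro flatI) auto
qed

end

section \<open>Embedding into a sum of rank one modules\<close>

text \<open>The remainder identifies the quotient by the left ideal of \<open>lin \<mu>\<close> with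
  the power series; in this model a acts by \<open>lin_rem_lin\<close>.\<close>

definition lin_rem :: "complex \<Rightarrow> atilde \<Rightarrow> complex fps" where
  "lin_rem \<mu> r = (THE g. \<exists>q. r = q * lin \<mu> + of_fps g)"

lemma lin_rem_eq [simp]: "lin_rem \<mu> (q * lin \<mu> + of_fps g) = g"
  unfolding lin_rem_def by (rule the_equality) (auto dest: right_division_unique)

lemma lin_rem_of_fps [simp]: "lin_rem \<mu> (of_fps g) = g"
  using lin_rem_eq[of \<mu> 0 g] by simp

lemma lin_rem_add: "lin_rem \<mu> (r + s) = lin_rem \<mu> r + lin_rem \<mu> s"
proof -
  obtain q g q' g' where "r = q * lin \<mu> + of_fps g" "s = q' * lin \<mu> + of_fps g'"
    using right_division[of r \<mu>] right_division[of s \<mu>] by blast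
  moreover from this have "r + s = (q + q') * lin \<mu> + of_fps (g + g')" by (simp add: algebra_simps)
  ultimately show ?thesis by (metis lin_rem_eq)
qed

lemma lin_rem_mult: "lin_rem \<mu> (r * of_fps (lin_rem \<mu> s)) = lin_rem \<mu> (r * s)"
proof -
  obtain q g where s: "s = q * lin \<mu> + of_fps g" using right_division by blast
  obtain q' g' where "r * of_fps g = q' * lin \<mu> + of_fps g'" using right_division by blast
  moreover from this have "r * s = (r * q + q') * lin \<mu> + of_fps g'" by (simp add: s algebra_simps)
  ultimately show ?thesis by (metis lin_rem_eq s)
qed

lemma lin_rem_lin: "lin_rem \<mu> (lin \<nu> * of_fps g) = fps_X^2 * fps_deriv g + fps_const (\<mu> - \<nu>) * fps_X * g"
  unfolding lin_mult_of_fps[of \<nu> g \<mu>] by (rule lin_rem_eq)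

text \<open>The rank one module \<open>E_rank1 \<mu>\<close> rebuilt on constant sequences of power
  series, because \<open>regular\<close> and \<open>semi_simple\<close> quantify over modules with
  elements of type \<open>ab_univ\<close>.\<close>

definition E_mod :: "complex \<Rightarrow> (atilde, ab_univ) module" where
  "E_mod \<mu> = \<lparr>carrier = range (\<lambda>g _. g), mult = undefined, one = undefined,
     zero = (\<lambda>_. 0), add = (\<lambda>x y i. x i + y i), smult = (\<lambda>r x _. lin_rem \<mu> (r * of_fps (x 0)))\<rparr>"

lemma E_mod_simps [simp]:
  "carrier (E_mod \<mu>) = range (\<lambda>g _. g)" "\<zero>\<^bsub>E_mod \<mu>\<^esub> = (\<lambda>_. 0)"
  "x \<oplus>\<^bsub>E_mod \<mu>\<^esub> y = (\<lambda>i. x i + y i)" "r \<odot>\<^bsub>E_mod \<mu>\<^esub> x = (\<lambda>_. lin_rem \<mu> (r * of_fps (x 0)))"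
  by (simp_all add: E_mod_def)

lemma E_mod_left_module: "left_module (E_mod \<mu>)"
proof (rule left_moduleI)
  show "\<zero>\<^bsub>E_mod \<mu>\<^esub> \<in> carrier (E_mod \<mu>)" by auto
  show "(r * s) \<odot>\<^bsub>E_mod \<mu>\<^esub> x = r \<odot>\<^bsub>E_mod \<mu>\<^esub> (s \<odot>\<^bsub>E_mod \<mu>\<^esub> x)" for r s x
    by (simp add: lin_rem_mult mult.assoc)
  show "0 \<odot>\<^bsub>E_mod \<mu>\<^esub> x = \<zero>\<^bsub>E_mod \<mu>\<^esub>" for x using lin_rem_of_fps[of \<mu> 0] by simp
qed (auto simp: add_ac distrib_left distrib_right lin_rem_add)

lemma E_mod_basis: "ab_left.basis (E_mod \<mu>) (\<lambda>_ _. 1) 1"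
proof -
  interpret ab_left "E_mod \<mu>" by (rule ab_leftI[OF E_mod_left_module])
  have "comb (E_mod \<mu>) (\<lambda>_ _. 1) 1 g = (\<lambda>_. g 0)" for g
    by (simp add: comb.simps(2))
  then show ?thesis by (auto simp: basis_def indep_def fun_eq_iff image_iff intro: exI[of _ "\<lambda>_. _"])
qed

lemma E_mod_regular: "regular (E_mod \<mu>)" "has_rank (E_mod \<mu>) 1"
proof -
  interpret ab_left "E_mod \<mu>" by (rule ab_leftI[OF E_mod_left_module])
  show rk: "has_rank (E_mod \<mu>) 1" by (rule basis_has_rank[OF E_mod_basis])
  then have ab: "ab_module (E_mod \<mu>)" using E_mod_left_module by (auto simp: ab_module_def)
  have a: "lin_rem \<mu> (avar * of_fps g) = lin_rem \<mu> (bvar * of_fps (fps_X * fps_deriv g + fps_const \<mu> * g))" for g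
  proof -
    have "lin_rem \<mu> (avar * of_fps g) = fps_X^2 * fps_deriv g + fps_const \<mu> * fps_X * g"
      using lin_rem_lin[of \<mu> 0 g] by (simp add: lin_alt)
    then show ?thesis by (simp add: bvar_of_fps of_fps_mult[symmetric] algebra_simps power2_eq_square
        del: of_fps_simps)
  qed
  have "simple_pole (E_mod \<mu>)"
    unfolding simple_pole_def bE_def
  proof (intro conjI ab image_subsetI)
    fix x assume "x \<in> carrier (E_mod \<mu>)"
    then obtain g where "x = (\<lambda>_. g)" by auto
    then have "avar \<odot>\<^bsub>E_mod \<mu>\<^esub> x = bvar \<odot>\<^bsub>E_mod \<mu>\<^esub> (\<lambda>_. fps_X * fps_deriv g + fps_const \<mu> * g)"
      using a by (simp del: of_fps_simps)
    then show "avar \<odot>\<^bsub>E_mod \<mu>\<^esub> x \<in> (\<odot>\<^bsub>E_mod \<mu>\<^esub>) bvar ` carrier (E_mod \<mu>)" by (simp del: E_mod_simps(4))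
  qed
  moreover have "embeds (\<lambda>x. x) (E_mod \<mu>) (E_mod \<mu>)" by (auto simp: embeds_def lmod_hom_def simp del: E_mod_simps)
  ultimately show "regular (E_mod \<mu>)" using ab unfolding regular_def by blast
qed

context real_chain
begin

text \<open>One solution starting at each index gives a triangular system of functionals. After
  clearing poles they all take values in the same rank one module, so together they embed M into a
  direct sum of copies of it.\<close>

lemma semi_simpleI:
  assumes reg: "regular M" and sols: "\<And>i. i < n \<Longrightarrow> \<exists>y. sol d S n y \<and> (\<forall>j<i. y j = 0) \<and> y i \<noteq> 0"
  shows "semi_simple M"
proof -
  obtain Y where Y: "\<And>i. i < n \<Longrightarrow> sol d S n (Y i)" "\<And>i j. i < n \<Longrightarrow> j < i \<Longrightarrow> Y i j = 0" "\<And>i. i < n \<Longrightarrow> Y i i \<noteq> 0"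
    using sols by metis
  \<comment> \<open>A crude common bound for all pole orders; multiplying by b to the power
    \<open>K\<close> lowers the exponent from \<open>l 0\<close> to \<open>l 0 - K\<close>, which is
    \<open>\<mu>\<close> below.\<close>
  define K where "K = (\<Sum>i<n. \<Sum>j<n. nat (- fls_subdegree (Y i j)))"
  have K: "- int K \<le> fls_subdegree (Y i j)" if "i < n" "j < n" for i j
  proof -
    have "nat (- fls_subdegree (Y i j)) \<le> (\<Sum>j<n. nat (- fls_subdegree (Y i j)))"
      using that by (intro member_le_sum) auto
    also have "\<dots> \<le> K" unfolding K_def
      using that by (intro member_le_sum[of _ _ "\<lambda>i. \<Sum>j<n. nat (- fls_subdegree (Y i j))"]) auto
    finally show ?thesis by linarith
  qed
  define z where "z i j = fls_regpart (fls_X_intpow (int K) * Y i j)" for i j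
  have z: "fps_to_fls (z i j) = fls_X_intpow (int K) * Y i j" if "i < n" "j < n" for i j
    unfolding z_def
  proof (rule fls_regpart_to_fls_trivial)
    show "0 \<le> fls_subdegree (fls_X_intpow (int K) * Y i j)"
      using K[OF that] by (cases "Y i j = 0") (auto simp: fls_X_intpow_times_conv_shift)
  qed
  define \<mu> where "\<mu> = l 0 - of_nat K"
  have zeq: "fps_X^2 * fps_deriv (z i j) + fps_const (\<mu> - l j) * fps_X * z i j =
     (if j = 0 then 0 else S (j - 1) * z i (j - 1))" if i: "i < n" and j: "j < n" for i j
  proof -
    have \<theta>m: "\<theta> (fls_X_intpow (int K)) = fls_const (of_int (int K)) * (fls_X_intpow (int K) :: complex fls)"
      by (rule fls_eqI) (auto simp: fls_X_mult_nth)
    have c: "\<mu> - l j = - of_int (int K) - of_int (d j)" using l[OF j] by (simp add: \<mu>_def)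
    have "fps_to_fls (fps_X^2 * fps_deriv (z i j) + fps_const (\<mu> - l j) * fps_X * z i j) =
      fls_X * \<theta> (fps_to_fls (z i j)) + (- fls_const (of_int (int K)) - fls_const (of_int (d j))) * (fls_X * fps_to_fls (z i j))"
      unfolding \<theta>_fps c by (simp add: fls_times_fps_to_fls mult.assoc flip: fls_minus_const)
    also have "\<dots> = fls_X_intpow (int K) * (fls_X * (\<theta> (Y i j) - fls_const (of_int (d j)) * Y i j))"
      unfolding z[OF i j] \<theta>_mult \<theta>m
      by (simp only: distrib_left distrib_right left_diff_distrib right_diff_distrib mult_minus_left
          mult_minus_right mult_ac) simp
    also have "\<dots> = fps_to_fls (if j = 0 then 0 else S (j - 1) * z i (j - 1))"
      using Y(1)[OF i] j z[OF i, of "j - 1"] by (auto simp: sol_def fls_times_fps_to_fls mult_ac)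
    finally show ?thesis by (simp only: fps_to_fls_eq_iff)
  qed
  define w where "w i x = (\<Sum>j<n. c x j * z i j)" for i x
  have w_add: "w i (x \<oplus> y) = w i x + w i y" if "x \<in> carrier M" "y \<in> carrier M" for i x y
    using that by (simp add: w_def crd_add[OF basis] distrib_right sum.distrib)
  have w_fs: "w i (of_fps f \<odot> x) = f * w i x" if "x \<in> carrier M" for i x f
    using that by (simp add: w_def crd_fs[OF basis] sum_distrib_left mult.assoc)
  have w_e: "w i (e j) = z i j" if "j < n" for i j
  proof -
    have "w i (e j) = (\<Sum>k<n. if k = j then z i j else 0)"
      unfolding w_def by (intro sum.cong refl) (auto simp: crd_basis[OF basis that])
    then show ?thesis using that by simp
  qed
  have w_zero: "w i \<zero> = 0" for i using w_fs[of \<zero> i 0] by simp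
  let ?R = "\<lambda>i::nat. E_mod \<mu>"
  let ?D = "direct_sum n ?R"
  have D: "left_module ?D" by (rule direct_sum_left_module) (rule E_mod_left_module)
  define H where "H x = (\<lambda>i\<in>{..<n}. \<lambda>_::nat. w i x)" for x
  have H: "H \<in> lmod_hom M ?D"
  proof (rule hom_linear[OF D])
    show "H x \<in> carrier ?D" for x by (auto simp: H_def direct_sum_def)
    show "H (x \<oplus> y) = H x \<oplus>\<^bsub>?D\<^esub> H y" if "x \<in> carrier M" "y \<in> carrier M" for x y
      using that by (auto simp: H_def direct_sum_def w_add fun_eq_iff)
    show "H (of_fps f \<odot> x) = of_fps f \<odot>\<^bsub>?D\<^esub> H x" if "x \<in> carrier M" for x f
      using that by (auto simp: H_def direct_sum_def w_fs fun_eq_iff of_fps_mult[symmetric])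
    fix j assume j: "j < n"
    have "w i (lin (l j) \<odot> e j) = fps_X^2 * fps_deriv (z i j) + fps_const (\<mu> - l j) * fps_X * z i j" if "i < n" for i
      unfolding zeq[OF that j] using lin_e[OF j] e_closed[of "j - 1"] j by (auto simp: w_zero w_fs w_e)
    then show "H (lin (l j) \<odot> e j) = lin (l j) \<odot>\<^bsub>?D\<^esub> H (e j)"
      using j by (auto simp: H_def direct_sum_def fun_eq_iff w_e lin_rem_lin)
  qed
  interpret P: lmod_pair M ?D H by (rule lmod_pairI[OF left_module_axioms D H])
  have inj: "inj_on H (carrier M)"
    unfolding P.hom_inj_iff
  proof (intro ballI impI)
    fix x assume x: "x \<in> carrier M" and Hx: "H x = \<zero>\<^bsub>?D\<^esub>"
    have w0: "w i x = 0" if "i < n" for i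
    proof -
      have "H x i 0 = \<zero>\<^bsub>?D\<^esub> i 0" by (simp only: Hx)
      then show ?thesis using that by (simp add: H_def direct_sum_def)
    qed
    \<comment> \<open>Back substitution from the last coordinate: the functional with index
      \<open>i\<close> sees no coordinate below \<open>i\<close>, and those above it are already
      known to vanish.\<close>
    have "c x (n - Suc k) = 0" if "k < n" for k
      using that
    proof (induction k rule: less_induct)
      case (less k)
      define i where "i = n - Suc k"
      have i: "i < n" using less.prems by (simp add: i_def)
      have "c x j * z i j = (if j = i then c x i * z i i else 0)" if "j < n" for j
      proof -
        consider "j < i" | "j = i" | "j > i" by linarith
        then show ?thesis
        proof cases
          case 1
          then have "fps_to_fls (z i j) = 0" using z[OF i that] Y(2)[OF i] by simp
          then show ?thesis using 1 by simp
        next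
          case 3
          then have "c x (n - Suc (n - Suc j)) = 0" using that less.prems by (intro less.IH) (auto simp: i_def)
          then show ?thesis using 3 that by simp
        qed simp
      qed
      then have "w i x = (\<Sum>j<n. if j = i then c x i * z i i else 0)"
        unfolding w_def by (intro sum.cong) auto
      then have "c x i * z i i = 0" using w0[OF i] i by simp
      moreover have "fps_to_fls (z i i) \<noteq> 0" using z[OF i i] Y(3)[OF i] by simp
      ultimately show ?case by (auto simp: i_def)
    qed
    then have "c x i = 0" if "i < n" for i
    proof -
      have "n - Suc (n - Suc i) = i" "n - Suc i < n" using that by auto
      then show ?thesis using \<open>\<And>k. k < n \<Longrightarrow> c x (n - Suc k) = 0\<close>[of "n - Suc i"] by simp
    qed
    then show "x = \<zero>" using crd_eq_iff[OF basis x zero_closed] crd_zero[OF basis] by simp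
  qed
  define N where "N = H ` carrier M"
  have N: "left_submodule N ?D" unfolding N_def by (rule P.image_submodule)
  have "H \<in> lmod_hom M (sub_mod ?D N)" using H by (auto simp: lmod_hom_def N_def)
  moreover have "bij_betw H (carrier M) (carrier (sub_mod ?D N))" using inj by (simp add: bij_betw_def N_def)
  ultimately have iso: "lmod_iso M (sub_mod ?D N)" by (auto simp: lmod_iso_def)
  show ?thesis
    unfolding semi_simple_def
    by (intro conjI exI[of _ n] exI[of _ ?R] exI[of _ N] allI impI reg N iso E_mod_regular)
qed

text \<open>Of the solutions required by \<open>semi_simpleI\<close>, \<open>flat\<close> gives
  those starting at positive indices; the one starting at 0 exists exactly if the obstruction
  vanishes.\<close>

lemma semi_simple_iff_obstr:
  assumes reg: "regular M" and fl: "flat d S n" and dpos: "\<And>j. j < n \<Longrightarrow> d j \<ge> 0" and n: "n \<ge> 2"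
  shows "semi_simple M \<longleftrightarrow> obstr d S n = 0"
proof -
  have d0: "d 0 = 0" using l[of 0] n by simp
  note iff = obstr_zero_iff[where d = d, OF fl d0 dpos n]
  show ?thesis
  proof
    assume "semi_simple M"
    moreover have "0 < n" using n by simp
    ultimately obtain y where "sol d S n y" "y 0 \<noteq> 0"
      using separated_sol[OF semi_simple_separated] by blast
    then show "obstr d S n = 0" using iff by blast
  next
    assume "obstr d S n = 0"
    then obtain y where y: "sol d S n y" "y 0 \<noteq> 0" using iff by blast
    show "semi_simple M"
    proof (rule semi_simpleI[OF reg])
      fix i assume "i < n"
      then show "\<exists>y. sol d S n y \<and> (\<forall>j<i. y j = 0) \<and> y i \<noteq> 0"
        using y fl by (cases "i = 0") (auto simp: flat_def)
    qed
  qed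
qed

end

section \<open>Bernstein polynomials\<close>

text \<open>
  The action of \<open>-b\<inverse>a\<close> on \<open>E\<^sup>\<sharp>/bE\<^sup>\<sharp>\<close> in the basis induced by a chain.
\<close>

definition jord :: "(nat \<Rightarrow> complex) \<Rightarrow> nat \<Rightarrow> (nat \<Rightarrow> complex) \<Rightarrow> nat \<Rightarrow> complex" where
  "jord m n v = (\<lambda>j. - (m j * v j + (if Suc j < n then v (Suc j) else 0)))"

definition poly_op :: "((nat \<Rightarrow> complex) \<Rightarrow> nat \<Rightarrow> complex) \<Rightarrow> complex poly \<Rightarrow> (nat \<Rightarrow> complex) \<Rightarrow> nat \<Rightarrow> complex" where
  "poly_op A q v j = (\<Sum>i\<le>degree q. coeff q i * (A ^^ i) v j)"

lemma poly_op_bound: "degree q \<le> N \<Longrightarrow> poly_op A q v j = (\<Sum>i\<le>N. coeff q i * (A ^^ i) v j)"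
  unfolding poly_op_def by (rule sum.mono_neutral_left) (auto simp: coeff_eq_0)

lemma poly_op_pCons: "poly_op A (pCons a p) v j = a * v j + poly_op A p (A v) j"
proof -
  have "poly_op A (pCons a p) v j = (\<Sum>i\<le>Suc (degree p). coeff (pCons a p) i * (A ^^ i) v j)"
    by (rule poly_op_bound) (rule degree_pCons_le)
  also have "\<dots> = a * v j + poly_op A p (A v) j"
    by (subst sum.atMost_Suc_shift) (simp add: poly_op_def funpow_Suc_right del: funpow.simps)
  finally show ?thesis .
qed

lemma poly_op_add: "poly_op A (p + q) v j = poly_op A p v j + poly_op A q v j"
proof -
  let ?N = "max (degree p) (degree q)"
  have "poly_op A (p + q) v j = (\<Sum>i\<le>?N. coeff (p + q) i * (A ^^ i) v j)"
    by (rule poly_op_bound) (rule degree_add_le_max)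
  then show ?thesis
    using poly_op_bound[of p ?N A v j] poly_op_bound[of q ?N A v j]
    by (simp add: distrib_right sum.distrib)
qed

lemma poly_op_smult: "poly_op A (Polynomial.smult a p) v j = a * poly_op A p v j"
  using poly_op_bound[OF degree_smult_le, of A a p v j]
  by (simp add: poly_op_def sum_distrib_left mult.assoc)

lemma jord_pow_linear:
  "(jord m n ^^ i) (\<lambda>j. a * v j + b * w j) = (\<lambda>j. a * (jord m n ^^ i) v j + b * (jord m n ^^ i) w j)"
  by (induction i) (auto simp: jord_def fun_eq_iff algebra_simps)

lemma poly_op_linear:
  "poly_op (jord m n) q (\<lambda>j. a * v j + b * w j) j = a * poly_op (jord m n) q v j + b * poly_op (jord m n) q w j"
  by (simp add: poly_op_def jord_pow_linear distrib_left sum.distrib sum_distrib_left mult_ac)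

definition unit_vec :: "nat \<Rightarrow> nat \<Rightarrow> complex" where
  "unit_vec k = (\<lambda>j. if j = k then 1 else 0)"

lemma jord_unit_vec:
  "k < n \<Longrightarrow> jord m n (unit_vec k) j = - m k * unit_vec k j - (if k = 0 then 0 else unit_vec (k - 1) j)"
  by (auto simp: jord_def unit_vec_def)

lemma jord_pow_support: "(\<And>j. j > k \<Longrightarrow> v j = 0) \<Longrightarrow> j > k \<Longrightarrow> (jord m n ^^ i) v j = 0"
  by (induction i arbitrary: j) (auto simp: jord_def)

text \<open>Synthetic division splits \<open>q\<close> at the eigenvalue \<open>- m k\<close>, and
  the operator plus \<open>m k\<close> sends the basis vector \<open>k\<close> to minus its
  predecessor.\<close>

lemma poly_op_unit_vec:
  assumes "k < n"
  shows "poly_op (jord m n) q (unit_vec k) j = poly q (- m k) * unit_vec k j -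
     (if k = 0 then 0 else poly_op (jord m n) (synthetic_div q (- m k)) (unit_vec (k - 1)) j)"
proof -
  let ?s = "synthetic_div q (- m k)" and ?A = "jord m n"
  have "q = pCons (poly q (- m k)) ?s + Polynomial.smult (m k) ?s"
    using synthetic_div_correct[of q "- m k"] by (simp add: algebra_simps)
  then have "poly_op ?A q (unit_vec k) j = poly_op ?A (pCons (poly q (- m k)) ?s + Polynomial.smult (m k) ?s) (unit_vec k) j"
    by simp
  also have "\<dots> = poly q (- m k) * unit_vec k j + (1 * poly_op ?A ?s (?A (unit_vec k)) j + m k * poly_op ?A ?s (unit_vec k) j)"
    by (simp add: poly_op_add poly_op_smult poly_op_pCons)
  also have "1 * poly_op ?A ?s (?A (unit_vec k)) j + m k * poly_op ?A ?s (unit_vec k) j =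
      poly_op ?A ?s (\<lambda>j. 1 * ?A (unit_vec k) j + m k * unit_vec k j) j"
    by (rule poly_op_linear[symmetric])
  also have "(\<lambda>j. 1 * ?A (unit_vec k) j + m k * unit_vec k j) =
      (\<lambda>j. (if k = 0 then 0 else -1) * unit_vec (k - 1) j + 0 * unit_vec 0 j)"
    by (auto simp: jord_unit_vec[OF assms] fun_eq_iff)
  also have "poly_op ?A ?s \<dots> j = (if k = 0 then 0 else -1) * poly_op ?A ?s (unit_vec (k - 1)) j + 0 * poly_op ?A ?s (unit_vec 0) j"
    by (rule poly_op_linear)
  finally show ?thesis by simp
qed

text \<open>The off-diagonal entries next to the diagonal are all nonzero, so each basis vector is
  cyclic for the span of those up to it. Its annihilator is then the full product of linear factors,
  repeated eigenvalues included; synthetic division peels off one factor per step.\<close>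

lemma poly_op_unit_vec_zero_iff:
  "k < n \<Longrightarrow> (\<forall>j. poly_op (jord m n) q (unit_vec k) j = 0) \<longleftrightarrow> (\<Prod>i\<le>k. [:m i, 1:]) dvd q"
proof (induction k arbitrary: q)
  case 0
  have "(\<forall>j. poly_op (jord m n) q (unit_vec 0) j = 0) \<longleftrightarrow> poly q (- m 0) = 0"
  proof -
    have eq: "poly_op (jord m n) q (unit_vec 0) j = poly q (- m 0) * unit_vec 0 j" for j
      using poly_op_unit_vec[OF 0, of m q j] by simp
    show ?thesis unfolding eq by (auto simp: unit_vec_def)
  qed
  also have "\<dots> \<longleftrightarrow> [:m 0, 1:] dvd q" using poly_eq_0_iff_dvd[of q "- m 0"] by simp
  finally show ?case by simp
next
  case (Suc k)
  let ?s = "synthetic_div q (- m (Suc k))" and ?A = "jord m n"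
  have sup: "poly_op ?A ?s (unit_vec k) (Suc k) = 0"
    unfolding poly_op_def by (intro sum.neutral ballI) (use jord_pow_support[where k = k and v = "unit_vec k" and j = "Suc k" and m = m and n = n] in \<open>auto simp: unit_vec_def\<close>)
  have eq: "poly_op ?A q (unit_vec (Suc k)) j = poly q (- m (Suc k)) * unit_vec (Suc k) j - poly_op ?A ?s (unit_vec k) j" for j
    using poly_op_unit_vec[OF Suc.prems, of m q j] by simp
  have "(\<forall>j. poly_op ?A q (unit_vec (Suc k)) j = 0) \<longleftrightarrow>
      poly q (- m (Suc k)) = 0 \<and> (\<forall>j. poly_op ?A ?s (unit_vec k) j = 0)"
  proof
    assume *: "\<forall>j. poly_op ?A q (unit_vec (Suc k)) j = 0"
    then have "poly_op ?A q (unit_vec (Suc k)) (Suc k) = 0" by blast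
    then have 0: "poly q (- m (Suc k)) = 0" unfolding eq sup by (simp add: unit_vec_def)
    with * show "poly q (- m (Suc k)) = 0 \<and> (\<forall>j. poly_op ?A ?s (unit_vec k) j = 0)" unfolding eq by simp
  qed (simp add: eq)
  also have "\<dots> \<longleftrightarrow> poly q (- m (Suc k)) = 0 \<and> (\<Prod>i\<le>k. [:m i, 1:]) dvd ?s" using Suc by simp
  also have "\<dots> \<longleftrightarrow> (\<Prod>i\<le>Suc k. [:m i, 1:]) dvd q"
  proof
    assume *: "poly q (- m (Suc k)) = 0 \<and> (\<Prod>i\<le>k. [:m i, 1:]) dvd ?s"
    then have "q = [:m (Suc k), 1:] * ?s" using synthetic_div_correct'[of "- m (Suc k)" q] by simp
    then show "(\<Prod>i\<le>Suc k. [:m i, 1:]) dvd q" using * by (metis mult.commute mult_dvd_mono dvd_refl prod.atMost_Suc)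
  next
    assume *: "(\<Prod>i\<le>Suc k. [:m i, 1:]) dvd q"
    then have "[:m (Suc k), 1:] dvd q" by (metis dvd_mult_right prod.atMost_Suc)
    then have 0: "poly q (- m (Suc k)) = 0" using poly_eq_0_iff_dvd[of q "- m (Suc k)"] by simp
    then have "q = [:m (Suc k), 1:] * ?s" using synthetic_div_correct'[of "- m (Suc k)" q] by simp
    then have "[:m (Suc k), 1:] * (\<Prod>i\<le>k. [:m i, 1:]) dvd [:m (Suc k), 1:] * ?s"
      using * by (metis mult.commute prod.atMost_Suc)
    then have "(\<Prod>i\<le>k. [:m i, 1:]) dvd ?s" by (subst (asm) dvd_mult_cancel_left) simp
    with 0 show "poly q (- m (Suc k)) = 0 \<and> (\<Prod>i\<le>k. [:m i, 1:]) dvd ?s" by blast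
  qed
  finally show ?case .
qed

lemma poly_op_zero_iff:
  assumes n: "n > 0"
  shows "(\<forall>v. (\<forall>j\<ge>n. v j = 0) \<longrightarrow> (\<forall>j. poly_op (jord m n) q v j = 0)) \<longleftrightarrow> (\<Prod>i<n. [:m i, 1:]) dvd q"
proof
  assume *: "\<forall>v. (\<forall>j\<ge>n. v j = 0) \<longrightarrow> (\<forall>j. poly_op (jord m n) q v j = 0)"
  have "\<forall>j\<ge>n. unit_vec (n - 1) j = 0" using n by (auto simp: unit_vec_def)
  then have "\<forall>j. poly_op (jord m n) q (unit_vec (n - 1)) j = 0" using * by blast
  then have "(\<Prod>i\<le>n - 1. [:m i, 1:]) dvd q" using poly_op_unit_vec_zero_iff[of "n - 1" n] n by simp
  moreover have "{..n - 1} = {..<n}" using n by auto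
  ultimately show "(\<Prod>i<n. [:m i, 1:]) dvd q" by simp
next
  assume dv: "(\<Prod>i<n. [:m i, 1:]) dvd q"
  have u: "poly_op (jord m n) q (unit_vec k) j = 0" if "k < n" for k j
  proof -
    have "(\<Prod>i\<le>k. [:m i, 1:]) dvd (\<Prod>i<n. [:m i, 1:])" using that by (intro prod_dvd_prod_subset) auto
    then show ?thesis using poly_op_unit_vec_zero_iff[OF that] dv dvd_trans by blast
  qed
  show "\<forall>v. (\<forall>j\<ge>n. v j = 0) \<longrightarrow> (\<forall>j. poly_op (jord m n) q v j = 0)"
  proof (intro allI impI)
    fix v j assume v: "\<forall>j\<ge>n. v j = (0::complex)"
    have "poly_op (jord m n) q (\<lambda>j. if j < k then v j else 0) j = 0" if "k \<le> n" for k
      using that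
    proof (induction k)
      case 0
      have "(\<lambda>j. if j < 0 then v j else 0) = (\<lambda>j. 0 * unit_vec 0 j + 0 * unit_vec 0 j)" by auto
      then show ?case by (simp only: poly_op_linear) simp
    next
      case (Suc k)
      have "(\<lambda>j. if j < Suc k then v j else 0) = (\<lambda>j. 1 * (if j < k then v j else 0) + v k * unit_vec k j)"
        by (auto simp: unit_vec_def less_Suc_eq fun_eq_iff)
      then show ?case using Suc u[of k] by (simp only: poly_op_linear) simp
    qed
    moreover have "(\<lambda>j. if j < n then v j else 0) = v" using v by (auto simp: fun_eq_iff)
    ultimately show "poly_op (jord m n) q v j = 0" by (metis order_refl)
  qed
qed

section \<open>The Bernstein polynomial of a module with simple pole\<close>

lemma monic_dvd_antisym:
  fixes p q :: "complex poly"
  assumes "lead_coeff p = 1" "lead_coeff q = 1" "p dvd q" "q dvd p"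
  shows "p = q"
proof -
  obtain h where h: "q = p * h" using assms(3) by blast
  have "p \<noteq> 0" "q \<noteq> 0" using assms(1,2) by auto
  then have "degree p = degree q" using assms(3,4) by (intro antisym dvd_imp_degree_le) auto
  moreover have "h \<noteq> 0" using h \<open>q \<noteq> 0\<close> by auto
  ultimately have "degree h = 0" using h \<open>p \<noteq> 0\<close> by (simp add: degree_mult_eq)
  then obtain a where "h = [:a:]" by (rule degree_eq_zeroE)
  moreover from this have "a = 1" using h assms(1,2) by (simp split: if_splits)
  ultimately show ?thesis using h by simp
qed

text \<open>The factor \<open>fps_X\<close> is the difference from a chain. It makes a divisible by
  b, and modulo b the operator \<open>-b^(-1) a\<close> becomes the matrix \<open>jord\<close>
  because the \<open>S i\<close> have constant term 1.\<close>

locale saturated_basis = ab_left M for M :: "(atilde, 'm) module" (structure) +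
  fixes m S \<epsilon> n
  assumes b: "basis \<epsilon> n" and n: "n > 0" and S0: "\<And>i. Suc i < n \<Longrightarrow> S i $ 0 = 1"
    and lin_\<epsilon>: "\<And>i. i < n \<Longrightarrow> lin (m i) \<odot> \<epsilon> i = (if i = 0 then \<zero> else of_fps (fps_X * S (i - 1)) \<odot> \<epsilon> (i - 1))"
begin

lemma \<epsilon>_closed: "i < n \<Longrightarrow> \<epsilon> i \<in> carrier M" by (rule basis_closed[OF b])

abbreviation "c \<equiv> crd \<epsilon> n"

definition bc :: "'m \<Rightarrow> nat \<Rightarrow> complex" where "bc x j = c x j $ 0"

lemma avar_eq: "avar = lin 0" by (simp add: lin_alt)

lemma avar_comb: "avar \<odot> comb M \<epsilon> n g = bvar \<odot> comb M \<epsilon> n (\<lambda>i. fps_X * fps_deriv (g i) + fps_const (m i) * g i +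
     (if Suc i < n then S i * g (Suc i) else 0))"
proof -
  have "avar \<odot> comb M \<epsilon> n g = comb M \<epsilon> n (\<lambda>i. fps_X^2 * fps_deriv (g i) +
     fps_const (m i - 0) * fps_X * g i + (if Suc i < n then (fps_X * S i) * g (Suc i) else 0))"
    unfolding avar_eq by (rule lin_comb) (auto simp: \<epsilon>_closed lin_\<epsilon>)
  also have "\<dots> = comb M \<epsilon> n (\<lambda>i. fps_X * (fps_X * fps_deriv (g i) + fps_const (m i) * g i +
     (if Suc i < n then S i * g (Suc i) else 0)))"
    by (rule comb_cong) (auto simp: algebra_simps power2_eq_square)
  also have "\<dots> = bvar \<odot> comb M \<epsilon> n (\<lambda>i. fps_X * fps_deriv (g i) + fps_const (m i) * g i +
     (if Suc i < n then S i * g (Suc i) else 0))"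
    unfolding bvar_of_fps by (rule comb_smult) (rule \<epsilon>_closed)
  finally show ?thesis .
qed

lemma binv_a_eq:
  assumes x: "x \<in> carrier M"
  shows "binv_a M x = comb M \<epsilon> n (\<lambda>i. fps_X * fps_deriv (c x i) + fps_const (m i) * c x i +
     (if Suc i < n then S i * c x (Suc i) else 0))" (is "_ = ?y")
  unfolding binv_a_def
proof (rule the_equality)
  have y: "?y \<in> carrier M" using \<epsilon>_closed by (rule comb_closed)
  have eq: "avar \<odot> x = bvar \<odot> ?y" using avar_comb[of "c x"] comb_crd[OF b x] by simp
  with y show "?y \<in> carrier M \<and> avar \<odot> x = bvar \<odot> ?y" by blast
  show "y = ?y" if "y \<in> carrier M \<and> avar \<odot> x = bvar \<odot> y" for y
    using bvar_inj[OF b, of y ?y] that y eq by simp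
qed

definition negT :: "'m \<Rightarrow> 'm" where "negT x = \<ominus> binv_a M x"

lemma negT_closed: "x \<in> carrier M \<Longrightarrow> negT x \<in> carrier M"
  unfolding negT_def binv_a_eq by (intro a_inv_closed comb_closed \<epsilon>_closed)

lemma bc_add: "x \<in> carrier M \<Longrightarrow> y \<in> carrier M \<Longrightarrow> bc (x \<oplus> y) j = bc x j + bc y j"
  by (simp add: bc_def crd_add[OF b])

lemma bc_fs: "x \<in> carrier M \<Longrightarrow> bc (of_fps f \<odot> x) j = f $ 0 * bc x j"
  by (simp add: bc_def crd_fs[OF b])

lemma bc_neg: "x \<in> carrier M \<Longrightarrow> bc (\<ominus> x) j = - bc x j"
  using bc_fs[of x "-1" j] lsmult_neg[of x 1] by (simp add: lsmult_one)

lemma bc_negT: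
  assumes x: "x \<in> carrier M"
  shows "bc (negT x) = jord m n (bc x)"
proof
  fix j
  have y: "binv_a M x \<in> carrier M" unfolding binv_a_eq[OF x] using \<epsilon>_closed by (rule comb_closed)
  have "bc (binv_a M x) j = m j * bc x j + (if Suc j < n then bc x (Suc j) else 0)"
  proof (cases "j < n")
    case True
    show ?thesis
      unfolding bc_def crd_unique[OF b binv_a_eq[OF x] True] using S0[of j] by simp
  next
    case False
    then show ?thesis by (simp add: bc_def crd_beyond[OF b])
  qed
  then show "bc (negT x) j = jord m n (bc x) j"
    unfolding negT_def bc_neg[OF y] jord_def by simp
qed

lemma bE_submodule: "left_submodule (bE M) M"
proof (rule left_submoduleI)
  show "bE M \<subseteq> carrier M" by (auto simp: bE_def lsmult_closed)
  show "\<zero> \<in> bE M" using bE_crd[OF b] by (simp add: crd_zero[OF b])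
  show "x \<oplus> y \<in> bE M" if "x \<in> bE M" "y \<in> bE M" for x y
    using that bE_crd[OF b] by (simp add: crd_add[OF b])
  show "r \<odot> x \<in> bE M" if x: "x \<in> bE M" for r x
  proof -
    obtain y where y: "y \<in> carrier M" "x = bvar \<odot> y" using x by (auto simp: bE_def)
    obtain r' where "r * bvar = bvar * r'" using mult_bvar_left by blast
    then have "r \<odot> x = bvar \<odot> (r' \<odot> y)" using y by (simp add: lsmult_assoc[symmetric])
    then show ?thesis using y(1) by (auto simp: bE_def lsmult_closed)
  qed
qed

sublocale Q: left_quotient M "bE M"
  by (rule left_quotientI[OF left_module_axioms bE_submodule])

lemma cls_eq_bc:
  assumes "x \<in> carrier M" "y \<in> carrier M"
  shows "Q.cls x = Q.cls y \<longleftrightarrow> bc x = bc y"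
proof -
  have "bc (x \<ominus> y) j = bc x j - bc y j" for j
    using assms by (simp add: a_minus_def bc_add bc_neg)
  then have "x \<ominus> y \<in> bE M \<longleftrightarrow> (\<forall>j. bc x j - bc y j = 0)"
    using bE_crd[OF b, of "x \<ominus> y"] assms by (simp add: bc_def)
  then show ?thesis using Q.cls_eq_iff[OF assms] by (auto simp: fun_eq_iff)
qed

abbreviation "V \<equiv> quot_mod M (bE M)"

lemma neg_binv_cls:
  assumes x: "x \<in> carrier M"
  shows "neg_binv_a_mod_b M (Q.cls x) = Q.cls (negT x)"
proof -
  have "Q.cls (negT y) = Q.cls (negT x)" if "y \<in> Q.cls x" for y
  proof -
    have y: "y \<in> carrier M" "y \<ominus> x \<in> bE M" using that x Q.cls_eq_set by auto
    then have "Q.cls y = Q.cls x" using x Q.cls_eq_iff by blast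
    then have "bc y = bc x" using cls_eq_bc y x by blast
    then show ?thesis using cls_eq_bc negT_closed bc_negT x y by simp
  qed
  moreover have "x \<in> Q.cls x" using x Q.cls_eq_set Q.N_props(2) by (simp add: a_minus_def r_neg)
  ultimately have "(\<Union>y\<in>Q.cls x. Q.cls (negT y)) = Q.cls (negT x)" by blast
  then show ?thesis by (simp add: neg_binv_a_mod_b_def negT_def)
qed

lemma negT_pow: "x \<in> carrier M \<Longrightarrow> (negT ^^ i) x \<in> carrier M \<and> bc ((negT ^^ i) x) = (jord m n ^^ i) (bc x) \<and>
    (neg_binv_a_mod_b M ^^ i) (Q.cls x) = Q.cls ((negT ^^ i) x)"
  by (induction i) (auto simp: negT_closed bc_negT neg_binv_cls)

lemma finsum_cls:
  fixes x :: "nat \<Rightarrow> 'm"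
  assumes x: "\<And>i. x i \<in> carrier M"
  shows "\<exists>y\<in>carrier M. (\<Oplus>\<^bsub>V\<^esub>i\<in>{..k}. Q.cls (x i)) = Q.cls y \<and> (\<forall>j. bc y j = (\<Sum>i\<le>k. bc (x i) j))"
proof -
  interpret V: left_module V by (rule Q.quot_left_module)
  have Q_closed: "Q.cls (x i) \<in> carrier V" for i using x by (simp add: Q.quot_carrier)
  show ?thesis
  proof (induction k)
    case 0
    have "(\<Oplus>\<^bsub>V\<^esub>i\<in>{..0}. Q.cls (x i)) = Q.cls (x 0)" using Q_closed by simp
    then show ?case using x by (intro bexI[of _ "x 0"]) auto
  next
    case (Suc k)
    then obtain y where y: "y \<in> carrier M" "(\<Oplus>\<^bsub>V\<^esub>i\<in>{..k}. Q.cls (x i)) = Q.cls y" "\<forall>j. bc y j = (\<Sum>i\<le>k. bc (x i) j)"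
      by blast
    have "(\<Oplus>\<^bsub>V\<^esub>i\<in>{..Suc k}. Q.cls (x i)) = Q.cls (x (Suc k)) \<oplus>\<^bsub>V\<^esub> Q.cls y"
      unfolding y(2)[symmetric] by (rule V.finsum_Suc) (use Q_closed in auto)
    also have "\<dots> = Q.cls (x (Suc k) \<oplus> y)" using x y(1) by (simp add: Q.quot_add)
    finally show ?case
      using x y by (intro bexI[of _ "x (Suc k) \<oplus> y"]) (auto simp: bc_add)
  qed
qed

lemma annihilating_iff:
  "annihilating_poly V (neg_binv_a_mod_b M) q \<longleftrightarrow> (\<Prod>i<n. [:m i, 1:]) dvd q"
proof -
  have ev: "(\<Oplus>\<^bsub>V\<^esub>i\<in>{..degree q}. acst (coeff q i) \<odot>\<^bsub>V\<^esub> (neg_binv_a_mod_b M ^^ i) (Q.cls x)) = \<zero>\<^bsub>V\<^esub>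
     \<longleftrightarrow> (\<forall>j. poly_op (jord m n) q (bc x) j = 0)" if x: "x \<in> carrier M" for x
  proof -
    define z where "z i = acst (coeff q i) \<odot> (negT ^^ i) x" for i
    have z: "z i \<in> carrier M" for i using negT_pow[OF x] by (simp add: z_def lsmult_closed)
    have zc: "acst (coeff q i) \<odot>\<^bsub>V\<^esub> (neg_binv_a_mod_b M ^^ i) (Q.cls x) = Q.cls (z i)" for i
      using negT_pow[OF x] by (simp add: z_def Q.quot_smult)
    obtain y where y: "y \<in> carrier M" "(\<Oplus>\<^bsub>V\<^esub>i\<in>{..degree q}. Q.cls (z i)) = Q.cls y"
        "\<forall>j. bc y j = (\<Sum>i\<le>degree q. bc (z i) j)"
      using finsum_cls[of z "degree q", OF z] by (elim bexE conjE)
    have "bc (z i) j = coeff q i * (jord m n ^^ i) (bc x) j" for i j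
      using negT_pow[OF x, of i] by (simp add: z_def bc_fs)
    then have "bc y j = poly_op (jord m n) q (bc x) j" for j using y(3) by (simp add: poly_op_def)
    moreover have "Q.cls y = \<zero>\<^bsub>V\<^esub> \<longleftrightarrow> (\<forall>j. bc y j = 0)"
      using Q.cls_eq_zero_iff[OF y(1)] bE_crd[OF b, of y] y(1) by (simp add: Q.quot_zero bc_def)
    ultimately show ?thesis unfolding zc y(2) by simp
  qed
  have "annihilating_poly V (neg_binv_a_mod_b M) q \<longleftrightarrow> (\<forall>x\<in>carrier M. \<forall>j. poly_op (jord m n) q (bc x) j = 0)"
    unfolding annihilating_poly_def Q.quot_carrier using ev by auto
  also have "\<dots> \<longleftrightarrow> (\<forall>v. (\<forall>j\<ge>n. v j = 0) \<longrightarrow> (\<forall>j. poly_op (jord m n) q v j = 0))"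
  proof safe
    fix v j assume *: "\<forall>x\<in>carrier M. \<forall>j. poly_op (jord m n) q (bc x) j = 0" and v: "\<forall>j\<ge>n. v j = (0::complex)"
    define x where "x = comb M \<epsilon> n (\<lambda>j. fps_const (v j))"
    have x: "x \<in> carrier M" unfolding x_def using \<epsilon>_closed by (rule comb_closed)
    have "bc x = v"
    proof
      fix j show "bc x j = v j"
        using crd_unique[OF b x_def, of j] crd_beyond[OF b, of j x] v by (cases "j < n") (auto simp: bc_def)
    qed
    then show "poly_op (jord m n) q v j = 0" using * x by blast
  next
    fix x j assume *: "\<forall>v. (\<forall>j\<ge>n. v j = 0) \<longrightarrow> (\<forall>j. poly_op (jord m n) q v j = 0)" and x: "x \<in> carrier M"
    have "\<forall>j\<ge>n. bc x j = 0" using crd_beyond[OF b] by (simp add: bc_def)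
    then show "poly_op (jord m n) q (bc x) j = 0" using * by blast
  qed
  also have "\<dots> \<longleftrightarrow> (\<Prod>i<n. [:m i, 1:]) dvd q" by (rule poly_op_zero_iff[OF n])
  finally show ?thesis .
qed

lemma bernstein_simple_pole_eq: "bernstein_simple_pole M = (\<Prod>i<n. [:m i, 1:])"
  unfolding bernstein_simple_pole_def minimal_poly_def annihilating_iff
proof (rule the_equality)
  have B: "lead_coeff (\<Prod>i<n. [:m i, 1:]) = 1" by (simp add: lead_coeff_prod)
  then show "lead_coeff (\<Prod>i<n. [:m i, 1:]) = 1 \<and> (\<Prod>i<n. [:m i, 1:]) dvd (\<Prod>i<n. [:m i, 1:]) \<and>
     (\<forall>q. (\<Prod>i<n. [:m i, 1:]) dvd q \<longrightarrow> (\<Prod>i<n. [:m i, 1:]) dvd q)" by simp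
  show "p = (\<Prod>i<n. [:m i, 1:])" if "lead_coeff p = 1 \<and> (\<Prod>i<n. [:m i, 1:]) dvd p \<and>
     (\<forall>q. (\<Prod>i<n. [:m i, 1:]) dvd q \<longrightarrow> p dvd q)" for p
    using that B by (intro monic_dvd_antisym) auto
qed

end

text \<open>Dividing a vector by \<open>b^k\<close> lowers its exponent by k; this is the origin of
  the shifts \<open>n - 1 - j\<close> in the Bernstein polynomial.\<close>

lemma lin_X_pow: "lin \<nu> * of_fps (fps_X ^ k) = of_fps (fps_X ^ k) * lin (\<nu> - of_nat k)"
proof -
  have "fps_X^2 * fps_deriv (fps_X ^ k) = fps_X ^ k * (fps_const (of_nat k) * fps_X :: complex fps)"
  proof (cases k)
    case (Suc i)
    then show ?thesis
      by (simp only: fps_deriv_power fps_deriv_fps_X diff_Suc_1)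
        (simp only: power_Suc power2_eq_square mult_1_left mult_1_right mult_ac)
  qed simp
  moreover have "fps_const (\<nu> - of_nat k - \<nu>) = - fps_const (of_nat k)" by simp
  ultimately have "fps_X^2 * fps_deriv (fps_X ^ k) + fps_const (\<nu> - of_nat k - \<nu>) * fps_X * fps_X ^ k = 0"
    by (simp only: mult_minus_left) (simp add: mult_ac)
  then show ?thesis using lin_mult_of_fps[of \<nu> "fps_X ^ k" "\<nu> - of_nat k"] by simp
qed

text \<open>Inside any module with simple pole the image of \<open>e j\<close> is divisible by
  \<open>b^(n - 1 - j)\<close>, and the quotients form a basis of the saturation. The answer does
  not involve \<open>L\<close> or the embedding, so the definite description in
  \<open>bernstein\<close> is legitimate.\<close>

lemma bernstein_of_embedding:
  fixes E :: "(atilde, 'm) module" and L :: "(atilde, 'k) module"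
  assumes ch: "chain E l S e n" and n: "n > 0" and L: "simple_pole L" and emb: "embeds \<phi> E L"
  shows "bernstein_simple_pole (sub_mod L (saturation L (\<phi> ` carrier E))) =
    (\<Prod>j<n. [:l j - of_nat (n - 1 - j), 1:])"
proof -
  interpret E: ab_chain E l S e n by (rule ab_chainI[OF ch])
  interpret L: ab_left L using L by (auto simp: simple_pole_def ab_module_def intro: ab_leftI)
  interpret P: lmod_pair E L \<phi> using emb by (intro lmod_pairI E.left_module_axioms L.left_module_axioms) (simp add: embeds_def)
  obtain nL eL where bL: "L.basis eL nL"
    using L L.has_rank_basis unfolding simple_pole_def ab_module_def by metis
  have X_inj: "y = z" if "y \<in> carrier L" "z \<in> carrier L" "of_fps (fps_X ^ k) \<odot>\<^bsub>L\<^esub> y = of_fps (fps_X ^ k) \<odot>\<^bsub>L\<^esub> z" for y z k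
  proof -
    have "fps_X ^ k * L.crd eL nL y i = fps_X ^ k * L.crd eL nL z i" for i
      using L.crd_fs[OF bL that(1)] L.crd_fs[OF bL that(2)] that(3) by metis
    then show ?thesis using L.crd_eq_iff[OF bL] that by simp
  qed
  define m where "m j = l j - of_nat (n - 1 - j)" for j
  have S_inv: "inverse (S i) * S i = 1" if "Suc i < n" for i
    using E.S0[OF that] by (simp add: inverse_mult_eq_1)
  have lin_pole: "\<exists>z\<in>carrier L. lin \<nu> \<odot>\<^bsub>L\<^esub> y = of_fps fps_X \<odot>\<^bsub>L\<^esub> z" if y: "y \<in> carrier L" for y \<nu>
  proof -
    obtain z where z: "z \<in> carrier L" "avar \<odot>\<^bsub>L\<^esub> y = of_fps fps_X \<odot>\<^bsub>L\<^esub> z"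
      using L y by (force simp: simple_pole_def bE_def bvar_of_fps)
    have "lin \<nu> \<odot>\<^bsub>L\<^esub> y = avar \<odot>\<^bsub>L\<^esub> y \<ominus>\<^bsub>L\<^esub> of_fps fps_X \<odot>\<^bsub>L\<^esub> (acst \<nu> \<odot>\<^bsub>L\<^esub> y)"
      using y by (simp add: lin_alt L.lsmult_diff L.fs_mult mult.commute)
    also have "\<dots> = of_fps fps_X \<odot>\<^bsub>L\<^esub> (z \<ominus>\<^bsub>L\<^esub> acst \<nu> \<odot>\<^bsub>L\<^esub> y)"
      using y z by (simp add: L.lsmult_rdiff L.lsmult_closed)
    finally show ?thesis using y z L.lsmult_closed by blast
  qed
  have ec: "\<phi> (e j) \<in> carrier L" if "j < n" for j using P.hD(1) E.e_closed that by blast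
  have phi_lin: "lin (l j) \<odot>\<^bsub>L\<^esub> \<phi> (e j) = (if j = 0 then \<zero>\<^bsub>L\<^esub> else of_fps (S (j - 1)) \<odot>\<^bsub>L\<^esub> \<phi> (e (j - 1)))" if j: "j < n" for j
    using P.hD(3)[OF E.e_closed[OF j], of "lin (l j)"] E.lin_e[OF j] P.hom_zero P.hD(3)[of "e (j - 1)"] E.e_closed[of "j - 1"] j
    by auto
  have shift: "lin (l j) \<odot>\<^bsub>L\<^esub> (of_fps (fps_X ^ (n - 1 - j)) \<odot>\<^bsub>L\<^esub> x) = of_fps (fps_X ^ (n - 1 - j)) \<odot>\<^bsub>L\<^esub> (lin (m j) \<odot>\<^bsub>L\<^esub> x)"
    if "x \<in> carrier L" for j x
    using that by (simp add: L.lsmult_assoc[symmetric] lin_X_pow m_def)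
  \<comment> \<open>From the top downwards: up to a unit the image of \<open>e (j - 1)\<close> is
    \<open>lin (l j)\<close> applied to that of \<open>e j\<close>, and the simple pole gains one
    factor b at each step.\<close>
  have ex: "\<exists>x\<in>carrier L. \<phi> (e (n - Suc k)) = of_fps (fps_X ^ k) \<odot>\<^bsub>L\<^esub> x" if "k < n" for k
    using that
  proof (induction k)
    case 0
    then show ?case using ec[of "n - 1"] by (intro bexI[of _ "\<phi> (e (n - 1))"]) (auto simp: L.lsmult_one)
  next
    case (Suc k)
    define j where "j = n - Suc k"
    have j: "j < n" "j > 0" "n - Suc (Suc k) = j - 1" "n - 1 - j = k" using Suc.prems by (auto simp: j_def)
    obtain x where x: "x \<in> carrier L" "\<phi> (e j) = of_fps (fps_X ^ k) \<odot>\<^bsub>L\<^esub> x" using Suc by (auto simp: j_def)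
    obtain y where y: "y \<in> carrier L" "lin (m j) \<odot>\<^bsub>L\<^esub> x = of_fps fps_X \<odot>\<^bsub>L\<^esub> y" using lin_pole[OF x(1)] by blast
    have "of_fps (S (j - 1)) \<odot>\<^bsub>L\<^esub> \<phi> (e (j - 1)) = lin (l j) \<odot>\<^bsub>L\<^esub> \<phi> (e j)" using phi_lin[OF j(1)] j by simp
    also have "\<dots> = of_fps (fps_X ^ k) \<odot>\<^bsub>L\<^esub> (of_fps fps_X \<odot>\<^bsub>L\<^esub> y)"
      unfolding x(2) using shift[OF x(1), of j] y(2) j(4) by simp
    finally have "of_fps (inverse (S (j - 1))) \<odot>\<^bsub>L\<^esub> (of_fps (S (j - 1)) \<odot>\<^bsub>L\<^esub> \<phi> (e (j - 1))) =
       of_fps (inverse (S (j - 1))) \<odot>\<^bsub>L\<^esub> (of_fps (fps_X ^ k) \<odot>\<^bsub>L\<^esub> (of_fps fps_X \<odot>\<^bsub>L\<^esub> y))" by simp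
    then have "\<phi> (e (j - 1)) = of_fps (fps_X ^ Suc k) \<odot>\<^bsub>L\<^esub> (of_fps (inverse (S (j - 1))) \<odot>\<^bsub>L\<^esub> y)"
      using y(1) ec[of "j - 1"] j S_inv[of "j - 1"] by (simp add: L.fs_mult L.lsmult_one mult_ac)
    then show ?case using j y(1) L.lsmult_closed by auto
  qed
  define \<epsilon> where "\<epsilon> j = (SOME x. x \<in> carrier L \<and> \<phi> (e j) = of_fps (fps_X ^ (n - 1 - j)) \<odot>\<^bsub>L\<^esub> x)" for j
  have \<epsilon>: "\<epsilon> j \<in> carrier L \<and> \<phi> (e j) = of_fps (fps_X ^ (n - 1 - j)) \<odot>\<^bsub>L\<^esub> \<epsilon> j" if "j < n" for j
    unfolding \<epsilon>_def
  proof (rule someI_ex)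
    have "n - Suc (n - 1 - j) = j" "n - 1 - j < n" using that by auto
    then show "\<exists>x. x \<in> carrier L \<and> \<phi> (e j) = of_fps (fps_X ^ (n - 1 - j)) \<odot>\<^bsub>L\<^esub> x" using ex[of "n - 1 - j"] by auto
  qed
  have \<epsilon>c: "\<epsilon> j \<in> carrier L" if "j < n" for j using \<epsilon>[OF that] by blast
  have lin_\<epsilon>: "lin (m j) \<odot>\<^bsub>L\<^esub> \<epsilon> j = (if j = 0 then \<zero>\<^bsub>L\<^esub> else of_fps (fps_X * S (j - 1)) \<odot>\<^bsub>L\<^esub> \<epsilon> (j - 1))" if j: "j < n" for j
  proof (rule X_inj[where k = "n - 1 - j"])
    have "of_fps (fps_X ^ (n - 1 - j)) \<odot>\<^bsub>L\<^esub> (lin (m j) \<odot>\<^bsub>L\<^esub> \<epsilon> j) = lin (l j) \<odot>\<^bsub>L\<^esub> \<phi> (e j)"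
      using shift[OF \<epsilon>c[OF j], of j] \<epsilon>[OF j] by simp
    also have "\<dots> = of_fps (fps_X ^ (n - 1 - j)) \<odot>\<^bsub>L\<^esub> (if j = 0 then \<zero>\<^bsub>L\<^esub> else of_fps (fps_X * S (j - 1)) \<odot>\<^bsub>L\<^esub> \<epsilon> (j - 1))"
    proof (cases j)
      case (Suc i)
      have "n - 1 - i = Suc (n - 1 - j)" using j Suc by simp
      then have "\<phi> (e i) = of_fps (fps_X ^ Suc (n - 1 - j)) \<odot>\<^bsub>L\<^esub> \<epsilon> i" using \<epsilon>[of i] j Suc by simp
      then show ?thesis using phi_lin[OF j] Suc \<epsilon>c[of i] j by (simp add: L.fs_mult mult_ac)
    qed (use phi_lin[OF j] in simp)
    finally show "of_fps (fps_X ^ (n - 1 - j)) \<odot>\<^bsub>L\<^esub> (lin (m j) \<odot>\<^bsub>L\<^esub> \<epsilon> j) = \<dots>" .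
  qed (use \<epsilon>c j in \<open>auto intro!: L.lsmult_closed\<close>)
  define N0 where "N0 = spn L \<epsilon> n"
  have \<epsilon>_spn: "lin (m i) \<odot>\<^bsub>L\<^esub> \<epsilon> i \<in> spn L \<epsilon> i" if "i < n" for i
  proof (cases i)
    case 0
    then show ?thesis using lin_\<epsilon>[OF that] by simp
  next
    case (Suc j)
    have "comb L \<epsilon> i (single j (fps_X * S j)) = of_fps (fps_X * S j) \<odot>\<^bsub>L\<^esub> \<epsilon> j"
      using that Suc \<epsilon>c by (subst L.comb_single) auto
    then show ?thesis using lin_\<epsilon>[OF that] Suc by (metis diff_Suc_1 nat.distinct(1) rangeI)
  qed
  have N0: "left_submodule N0 L" unfolding N0_def by (rule L.spn_submodule[where l = m]) (use \<epsilon>c \<epsilon>_spn in auto)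
  note N0D = left_submoduleD[OF N0]
  interpret M: ab_left "sub_mod L N0" by (rule ab_leftI[OF L.sub_mod_left_module[OF N0]])
  have \<epsilon>N: "\<epsilon> j \<in> N0" if "j < n" for j unfolding N0_def using that \<epsilon>c by (rule L.spn_basis)
  have "indep L \<epsilon> n"
    unfolding indep_def
  proof (intro allI impI)
    fix g i assume z: "comb L \<epsilon> n g = \<zero>\<^bsub>L\<^esub>" and i: "i < n"
    \<comment> \<open>Multiplication by \<open>b^(n - 1)\<close> leads back into the image of E,
      where the independence of the chain and the injectivity of the embedding apply.\<close>
    have cm: "of_fps (fps_X ^ (n - 1)) \<odot>\<^bsub>L\<^esub> comb L \<epsilon> k g = \<phi> (comb E e k (\<lambda>i. fps_X ^ i * g i))" if "k \<le> n" for k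
      using that
    proof (induction k)
      case (Suc k)
      have c: "comb L \<epsilon> k g \<in> carrier L" "\<epsilon> k \<in> carrier L" "e k \<in> carrier E" "comb E e k (\<lambda>i. fps_X ^ i * g i) \<in> carrier E"
        using Suc.prems \<epsilon>c E.e_closed by (auto intro!: L.comb_closed E.comb_closed)
      have "fps_X ^ (n - 1) = fps_X ^ k * (fps_X ^ (n - 1 - k) :: complex fps)"
        using Suc.prems by (simp flip: power_add)
      note pw = this
      have "of_fps (fps_X ^ (n - 1)) \<odot>\<^bsub>L\<^esub> (of_fps (g k) \<odot>\<^bsub>L\<^esub> \<epsilon> k) = of_fps (fps_X ^ k * g k) \<odot>\<^bsub>L\<^esub> \<phi> (e k)"
      proof -
        have "of_fps (fps_X ^ (n - 1)) \<odot>\<^bsub>L\<^esub> (of_fps (g k) \<odot>\<^bsub>L\<^esub> \<epsilon> k) = of_fps (fps_X ^ (n - 1) * g k) \<odot>\<^bsub>L\<^esub> \<epsilon> k"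
          by (rule L.fs_mult[OF c(2)])
        also have "fps_X ^ (n - 1) * g k = (fps_X ^ k * g k) * fps_X ^ (n - 1 - k)"
          unfolding pw by (simp only: mult_ac)
        also have "of_fps \<dots> \<odot>\<^bsub>L\<^esub> \<epsilon> k = of_fps (fps_X ^ k * g k) \<odot>\<^bsub>L\<^esub> (of_fps (fps_X ^ (n - 1 - k)) \<odot>\<^bsub>L\<^esub> \<epsilon> k)"
          by (rule L.fs_mult[OF c(2), symmetric])
        finally show ?thesis using \<epsilon>[of k] Suc.prems by simp
      qed
      then show ?case using Suc c
        by (simp add: comb.simps(2) L.lsmult_r_distr L.lsmult_closed P.hD E.lsmult_closed)
    qed (simp add: P.hom_zero)
    have "comb E e n (\<lambda>i. fps_X ^ i * g i) \<in> carrier E" using E.e_closed by (rule E.comb_closed)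
    moreover have "\<phi> (comb E e n (\<lambda>i. fps_X ^ i * g i)) = \<zero>\<^bsub>L\<^esub>" using cm[of n] z by simp
    ultimately have "comb E e n (\<lambda>i. fps_X ^ i * g i) = \<zero>\<^bsub>E\<^esub>" using emb P.hom_inj_iff by (auto simp: embeds_def)
    moreover have "indep E e n" using E.basis by (simp add: E.basis_def)
    ultimately have "fps_X ^ i * g i = 0" using i by (auto simp: indep_def)
    then show "g i = 0" by simp
  qed
  then have bM: "M.basis \<epsilon> n"
    unfolding M.basis_def using \<epsilon>N by (auto simp: L.comb_sub_mod N0_def indep_def)
  interpret SB: saturated_basis "sub_mod L N0" m S \<epsilon> n
    by unfold_locales (use bM n E.S0 lin_\<epsilon> in auto)
  \<comment> \<open>For minimality the divisions are repeated inside an arbitrary competitor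
    \<open>N\<close>: it contains the top vector, and stability under \<open>b^(-1) a\<close>
    produces the lower ones in turn.\<close>
  have "saturation L (\<phi> ` carrier E) = N0"
    unfolding saturation_def
  proof (rule antisym[OF Inter_lower Inter_greatest])
    have "\<phi> ` carrier E \<subseteq> N0"
    proof safe
      fix x assume "x \<in> carrier E"
      then obtain g where x: "x = comb E e n g" using E.basis by (auto simp: E.basis_def)
      have "\<phi> (comb E e k g) \<in> N0" if "k \<le> n" for k
        using that
      proof (induction k)
        case (Suc k)
        have c: "e k \<in> carrier E" "comb E e k g \<in> carrier E" using Suc.prems E.e_closed by (auto intro!: E.comb_closed)
        have "\<phi> (e k) \<in> N0" using \<epsilon>[of k] \<epsilon>N[of k] N0D(4) Suc.prems by simp
        then show ?case using Suc c N0D(3,4) by (simp add: comb.simps(2) P.hD E.lsmult_closed)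
      qed (simp add: P.hom_zero N0D)
      then show "\<phi> x \<in> N0" using x by blast
    qed
    moreover have "(\<lambda>x. avar \<odot>\<^bsub>L\<^esub> x) ` N0 \<subseteq> (\<lambda>x. bvar \<odot>\<^bsub>L\<^esub> x) ` N0"
    proof safe
      fix x assume "x \<in> N0"
      then obtain g where x: "x = comb L \<epsilon> n g" by (auto simp: N0_def)
      show "avar \<odot>\<^bsub>L\<^esub> x \<in> (\<lambda>x. bvar \<odot>\<^bsub>L\<^esub> x) ` N0"
        using SB.avar_comb[of g] unfolding x by (auto simp: L.comb_sub_mod N0_def)
    qed
    ultimately show "N0 \<in> {N. left_submodule N L \<and> \<phi> ` carrier E \<subseteq> N \<and> (\<lambda>x. avar \<odot>\<^bsub>L\<^esub> x) ` N \<subseteq> (\<lambda>x. bvar \<odot>\<^bsub>L\<^esub> x) ` N}"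
      using N0 by blast
  next
    fix N assume "N \<in> {N. left_submodule N L \<and> \<phi> ` carrier E \<subseteq> N \<and> (\<lambda>x. avar \<odot>\<^bsub>L\<^esub> x) ` N \<subseteq> (\<lambda>x. bvar \<odot>\<^bsub>L\<^esub> x) ` N}"
    then have N: "left_submodule N L" "\<phi> ` carrier E \<subseteq> N"
      and pole: "\<And>x. x \<in> N \<Longrightarrow> \<exists>y\<in>N. avar \<odot>\<^bsub>L\<^esub> x = of_fps fps_X \<odot>\<^bsub>L\<^esub> y" by (auto simp: bvar_of_fps)
    note ND = left_submoduleD[OF N(1)]
    have "\<epsilon> (n - Suc k) \<in> N" if "k < n" for k
      using that
    proof (induction k)
      case 0
      have "\<epsilon> (n - 1) = \<phi> (e (n - 1))" using \<epsilon>[of "n - 1"] n by (simp add: L.lsmult_one)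
      then show ?case using N(2) E.e_closed[of "n - 1"] n by auto
    next
      case (Suc k)
      define j where "j = n - Suc k"
      have j: "j < n" "j > 0" "n - Suc (Suc k) = j - 1" using Suc.prems by (auto simp: j_def)
      have \<epsilon>j: "\<epsilon> j \<in> N" using Suc by (simp add: j_def)
      obtain y where y: "y \<in> N" "avar \<odot>\<^bsub>L\<^esub> \<epsilon> j = of_fps fps_X \<odot>\<^bsub>L\<^esub> y" using pole[OF \<epsilon>j] by blast
      define y' where "y' = y \<ominus>\<^bsub>L\<^esub> acst (m j) \<odot>\<^bsub>L\<^esub> \<epsilon> j"
      have y': "y' \<in> N" unfolding y'_def using y \<epsilon>j ND(4,6) by blast
      have yc: "y \<in> carrier L" "y' \<in> carrier L" using y y' ND(1) by auto
      have "lin (m j) \<odot>\<^bsub>L\<^esub> \<epsilon> j = of_fps fps_X \<odot>\<^bsub>L\<^esub> y'"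
        using y yc \<epsilon>c[OF j(1)]
        by (simp add: y'_def lin_alt L.lsmult_diff L.lsmult_rdiff L.lsmult_closed L.fs_mult mult.commute)
      then have "of_fps (fps_X ^ 1) \<odot>\<^bsub>L\<^esub> (of_fps (S (j - 1)) \<odot>\<^bsub>L\<^esub> \<epsilon> (j - 1)) = of_fps (fps_X ^ 1) \<odot>\<^bsub>L\<^esub> y'"
        using lin_\<epsilon>[OF j(1)] j \<epsilon>c[of "j - 1"] by (simp add: L.fs_mult)
      moreover have ej: "\<epsilon> (j - 1) \<in> carrier L" using \<epsilon>c[of "j - 1"] j by simp
      ultimately have "of_fps (S (j - 1)) \<odot>\<^bsub>L\<^esub> \<epsilon> (j - 1) = y'"
        using X_inj[OF L.lsmult_closed[OF ej] yc(2)] by blast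
      then have "of_fps (inverse (S (j - 1))) \<odot>\<^bsub>L\<^esub> y' = of_fps (inverse (S (j - 1)) * S (j - 1)) \<odot>\<^bsub>L\<^esub> \<epsilon> (j - 1)"
        using L.fs_mult[OF ej, of "inverse (S (j - 1))" "S (j - 1)"] by simp
      also have "\<dots> = \<epsilon> (j - 1)" using S_inv[of "j - 1"] j ej by (simp add: L.lsmult_one)
      finally show ?case using ND(4)[OF y', of "of_fps (inverse (S (j - 1)))"] j(3) by simp
    qed
    note \<epsilon>N' = this
    have "\<epsilon> j \<in> N" if "j < n" for j
    proof -
      have "n - Suc (n - Suc j) = j" "n - Suc j < n" using that by auto
      then show ?thesis using \<epsilon>N'[of "n - Suc j"] by simp
    qed
    then show "N0 \<subseteq> N" unfolding N0_def by (rule L.spn_least[OF N(1)])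
  qed
  then show ?thesis using SB.bernstein_simple_pole_eq by (simp add: m_def)
qed

lemma bernstein_chain:
  assumes ch: "chain E l S e n" and n: "n > 0" and reg: "regular E"
  shows "bernstein E = (\<Prod>j<n. [:l j - of_nat (n - 1 - j), 1:])"
  unfolding bernstein_def
proof (rule the_equality)
  show "\<exists>(L :: (atilde, ab_univ) module) \<phi>. simple_pole L \<and> embeds \<phi> E L \<and>
      (\<Prod>j<n. [:l j - of_nat (n - 1 - j), 1:]) = bernstein_simple_pole (sub_mod L (saturation L (\<phi> ` carrier E)))"
  proof -
    obtain L :: "(atilde, ab_univ) module" and \<phi> where L: "simple_pole L" "embeds \<phi> E L"
      using reg by (auto simp: regular_def)
    show ?thesis
      by (intro exI[of _ L] exI[of _ \<phi>] conjI L bernstein_of_embedding[OF ch n L, symmetric])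
  qed
qed (use bernstein_of_embedding[OF ch n] in auto)

lemma bernstein_chain_root_iff:
  assumes "chain E l S e n" "n > 0" "regular E"
  shows "poly (bernstein E) z = 0 \<longleftrightarrow> (\<exists>j<n. z = of_nat (n - 1 - j) - l j)"
proof -
  have eq: "x - y + z = 0 \<longleftrightarrow> z = y - x" for x y z :: complex
    by (auto simp: algebra_simps eq_neg_iff_add_eq_0)
  have "poly (\<Prod>j<n. [:a j, 1:]) z = 0 \<longleftrightarrow> (\<exists>j<n. a j + z = 0)" for a :: "nat \<Rightarrow> complex"
    by (auto simp: poly_prod)
  then show ?thesis unfolding bernstein_chain[OF assms] by (simp only: eq)
qed

section \<open>Polynomial dependence\<close>

definition mono_eval :: "('v \<Rightarrow>\<^sub>0 nat) \<Rightarrow> ('v \<Rightarrow> complex) \<Rightarrow> complex" where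
  "mono_eval m s = (\<Prod>v\<in>Poly_Mapping.keys m. s v ^ Poly_Mapping.lookup m v)"

lemma mono_eval_superset:
  assumes "finite A" "Poly_Mapping.keys m \<subseteq> A"
  shows "mono_eval m s = (\<Prod>v\<in>A. s v ^ Poly_Mapping.lookup m v)"
  unfolding mono_eval_def using assms by (intro prod.mono_neutral_left) (auto simp: in_keys_iff)

lemma mono_eval_times_var: "mono_eval (m + Poly_Mapping.single v 1) s = mono_eval m s * s v"
proof -
  let ?A = "insert v (Poly_Mapping.keys m)"
  have k: "Poly_Mapping.keys (m + Poly_Mapping.single v 1) \<subseteq> ?A"
    using Poly_Mapping.keys_add[of m "Poly_Mapping.single v 1"] by (auto split: if_splits)
  have "mono_eval (m + Poly_Mapping.single v 1) s =
      (\<Prod>u\<in>?A. s u ^ Poly_Mapping.lookup m u * (if u = v then s v else 1))"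
    using k by (subst mono_eval_superset[of ?A])
      (auto simp: lookup_add lookup_single power_add when_def intro!: prod.cong)
  also have "\<dots> = mono_eval m s * s v"
    using mono_eval_superset[of ?A m s] by (simp add: prod.distrib subset_insertI)
  finally show ?thesis .
qed

lemma mpoly_eval_superset:
  assumes "finite A" "Poly_Mapping.keys f \<subseteq> A"
  shows "mpoly_eval f s = (\<Sum>m\<in>A. Poly_Mapping.lookup f m * mono_eval m s)"
  unfolding mpoly_eval_def mono_eval_def[symmetric] using assms
  by (intro sum.mono_neutral_left) (auto simp: in_keys_iff)

lemma mpoly_eval_add: "mpoly_eval (f + g) s = mpoly_eval f s + mpoly_eval g s"
proof -
  let ?A = "Poly_Mapping.keys f \<union> Poly_Mapping.keys g"
  have "mpoly_eval (f + g) s = (\<Sum>m\<in>?A. Poly_Mapping.lookup (f + g) m * mono_eval m s)"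
    using Poly_Mapping.keys_add[of f g] by (intro mpoly_eval_superset) auto
  also have "\<dots> = mpoly_eval f s + mpoly_eval g s"
    using mpoly_eval_superset[of ?A f s] mpoly_eval_superset[of ?A g s]
    by (simp add: lookup_add distrib_right sum.distrib)
  finally show ?thesis .
qed

lemma mpoly_eval_single: "mpoly_eval (Poly_Mapping.single m c) s = c * mono_eval m s"
  by (simp add: mpoly_eval_def mono_eval_def lookup_single)

definition poly_fun :: "'v set \<Rightarrow> (('v \<Rightarrow> complex) \<Rightarrow> complex) \<Rightarrow> bool" where
  "poly_fun V g \<longleftrightarrow> (\<exists>f :: ('v \<Rightarrow>\<^sub>0 nat) \<Rightarrow>\<^sub>0 complex.
     (\<forall>m\<in>Poly_Mapping.keys f. Poly_Mapping.keys m \<subseteq> V) \<and> (\<forall>s. mpoly_eval f s = g s))"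

lemma poly_fun_mono: "Poly_Mapping.keys m \<subseteq> V \<Longrightarrow> poly_fun V (\<lambda>s. c * mono_eval m s)"
  unfolding poly_fun_def
  by (intro exI[of _ "Poly_Mapping.single m c"]) (auto simp: mpoly_eval_single split: if_splits)

lemma poly_fun_const: "poly_fun V (\<lambda>s. c)"
  using poly_fun_mono[of 0 V c] by (simp add: mono_eval_def)

lemma poly_fun_add:
  assumes "poly_fun V g" "poly_fun V h"
  shows "poly_fun V (\<lambda>s. g s + h s)"
proof -
  obtain f f' where "\<forall>m\<in>Poly_Mapping.keys f. Poly_Mapping.keys m \<subseteq> V" "\<forall>s. mpoly_eval f s = g s"
    "\<forall>m\<in>Poly_Mapping.keys f'. Poly_Mapping.keys m \<subseteq> V" "\<forall>s. mpoly_eval f' s = h s"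
    using assms unfolding poly_fun_def by blast
  then have "(\<forall>m\<in>Poly_Mapping.keys (f + f'). Poly_Mapping.keys m \<subseteq> V) \<and>
      (\<forall>s. mpoly_eval (f + f') s = g s + h s)"
    using Poly_Mapping.keys_add[of f f'] by (auto simp: mpoly_eval_add simp del: keys_add) blast
  then show ?thesis unfolding poly_fun_def by blast
qed

lemma poly_fun_sum: "finite A \<Longrightarrow> (\<And>i. i \<in> A \<Longrightarrow> poly_fun V (g i)) \<Longrightarrow> poly_fun V (\<lambda>s. \<Sum>i\<in>A. g i s)"
  by (induction A rule: finite_induct) (auto intro: poly_fun_const poly_fun_add)

lemma poly_fun_scale_var:
  assumes "poly_fun V g" "v \<in> V"
  shows "poly_fun V (\<lambda>s. c * g s)" "poly_fun V (\<lambda>s. s v * g s)"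
proof -
  obtain f where f: "\<forall>m\<in>Poly_Mapping.keys f. Poly_Mapping.keys m \<subseteq> V" "\<forall>s. mpoly_eval f s = g s"
    using assms unfolding poly_fun_def by blast
  have g: "g s = (\<Sum>m\<in>Poly_Mapping.keys f. Poly_Mapping.lookup f m * mono_eval m s)" for s
    using mpoly_eval_superset[of "Poly_Mapping.keys f" f s] f by simp
  have "poly_fun V (\<lambda>s. \<Sum>m\<in>Poly_Mapping.keys f. (c * Poly_Mapping.lookup f m) * mono_eval m s)"
    using f by (intro poly_fun_sum poly_fun_mono) auto
  then show "poly_fun V (\<lambda>s. c * g s)" by (simp add: g sum_distrib_left mult.assoc)
  have "Poly_Mapping.keys (m + Poly_Mapping.single v 1) \<subseteq> V" if "m \<in> Poly_Mapping.keys f" for m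
    using that f assms(2) Poly_Mapping.keys_add[of m "Poly_Mapping.single v 1"] by (auto split: if_splits)
  then have "poly_fun V (\<lambda>s. \<Sum>m\<in>Poly_Mapping.keys f. Poly_Mapping.lookup f m * mono_eval (m + Poly_Mapping.single v 1) s)"
    by (intro poly_fun_sum poly_fun_mono) auto
  then show "poly_fun V (\<lambda>s. s v * g s)"
    unfolding mono_eval_times_var by (simp add: g sum_distrib_left mult_ac)
qed

lemma poly_fun_unit_series_mult:
  assumes "\<And>i. poly_fun ({..<n} \<times> {1..}) (\<lambda>s. g s $ i)" "j < n"
  shows "poly_fun ({..<n} \<times> {1..}) (\<lambda>s. (unit_series s j * g s) $ i)"
proof -
  have "poly_fun ({..<n} \<times> {1..}) (\<lambda>s. unit_series s j $ k * g s $ (i - k))" for k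
    using assms poly_fun_scale_var(2)[OF assms(1), of "(j, k)"] by (cases "k = 0") (auto simp: unit_series_def)
  then show ?thesis unfolding fps_mult_nth by (intro poly_fun_sum) auto
qed

text \<open>The recursion divides only by numbers that depend on \<open>d\<close> and not on the
  variables, so every coefficient stays polynomial.\<close>

lemma poly_fun_canon: "j \<le> n \<Longrightarrow> poly_fun ({..<n} \<times> {1..}) (\<lambda>s. canon d (unit_series s) j $ i)"
proof (induction j arbitrary: i)
  case 0
  show ?case by (simp add: poly_fun_const)
next
  case (Suc j)
  have "poly_fun ({..<n} \<times> {1..}) (\<lambda>s. (unit_series s j * canon d (unit_series s) j) $ i)"
    using Suc by (intro poly_fun_unit_series_mult) auto
  then have "poly_fun ({..<n} \<times> {1..}) (\<lambda>s. inverse (of_int (int i - int (Suc j) - d (Suc j))) *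
      (unit_series s j * canon d (unit_series s) j) $ i)"
    using Suc.prems by (intro poly_fun_scale_var(1)[where v = "(j, 1)"]) auto
  then show ?case by (simp add: divide_inverse mult.commute)
qed

lemma poly_fun_obstr:
  assumes "n \<ge> 2"
  shows "poly_fun ({..<n} \<times> {1..}) (\<lambda>s. c * obstr d (unit_series s) n)"
  unfolding obstr_def using assms
  by (intro poly_fun_scale_var(1)[where v = "(0, 1)"] poly_fun_unit_series_mult poly_fun_canon) auto

section \<open>Submodules and quotients\<close>

lemma chain_cong:
  assumes "chain M l S e n" "\<And>i. i < n \<Longrightarrow> l i = l' i" "\<And>i. Suc i < n \<Longrightarrow> S i = S' i"
  shows "chain M l' S' e n"
  using assms unfolding chain_def by (auto split: if_splits)

lemma regular_sub_mod:
  assumes reg: "regular M" and N: "left_submodule N M" and rk: "has_rank (sub_mod M N) k"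
  shows "regular (sub_mod M N)"
proof -
  interpret left_module M using reg by (auto simp: regular_def ab_module_def)
  obtain L :: "(atilde, ab_univ) module" and \<phi> where L: "simple_pole L" "embeds \<phi> M L"
    using reg by (auto simp: regular_def)
  have "embeds \<phi> (sub_mod M N) L"
    using L(2) left_submoduleD(1)[OF N] by (auto simp: embeds_def lmod_hom_def subset_iff intro: inj_on_subset)
  moreover have "ab_module (sub_mod M N)"
    using sub_mod_left_module[OF N] rk by (auto simp: ab_module_def)
  ultimately show ?thesis unfolding regular_def using L(1) by blast
qed

lemma semi_simple_sub_mod:
  assumes ss: "semi_simple M" and N: "left_submodule N M" and rk: "has_rank (sub_mod M N) k"
  shows "semi_simple (sub_mod M N)"
proof -
  have reg: "regular M" using ss by (simp add: semi_simple_def)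
  then have M: "left_module M" by (auto simp: regular_def ab_module_def)
  obtain n and R :: "nat \<Rightarrow> (atilde, ab_univ) module" and K where
    R: "\<forall>i<n. regular (R i) \<and> has_rank (R i) 1" and
    K: "left_submodule K (direct_sum n R)" and iso: "lmod_iso M (sub_mod (direct_sum n R) K)"
    using ss unfolding semi_simple_def by blast
  have "left_module (R i)" if "i < n" for i using R that by (auto simp: regular_def ab_module_def)
  then have D: "left_module (direct_sum n R)" by (rule direct_sum_left_module)
  obtain h where h: "h \<in> lmod_hom M (sub_mod (direct_sum n R) K)"
    and bij: "bij_betw h (carrier M) (carrier (sub_mod (direct_sum n R) K))"
    using iso by (rule lmod_isoE)
  have NM: "N \<subseteq> carrier M" using left_submoduleD(1)[OF N] .
  have KD: "K \<subseteq> carrier (direct_sum n R)" using left_submoduleD(1)[OF K] .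
  have h': "h \<in> lmod_hom (sub_mod M N) (direct_sum n R)"
    using h NM KD by (auto simp: lmod_hom_def subset_iff)
  have S: "left_module (sub_mod M N)" using left_module.sub_mod_left_module[OF M N] .
  interpret P: lmod_pair "sub_mod M N" "direct_sum n R" h by (rule lmod_pairI[OF S D h'])
  have sub: "left_submodule (h ` N) (direct_sum n R)" using P.image_submodule by simp
  have "h \<in> lmod_hom (sub_mod M N) (sub_mod (direct_sum n R) (h ` N))"
    using h' by (auto simp: lmod_hom_def)
  moreover have "bij_betw h (carrier (sub_mod M N)) (carrier (sub_mod (direct_sum n R) (h ` N)))"
    using bij NM by (auto simp: bij_betw_def intro: inj_on_subset)
  ultimately have iso': "lmod_iso (sub_mod M N) (sub_mod (direct_sum n R) (h ` N))" by (auto simp: lmod_iso_def)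
  show ?thesis
    unfolding semi_simple_def
    by (intro conjI regular_sub_mod[OF reg N rk] exI[of _ n] exI[of _ R] exI[of _ "h ` N"] R sub iso')
qed

text \<open>Cosets of \<open>N\<close> are the same sets in \<open>G\<close> and in
  \<open>M\<close>. So the two modules are equal and not merely isomorphic, and semi-simplicity
  passes to the quotient of \<open>G\<close> without any transport.\<close>

lemma quot_sub_mod:
  fixes M :: "('r::ring_1, 'm) module" (structure)
  assumes M: "left_module M" and N: "left_submodule N M" and G: "left_submodule G M" and NG: "N \<subseteq> G"
  shows "quot_mod (sub_mod M G) N = sub_mod (quot_mod M N) ((+>) N ` G)"
    "left_submodule ((+>) N ` G) (quot_mod M N)"
proof -
  interpret Q: left_quotient M N by (rule left_quotientI[OF M N])
  have rc: "N +>\<^bsub>sub_mod M G\<^esub> x = N +> x" for x by (simp add: a_r_coset_def')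
  have sa: "X <+>\<^bsub>sub_mod M G\<^esub> Y = set_add M X Y" for X Y by (simp add: set_add_def')
  show "quot_mod (sub_mod M G) N = sub_mod (quot_mod M N) ((+>) N ` G)"
    unfolding quot_mod_def rc sa by (auto simp: A_RCOSETS_def' rc)
  have "lmod_pair (sub_mod M G) (quot_mod M N) Q.cls"
    using Q.cls_hom left_submoduleD(1)[OF G]
    by (intro lmod_pairI Q.sub_mod_left_module[OF G] Q.quot_left_module) (auto simp: lmod_hom_def subset_iff)
  from lmod_pair.image_submodule[OF this] show "left_submodule ((+>) N ` G) (quot_mod M N)" by simp
qed

lemma (in ab_chain) quot_chain:
  assumes n: "n > 0"
  shows "chain (quot_mod M (spn M e 1)) (\<lambda>i. l (Suc i)) (\<lambda>i. S (Suc i)) (\<lambda>i. spn M e 1 +> e (Suc i)) (n - 1)"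
proof -
  define F1 where "F1 = spn M e 1"
  have s1: "left_submodule F1 M" unfolding F1_def using n by (intro spn_sub) simp
  interpret Q: left_quotient M F1 by (rule left_quotientI[OF left_module_axioms s1])
  let ?Q = "quot_mod M F1"
  interpret QQ: ab_left ?Q by (rule ab_leftI[OF Q.quot_left_module])
  define e' where "e' i = Q.cls (e (Suc i))" for i
  have e1: "e (Suc i) \<in> carrier M" if "i < n - 1" for i using e_closed that by simp
  have ec: "e' i \<in> carrier ?Q" if "i < n - 1" for i by (simp only: e'_def Q.quot_carrier imageI e1[OF that])
  have cm: "comb ?Q e' k g = Q.cls (comb M (\<lambda>i. e (Suc i)) k g)" if "k \<le> n - 1" for k g
    using that
  proof (induction k)
    case 0
    show ?case using Q.cls_eq_zero_iff[of \<zero>] Q.N_props(2) by (simp add: Q.quot_zero)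
  next
    case (Suc k)
    have "comb M (\<lambda>i. e (Suc i)) k g \<in> carrier M" "e (Suc k) \<in> carrier M"
      using Suc.prems e1 by (auto intro!: comb_closed)
    then show ?case using Suc by (simp add: comb.simps(2) e'_def Q.quot_smult Q.quot_add lsmult_closed)
  qed
  have full: "comb M e n g = of_fps (g 0) \<odot> e 0 \<oplus> comb M (\<lambda>i. e (Suc i)) (n - 1) (\<lambda>i. g (Suc i))" for g
    using comb_Suc_shift[of "n - 1" e g] e_closed n by simp
  have e0: "of_fps f \<odot> e 0 \<in> F1" for f
  proof -
    have "comb M e 1 (\<lambda>_. f) = of_fps f \<odot> e 0" using e_closed[of 0] n by (simp add: comb.simps(2) lsmult_closed)
    then show ?thesis unfolding F1_def by (metis rangeI)
  qed
  have tc: "comb M (\<lambda>i. e (Suc i)) (n - 1) g \<in> carrier M" for g using e1 by (rule comb_closed)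
  have "QQ.basis e' (n - 1)"
    unfolding QQ.basis_def
  proof (intro conjI allI impI)
    show "e' i \<in> carrier ?Q" if "i < n - 1" for i by (rule ec[OF that])
    show "carrier ?Q = spn ?Q e' (n - 1)"
    proof
      show "spn ?Q e' (n - 1) \<subseteq> carrier ?Q" using ec by (auto intro: QQ.comb_closed)
      show "carrier ?Q \<subseteq> spn ?Q e' (n - 1)"
      proof
        fix X assume "X \<in> carrier ?Q"
        then obtain x where x: "x \<in> carrier M" "X = Q.cls x" by (auto simp: Q.quot_carrier)
        define t where "t = comb M (\<lambda>i. e (Suc i)) (n - 1) (\<lambda>i. c x (Suc i))"
        have t: "t \<in> carrier M" unfolding t_def by (rule tc)
        define w where "w = of_fps (c x 0) \<odot> e 0"
        have w: "w \<in> carrier M" "w \<in> F1" using e_closed[of 0] n e0 by (simp_all add: w_def lsmult_closed)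
        have "x = w \<oplus> t" using full[of "c x"] comb_crd[OF basis x(1)] by (simp add: t_def w_def)
        then have "x \<ominus> t = w" using t w by (simp add: a_minus_def a_assoc r_neg)
        then have "Q.cls x = Q.cls t" using Q.cls_eq_iff[OF x(1) t] w by simp
        then show "X \<in> spn ?Q e' (n - 1)" using cm[of "n - 1"] by (auto simp: x(2) t_def)
      qed
    qed
    show "indep ?Q e' (n - 1)"
      unfolding indep_def
    proof (intro allI impI)
      fix g i assume z: "comb ?Q e' (n - 1) g = \<zero>\<^bsub>?Q\<^esub>" and i: "i < n - 1"
      define x where "x = comb M (\<lambda>i. e (Suc i)) (n - 1) g"
      have x: "x \<in> carrier M" unfolding x_def by (rule tc)
      have "x \<in> F1" using z cm[of "n - 1" g] Q.cls_eq_zero_iff[OF x] by (simp add: x_def Q.quot_zero)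
      then have 0: "c x (Suc i) = 0" using spn_crd_iff[OF basis _ x, of 1] n unfolding F1_def by auto
      have "x = comb M e n (case_nat 0 g)" using full[of "case_nat 0 g"] e_closed[of 0] n x by (simp add: x_def)
      then have "c x (Suc i) = g i" using crd_unique[OF basis, of x "case_nat 0 g" "Suc i"] i by simp
      then show "g i = 0" using 0 by simp
    qed
  qed
  moreover have "lin (l (Suc i)) \<odot>\<^bsub>?Q\<^esub> e' i = (if i = 0 then \<zero>\<^bsub>?Q\<^esub> else of_fps (S (Suc (i - 1))) \<odot>\<^bsub>?Q\<^esub> e' (i - 1))"
    if i: "i < n - 1" for i
  proof -
    have "lin (l (Suc i)) \<odot>\<^bsub>?Q\<^esub> e' i = Q.cls (of_fps (S i) \<odot> e i)"
      using lin_e[of "Suc i"] e1[OF i] i by (simp add: e'_def Q.quot_smult)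
    also have "\<dots> = (if i = 0 then \<zero>\<^bsub>?Q\<^esub> else of_fps (S (Suc (i - 1))) \<odot>\<^bsub>?Q\<^esub> e' (i - 1))"
    proof (cases i)
      case 0
      then show ?thesis using Q.cls_eq_zero_iff[of "of_fps (S 0) \<odot> e 0"] e0 by (simp add: Q.quot_zero)
    next
      case (Suc j)
      then show ?thesis using e1[of j] i by (simp add: e'_def Q.quot_smult)
    qed
    finally show ?thesis .
  qed
  ultimately show ?thesis
    using S0 unfolding chain_def F1_def[symmetric] e'_def[symmetric] by (auto intro: Q.quot_left_module)
qed

section \<open>Frescos with semi-simple \<open>F\<^sub>k\<^sub>-\<^sub>1\<close> and \<open>E/F\<^sub>1\<close>\<close>

definition inv_seq :: "real list \<Rightarrow> nat \<Rightarrow> complex" where "inv_seq ls i = complex_of_real (ls ! i)"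

text \<open>The floor merely converts to an integer: by \<open>good_roots_dd\<close> the difference
  is integral for the invariants of a primitive module.\<close>

definition inv_diff :: "real list \<Rightarrow> nat \<Rightarrow> int" where "inv_diff ls i = \<lfloor>ls ! i - ls ! 0\<rfloor>"

text \<open>The numerical half of \<open>admissible_invariants\<close>. It can be checked for the
  reduced list at once, whereas the existence of a fresco with these invariants comes only with the
  construction of G.\<close>

definition adm :: "real list \<Rightarrow> bool" where
  "adm ls \<longleftrightarrow> length ls \<ge> 2 \<and> (\<forall>j. Suc j < length ls \<longrightarrow> p_inv ls j \<ge> 1)"

lemma adm_mono: "adm ls \<Longrightarrow> i \<le> j \<Longrightarrow> j < length ls \<Longrightarrow> ls ! i \<le> ls ! j"
proof (induction j)
  case (Suc j)
  then have "ls ! j \<le> ls ! Suc j" by (auto simp: adm_def p_inv_def)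
  then show ?case using Suc by (cases "i = Suc j") auto
qed simp

text \<open>
  With indices from 0 the roots of the Bernstein polynomial are \<open>k - 1 - j - \<lambda>\<^sub>j\<close>; they have to be rational,
  negative and in \<open>-\<lambda> + \<int>\<close>.
\<close>

definition good_roots :: "real \<Rightarrow> real list \<Rightarrow> bool" where
  "good_roots lam ls \<longleftrightarrow> (\<forall>j<length ls. ls ! j \<in> \<rat> \<and> real (length ls - 1 - j) < ls ! j \<and> (\<exists>m::int. ls ! j = lam + of_int m))"

lemma good_roots_dd:
  assumes "good_roots lam ls" "i < length ls"
  shows "ls ! i - ls ! 0 = of_int (inv_diff ls i)"
proof -
  obtain m m' :: int where "ls ! i = lam + of_int m" "ls ! 0 = lam + of_int m'"
    using assms unfolding good_roots_def by (metis gr_zeroI not_less0)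
  then have "ls ! i - ls ! 0 = of_int (m - m')" by simp
  then show ?thesis unfolding inv_diff_def by (simp only: floor_of_int)
qed

lemma good_rootsI:
  assumes ch: "chain E (inv_seq ls) S e (length ls)" and n: "ls \<noteq> []" and g: "geometric E" and p: "primitive lam E"
  shows "good_roots lam ls"
  unfolding good_roots_def
proof (intro allI impI)
  fix j assume j: "j < length ls"
  define z where "z = of_nat (length ls - 1 - j) - inv_seq ls j"
  have reg: "regular E" using g by (simp add: geometric_def)
  have z0: "poly (bernstein E) z = 0"
    using bernstein_chain_root_iff[OF ch _ reg, of z] n j by (auto simp: z_def)
  have z: "z = complex_of_real (real (length ls - 1 - j) - ls ! j)" by (simp add: z_def inv_seq_def)
  have "z \<in> \<rat>" "Re z < 0" using g z0 by (auto simp: geometric_def)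
  then have "real (length ls - 1 - j) - ls ! j \<in> \<rat>" unfolding z by (simp only: Rats_complex_of_real_iff)
  then have "real (length ls - 1 - j) - (real (length ls - 1 - j) - ls ! j) \<in> \<rat>" by (rule Rats_diff[OF Rats_of_nat])
  moreover have "real (length ls - 1 - j) - (real (length ls - 1 - j) - ls ! j) = ls ! j" by linarith
  ultimately have "ls ! j \<in> \<rat>" by (simp only:)
  moreover have "real (length ls - 1 - j) < ls ! j" using \<open>Re z < 0\<close> by (simp add: z)
  moreover have "\<exists>m::int. ls ! j = lam + of_int m"
  proof -
    obtain m :: int where "z = - of_real lam + of_int m" using p z0 by (auto simp: primitive_def)
    then have "complex_of_real (real (length ls - 1 - j) - ls ! j) = complex_of_real (- lam + of_int m)" using z by simp
    then have "real (length ls - 1 - j) - ls ! j = - lam + of_int m" by (simp only: of_real_eq_iff)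
    then have "ls ! j = lam + of_int (int (length ls - 1 - j) - m)" by simp
    then show ?thesis by blast
  qed
  ultimately show "ls ! j \<in> \<rat> \<and> real (length ls - 1 - j) < ls ! j \<and> (\<exists>m::int. ls ! j = lam + of_int m)" by blast
qed

text \<open>Converse of \<open>good_rootsI\<close>: it recognizes the submodule G as geometric and
  primitive from its list of invariants.\<close>

lemma good_roots_geometric:
  assumes ch: "chain E (inv_seq ls) S e (length ls)" and n: "ls \<noteq> []" and reg: "regular E" and g: "good_roots lam ls"
  shows "geometric E" "primitive lam E"
proof -
  have *: "z \<in> \<rat> \<and> Re z < 0 \<and> (\<exists>m::int. z = - of_real lam + of_int m)" if z0: "poly (bernstein E) z = 0" for z
  proof -
    have "length ls > 0" using n by simp
    then obtain j where j: "j < length ls" "z = of_nat (length ls - 1 - j) - inv_seq ls j"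
      using z0 bernstein_chain_root_iff[OF ch _ reg] by blast
    have z: "z = complex_of_real (real (length ls - 1 - j) - ls ! j)" using j by (simp add: inv_seq_def)
    obtain m :: int where m: "ls ! j = lam + of_int m" using g j by (auto simp: good_roots_def)
    have "ls ! j \<in> \<rat>" using g j by (auto simp: good_roots_def)
    then have "z \<in> \<rat>" unfolding z by (simp only: Rats_complex_of_real_iff) (intro Rats_diff, simp_all)
    moreover have "z = - of_real lam + of_int (int (length ls - 1 - j) - m)" using z m by simp
    moreover have "Re z = real (length ls - 1 - j) - ls ! j" unfolding z by (rule Re_complex_of_real)
    moreover have "real (length ls - 1 - j) < ls ! j" using g j(1) unfolding good_roots_def by blast
    moreover from calculation have "Re z < 0" by linarith
    ultimately show ?thesis by blast
  qed
  show "geometric E" using * reg by (auto simp: geometric_def)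
  show "primitive lam E" using * reg by (auto simp: primitive_def)
qed

lemma principal_JH_chain:
  fixes E :: "(atilde, 'm) module"
  assumes "left_module E" "principal_JH E F ls" "is_generator E w" "ls \<noteq> []"
  obtains S e u where "chain E (inv_seq ls) S e (length ls)" "\<And>j. j \<le> length ls \<Longrightarrow> F j = spn E e j"
    "w = of_fps u \<odot>\<^bsub>E\<^esub> e (length ls - 1)" "u $ 0 = 1"
proof -
  have J: "JH_sequence E F (map complex_of_real ls)" using assms(2) by (simp add: principal_JH_def)
  obtain S e u where *: "chain E (\<lambda>i. map complex_of_real ls ! i) S e (length (map complex_of_real ls))"
    "\<And>j. j \<le> length (map complex_of_real ls) \<Longrightarrow> F j = spn E e j"
    "w = of_fps u \<odot>\<^bsub>E\<^esub> e (length (map complex_of_real ls) - 1)" "u $ 0 = 1"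
    by (rule JH_chain_exists[OF assms(1) J assms(3)]) (use assms(4) in auto)
  have "chain E (inv_seq ls) S e (length ls)"
    by (rule chain_cong[OF *(1)[unfolded length_map]]) (auto simp: inv_seq_def)
  then show thesis using that *(2-4) by auto
qed

lemma chain_principal_JH:
  assumes ch: "chain E (inv_seq ls) S e (length ls)" and "\<And>i j. i \<le> j \<Longrightarrow> j < length ls \<Longrightarrow> ls ! i + real i \<le> ls ! j + real j"
  shows "principal_JH E (spn E e) ls"
proof -
  have "chain E (\<lambda>i. map complex_of_real ls ! i) S e (length (map complex_of_real ls))"
    unfolding length_map by (rule chain_cong[OF ch]) (auto simp: inv_seq_def)
  from chain_JH_sequence[OF this] show ?thesis using assms(2) by (auto simp: principal_JH_def)
qed

lemma fresco_left_module: "fresco E \<Longrightarrow> left_module E"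
  by (auto simp: fresco_def geometric_def regular_def ab_module_def)

lemma F0_facts:
  fixes E :: "(atilde, 'm) module"
  assumes F0: "F0_fresco lam ls E" and adm: "adm ls"
  obtains S e where "chain E (inv_seq ls) S e (length ls)" "flat (inv_diff ls) S (length ls)"
    "semi_simple (sub_mod E (spn E e (length ls - 1)))" "semi_simple (quot_mod E (spn E e 1))"
    "good_roots lam ls"
proof -
  let ?n = "length ls"
  have n: "?n \<ge> 2" "ls \<noteq> []" using adm by (auto simp: adm_def)
  obtain F where F: "principal_JH E F ls" "semi_simple (sub_mod E (F (?n - 1)))" "semi_simple (quot_mod E (F 1))"
    and fr: "fresco E" and pr: "primitive lam E" using F0 by (auto simp: F0_fresco_def)
  obtain w where w: "is_generator E w" using fr by (auto simp: fresco_def)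
  obtain S e u where ch: "chain E (inv_seq ls) S e ?n" and FS: "\<And>j. j \<le> ?n \<Longrightarrow> F j = spn E e j"
    by (rule principal_JH_chain[OF fresco_left_module[OF fr] F(1) w n(2)]) blast
  have g: "good_roots lam ls" using good_rootsI[OF ch n(2) _ pr] fr by (simp add: fresco_def)
  interpret R: real_chain E "inv_seq ls" S e ?n "inv_diff ls"
  proof (intro real_chain.intro ab_chainI[OF ch] real_chain_axioms.intro)
    fix i assume "i < ?n"
    then have "ls ! i = ls ! 0 + of_int (inv_diff ls i)" using good_roots_dd[OF g] by (simp add: algebra_simps)
    then show "inv_seq ls i = inv_seq ls 0 + of_int (inv_diff ls i)" unfolding inv_seq_def by (metis of_real_add of_real_of_int_eq)
  qed
  have s: "semi_simple (sub_mod E (spn E e (?n - 1)))" "semi_simple (quot_mod E (spn E e 1))"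
    using F FS[of "?n - 1"] FS[of 1] n by auto
  show thesis using that[OF ch R.flat_of_semi_simple[OF n(1) s] s g] .
qed

lemma good_roots_real_chain:
  assumes "chain E (inv_seq ls) S e (length ls)" "good_roots lam ls"
  shows "real_chain E (inv_seq ls) S e (length ls) (inv_diff ls)"
proof (intro real_chain.intro ab_chainI[OF assms(1)] real_chain_axioms.intro)
  fix i assume "i < length ls"
  then have "ls ! i = ls ! 0 + of_int (inv_diff ls i)" using good_roots_dd[OF assms(2)] by (simp add: algebra_simps)
  then show "inv_seq ls i = inv_seq ls 0 + of_int (inv_diff ls i)" unfolding inv_seq_def by (metis of_real_add of_real_of_int_eq)
qed

lemma F0_chain_obstr:
  fixes E :: "(atilde, 'm) module"
  assumes F0: "F0_fresco lam ls E" and adm: "adm ls"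
    and c1: "chain E (inv_seq ls) S e (length ls)" and c2: "chain E (inv_seq ls) S' e' (length ls)"
  shows "flat (inv_diff ls) S (length ls)" "obstr (inv_diff ls) S' (length ls) = obstr (inv_diff ls) S (length ls)"
proof -
  obtain S0 e0 where c0: "chain E (inv_seq ls) S0 e0 (length ls)" and fl: "flat (inv_diff ls) S0 (length ls)"
    and g: "good_roots lam ls" by (rule F0_facts[OF F0 adm])
  have n: "length ls \<ge> 2" using adm by (simp add: adm_def)
  have *: "flat (inv_diff ls) S (length ls) \<and> obstr (inv_diff ls) S (length ls) = obstr (inv_diff ls) S0 (length ls)"
    if "chain E (inv_seq ls) S e (length ls)" for S e
    by (rule obstr_chain_indep[OF c0 that, of "\<lambda>i. ls ! i"])
       (use adm_mono[OF adm] good_roots_dd[OF g] n fl in \<open>auto simp: inv_seq_def\<close>)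
  show "flat (inv_diff ls) S (length ls)" "obstr (inv_diff ls) S' (length ls) = obstr (inv_diff ls) S (length ls)"
    using *[OF c1] *[OF c2] by auto
qed

section \<open>The invariant\<close>

text \<open>
  The product of resonances makes the value stable under the reduction of the rank, which multiplies
  the obstruction by \<open>\<lambda>\<^sub>k - \<lambda>\<^sub>k\<^sub>-\<^sub>1 + 1\<close> (1-based indices).
\<close>

definition resonance_factor :: "real list \<Rightarrow> complex" where
  "resonance_factor ls = (\<Prod>i\<in>{1..<length ls - 1}. of_real (ls ! (length ls - 1) - ls ! i + real (length ls - 1 - i)))"

text \<open>A definite description because a class comes with neither a preferred representative nor
  a preferred chain; \<open>alpha_val_eq\<close> proves independence of both.\<close>

definition alpha_val :: "real list \<Rightarrow> fresco_univ set \<Rightarrow> complex" where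
  "alpha_val ls C = (THE z. \<exists>E\<in>C. \<exists>S e. chain E (inv_seq ls) S e (length ls) \<and>
     z = resonance_factor ls * obstr (inv_diff ls) S (length ls))"

lemma resonance_factor_nonzero:
  assumes "adm ls"
  shows "resonance_factor ls \<noteq> 0"
proof -
  have "ls ! (length ls - 1) - ls ! i + real (length ls - 1 - i) > 0" if "i \<in> {1..<length ls - 1}" for i
    using that adm_mono[OF assms, of i "length ls - 1"] by (intro add_nonneg_pos) auto
  then show ?thesis unfolding resonance_factor_def by (force simp: prod_zero_iff simp del: of_real_add of_real_diff)
qed

lemma iso_class_self: "left_module (E :: fresco_univ) \<Longrightarrow> E \<in> iso_class E"
  using lmod_iso_refl by (auto simp: iso_class_def)

lemma alpha_val_eq:
  fixes E :: fresco_univ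
  assumes F0: "F0_fresco lam ls E" and adm: "adm ls" and ch: "chain E (inv_seq ls) S e (length ls)"
  shows "alpha_val ls (iso_class E) = resonance_factor ls * obstr (inv_diff ls) S (length ls)"
  unfolding alpha_val_def
proof (rule the_equality)
  have E: "left_module E" using ch by (simp add: chain_def)
  show "\<exists>E\<in>iso_class E. \<exists>S' e. chain E (inv_seq ls) S' e (length ls) \<and>
      resonance_factor ls * obstr (inv_diff ls) S (length ls) = resonance_factor ls * obstr (inv_diff ls) S' (length ls)"
    using iso_class_self[OF E] ch by blast
  fix z assume "\<exists>E\<in>iso_class E. \<exists>S e. chain E (inv_seq ls) S e (length ls) \<and> z = resonance_factor ls * obstr (inv_diff ls) S (length ls)"
  then obtain E' S' e' where E': "E' \<in> iso_class E" "chain E' (inv_seq ls) S' e' (length ls)"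
    and z: "z = resonance_factor ls * obstr (inv_diff ls) S' (length ls)" by blast
  obtain h where "h \<in> lmod_hom E' E" "bij_betw h (carrier E') (carrier E)"
    using E'(1) by (auto simp: iso_class_def lmod_iso_def)
  then have "chain E (inv_seq ls) S' (\<lambda>i. h (e' i)) (length ls)" by (rule chain_transport[OF E'(2) E])
  from F0_chain_obstr(2)[OF F0 adm ch this] show "z = resonance_factor ls * obstr (inv_diff ls) S (length ls)" using z by simp
qed

lemma iso_chain:
  assumes "lmod_iso E' E" "left_module E" "chain E' l S e n"
  obtains e' where "chain E l S e' n"
  using assms chain_transport by (metis lmod_iso_def)

lemma F0_classesE:
  assumes "C \<in> F0_classes lam ls"
  obtains E :: fresco_univ where "C = iso_class E" "F0_fresco lam ls E" "left_module E"
  using assms by (auto simp: F0_classes_def F0_fresco_def intro: fresco_left_module)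

lemma chain_left_module: "chain E l S e n \<Longrightarrow> left_module E" by (simp add: chain_def)

lemma ex_chain_E_of: "\<exists>e. chain (E_of ls s) (inv_seq ls) (unit_series s) e (length ls)"
  using E_of_chain[of ls s] unfolding inv_seq_def .

lemma alpha_val_E_of:
  assumes adm: "adm ls" and C: "iso_class (E_of ls s) \<in> F0_classes lam ls"
  shows "alpha_val ls (iso_class (E_of ls s)) = resonance_factor ls * obstr (inv_diff ls) (unit_series s) (length ls)"
proof -
  obtain E :: fresco_univ where E: "iso_class (E_of ls s) = iso_class E" "F0_fresco lam ls E" "left_module E"
    by (rule F0_classesE[OF C])
  obtain e where ch: "chain (E_of ls s) (inv_seq ls) (unit_series s) e (length ls)" using ex_chain_E_of by blast
  have "lmod_iso (E_of ls s) E" using iso_class_eq_iff[OF chain_left_module[OF ch] E(3)] E(1) by blast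
  then obtain e' where "chain E (inv_seq ls) (unit_series s) e' (length ls)" by (rule iso_chain[OF _ E(3) ch]) blast
  then show ?thesis unfolding E(1) by (rule alpha_val_eq[OF E(2) adm])
qed

lemma alpha_val_zero_iff:
  fixes E :: fresco_univ
  assumes F0: "F0_fresco lam ls E" and adm: "adm ls"
  shows "alpha_val ls (iso_class E) = 0 \<longleftrightarrow> semi_simple E"
proof -
  obtain S e where ch: "chain E (inv_seq ls) S e (length ls)" and fl: "flat (inv_diff ls) S (length ls)"
    and g: "good_roots lam ls" by (rule F0_facts[OF F0 adm])
  interpret R: real_chain E "inv_seq ls" S e "length ls" "inv_diff ls" by (rule good_roots_real_chain[OF ch g])
  have n: "length ls \<ge> 2" using adm by (simp add: adm_def)
  have "inv_diff ls j \<ge> 0" if "j < length ls" for j using adm_mono[OF adm, of 0 j] that by (simp add: inv_diff_def)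
  moreover have "regular E" using F0 by (auto simp: F0_fresco_def primitive_def)
  ultimately have "semi_simple E \<longleftrightarrow> obstr (inv_diff ls) S (length ls) = 0"
    using R.semi_simple_iff_obstr[OF _ fl _ n] by blast
  then show ?thesis using alpha_val_eq[OF F0 adm ch] resonance_factor_nonzero[OF adm] by simp
qed

lemma alpha_val_polynomial:
  assumes adm: "adm ls"
  shows "polynomial_function ls (F0_classes lam ls) (alpha_val ls)"
proof -
  have "poly_fun ({..<length ls} \<times> {1..}) (\<lambda>s. resonance_factor ls * obstr (inv_diff ls) (unit_series s) (length ls))"
    using adm by (intro poly_fun_obstr) (simp add: adm_def)
  then obtain f :: "(nat \<times> nat \<Rightarrow>\<^sub>0 nat) \<Rightarrow>\<^sub>0 complex" where
    f: "\<forall>m\<in>Poly_Mapping.keys f. Poly_Mapping.keys m \<subseteq> {..<length ls} \<times> {1..}"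
      "\<forall>s. mpoly_eval f s = resonance_factor ls * obstr (inv_diff ls) (unit_series s) (length ls)"
    unfolding poly_fun_def by blast
  show ?thesis
    unfolding polynomial_function_def
  proof (intro exI[of _ f] conjI f(1) allI impI)
    fix s assume "iso_class (E_of ls s) \<in> F0_classes lam ls"
    from alpha_val_E_of[OF adm this] f(2)
    show "mpoly_eval f s = alpha_val ls (iso_class (E_of ls s))" by simp
  qed
qed

text \<open>In rank two the product of resonances is empty, and the obstruction is the coefficient
  of \<open>S 0\<close> in degree \<open>inv_diff ls 1 + 1 = p\<close>. The given presentation is
  the member of the family \<open>E_of\<close> with a single nonzero variable.\<close>

lemma alpha_val_rank_two:
  fixes E :: fresco_univ
  assumes F0: "F0_fresco lam ls E" and adm: "adm ls" and n: "length ls = 2" and p: "real p = p_inv ls 0"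
    and iso: "lmod_iso E (cyclic_quot (lin (of_real (ls ! 0)) *
      of_fps (inverse (1 + fps_const x * fps_X ^ p)) * lin (of_real (ls ! 1))))"
  shows "alpha_val ls (iso_class E) = x"
proof -
  have p1: "p \<ge> 1" using adm n p by (auto simp: adm_def)
  define s where "s = (\<lambda>(j, m). if j = (0::nat) \<and> m = p then x else 0)"
  have u: "unit_series s 0 = 1 + fps_const x * fps_X ^ p" "unit_series s 1 = 1"
    using p1 by (auto simp: fps_eq_iff unit_series_def s_def)
  have l: "[0..<length ls] = [0, 1]" by (simp add: n upt_rec)
  have "P_of ls s = lin (of_real (ls ! 0)) * of_fps (inverse (1 + fps_const x * fps_X ^ p)) * lin (of_real (ls ! 1))"
    unfolding P_of_def l list.map u by (simp add: mult.assoc)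
  then have iso': "lmod_iso E (E_of ls s)" using iso by (simp add: E_of_def)
  have E: "left_module E" using F0 by (auto simp: F0_fresco_def intro: fresco_left_module)
  obtain e where ch: "chain (E_of ls s) (inv_seq ls) (unit_series s) e (length ls)" using ex_chain_E_of by blast
  obtain e' where ch': "chain E (inv_seq ls) (unit_series s) e' (length ls)"
    by (rule iso_chain[OF lmod_iso_sym[OF E iso'] E ch]) blast
  have "real_of_int (int p) = ls ! 1 - ls ! 0 + 1" using p by (simp add: p_inv_def)
  then have "ls ! 1 - ls ! 0 = of_int (int p - 1)" by simp
  then have "inv_diff ls 1 = int p - 1" unfolding inv_diff_def by (simp only: floor_of_int)
  then have "obstr (inv_diff ls) (unit_series s) (length ls) = unit_series s 0 $ p"
    by (simp add: obstr_def n)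
  also have "\<dots> = x" using p1 by (simp add: unit_series_def s_def)
  finally show ?thesis using alpha_val_eq[OF F0 adm ch'] by (simp add: resonance_factor_def n)
qed

section \<open>Reduction of the rank\<close>

text \<open>The chain adapted to \<open>w\<close> has \<open>w\<close> equal to a unit
  \<open>u\<close> times its last vector. The membership hypothesis makes the two top coordinates
  vanish: the first gives an Euler equation that forces \<open>u' = 0\<close>, the second then gives
  \<open>S' = 0\<close>. Constant terms 1 finish both.\<close>

lemma special_generator_chain:
  fixes E :: "(atilde, 'm) module"
  assumes E: "left_module E" and adm: "adm ls" and F: "principal_JH E F ls" and w: "is_generator E w"
    and mem: "(lin (of_real (ls ! (length ls - 2))) * lin (of_real (ls ! (length ls - 1)))) \<odot>\<^bsub>E\<^esub> w \<in> F (length ls - 2)"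
  obtains S e where "chain E (inv_seq ls) S e (length ls)" "S (length ls - 2) = 1" "e (length ls - 1) = w"
    "\<And>j. j \<le> length ls \<Longrightarrow> F j = spn E e j"
proof -
  let ?n = "length ls"
  have n: "?n \<ge> 2" "ls \<noteq> []" using adm by (auto simp: adm_def)
  obtain S e u where ch: "chain E (inv_seq ls) S e ?n" and FS: "\<And>j. j \<le> ?n \<Longrightarrow> F j = spn E e j"
    and wu: "w = of_fps u \<odot>\<^bsub>E\<^esub> e (?n - 1)" "u $ 0 = 1"
    by (rule principal_JH_chain[OF E F w n(2)]) blast
  interpret ab_chain E "inv_seq ls" S e ?n by (rule ab_chainI[OF ch])
  have e1: "e (?n - 1) \<in> carrier E" using e_closed[of "?n - 1"] n by simp
  have wc: "w \<in> carrier E" using e1 by (simp add: wu lsmult_closed)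
  have cw: "c w i = (if i = ?n - 1 then u else 0)" for i
    using e1 n by (simp add: wu crd_fs[OF basis] crd_basis[OF basis])
  define y where "y = lin (inv_seq ls (?n - 1)) \<odot>\<^bsub>E\<^esub> w"
  define z where "z = lin (inv_seq ls (?n - 2)) \<odot>\<^bsub>E\<^esub> y"
  have yc: "y \<in> carrier E" using wc by (simp add: y_def lsmult_closed)
  have zc: "z \<in> carrier E" using yc by (simp add: z_def lsmult_closed)
  have "z \<in> spn E e (?n - 2)"
    using mem FS[of "?n - 2"] wc by (simp add: z_def y_def inv_seq_def lsmult_assoc)
  then have z0: "c z i = 0" if "i \<ge> ?n - 2" for i
    using spn_crd_iff[OF basis _ zc, of "?n - 2"] that by simp
  have sn: "Suc (?n - 1) = ?n" "Suc (?n - 2) = ?n - 1" "?n - 2 \<noteq> ?n - 1" using n by auto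
  have cy1: "c y (?n - 1) = fps_X^2 * fps_deriv u"
    unfolding y_def crd_lin[OF wc] using cw[of "?n - 1"] cw[of ?n] n sn by simp
  have "c z (?n - 1) = fps_X^2 * fps_deriv (c y (?n - 1)) + fps_const (inv_seq ls (?n - 1) - inv_seq ls (?n - 2)) * fps_X * c y (?n - 1)"
    unfolding z_def crd_lin[OF yc] using sn crd_beyond[OF basis, of ?n y] by simp
  then have "fps_X^2 * fps_deriv (c y (?n - 1)) + fps_const (of_real (ls ! (?n - 1) - ls ! (?n - 2))) * fps_X * c y (?n - 1) = 0"
    using z0[of "?n - 1"] by (simp add: inv_seq_def)
  then have "c y (?n - 1) = fps_const (c y (?n - 1) $ 0)"
    by (rule fps_euler_zero) (use adm_mono[OF adm, of "?n - 2" "?n - 1"] n in simp)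
  moreover have y10: "c y (?n - 1) $ 0 = 0" unfolding cy1 by (simp add: fps_X_power_mult_nth)
  ultimately have cy10: "c y (?n - 1) = 0" by simp
  then have "fps_deriv u = 0" unfolding cy1 by simp
  then have u: "u = 1" using wu(2) by (simp add: fps_deriv_eq_0_iff)
  then have w: "w = e (?n - 1)" using e1 by (simp add: wu(1) lsmult_one)
  have cy2: "c y (?n - 2) = S (?n - 2)"
    unfolding y_def crd_lin[OF wc] using cw[of "?n - 2"] cw[of "?n - 1"] sn u by simp
  have "c z (?n - 2) = fps_X^2 * fps_deriv (S (?n - 2))"
    unfolding z_def crd_lin[OF yc] using cy2 cy10 sn by simp
  then have "fps_deriv (S (?n - 2)) = 0" using z0[of "?n - 2"] by simp
  then have "S (?n - 2) = 1" using S0[of "?n - 2"] n sn by (simp add: fps_deriv_eq_0_iff)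
  then show thesis using that[OF ch] w FS by blast
qed

text \<open>By \<open>lin_swap\<close> and \<open>S (n - 2) = 1\<close>,
  \<open>lin (l (n - 1) + 1)\<close> sends \<open>\<epsilon>\<close> to the same vector as
  \<open>lin (l (n - 2))\<close> sends \<open>e (n - 2)\<close>. So \<open>\<epsilon>\<close> can
  replace \<open>e (n - 2)\<close> with the series unchanged. Independence holds because the top
  coordinate of \<open>\<epsilon>\<close> is b times the nonzero number in \<open>p\<close>.\<close>

lemma (in ab_chain) reduced_chain:
  assumes n: "n \<ge> 3" and S1: "S (n - 2) = 1" and p: "l (n - 1) - l (n - 2) + 1 \<noteq> 0"
  defines "\<epsilon> \<equiv> lin (l (n - 2) - 1) \<odot> e (n - 1)"
  defines "N \<equiv> cyclic M \<epsilon>"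
  shows "left_submodule N M" "chain (sub_mod M N) (l(n - 2 := l (n - 1) + 1)) S (e(n - 2 := \<epsilon>)) (n - 1)"
    "is_generator (sub_mod M N) \<epsilon>"
proof -
  define eG where "eG = e(n - 2 := \<epsilon>)"
  define lG where "lG = l(n - 2 := l (n - 1) + 1)"
  have e1: "e (n - 1) \<in> carrier M" "e (n - 2) \<in> carrier M" "e (n - 3) \<in> carrier M"
    using e_closed n by auto
  have \<epsilon>: "\<epsilon> \<in> carrier M" using e1 by (simp add: \<epsilon>_def lsmult_closed)
  have sn: "Suc (n - 2) = n - 1" "Suc (n - 3) = n - 2" "n - 1 \<noteq> 0" "n - 2 \<noteq> 0" "n - 1 - 1 = n - 2" "n - 2 - 1 = n - 3"
    using n by auto
  have c\<epsilon>: "c \<epsilon> (n - 1) = fps_const (l (n - 1) - l (n - 2) + 1) * fps_X"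
  proof -
    have "l (n - 1) - (l (n - 2) - 1) = l (n - 1) - l (n - 2) + 1" by simp
    moreover have "n \<noteq> n - Suc 0" using n by simp
    ultimately show ?thesis unfolding \<epsilon>_def crd_lin[OF e1(1)] using n by (simp add: crd_basis[OF basis])
  qed
  have lin\<epsilon>: "lin (l (n - 1) + 1) \<odot> \<epsilon> = of_fps (S (n - 3)) \<odot> e (n - 3)"
  proof -
    have "lin (l (n - 1) + 1) \<odot> \<epsilon> = (lin (l (n - 2)) * lin (l (n - 1))) \<odot> e (n - 1)"
      unfolding lin_swap[of "l (n - 2)" "l (n - 1)"] using e1 by (simp add: \<epsilon>_def lsmult_assoc)
    also have "\<dots> = lin (l (n - 2)) \<odot> (lin (l (n - 1)) \<odot> e (n - 1))" using e1 by (simp add: lsmult_assoc)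
    also have "lin (l (n - 1)) \<odot> e (n - 1) = e (n - 2)"
      using lin_e[of "n - 1"] n sn S1 e1 by (simp add: lsmult_one)
    also have "lin (l (n - 2)) \<odot> e (n - 2) = of_fps (S (n - 3)) \<odot> e (n - 3)"
      using lin_e[of "n - 2"] n sn by simp
    finally show ?thesis .
  qed
  have eGc: "eG i \<in> carrier M" if "i < n - 1" for i using that \<epsilon> e_closed by (simp add: eG_def)
  have lin_eG: "lin (lG i) \<odot> eG i = (if i = 0 then \<zero> else of_fps (S (i - 1)) \<odot> eG (i - 1))" if i: "i < n - 1" for i
  proof (cases "i = n - 2")
    case True
    then show ?thesis using lin\<epsilon> sn n by (simp add: eG_def lG_def)
  next
    case False
    then show ?thesis using lin_e[of i] i by (auto simp: eG_def lG_def)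
  qed
  have lin_spn: "lin (lG i) \<odot> eG i \<in> spn M eG i" if i: "i < n - 1" for i
  proof (cases i)
    case 0
    then show ?thesis using lin_eG[OF i] by simp
  next
    case (Suc j)
    have "comb M eG i (single j (S j)) = of_fps (S j) \<odot> eG j"
      using i Suc eGc by (subst comb_single) auto
    then show ?thesis using lin_eG[OF i] Suc by (metis diff_Suc_1 nat.distinct(1) rangeI)
  qed
  define G where "G = spn M eG (n - 1)"
  have G: "left_submodule G M" unfolding G_def by (rule spn_submodule[where l = lG]) (use eGc lin_spn in auto)
  interpret T: ab_left "sub_mod M G" by (rule ab_leftI[OF sub_mod_left_module[OF G]])
  have cm: "comb M eG (n - 1) g = comb M e (n - 2) g \<oplus> of_fps (g (n - 2)) \<odot> \<epsilon>" for g
  proof -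
    have "comb M eG (n - 1) g = comb M eG (n - 2) g \<oplus> of_fps (g (n - 2)) \<odot> eG (n - 2)"
      using comb.simps(2)[of M eG "n - 2" g] sn by simp
    moreover have "comb M eG (n - 2) g = comb M e (n - 2) g" by (rule comb_cong) (auto simp: eG_def)
    ultimately show ?thesis by (simp add: eG_def)
  qed
  have low: "comb M e (n - 2) g \<in> carrier M" "comb M e (n - 2) g = comb M e n (\<lambda>i. if i < n - 2 then g i else 0)" for g
  proof -
    show "comb M e (n - 2) g \<in> carrier M" using e_closed by (intro comb_closed) auto
    have "comb M e (n - 2) g = comb M e (n - 2) (\<lambda>i. if i < n - 2 then g i else 0)" by (rule comb_cong) auto
    also have "\<dots> = comb M e n (\<lambda>i. if i < n - 2 then g i else 0)"
      using e_closed by (intro comb_le[symmetric]) auto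
    finally show "comb M e (n - 2) g = comb M e n (\<lambda>i. if i < n - 2 then g i else 0)" .
  qed
  have "indep M eG (n - 1)"
    unfolding indep_def
  proof (intro allI impI)
    fix g i assume z: "comb M eG (n - 1) g = \<zero>" and i: "i < n - 1"
    have "c (comb M e (n - 2) g) (n - 1) = 0"
      using crd_unique[OF basis low(2)[of g], of "n - 1"] n by simp
    moreover have "c (comb M eG (n - 1) g) (n - 1) = c (comb M e (n - 2) g) (n - 1) + g (n - 2) * c \<epsilon> (n - 1)"
      unfolding cm using low(1)[of g] \<epsilon> by (simp add: crd_add[OF basis] crd_fs[OF basis] lsmult_closed)
    ultimately have "g (n - 2) * c \<epsilon> (n - 1) = 0" unfolding z crd_zero[OF basis] by simp
    moreover have "c \<epsilon> (n - 1) \<noteq> 0" unfolding c\<epsilon> using p by (simp only: mult_eq_0_iff fps_const_eq_0_iff fps_X_neq_zero simp_thms)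
    ultimately have g2: "g (n - 2) = 0" by (simp only: mult_eq_0_iff simp_thms)
    then have "comb M e n (\<lambda>i. if i < n - 2 then g i else 0) = \<zero>" using z[unfolded cm] low[of g] \<epsilon> by simp
    moreover have "indep M e n" using basis by (simp add: basis_def)
    ultimately have "\<forall>i<n. (if i < n - 2 then g i else 0) = 0" unfolding indep_def by blast
    then show "g i = 0" using g2 i by (cases "i = n - 2") (auto split: if_splits)
  qed
  then have "T.basis eG (n - 1)"
    unfolding T.basis_def using eGc spn_basis[of _ "n - 1" eG] by (auto simp: comb_sub_mod G_def indep_def)
  then have chG: "chain (sub_mod M G) lG S eG (n - 1)"
    using lin_eG S0 T.left_module_axioms by (auto simp: chain_def)
  interpret TC: ab_chain "sub_mod M G" lG S eG "n - 1" by (rule ab_chainI[OF chG])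
  have eGn: "eG (n - 2) = \<epsilon>" by (simp add: eG_def)
  have gen: "is_generator (sub_mod M G) \<epsilon>"
  proof (rule TC.generator)
    show "0 < n - 1" using n by simp
    show "\<epsilon> \<in> carrier (sub_mod M G)" using TC.e_closed[of "n - 2"] n eGn by simp
    have "TC.c (eG (n - 2)) (n - 2) = 1" using T.crd_basis[OF TC.basis, of "n - 2" "n - 2"] n by simp
    then show "TC.c \<epsilon> (n - 1 - 1) = 1" using eGn sn by simp
  qed
  then have "G = N" by (simp add: is_generator_def cyclic_def N_def)
  then show "left_submodule N M" "chain (sub_mod M N) (l(n - 2 := l (n - 1) + 1)) S (e(n - 2 := \<epsilon>)) (n - 1)"
    "is_generator (sub_mod M N) \<epsilon>"
    using G chG gen by (auto simp: lG_def eG_def)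
qed

section \<open>The invariants of the reduced fresco\<close>

definition reduced_invs :: "real list \<Rightarrow> real list" where
  "reduced_invs ls = take (length ls - 2) ls @ [ls ! (length ls - 1) + 1]"

lemma length_red: "length ls \<ge> 2 \<Longrightarrow> length (reduced_invs ls) = length ls - 1"
  by (simp add: reduced_invs_def)

lemma red_nth: "length ls \<ge> 2 \<Longrightarrow> i < length ls - 1 \<Longrightarrow>
    reduced_invs ls ! i = (if i = length ls - 2 then ls ! (length ls - 1) + 1 else ls ! i)"
  by (auto simp: reduced_invs_def nth_append min_def)

lemma adm_red:
  assumes "adm ls" "length ls \<ge> 3"
  shows "adm (reduced_invs ls)"
  unfolding adm_def
proof (intro conjI allI impI)
  show "length (reduced_invs ls) \<ge> 2" using assms(2) by (simp add: length_red)
  fix j assume "Suc j < length (reduced_invs ls)"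
  then have j: "Suc j < length ls - 1" using assms(2) by (simp add: length_red)
  have "ls ! j \<le> ls ! Suc j" "ls ! j \<le> ls ! (length ls - 1)" using adm_mono[OF assms(1)] j by auto
  then show "p_inv (reduced_invs ls) j \<ge> 1" using j assms(2) by (auto simp: p_inv_def red_nth)
qed

lemma good_roots_red:
  assumes "good_roots lam ls" "length ls \<ge> 3"
  shows "good_roots lam (reduced_invs ls)"
  unfolding good_roots_def
proof (intro allI impI)
  fix j assume "j < length (reduced_invs ls)"
  then have j: "j < length ls - 1" using assms(2) by (simp add: length_red)
  show "reduced_invs ls ! j \<in> \<rat> \<and> real (length (reduced_invs ls) - 1 - j) < reduced_invs ls ! j \<and> (\<exists>m::int. reduced_invs ls ! j = lam + of_int m)"
  proof (cases "j = length ls - 2")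
    case True
    have "length ls - 1 < length ls" using j by simp
    then have g: "ls ! (length ls - 1) \<in> \<rat>" "0 < ls ! (length ls - 1)" "\<exists>m::int. ls ! (length ls - 1) = lam + of_int m"
      using assms(1) unfolding good_roots_def by force+
    obtain m :: int where "ls ! (length ls - 1) = lam + of_int m" using g(3) by blast
    then have "ls ! (length ls - 1) + 1 = lam + of_int (m + 1)" by simp
    then have "\<exists>m::int. ls ! (length ls - 1) + 1 = lam + of_int m" by blast
    moreover have "ls ! (length ls - 1) + 1 \<in> \<rat>" using g(1) by simp
    moreover have "length (reduced_invs ls) - 1 - j = 0" using True assms(2) by (simp add: length_red)
    ultimately show ?thesis using g(2) True assms(2) by (simp add: red_nth)
  next
    case False
    have "j < length ls" using j by simp
    then have g: "ls ! j \<in> \<rat>" "real (length ls - 1 - j) < ls ! j" "\<exists>m::int. ls ! j = lam + of_int m"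
      using assms(1) unfolding good_roots_def by blast+
    have "real (length (reduced_invs ls) - 1 - j) \<le> real (length ls - 1 - j)" using assms(2) by (simp add: length_red)
    then show ?thesis using g False j assms(2) by (simp add: red_nth)
  qed
qed

text \<open>Semi-simplicity is inherited by submodules: the corank one step of G is F_{k-2},
  contained in F_{k-1}, and G/F_1 is contained in E/F_1.\<close>

lemma reduced_F0:
  fixes E :: "(atilde, 'm) module"
  assumes F0: "F0_fresco lam ls E" and adm: "adm ls" and n: "length ls \<ge> 3"
    and ch: "chain E (inv_seq ls) S e (length ls)" and S1: "S (length ls - 2) = 1"
  defines "G \<equiv> sub_mod E (cyclic E (lin (of_real (ls ! (length ls - 2)) - 1) \<odot>\<^bsub>E\<^esub> e (length ls - 1)))"
  shows "F0_fresco lam (reduced_invs ls) G" "\<exists>e'. chain G (inv_seq (reduced_invs ls)) S e' (length (reduced_invs ls))"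
proof -
  let ?n = "length ls"
  let ?l' = "reduced_invs ls"
  obtain S0 e0 where c0: "chain E (inv_seq ls) S0 e0 ?n"
    and ss: "semi_simple (sub_mod E (spn E e0 (?n - 1)))" "semi_simple (quot_mod E (spn E e0 1))"
    and g: "good_roots lam ls" by (rule F0_facts[OF F0 adm])
  have reg: "regular E" using F0 by (simp add: F0_fresco_def primitive_def)
  have spn_eq: "spn E e0 m = spn E e m" if "m \<le> ?n" for m
    by (rule chain_spn_eq[OF ch c0, of "\<lambda>i. ls ! i"]) (use adm_mono[OF adm] that in \<open>auto simp: inv_seq_def\<close>)
  have ss: "semi_simple (sub_mod E (spn E e (?n - 1)))" "semi_simple (quot_mod E (spn E e 1))"
    using ss spn_eq[of "?n - 1"] spn_eq[of 1] n by auto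
  interpret R: real_chain E "inv_seq ls" S e ?n "inv_diff ls" by (rule good_roots_real_chain[OF ch g])
  define \<epsilon> where "\<epsilon> = lin (inv_seq ls (?n - 2) - 1) \<odot>\<^bsub>E\<^esub> e (?n - 1)"
  define N where "N = cyclic E \<epsilon>"
  have GN: "G = sub_mod E N" by (simp add: G_def N_def \<epsilon>_def inv_seq_def)
  define eG where "eG = e(?n - 2 := \<epsilon>)"
  have p: "inv_seq ls (?n - 1) - inv_seq ls (?n - 2) + 1 \<noteq> 0"
  proof -
    have "?n - 2 \<le> ?n - 1" "?n - 1 < ?n" using n by auto
    from adm_mono[OF adm this] have "ls ! (?n - 1) - ls ! (?n - 2) + 1 > 0" by simp
    then have "complex_of_real (ls ! (?n - 1) - ls ! (?n - 2) + 1) \<noteq> 0" by (simp only: of_real_eq_0_iff)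
    then show ?thesis by (simp add: inv_seq_def)
  qed
  note rc = R.reduced_chain[OF n S1 p, folded \<epsilon>_def, folded N_def eG_def]
  have lr: "length ?l' = ?n - 1" using n by (simp add: length_red)
  have chG: "chain G (inv_seq ?l') S eG (length ?l')"
    unfolding GN lr by (rule chain_cong[OF rc(2)]) (use n in \<open>auto simp: inv_seq_def red_nth\<close>)
  then show "\<exists>e'. chain G (inv_seq ?l') S e' (length ?l')" by blast
  interpret C: ab_chain G "inv_seq ?l'" S eG "length ?l'" by (rule ab_chainI[OF chG])
  have rk: "has_rank G (length ?l')" by (rule C.basis_has_rank[OF C.basis])
  have regG: "regular G" using regular_sub_mod[OF reg rc(1)] rk unfolding GN by blast
  have admG: "adm ?l'" by (rule adm_red[OF adm n])
  have l'n: "?l' \<noteq> []" by (simp add: reduced_invs_def)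
  have geo: "geometric G" "primitive lam G"
    using good_roots_geometric[OF chG l'n regG good_roots_red[OF g n]] by auto
  have "fresco G" using geo rc(3) unfolding fresco_def GN by blast
  moreover have "principal_JH G (spn G eG) ?l'"
    using adm_mono[OF admG] by (intro chain_principal_JH[OF chG] add_mono) auto
  moreover have "semi_simple (sub_mod G (spn G eG (length ?l' - 1)))"
  proof -
    have "comb G eG (?n - 2) g = comb E e (?n - 2) g" for g
      unfolding GN R.comb_sub_mod by (rule comb_cong) (auto simp: eG_def)
    then have eq: "sub_mod G (spn G eG (length ?l' - 1)) = sub_mod (sub_mod E (spn E e (?n - 1))) (spn E e (?n - 2))"
      using lr n by (simp add: GN numeral_2_eq_2)
    have le: "?n - 1 \<le> ?n" "?n - 2 \<le> ?n" "?n - 2 \<le> ?n - 1" by auto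
    have sub: "left_submodule (spn E e (?n - 2)) (sub_mod E (spn E e (?n - 1)))"
      using R.spn_mono[OF le(3)] R.e_closed by (intro R.left_submodule_sub_mod R.spn_sub le) auto
    have chs: "chain (sub_mod E (spn E e (?n - 2))) (inv_seq ls) S e (?n - 2)" by (rule R.sub_chain[OF le(2)])
    interpret U: ab_chain "sub_mod E (spn E e (?n - 2))" "inv_seq ls" S e "?n - 2" by (rule ab_chainI[OF chs])
    have "has_rank (sub_mod E (spn E e (?n - 2))) (?n - 2)" by (rule U.basis_has_rank[OF U.basis])
    then have "has_rank (sub_mod (sub_mod E (spn E e (?n - 1))) (spn E e (?n - 2))) (?n - 2)" by simp
    from semi_simple_sub_mod[OF ss(1) sub this] show ?thesis unfolding eq .
  qed
  moreover have "semi_simple (quot_mod G (spn G eG 1))"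
  proof -
    have "comb G eG 1 g = comb E e 1 g" for g
      unfolding GN R.comb_sub_mod using n by (intro comb_cong) (auto simp: eG_def)
    then have F1: "spn G eG 1 = spn E e 1" by simp
    have s1: "left_submodule (spn E e 1) E" using n by (intro R.spn_sub) simp
    have "1 \<le> length ?l'" using lr n by simp
    then have sub: "spn E e 1 \<subseteq> N" using left_submoduleD(1)[OF C.spn_sub[of 1]] F1 by (simp add: GN)
    note q = quot_sub_mod[OF R.left_module_axioms s1 rc(1) sub]
    have "0 < length ?l'" using lr n by simp
    from C.quot_chain[OF this] have qc: "chain (quot_mod G (spn E e 1)) (\<lambda>i. inv_seq ?l' (Suc i)) (\<lambda>i. S (Suc i))
       (\<lambda>i. spn E e 1 +>\<^bsub>G\<^esub> eG (Suc i)) (length ?l' - 1)" unfolding F1 .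
    interpret V: ab_chain "quot_mod G (spn E e 1)" "\<lambda>i. inv_seq ?l' (Suc i)" "\<lambda>i. S (Suc i)"
       "\<lambda>i. spn E e 1 +>\<^bsub>G\<^esub> eG (Suc i)" "length ?l' - 1" by (rule ab_chainI[OF qc])
    have "has_rank (quot_mod G (spn E e 1)) (length ?l' - 1)" by (rule V.basis_has_rank[OF V.basis])
    note semi_simple_sub_mod[OF ss(2) q(2), folded q(1), folded GN, OF this]
    then show ?thesis by (simp only: F1)
  qed
  ultimately show "F0_fresco lam ?l' G" using geo(2) unfolding F0_fresco_def by blast
qed

lemma canon_cong:
  "(\<And>i. i \<le> j \<Longrightarrow> d i = d' i) \<Longrightarrow> canon d S j = canon d' S j"
  by (induction j) simp_all

text \<open>With \<open>S\<close> equal to 1 at the last step, the obstruction of E is a coefficient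
  of the last \<open>canon\<close> entry, that is, a quotient by \<open>p\<close>. Its numerator is
  the obstruction of the reduced list, and \<open>p\<close> is the factor by which the two products
  of resonances differ.\<close>

lemma obstr_red:
  assumes adm: "adm ls" and n: "length ls \<ge> 3" and g: "good_roots lam ls" and S1: "S (length ls - 2) = 1"
  shows "resonance_factor ls * obstr (inv_diff ls) S (length ls) = resonance_factor (reduced_invs ls) * obstr (inv_diff (reduced_invs ls)) S (length (reduced_invs ls))"
proof -
  obtain k where k: "length ls = k + 3" using n by (metis add.commute le_Suc_ex)
  have lr: "length (reduced_invs ls) = k + 2" using k by (simp add: length_red)
  have rn: "reduced_invs ls ! i = (if i = k + 1 then ls ! (k + 2) + 1 else ls ! i)" if "i < k + 2" for i
    using red_nth[of ls i] k that by (simp add: numeral_2_eq_2)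
  have d1: "inv_diff (reduced_invs ls) i = inv_diff ls i" if "i \<le> k" for i using rn[of i] rn[of 0] that by (simp add: inv_diff_def)
  have d2: "inv_diff (reduced_invs ls) (k + 1) = inv_diff ls (k + 2) + 1"
  proof -
    have "inv_diff (reduced_invs ls) (k + 1) = \<lfloor>ls ! (k + 2) - ls ! 0 + 1\<rfloor>" using rn[of "k + 1"] rn[of 0] by (simp add: inv_diff_def algebra_simps)
    then show ?thesis unfolding inv_diff_def by simp
  qed
  have dpos: "inv_diff ls i \<ge> 0" if "i < k + 3" for i using adm_mono[OF adm, of 0 i] that k by (simp add: inv_diff_def)
  \<comment> \<open>The degree in which both obstructions are read: the last invariant grows by 1
    while the rank, and with it the power of b in \<open>canon\<close>, drops by 1.\<close>
  define N where "N = nat (inv_diff ls (k + 2) + int k + 2)"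
  have N: "int N = inv_diff ls (k + 2) + int k + 2" using dpos[of "k + 2"] by (simp add: N_def)
  define p where "p = ls ! (k + 2) - ls ! (k + 1) + 1"
  have pd: "of_int (inv_diff ls (k + 2) - inv_diff ls (k + 1) + 1) = complex_of_real p"
  proof -
    have "of_int (inv_diff ls (k + 2) - inv_diff ls (k + 1) + 1) = p"
      using good_roots_dd[OF g, of "k + 2"] good_roots_dd[OF g, of "k + 1"] k by (simp add: p_def)
    then show ?thesis by (metis of_real_of_int_eq)
  qed
  have p0: "p \<noteq> 0" using adm_mono[OF adm, of "k + 1" "k + 2"] k by (simp add: p_def)
  have "obstr (inv_diff ls) S (length ls) = canon (inv_diff ls) S (k + 1) $ N"
    using S1 k by (simp add: obstr_def N_def add_ac)
  also have "\<dots> = (S k * canon (inv_diff ls) S k) $ N / of_int (inv_diff ls (k + 2) - inv_diff ls (k + 1) + 1)"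
  proof -
    have e: "int N - int (Suc k) - inv_diff ls (Suc k) = inv_diff ls (k + 2) - inv_diff ls (k + 1) + 1" using N by simp
    show ?thesis by (simp only: Suc_eq_plus1[symmetric] canon.simps(2) fps_nth_Abs_fps e[unfolded Suc_eq_plus1[symmetric]])
  qed
  finally have o1: "obstr (inv_diff ls) S (length ls) = (S k * canon (inv_diff ls) S k) $ N / complex_of_real p" unfolding pd .
  have "canon (inv_diff (reduced_invs ls)) S k = canon (inv_diff ls) S k" using d1 by (rule canon_cong)
  moreover have "nat (inv_diff (reduced_invs ls) (k + 1) + int (k + 2) - 1) = N" unfolding d2 N_def by (simp add: add_ac)
  ultimately have o2: "obstr (inv_diff (reduced_invs ls)) S (length (reduced_invs ls)) = (S k * canon (inv_diff ls) S k) $ N"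
    using lr by (simp add: obstr_def)
  have "resonance_factor ls = (\<Prod>i\<in>{1..<k + 2}. complex_of_real (ls ! (k + 2) - ls ! i + real (k + 2 - i)))"
    by (simp add: resonance_factor_def k)
  also have "{1..<k + 2} = insert (k + 1) {1..<k + 1}" by auto
  also have "(\<Prod>i\<in>insert (k + 1) {1..<k + 1}. complex_of_real (ls ! (k + 2) - ls ! i + real (k + 2 - i))) =
      complex_of_real p * (\<Prod>i\<in>{1..<k + 1}. complex_of_real (ls ! (k + 2) - ls ! i + real (k + 2 - i)))"
    by (subst prod.insert) (auto simp: p_def)
  \<comment> \<open>The remaining factors agree one by one: the increase of the last invariant
    compensates the smaller distance of the indices.\<close>
  also have "(\<Prod>i\<in>{1..<k + 1}. complex_of_real (ls ! (k + 2) - ls ! i + real (k + 2 - i))) = resonance_factor (reduced_invs ls)"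
    unfolding resonance_factor_def lr
  proof (intro prod.cong)
    fix i assume "i \<in> {1..<k + 2 - 1}"
    then have "ls ! (k + 2) - ls ! i + real (k + 2 - i) = reduced_invs ls ! (k + 2 - 1) - reduced_invs ls ! i + real (k + 2 - 1 - i)"
      using rn[of i] rn[of "k + 1"] by (simp add: of_nat_diff)
    then show "complex_of_real (ls ! (k + 2) - ls ! i + real (k + 2 - i)) =
      complex_of_real (reduced_invs ls ! (k + 2 - 1) - reduced_invs ls ! i + real (k + 2 - 1 - i))" by simp
  qed simp
  finally show ?thesis using o1 o2 p0 by simp
qed

section \<open>Normal forms\<close>

text \<open>In degree k + 1 the unknown coefficient of \<open>h\<close> has the factor k + 1 - p, so
  everything can be removed except the constant term and the resonant degree p.\<close>

lemma fps_normalize: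
  fixes S :: "complex fps"
  assumes "p \<ge> 1"
  obtains h where "S + fps_X^2 * fps_deriv h + fps_const (1 - of_nat p) * fps_X * h = fps_const (S $ 0) + fps_const (S $ p) * fps_X ^ p"
proof -
  define h where "h = Abs_fps (\<lambda>k. if Suc k = p then 0 else - S $ Suc k / (of_nat k + 1 - of_nat p))"
  have "(S + fps_X^2 * fps_deriv h + fps_const (1 - of_nat p) * fps_X * h) $ m = (fps_const (S $ 0) + fps_const (S $ p) * fps_X ^ p) $ m" for m
  proof (cases m)
    case 0
    then show ?thesis using assms by (simp add: fps_X_power_mult_nth mult.assoc)
  next
    case (Suc k)
    have "(fps_X^2 * fps_deriv h) $ Suc k = of_nat k * h $ k"
      by (cases k) (simp_all add: fps_X_power_mult_nth)
    then have "(S + fps_X^2 * fps_deriv h + fps_const (1 - of_nat p) * fps_X * h) $ m = S $ Suc k + (of_nat k + 1 - of_nat p) * h $ k"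
      using Suc by (simp add: mult.assoc algebra_simps)
    moreover have "(of_nat k + 1 - of_nat p) * h $ k = (if Suc k = p then 0 else - S $ Suc k)"
    proof (cases "Suc k = p")
      case False
      then have "of_nat (Suc k) \<noteq> (of_nat p :: complex)" by (simp only: of_nat_eq_iff) simp
      then have "of_nat k + 1 - of_nat p \<noteq> (0 :: complex)" by (simp add: add.commute)
      then show ?thesis using False by (simp add: h_def)
    qed (simp add: h_def)
    ultimately show ?thesis using Suc by (auto simp: add.assoc)
  qed
  then show thesis using that[of h] by (auto simp: fps_eq_iff)
qed

lemma p_nat:
  assumes adm: "adm ls" and g: "good_roots lam ls" and j: "Suc j < length ls"
  obtains p where "p \<ge> 1" "p_inv ls j = real p" "int p = inv_diff ls (Suc j) - inv_diff ls j + 1"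
proof -
  have e: "p_inv ls j = of_int (inv_diff ls (Suc j) - inv_diff ls j + 1)"
    using good_roots_dd[OF g, of "Suc j"] good_roots_dd[OF g, of j] j by (simp add: p_inv_def)
  moreover have "p_inv ls j \<ge> 1" using adm j by (simp add: adm_def)
  ultimately have "inv_diff ls (Suc j) - inv_diff ls j + 1 \<ge> 1" by linarith
  then show thesis using e by (intro that[of "nat (inv_diff ls (Suc j) - inv_diff ls j + 1)"]) auto
qed

text \<open>Adding a multiple \<open>h\<close> of \<open>e 0\<close> to \<open>e 1\<close> changes
  \<open>S 0\<close> precisely by the expression in \<open>fps_normalize\<close>, which leaves
  \<open>1 + x b^p\<close>.\<close>

lemma rank_two_normal_form:
  fixes E :: "(atilde, 'm) module"
  assumes F0: "F0_fresco lam ls E" and adm: "adm ls" and n: "length ls = 2"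
  obtains x p where "real p = p_inv ls 0" "lmod_iso E (cyclic_quot (lin (of_real (ls ! 0)) *
      of_fps (inverse (1 + fps_const x * fps_X ^ p)) * lin (of_real (ls ! 1))))"
proof -
  obtain S e where ch: "chain E (inv_seq ls) S e (length ls)" and g: "good_roots lam ls" by (rule F0_facts[OF F0 adm])
  obtain p where p: "p \<ge> 1" "p_inv ls 0 = real p" using p_nat[OF adm g, of 0] n by auto
  interpret ab_chain E "inv_seq ls" S e "length ls" by (rule ab_chainI[OF ch])
  obtain h where h: "S 0 + fps_X^2 * fps_deriv h + fps_const (1 - of_nat p) * fps_X * h = fps_const (S 0 $ 0) + fps_const (S 0 $ p) * fps_X ^ p"
    by (rule fps_normalize[OF p(1)])
  define x where "x = S 0 $ p"
  have e: "e 0 \<in> carrier E" "e 1 \<in> carrier E" using e_closed n by auto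
  define e' where "e' = e(1 := e 1 \<oplus>\<^bsub>E\<^esub> of_fps h \<odot>\<^bsub>E\<^esub> e 0)"
  have e'c: "e' i \<in> carrier E" if "i < 2" for i using that e by (auto simp: e'_def lsmult_closed less_2_cases_iff)
  have l0: "lin (inv_seq ls 0) \<odot>\<^bsub>E\<^esub> e 0 = \<zero>\<^bsub>E\<^esub>" using lin_e[of 0] n by simp
  have l1: "lin (inv_seq ls 1) \<odot>\<^bsub>E\<^esub> e 1 = of_fps (S 0) \<odot>\<^bsub>E\<^esub> e 0" using lin_e[of 1] n by simp
  have "inv_seq ls 0 - inv_seq ls 1 = 1 - of_nat p"
  proof -
    have "ls ! 0 - ls ! 1 = 1 - real p" using p(2) by (simp add: p_inv_def)
    then have "complex_of_real (ls ! 0 - ls ! 1) = complex_of_real (1 - real p)" by simp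
    then show ?thesis by (simp add: inv_seq_def)
  qed
  then have "lin (inv_seq ls 1) * of_fps h = of_fps h * lin (inv_seq ls 0) + of_fps (fps_X^2 * fps_deriv h + fps_const (1 - of_nat p) * fps_X * h)"
    using lin_mult_of_fps[of "inv_seq ls 1" h "inv_seq ls 0"] by simp
  then have "lin (inv_seq ls 1) \<odot>\<^bsub>E\<^esub> (of_fps h \<odot>\<^bsub>E\<^esub> e 0) = of_fps (fps_X^2 * fps_deriv h + fps_const (1 - of_nat p) * fps_X * h) \<odot>\<^bsub>E\<^esub> e 0"
    using e l0 by (simp add: lsmult_assoc[symmetric] lsmult_l_distr lsmult_closed del: of_fps_simps fs_simps) (simp add: lsmult_assoc l0 lsmult_closed del: of_fps_simps fs_simps)
  then have "lin (inv_seq ls 1) \<odot>\<^bsub>E\<^esub> e' 1 = of_fps (S 0 + (fps_X^2 * fps_deriv h + fps_const (1 - of_nat p) * fps_X * h)) \<odot>\<^bsub>E\<^esub> e 0"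
    using e l1 by (simp add: e'_def lsmult_r_distr lsmult_closed lsmult_l_distr)
  also have "S 0 + (fps_X^2 * fps_deriv h + fps_const (1 - of_nat p) * fps_X * h) = 1 + fps_const x * fps_X ^ p"
    using h S0[of 0] n by (simp add: x_def add.assoc)
  finally have l1': "lin (inv_seq ls 1) \<odot>\<^bsub>E\<^esub> e' 1 = of_fps (1 + fps_const x * fps_X ^ p) \<odot>\<^bsub>E\<^esub> e 0" .
  have c2: "comb E f 2 g = of_fps (g 0) \<odot>\<^bsub>E\<^esub> f 0 \<oplus>\<^bsub>E\<^esub> of_fps (g 1) \<odot>\<^bsub>E\<^esub> f 1" if "f 0 \<in> carrier E" "f 1 \<in> carrier E" for f g
    using that by (simp add: numeral_2_eq_2 comb.simps(2) lsmult_closed)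
  have ce': "comb E e' 2 g = comb E e 2 (\<lambda>i. if i = 0 then g 0 + g 1 * h else g i)" for g
    using e by (simp add: c2 e'_def lsmult_closed lsmult_r_distr lsmult_l_distr fs_mult a_ac)
  have ce: "comb E e 2 g = comb E e' 2 (\<lambda>i. if i = 0 then g 0 - g 1 * h else g i)" for g
    unfolding ce' by (rule comb_cong) auto
  have b: "carrier E = spn E e 2" "indep E e 2" using basis by (auto simp: basis_def n)
  have "basis e' 2"
    unfolding basis_def
  proof (intro conjI allI impI)
    show "e' i \<in> carrier E" if "i < 2" for i using e'c that by blast
    have "spn E e 2 \<subseteq> spn E e' 2" by (rule image_subsetI, rule range_eqI, rule ce)
    moreover have "spn E e' 2 \<subseteq> spn E e 2" by (rule image_subsetI, rule range_eqI, rule ce')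
    ultimately show "carrier E = spn E e' 2" using b(1) by simp
    show "indep E e' 2"
      unfolding indep_def
    proof (intro allI impI)
      fix g i assume "comb E e' 2 g = \<zero>\<^bsub>E\<^esub>" and i: "i < (2::nat)"
      then have "comb E e 2 (\<lambda>i. if i = 0 then g 0 + g 1 * h else g i) = \<zero>\<^bsub>E\<^esub>" by (simp add: ce')
      then have *: "\<forall>i<2. (if i = 0 then g 0 + g 1 * h else g i) = 0" using b(2) unfolding indep_def by blast
      then have "g 1 = 0" "g 0 + g 1 * h = 0" by (auto dest: spec[of _ 1] spec[of _ 0])
      then show "g i = 0" using i by (auto simp: less_2_cases_iff)
    qed
  qed
  then have ch': "chain E (inv_seq ls) (\<lambda>i. 1 + fps_const x * fps_X ^ p) e' (length ls)"
    unfolding chain_def using l0 l1' p(1) n left_module_axioms by (auto simp: less_2_cases_iff e'_def)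
  define s where "s = (\<lambda>(j, m). if j = (0::nat) \<and> m = p then x else 0)"
  have u: "unit_series s 0 = 1 + fps_const x * fps_X ^ p" "unit_series s 1 = 1"
    using p(1) by (auto simp: fps_eq_iff unit_series_def s_def)
  have l: "[0..<length ls] = [0, 1]" by (simp add: n upt_rec)
  have P: "P_of ls s = lin (of_real (ls ! 0)) * of_fps (inverse (1 + fps_const x * fps_X ^ p)) * lin (of_real (ls ! 1))"
    unfolding P_of_def l list.map u by (simp add: mult.assoc)
  obtain e0 where e0: "chain (E_of ls s) (inv_seq ls) (unit_series s) e0 (length ls)" using ex_chain_E_of by blast
  have "chain (E_of ls s) (inv_seq ls) (\<lambda>i. 1 + fps_const x * fps_X ^ p) e0 (length ls)"
    by (rule chain_cong[OF e0]) (use n u(1) in auto)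
  from same_chain_iso[OF ch' this] have "lmod_iso E (E_of ls s)" .
  then show thesis using that[of p x] p(2) P by (simp add: E_of_def)
qed

lemma special_generator_exists:
  fixes E :: "(atilde, 'm) module"
  assumes F0: "F0_fresco lam ls E" and adm: "adm ls" and n: "length ls \<ge> 3"
  obtains F w where "principal_JH E F ls" "is_generator E w"
    "(lin (of_real (ls ! (length ls - 2))) * lin (of_real (ls ! (length ls - 1)))) \<odot>\<^bsub>E\<^esub> w \<in> F (length ls - 2)"
proof -
  let ?n = "length ls"
  obtain S e where ch: "chain E (inv_seq ls) S e ?n" and fl: "flat (inv_diff ls) S ?n" and g: "good_roots lam ls"
    by (rule F0_facts[OF F0 adm])
  interpret ab_chain E "inv_seq ls" S e ?n by (rule ab_chainI[OF ch])
  have sn: "Suc (?n - 2) = ?n - 1" "?n - 1 \<noteq> 0" "?n - 1 - 1 = ?n - 2" using n by auto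
  have "Suc (?n - 2) < ?n" using n by simp
  then obtain p where p: "p \<ge> 1" "p_inv ls (?n - 2) = real p" "int p = inv_diff ls (?n - 1) - inv_diff ls (?n - 2) + 1"
    unfolding sn(1)[symmetric] by (rule p_nat[OF adm g])
  \<comment> \<open>Rank at least 3 makes \<open>?n - 2\<close> a positive index, so
    \<open>flat\<close> provides a solution starting there. Its first entry is a monomial, hence its
    next obstruction is a nonzero multiple of the coefficient of \<open>S (?n - 2)\<close> in degree
    \<open>p\<close>.\<close>
  have "1 \<le> ?n - 2 \<and> ?n - 2 < ?n" using n by auto
  then obtain \<chi> where \<chi>: "sol (inv_diff ls) S ?n \<chi>" "\<forall>j<?n - 2. \<chi> j = 0" "\<chi> (?n - 2) \<noteq> 0"
    using fl unfolding flat_def by blast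
  define k where "k = \<chi> (?n - 2) $$ inv_diff ls (?n - 2)"
  have \<chi>k: "\<chi> (?n - 2) = fls_const k * fls_X_intpow (inv_diff ls (?n - 2))"
    unfolding k_def using \<chi> n by (intro sol_first[OF \<chi>(1)]) auto
  have k: "k \<noteq> 0" using \<chi>k \<chi>(3) by auto
  have "(fps_to_fls (S (?n - 2)) * \<chi> (?n - 2)) $$ (inv_diff ls (?n - 1) + 1) = 0"
    using sol_obstruction[OF \<chi>(1), of "?n - 1"] n sn by simp
  moreover have "fps_to_fls (S (?n - 2)) * \<chi> (?n - 2) =
      fls_const k * fls_shift (- inv_diff ls (?n - 2)) (fps_to_fls (S (?n - 2)))"
    unfolding \<chi>k by (subst mult.left_commute) (simp only: fls_X_intpow_times_conv_shift(2))
  ultimately have "k * S (?n - 2) $ nat (inv_diff ls (?n - 1) + 1 - inv_diff ls (?n - 2)) = 0"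
    using p(3) by simp
  moreover have "nat (inv_diff ls (?n - 1) + 1 - inv_diff ls (?n - 2)) = p" using p(3) by simp
  ultimately have Sp: "S (?n - 2) $ p = 0" using k by simp
  obtain h where h: "S (?n - 2) + fps_X^2 * fps_deriv h + fps_const (1 - of_nat p) * fps_X * h =
      fps_const (S (?n - 2) $ 0) + fps_const (S (?n - 2) $ p) * fps_X ^ p" by (rule fps_normalize[OF p(1)])
  have S20: "S (?n - 2) $ 0 = 1" using S0[of "?n - 2"] n sn by simp
  have e: "e (?n - 1) \<in> carrier E" "e (?n - 2) \<in> carrier E" using e_closed n by auto
  define w where "w = e (?n - 1) \<oplus>\<^bsub>E\<^esub> of_fps h \<odot>\<^bsub>E\<^esub> e (?n - 2)"
  have wc: "w \<in> carrier E" using e by (simp add: w_def lsmult_closed)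
  have gen: "is_generator E w"
  proof (rule generator[OF _ wc])
    show "0 < ?n" using n by linarith
    show "c w (?n - 1) = 1"
      using e n sn by (simp add: w_def crd_add[OF basis] crd_fs[OF basis] crd_basis[OF basis] lsmult_closed)
  qed
  define y where "y = lin (inv_seq ls (?n - 2)) \<odot>\<^bsub>E\<^esub> e (?n - 2)"
  have yc: "y \<in> carrier E" using e by (simp add: y_def lsmult_closed)
  have y: "y \<in> spn E e (?n - 2)" using lin_e_spn[of "?n - 2"] n by (simp add: y_def)
  have "inv_seq ls (?n - 2) - inv_seq ls (?n - 1) = 1 - of_nat p"
  proof -
    have "ls ! (?n - 2) - ls ! (?n - 1) = 1 - real p" using p(2) sn by (simp add: p_inv_def)
    then have "complex_of_real (ls ! (?n - 2) - ls ! (?n - 1)) = complex_of_real (1 - real p)" by simp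
    then show ?thesis by (simp add: inv_seq_def)
  qed
  then have lh: "lin (inv_seq ls (?n - 1)) * of_fps h = of_fps h * lin (inv_seq ls (?n - 2)) + of_fps (fps_X^2 * fps_deriv h + fps_const (1 - of_nat p) * fps_X * h)"
    using lin_mult_of_fps[of "inv_seq ls (?n - 1)" h "inv_seq ls (?n - 2)"] by simp
  define T where "T = fps_X^2 * fps_deriv h + fps_const (1 - of_nat p) * fps_X * h"
  have ST: "S (?n - 2) + T = 1" using h Sp S20 by (simp add: T_def add.assoc)
  have "lin (inv_seq ls (?n - 1)) \<odot>\<^bsub>E\<^esub> (of_fps h \<odot>\<^bsub>E\<^esub> e (?n - 2)) = (lin (inv_seq ls (?n - 1)) * of_fps h) \<odot>\<^bsub>E\<^esub> e (?n - 2)"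
    using e by (simp add: lsmult_assoc)
  also have "\<dots> = of_fps h \<odot>\<^bsub>E\<^esub> y \<oplus>\<^bsub>E\<^esub> of_fps T \<odot>\<^bsub>E\<^esub> e (?n - 2)"
    unfolding lh T_def[symmetric] using e by (simp only: lsmult_l_distr lsmult_assoc y_def)
  finally have "lin (inv_seq ls (?n - 1)) \<odot>\<^bsub>E\<^esub> w = of_fps (S (?n - 2)) \<odot>\<^bsub>E\<^esub> e (?n - 2) \<oplus>\<^bsub>E\<^esub> (of_fps h \<odot>\<^bsub>E\<^esub> y \<oplus>\<^bsub>E\<^esub> of_fps T \<odot>\<^bsub>E\<^esub> e (?n - 2))"
    using lin_e[of "?n - 1"] n sn e by (simp add: w_def lsmult_r_distr lsmult_closed)
  also have "\<dots> = of_fps (S (?n - 2) + T) \<odot>\<^bsub>E\<^esub> e (?n - 2) \<oplus>\<^bsub>E\<^esub> of_fps h \<odot>\<^bsub>E\<^esub> y"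
    using e yc by (simp add: lsmult_closed lsmult_l_distr a_ac)
  also have "\<dots> = e (?n - 2) \<oplus>\<^bsub>E\<^esub> of_fps h \<odot>\<^bsub>E\<^esub> y" unfolding ST using e by (simp add: lsmult_one)
  finally have lw: "lin (inv_seq ls (?n - 1)) \<odot>\<^bsub>E\<^esub> w = e (?n - 2) \<oplus>\<^bsub>E\<^esub> of_fps h \<odot>\<^bsub>E\<^esub> y" .
  have sub: "left_submodule (spn E e (?n - 2)) E" by (rule spn_sub) simp
  note D = left_submoduleD[OF sub]
  \<comment> \<open>The corrected generator is sent to \<open>e (?n - 2)\<close> plus a multiple of
    \<open>y\<close>. As \<open>y\<close> already lies in the smaller span, a further
    \<open>lin\<close> ends there as well.\<close>
  have "lin (inv_seq ls (?n - 2)) \<odot>\<^bsub>E\<^esub> (lin (inv_seq ls (?n - 1)) \<odot>\<^bsub>E\<^esub> w) = y \<oplus>\<^bsub>E\<^esub> lin (inv_seq ls (?n - 2)) \<odot>\<^bsub>E\<^esub> (of_fps h \<odot>\<^bsub>E\<^esub> y)"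
    unfolding lw using e yc by (simp add: lsmult_r_distr lsmult_closed y_def)
  also have "\<dots> \<in> spn E e (?n - 2)" using D(3)[OF y D(4)[OF D(4)[OF y]]] .
  finally have mem: "(lin (of_real (ls ! (?n - 2))) * lin (of_real (ls ! (?n - 1)))) \<odot>\<^bsub>E\<^esub> w \<in> spn E e (?n - 2)"
    using wc by (simp add: lsmult_assoc inv_seq_def)
  have "principal_JH E (spn E e) ls"
    using adm_mono[OF adm] by (intro chain_principal_JH[OF ch] add_mono) auto
  then show thesis using gen mem by (rule that)
qed

lemma alpha_val_reduction:
  fixes E :: fresco_univ
  assumes F0: "F0_fresco lam ls E" and adm: "adm ls" and n: "length ls \<ge> 3"
    and F: "principal_JH E F ls" and w: "is_generator E w"
    and mem: "(lin (of_real (ls ! (length ls - 2))) * lin (of_real (ls ! (length ls - 1)))) \<odot>\<^bsub>E\<^esub> w \<in> F (length ls - 2)"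
  defines "G \<equiv> sub_mod E (cyclic E (lin (of_real (ls ! (length ls - 2)) - 1) \<odot>\<^bsub>E\<^esub> w))"
  shows "F0_fresco lam (reduced_invs ls) G" "alpha_val ls (iso_class E) = alpha_val (reduced_invs ls) (iso_class G)"
proof -
  have E: "left_module E" using F0 by (auto simp: F0_fresco_def intro: fresco_left_module)
  obtain S e where ch: "chain E (inv_seq ls) S e (length ls)" and S1: "S (length ls - 2) = 1" and ew: "e (length ls - 1) = w"
    by (rule special_generator_chain[OF E adm F w mem]) blast
  have GG: "F0_fresco lam (reduced_invs ls) G" "\<exists>e'. chain G (inv_seq (reduced_invs ls)) S e' (length (reduced_invs ls))"
    using reduced_F0[OF F0 adm n ch S1] unfolding ew G_def by auto
  then show "F0_fresco lam (reduced_invs ls) G" by blast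
  obtain e' where ch': "chain G (inv_seq (reduced_invs ls)) S e' (length (reduced_invs ls))" using GG(2) by blast
  obtain S0 e0 where g: "good_roots lam ls" by (rule F0_facts[OF F0 adm])
  show "alpha_val ls (iso_class E) = alpha_val (reduced_invs ls) (iso_class G)"
    unfolding alpha_val_eq[OF F0 adm ch] alpha_val_eq[OF GG(1) adm_red[OF adm n] ch']
    by (rule obstr_red[where S = S, OF adm n g S1])
qed

unbundle no fps_syntax

section \<open>The theorem\<close>

lemma admissible_adm: "ls \<in> admissible_invariants lam \<Longrightarrow> adm ls"
  by (auto simp: admissible_invariants_def adm_def)

text \<open>The module at hand is the witness that admissibility asks for; applied to G it makes the
  reduced list admissible.\<close>

lemma adm_admissible:
  fixes E :: fresco_univ
  shows "F0_fresco lam ls E \<Longrightarrow> adm ls \<Longrightarrow> ls \<in> admissible_invariants lam"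
  unfolding admissible_invariants_def F0_fresco_def adm_def by blast

lemma F0_classesI:
  fixes E :: fresco_univ
  shows "F0_fresco lam ls E \<Longrightarrow> iso_class E \<in> F0_classes lam ls"
  by (auto simp: F0_classes_def)

theorem theorem3p2p2:
  fixes lam :: real
  assumes "lam \<in> \<rat>" and "0 < lam" and "lam \<le> 1"
  shows "\<exists>!\<alpha> :: real list \<Rightarrow> fresco_univ set \<Rightarrow> complex.
    \<alpha> \<in> (\<Pi>\<^sub>E ls\<in>admissible_invariants lam. F0_classes lam ls \<rightarrow>\<^sub>E UNIV) \<and>
    (\<forall>ls\<in>admissible_invariants lam.
       polynomial_function ls (F0_classes lam ls) (\<alpha> ls) \<and>
       (\<forall>E :: fresco_univ. F0_fresco lam ls E \<longrightarrow>
          (\<alpha> ls (iso_class E) = 0 \<longleftrightarrow> semi_simple E)) \<and>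
       (length ls \<ge> 3 \<longrightarrow>
          (\<forall>(E :: fresco_univ) F e.
             F0_fresco lam ls E \<and> principal_JH E F ls \<and> is_generator E e \<and>
             (lin (of_real (ls ! (length ls - 2))) * lin (of_real (ls ! (length ls - 1)))) \<odot>\<^bsub>E\<^esub> e
               \<in> F (length ls - 2) \<longrightarrow>
             (let G = sub_mod E (cyclic E (lin (of_real (ls ! (length ls - 2)) - 1) \<odot>\<^bsub>E\<^esub> e));
                  ls' = take (length ls - 2) ls @ [ls ! (length ls - 1) + 1]
              in iso_class G \<in> F0_classes lam ls' \<and>
                 \<alpha> ls (iso_class E) = \<alpha> ls' (iso_class G)))) \<and>
       (length ls = 2 \<longrightarrow>
          (\<forall>(E :: fresco_univ) (x :: complex) (p :: nat).
             F0_fresco lam ls E \<and> real p = p_inv ls 0 \<and>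
             lmod_iso E (cyclic_quot
               (lin (of_real (ls ! 0)) * of_fps (inverse (1 + fps_const x * fps_X ^ p)) *
                lin (of_real (ls ! 1)))) \<longrightarrow>
             \<alpha> ls (iso_class E) = x)))"
  (is "\<exists>!\<alpha>. ?P \<alpha>")
proof (rule ex_ex1I)
  \<comment> \<open>Restricted in both arguments, since uniqueness as an equality of functions needs
    fixed values outside the admissible lists and outside the classes.\<close>
  define \<alpha> where "\<alpha> = (\<lambda>ls\<in>admissible_invariants lam. \<lambda>C\<in>F0_classes lam ls. alpha_val ls C)"
  have \<alpha>: "\<alpha> ls (iso_class E) = alpha_val ls (iso_class E)"
    if "ls \<in> admissible_invariants lam" "F0_fresco lam ls E" for ls and E :: fresco_univ
    using that F0_classesI by (simp add: \<alpha>_def)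
  have ex: "?P \<alpha>"
  proof (intro conjI ballI allI impI)
    show "\<alpha> \<in> (\<Pi>\<^sub>E ls\<in>admissible_invariants lam. F0_classes lam ls \<rightarrow>\<^sub>E UNIV)"
      unfolding \<alpha>_def by (intro restrict_PiE_iff[THEN iffD2] ballI) simp
    fix ls assume ls: "ls \<in> admissible_invariants lam"
    note adm = admissible_adm[OF ls]
    show "polynomial_function ls (F0_classes lam ls) (\<alpha> ls)"
      using alpha_val_polynomial[OF adm, of lam] ls by (simp add: polynomial_function_def \<alpha>_def)
    show "\<alpha> ls (iso_class E) = 0 \<longleftrightarrow> semi_simple E" if "F0_fresco lam ls E" for E :: fresco_univ
      using alpha_val_zero_iff[OF that adm] \<alpha>[OF ls that] by simp
    show "\<alpha> ls (iso_class E) = x"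
      if "length ls = 2" "F0_fresco lam ls E \<and> real p = p_inv ls 0 \<and> lmod_iso E (cyclic_quot
               (lin (of_real (ls ! 0)) * of_fps (inverse (1 + fps_const x * fps_X ^ p)) *
                lin (of_real (ls ! 1))))" for E :: fresco_univ and x p
      using alpha_val_rank_two[of lam ls E p x] adm \<alpha>[OF ls, of E] that by simp
    fix E :: fresco_univ and F e
    assume n: "length ls \<ge> 3" and *: "F0_fresco lam ls E \<and> principal_JH E F ls \<and> is_generator E e \<and>
      (lin (of_real (ls ! (length ls - 2))) * lin (of_real (ls ! (length ls - 1)))) \<odot>\<^bsub>E\<^esub> e \<in> F (length ls - 2)"
    have F0: "F0_fresco lam ls E" by (rule conjunct1[OF *])
    let ?G = "sub_mod E (cyclic E (lin (of_real (ls ! (length ls - 2)) - 1) \<odot>\<^bsub>E\<^esub> e))"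
    have G: "F0_fresco lam (reduced_invs ls) ?G" "alpha_val ls (iso_class E) = alpha_val (reduced_invs ls) (iso_class ?G)"
      by (rule alpha_val_reduction[OF F0 adm n conjunct1[OF conjunct2[OF *]]
            conjunct1[OF conjunct2[OF conjunct2[OF *]]] conjunct2[OF conjunct2[OF conjunct2[OF *]]]])+
    have "iso_class ?G \<in> F0_classes lam (reduced_invs ls) \<and> \<alpha> ls (iso_class E) = \<alpha> (reduced_invs ls) (iso_class ?G)"
      using F0_classesI[OF G(1)] \<alpha>[OF ls F0] \<alpha>[OF adm_admissible[OF G(1) adm_red[OF adm n]] G(1)] G(2)
      by simp
    then show "let G = ?G; ls' = take (length ls - 2) ls @ [ls ! (length ls - 1) + 1]
        in iso_class G \<in> F0_classes lam ls' \<and> \<alpha> ls (iso_class E) = \<alpha> ls' (iso_class G)"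
      unfolding Let_def reduced_invs_def .
  qed
  show "\<exists>\<alpha>. ?P \<alpha>" by (rule exI[where x = \<alpha>], fact ex)
next
  fix \<alpha> \<beta> assume a: "?P \<alpha>" and b: "?P \<beta>"
  have eq: "\<alpha> ls (iso_class E) = \<beta> ls (iso_class E)"
    if "ls \<in> admissible_invariants lam" "F0_fresco lam ls E" for ls and E :: fresco_univ
    using that
  \<comment> \<open>Property (ii) compares values at different lists of invariants, so the induction
    is on the length and runs over all admissible lists and all modules simultaneously, down to rank
    two.\<close>
  proof (induction ls arbitrary: E rule: measure_induct_rule[where f = length])
    case (less ls)
    note ls = less.prems(1) and F0 = less.prems(2)
    note adm = admissible_adm[OF ls]
    note A = bspec[OF conjunct2[OF a] ls, THEN conjunct2, THEN conjunct2]
      and B = bspec[OF conjunct2[OF b] ls, THEN conjunct2, THEN conjunct2]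
    consider "length ls = 2" | "length ls \<ge> 3" using adm by (force simp: adm_def)
    then show ?case
    proof cases
      case 1
      obtain x p where p: "real p = p_inv ls 0" and iso: "lmod_iso E (cyclic_quot (lin (of_real (ls ! 0)) *
          of_fps (inverse (1 + fps_const x * fps_X ^ p)) * lin (of_real (ls ! 1))))"
        by (rule rank_two_normal_form[OF F0 adm 1])
      note c = conjI[OF F0 conjI[OF p iso]]
      show ?thesis
        using A[THEN conjunct2, rule_format, OF 1 c] B[THEN conjunct2, rule_format, OF 1 c] by simp
    next
      case 2
      obtain F w where F: "principal_JH E F ls" and w: "is_generator E w" and
        mem: "(lin (of_real (ls ! (length ls - 2))) * lin (of_real (ls ! (length ls - 1)))) \<odot>\<^bsub>E\<^esub> w \<in> F (length ls - 2)"
        by (rule special_generator_exists[OF F0 adm 2])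
      note c = conjI[OF F0 conjI[OF F conjI[OF w mem]]]
      note G = alpha_val_reduction(1)[OF F0 adm 2 F w mem]
      have lt: "length (reduced_invs ls) < length ls" using 2 by (simp add: length_red)
      note IH = less.IH[OF lt adm_admissible[OF G adm_red[OF adm 2]] G]
      show ?thesis
        using A[THEN conjunct1, rule_format, OF 2 c, unfolded Let_def, folded reduced_invs_def, THEN conjunct2]
          B[THEN conjunct1, rule_format, OF 2 c, unfolded Let_def, folded reduced_invs_def, THEN conjunct2] IH by simp
    qed
  qed
  show "\<alpha> = \<beta>"
  proof (rule PiE_ext[OF conjunct1[OF a] conjunct1[OF b]])
    fix ls assume ls: "ls \<in> admissible_invariants lam"
    show "\<alpha> ls = \<beta> ls"
    proof (rule PiE_ext)
      show "\<alpha> ls \<in> F0_classes lam ls \<rightarrow>\<^sub>E UNIV" by (rule PiE_mem[OF conjunct1[OF a] ls])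
      show "\<beta> ls \<in> F0_classes lam ls \<rightarrow>\<^sub>E UNIV" by (rule PiE_mem[OF conjunct1[OF b] ls])
      show "\<alpha> ls C = \<beta> ls C" if "C \<in> F0_classes lam ls" for C
        by (rule F0_classesE[OF that]) (simp add: eq[OF ls])
    qed
  qed
qed

end
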